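(* Let $T$ be an isotropic spherical random field with harmonic coefficients $\{a_{\ell m}\}$ and angular power spectrum $\{C_\ell\}$, and let $V\in L^2(\mathbb{S}^2)$ be a deterministic real-valued function with Laplace expansion $V(\mathbf{x})=\sum_{\ell\in\mathbb{N}_0}\sum_{m=-\ell}^{\ell}v_{\ell m}Y_{\ell m}(\mathbf{x})$. Then the multiplicative field $T_V(\mathbf{x})=V(\mathbf{x})T(\mathbf{x})$ admits the spectral expansion $$T_V(\mathbf{x})=\sum_{\ell\in\mathbb{N}_0}\sum_{m=-\ell}^{\ell}a_{\ell m,V}Y_{\ell m}(\mathbf{x}),$$ where, for $\ell\in\mathbb{N}_0$, $m\in\{-\ell,\dots,\ell\}$, the coefficients are centered random variables given by $$a_{\ell m,V}:=\int_{\mathbb{S}^2}T_V(\mathbf{x})Y^*_{\ell m}(\mathbf{x})\,d\mathbf{s}(\mathbf{x})=(-1)^m\sum_{\ell_2\in\mathbb{N}_0}\sum_{\ell_1=|\ell_2-\ell|}^{\ell_2+\ell}\sum_{m_2=-\ell_2}^{\ell_2}v_{\ell_1\,m-m_2}\,a_{\ell_2m_2}\sqrt{\tfrac{(2\ell_1+1)(2\ell_2+1)(2\ell+1)}{4\pi}}\begin{pmatrix} \ell_1 & \ell_2 & \ell \\ 0 & 0 & 0 \end{pmatrix}\begin{pmatrix} \ell_1 & \ell_2 & \ell \\ {m-m_2} & m_2 & -m \end{pmatrix}.$$ The field $T_V$ is centered, and its covariance function is $$\mathrm{Cov}(T_V(\mathbf{x}_1),T_V(\mathbf{x}_2))=\sum_{\ell,\ell'\in\mathbb{N}_0}\sum_{m=-\ell}^{\ell}\sum_{m'=-\ell'}^{\ell'}C_{\ell\ell'mm'}Y_{\ell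 m}(\mathbf{x}_1)Y^*_{\ell'm'}(\mathbf{x}_2),$$ with $$C_{\ell\ell'mm'}=(-1)^{m+m'}\sum_{\ell_2\in\mathbb{N}_0}\sum_{\ell_1=|\ell_2-\ell|}^{\ell_2+\ell}\sum_{\ell_1'=|\ell_2-\ell'|}^{\ell_2+\ell'}\sum_{m_2=-\ell_2}^{\ell_2}v_{\ell_1\,m-m_2}v^*_{\ell_1'\,m'-m_2}C_{\ell_2}\tfrac{2\ell_2+1}{4\pi}\sqrt{(2\ell_1+1)(2\ell_1'+1)(2\ell+1)(2\ell'+1)}$$ $$\times\begin{pmatrix} \ell_1 & \ell_2 & \ell \\ 0 & 0 & 0 \end{pmatrix}\begin{pmatrix} \ell_1' & \ell_2 & \ell' \\ 0 & 0 & 0 \end{pmatrix}\begin{pmatrix} \ell_1 & \ell_2 & \ell \\ {m-m_2} & m_2 & -m \end{pmatrix}\begin{pmatrix} \ell_1' & \ell_2 & \ell' \\ {m'-m_2} & m_2 & -m' \end{pmatrix}$$ for $\ell,\ell'\in\mathbb{N}_0$, $m\in\{-\ell,\dots,\ell\}$, $m'\in\{-\ell',\dots,\ell'\}$.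
   Context: $T$ is a real-valued zero-mean second-order random field on the unit sphere $\mathbb{S}^2\subset\mathbb{R}^3$ with continuous, not identically constant covariance; isotropic means the covariance depends only on the great-circle distance. $d\mathbf{s}$ is the surface measure ($\sin\theta\,d\theta\,d\varphi$ in colatitude $\theta$ and longitude $\varphi$), $*$ is complex conjugation. $Y_{\ell m}$ are the standard complex orthonormal spherical harmonics, $Y_{\ell m}(\theta,\varphi)=e^{im\varphi}\left[\frac{(2\ell+1)(\ell-m)!}{4\pi(\ell+m)!}\right]^{1/2}P_\ell^m(\cos\theta)$ for $m\ge0$ and $Y_{\ell(-m)}=(-1)^mY_{\ell m}^*$, with $P_\ell^m$ the associated Legendre functions. $T=\sum_{\ell}\sum_m a_{\ell m}Y_{\ell m}$ with $a_{\ell m}=\int_{\mathbb{S}^2}T\,Y_{\ell m}^*\,d\mathbf{s}$, and isotropy gives $\mathbf{E}a_{\ell m}a_{\ell'm'}^*=\delta_\ell^{\ell'}\delta_m^{m'}C_\ell$; $\{C_\ell\}$ is the angular power spectrum. Expansions of random fields converge in $L^2(\Omega\times\mathbb{S}^2)$, of covariance functions in $L^2(\mathbb{S}^2\times\mathbb{S}^2)$, and series of random variables in $L^2(\Omega)$. The $2\times3$ arrays are Wigner $3j$-symbols; terms whose indices violate the selection rules (including $v_{\ell_1 k}$ with $|k|>\ell_1$) are zero. *)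

theory Defs
  imports "HOL-Probability.Probability" "HOL-Computational_Algebra.Polynomial"
begin

section \<open>The unit sphere and its surface measure\<close>

abbreviation S2 :: "(real^3) set" where
  "S2 \<equiv> sphere 0 1"

text \<open>Spherical coordinates: colatitude \<open>\<theta>\<close> and longitude \<open>\<phi>\<close>.\<close>

definition sph_point :: "real \<times> real \<Rightarrow> real^3" where
  "sph_point = (\<lambda>(\<theta>, \<phi>). vector [sin \<theta> * cos \<phi>, sin \<theta> * sin \<phi>, cos \<theta>])"

text \<open>The image of the measure \<open>sin \<theta> d\<theta> d\<phi>\<close>. Its space is \<^term>\<open>S2\<close>, so functions on
  \<^typ>\<open>real^3\<close> only matter through their values on the sphere.\<close>

definition surf :: "(real^3) measure" where
  "surf = distr
     (density (restrict_space lborel ({0..pi} \<times> {0..<2 * pi})) (\<lambda>(\<theta>, \<phi>). ennreal (sin \<theta>)))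
     (restrict_space borel S2) sph_point"

definition great_circle_dist :: "real^3 \<Rightarrow> real^3 \<Rightarrow> real" where
  "great_circle_dist x y = arccos (x \<bullet> y)"


section \<open>Spherical harmonics\<close>

text \<open>Rodrigues' formula, with the Condon--Shortley phase:
  \<open>P\<^sub>l\<^sup>m(x) = (-1)\<^sup>m / (2\<^sup>l l!) (1 - x\<^sup>2)\<^bsup>m/2\<^esup> (d/dx)\<^bsup>l+m\<^esup> (x\<^sup>2 - 1)\<^sup>l\<close>.
  It vanishes for \<open>m > l\<close>.\<close>

definition assoc_legendre :: "nat \<Rightarrow> nat \<Rightarrow> real \<Rightarrow> real" where
  "assoc_legendre l m x =
     (- 1) ^ m / (2 ^ l * fact l) * sqrt (1 - x\<^sup>2) ^ m *
     poly ((pderiv ^^ (l + m)) ([:- 1, 0, 1:] ^ l)) x"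

definition sph_harm_angle_nonneg :: "nat \<Rightarrow> nat \<Rightarrow> real \<Rightarrow> real \<Rightarrow> complex" where
  "sph_harm_angle_nonneg l m \<theta> \<phi> =
     exp (\<i> * of_nat m * complex_of_real \<phi>) *
     complex_of_real (sqrt (real (2 * l + 1) * fact (l - m) / (4 * pi * fact (l + m))) *
       assoc_legendre l m (cos \<theta>))"

definition sph_harm_angle :: "nat \<Rightarrow> int \<Rightarrow> real \<Rightarrow> real \<Rightarrow> complex" where
  "sph_harm_angle l m \<theta> \<phi> =
     (if m \<ge> 0 then sph_harm_angle_nonneg l (nat m) \<theta> \<phi>
      else (- 1) ^ nat (- m) * cnj (sph_harm_angle_nonneg l (nat (- m)) \<theta> \<phi>))"

text \<open>The longitude of a pole is immaterial, since \<open>P\<^sub>l\<^sup>m(\<plusminus>1) = 0\<close> for \<open>m > 0\<close>;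
  \<^const>\<open>Arg2pi\<close> takes the value \<open>0\<close> there.\<close>

definition sph_harm :: "nat \<Rightarrow> int \<Rightarrow> real^3 \<Rightarrow> complex" where
  "sph_harm l m x = sph_harm_angle l m (arccos (x $ 3)) (Arg2pi (Complex (x $ 1) (x $ 2)))"

definition harm_coeff :: "(real^3 \<Rightarrow> complex) \<Rightarrow> nat \<Rightarrow> int \<Rightarrow> complex" where
  "harm_coeff f l m = (\<integral>x. f x * cnj (sph_harm l m x) \<partial>surf)"


section \<open>Wigner 3j-symbols\<close>

text \<open>Racah's formula for integer angular momenta (the top row is meant to be nonnegative, which
  the triangle inequalities enforce); the symbol is zero if a selection rule is violated.\<close>

definition wigner3j :: "int \<Rightarrow> int \<Rightarrow> int \<Rightarrow> int \<Rightarrow> int \<Rightarrow> int \<Rightarrow> real" where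
  "wigner3j j1 j2 j3 m1 m2 m3 =
    (if m1 + m2 + m3 = 0 \<and> \<bar>j1 - j2\<bar> \<le> j3 \<and> j3 \<le> j1 + j2 \<and>
        \<bar>m1\<bar> \<le> j1 \<and> \<bar>m2\<bar> \<le> j2 \<and> \<bar>m3\<bar> \<le> j3
     then
       (let f = (\<lambda>k::int. fact (nat k) :: real) in
        (- 1) powi (j1 - j2 - m3) *
        sqrt (f (j1 + j2 - j3) * f (j1 - j2 + j3) * f (- j1 + j2 + j3) / f (j1 + j2 + j3 + 1)) *
        sqrt (f (j1 + m1) * f (j1 - m1) * f (j2 + m2) * f (j2 - m2) * f (j3 + m3) * f (j3 - m3)) *
        (\<Sum>s\<in>{s. 0 \<le> s \<and> 0 \<le> j1 + j2 - j3 - s \<and> 0 \<le> j1 - m1 - s \<and> 0 \<le> j2 + m2 - s \<and>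
                  0 \<le> j3 - j2 + m1 + s \<and> 0 \<le> j3 - j1 - m2 + s}.
           (- 1) powi s /
           (f s * f (j1 + j2 - j3 - s) * f (j1 - m1 - s) * f (j2 + m2 - s) *
            f (j3 - j2 + m1 + s) * f (j3 - j1 - m2 + s))))
     else 0)"


section \<open>Mean-square convergence\<close>

definition square_integrable :: "'a measure \<Rightarrow> ('a \<Rightarrow> 'b::{real_normed_vector, second_countable_topology}) \<Rightarrow> bool" where
  "square_integrable M f \<longleftrightarrow>
     f \<in> borel_measurable M \<and> integrable M (\<lambda>x. (norm (f x))\<^sup>2)"

definition L2_tendsto ::
  "'a measure \<Rightarrow> ('i \<Rightarrow> 'a \<Rightarrow> complex) \<Rightarrow> ('a \<Rightarrow> complex) \<Rightarrow> 'i filter \<Rightarrow> bool" where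
  "L2_tendsto M s f F \<longleftrightarrow>
     (\<forall>i. square_integrable M (s i)) \<and> square_integrable M f \<and>
     ((\<lambda>i. \<integral>x. (cmod (s i x - f x))\<^sup>2 \<partial>M) \<longlongrightarrow> 0) F"

definition laplace_expansion :: "(real^3 \<Rightarrow> real) \<Rightarrow> (nat \<Rightarrow> int \<Rightarrow> complex) \<Rightarrow> bool" where
  "laplace_expansion f v \<longleftrightarrow>
     L2_tendsto surf (\<lambda>L x. \<Sum>l\<le>L. \<Sum>m = - int l..int l. v l m * sph_harm l m x)
       (\<lambda>x. complex_of_real (f x)) sequentially"


section \<open>Random fields on the sphere\<close>

definition covariance :: "'w measure \<Rightarrow> ('w \<Rightarrow> real) \<Rightarrow> ('w \<Rightarrow> real) \<Rightarrow> real" where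
  "covariance M X Y =
     (\<integral>w. (X w - (\<integral>w'. X w' \<partial>M)) * (Y w - (\<integral>w'. Y w' \<partial>M)) \<partial>M)"

text \<open>Joint measurability is what makes the sample-path integrals defining the harmonic
  coefficients, and convergence in \<open>L\<^sup>2\<close> of the product space, meaningful.\<close>

definition spherical_random_field :: "'w measure \<Rightarrow> (real^3 \<Rightarrow> 'w \<Rightarrow> real) \<Rightarrow> bool" where
  "spherical_random_field M T \<longleftrightarrow>
     prob_space M \<and>
     (\<lambda>(w, x). T x w) \<in> borel_measurable (M \<Otimes>\<^sub>M surf) \<and>
     (\<forall>x\<in>S2. square_integrable M (T x)) \<and>
     (\<forall>x\<in>S2. (\<integral>w. T x w \<partial>M) = 0) \<and>
     continuous_on (S2 \<times> S2) (\<lambda>(x, y). covariance M (T x) (T y)) \<and>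
     \<not> (\<lambda>(x, y). covariance M (T x) (T y)) constant_on (S2 \<times> S2)"

definition isotropic :: "'w measure \<Rightarrow> (real^3 \<Rightarrow> 'w \<Rightarrow> real) \<Rightarrow> bool" where
  "isotropic M T \<longleftrightarrow>
     (\<exists>\<gamma>. \<forall>x\<in>S2. \<forall>y\<in>S2. covariance M (T x) (T y) = \<gamma> (great_circle_dist x y))"

definition field_coeff :: "(real^3 \<Rightarrow> 'w \<Rightarrow> real) \<Rightarrow> nat \<Rightarrow> int \<Rightarrow> 'w \<Rightarrow> complex" where
  "field_coeff T l m w = harm_coeff (\<lambda>x. complex_of_real (T x w)) l m"

text \<open>The number \<open>C l\<close> with \<open>E (a l m * cnj (a l' m')) = C l\<close> if \<open>(l, m) = (l', m')\<close> and \<open>= 0\<close>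
  otherwise. It is unique because \<open>l' = l\<close>, \<open>m = m' = 0\<close> is admissible; it exists whenever the
  field is isotropic.\<close>

definition angular_power_spectrum :: "'w measure \<Rightarrow> (real^3 \<Rightarrow> 'w \<Rightarrow> real) \<Rightarrow> nat \<Rightarrow> real" where
  "angular_power_spectrum M T l =
     (THE c. \<forall>l' m m'. \<bar>m\<bar> \<le> int l \<longrightarrow> \<bar>m'\<bar> \<le> int l' \<longrightarrow>
        (\<integral>w. field_coeff T l m w * cnj (field_coeff T l' m' w) \<partial>M) =
        (if l = l' \<and> m = m' then complex_of_real c else 0))"

end

theory Submission
  imports Defs
begin

text \<open>The ladder relations in \<open>m\<close> satisfied both by the associated Legendre functions and by Racah's
  formula determine a tensor in \<open>(m\<^sub>1, m\<^sub>2, m\<^sub>3)\<close> up to a factor. This identifies the integral of three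
  spherical harmonics with a product of two 3j-symbols; the factor follows from the values at the
  pole and the normalisation of the 3j-symbols. Hence the integral of \<open>V Y\<^bsub>l'm'\<^esub> Y\<^bsub>lm\<^esub>\<^sup>*\<close> is a finite
  combination of the coefficients of \<open>V\<close>.

  Spherical harmonics are complete because their span is closed under multiplication by the
  coordinate functions. Dominated convergence over the sample space then gives the expansions of
  \<open>T\<close> and \<open>T\<^sub>V\<close> in mean square, and integrating the expansion of \<open>T\<close> against \<open>V Y\<^bsub>lm\<^esub>\<^sup>*\<close> gives the
  coefficients of \<open>T\<^sub>V\<close>. The space \<open>L\<^sup>2\<close> of the product of two spheres carries the covariance
  expansion, whose partial sums are best approximations and so converge along all finite sets.

  For the orthogonality of the coefficients of an isotropic field, \<open>K\<^sub>l(x, y) = \<Sum>\<^sub>m Y\<^bsub>lm\<^esub>(x) Y\<^bsub>lm\<^esub>(y)\<^sup>*\<close>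
  satisfies the Legendre recurrence in \<open>x \<bullet> y\<close>. So polynomials in \<open>x \<bullet> y\<close> have diagonal
  coefficients, and by Weierstrass so do continuous functions of \<open>x \<bullet> y\<close>.\<close>

section \<open>Associated Legendre functions\<close>

text \<open>The multiplier \<open>V\<close> is merely square integrable, so it may be unbounded and
  its expansion need not converge pointwise. The product \<open>V T\<close> is therefore not
  expanded by multiplying two series. Continuity of the covariance on the compact sphere bounds the
  variance of \<open>T\<close>, which makes \<open>V T\<close> a field with integrable variance, and
  the general expansion is applied to it directly. In the formula for its coefficients
  \<open>V\<close> is moved onto the deterministic factor: its product with a bounded harmonic stays
  in L2, and the triangle rule leaves finitely many degrees of \<open>V\<close> for each degree of
  \<open>T\<close>. Symmetry enters through algebra rather than through rotations. Each differential
  ladder relation carries a factor \<open>sin \<theta>\<close>, which keeps it valid at the poles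
  and makes integration by parts free of boundary terms. The functions and symbols vanish outside
  the range of orders, and the ladder coefficients vanish at its two ends, so the relations extend
  to all integer orders and sums over orders can be shifted.\<close>

definition rodrigues :: "nat \<Rightarrow> nat \<Rightarrow> real \<Rightarrow> real" where
  "rodrigues l n t = poly ((pderiv ^^ n) ([:- 1, 0, 1:] ^ l)) t"

text \<open>The number \<open>n\<close> of derivatives is a free argument, not tied to
  \<open>l + m\<close>, so that differentiation is a shift of \<open>n\<close>.\<close>

lemma rodrigues_has_field_derivative:
  "(rodrigues l n has_field_derivative rodrigues l (Suc n) t) (at t)"
  unfolding rodrigues_def by (auto intro!: derivative_eq_intros)

text \<open>Leibniz's rule with a factor of degree 1. The truncated \<open>n - 1\<close> is harmless
  at \<open>n = 0\<close>, where its coefficient vanishes.\<close>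

lemma higher_pderiv_mult_X:
  "(pderiv ^^ n) ([:0, 1:] * p) =
     [:0, 1:] * (pderiv ^^ n) p + smult (of_nat n) ((pderiv ^^ (n - 1)) (p :: real poly))"
proof (induction n)
  case (Suc n)
  have "n = 0 \<or> (pderiv ^^ n) p = pderiv ((pderiv ^^ (n - 1)) p)"
    by (cases n) auto
  with Suc show ?case
    by (auto simp: pderiv_add pderiv_mult pderiv_smult pderiv_pCons smult_add_left algebra_simps)
qed simp

lemma higher_pderiv_diff:
  "(pderiv ^^ n) (p - q) = (pderiv ^^ n) p - (pderiv ^^ n) (q :: real poly)"
  by (induction n arbitrary: p q) (simp_all del: funpow.simps add: funpow_Suc_right pderiv_diff)

lemma higher_pderiv_mult_X2_minus_1:
  "(pderiv ^^ n) ([:- 1, 0, 1:] * p) =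
     [:- 1, 0, 1:] * (pderiv ^^ n) p + smult (2 * of_nat n) ([:0, 1:] * (pderiv ^^ (n - 1)) p)
     + smult (of_nat (n * (n - 1))) ((pderiv ^^ (n - 2)) (p :: real poly))"
proof -
  have "[:- 1, 0, 1:] * p = [:0, 1:] * ([:0, 1:] * p) - p"
    by simp
  then have "(pderiv ^^ n) ([:- 1, 0, 1:] * p) =
      (pderiv ^^ n) ([:0, 1:] * ([:0, 1:] * p)) - (pderiv ^^ n) p"
    by (metis higher_pderiv_diff)
  also have "\<dots> = [:0, 1:] * ([:0, 1:] * (pderiv ^^ n) p + smult (of_nat n) ((pderiv ^^ (n - 1)) p))
      + smult (of_nat n) ([:0, 1:] * (pderiv ^^ (n - 1)) p
      + smult (of_nat (n - 1)) ((pderiv ^^ (n - 1 - 1)) p)) - (pderiv ^^ n) p"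
    by (simp only: higher_pderiv_mult_X)
  also have "\<dots> = [:- 1, 0, 1:] * (pderiv ^^ n) p
      + smult (2 * of_nat n) ([:0, 1:] * (pderiv ^^ (n - 1)) p)
      + smult (of_nat (n * (n - 1))) ((pderiv ^^ (n - 1 - 1)) p)"
    by (intro poly_eq_poly_eq_iff[THEN iffD1] ext) (cases n; simp add: algebra_simps)
  finally show ?thesis
    by (simp add: numeral_2_eq_2)
qed

text \<open>One derivative of \<open>(t^2 - 1)^(l + 1)\<close> is
  \<open>2 (l + 1) t (t^2 - 1)^l\<close>; the remaining \<open>n\<close> are distributed by
  Leibniz's rule.\<close>

lemma rodrigues_Suc_Suc:
  "rodrigues (Suc l) (Suc n) t =
     2 * (l + 1) * (t * rodrigues l n t + n * rodrigues l (n - 1) t)"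
proof -
  have "pderiv ([:- 1, 0, 1:] ^ Suc l) = smult (2 * (real l + 1)) ([:0, 1:] * [:- 1, 0, 1:] ^ l)"
    unfolding pderiv_power_Suc by (simp add: pderiv_pCons algebra_simps)
  then have "(pderiv ^^ Suc n) ([:- 1, 0, 1:] ^ Suc l) =
      smult (2 * (real l + 1)) ((pderiv ^^ n) ([:0, 1:] * [:- 1, 0, 1:] ^ l))"
    unfolding funpow_Suc_right o_def by (simp only: higher_pderiv_smult)
  then show ?thesis
    unfolding rodrigues_def higher_pderiv_mult_X by (simp add: algebra_simps)
qed

lemma rodrigues_Suc:
  "rodrigues (Suc l) n t =
     (t\<^sup>2 - 1) * rodrigues l n t + 2 * n * t * rodrigues l (n - 1) t
     + n * (n - 1) * rodrigues l (n - 2) t"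
  unfolding rodrigues_def power_Suc higher_pderiv_mult_X2_minus_1
  by (simp add: algebra_simps power2_eq_square)

text \<open>The derivative of order \<open>n + 1\<close> of \<open>(t^2 - 1)^(l + 1)\<close> is
  expanded in two ways, by differentiating once first and by splitting off a factor
  \<open>t^2 - 1\<close>. The comparison is the \<open>n\<close>-th derivative of the equation
  \<open>(t^2 - 1) y' = 2 l t y\<close> for \<open>y = (t^2 - 1)^l\<close>.\<close>

lemma legendre_ode:
  "(t\<^sup>2 - 1) * rodrigues l (Suc n) t =
     2 * (real l - n) * t * rodrigues l n t + n * (2 * real l + 1 - n) * rodrigues l (n - 1) t"
  using rodrigues_Suc_Suc[of l n t] rodrigues_Suc[of l "Suc n" t] by (simp add: algebra_simps)

text \<open>In the second derivative of \<open>(t^2 - 1)^(l + 1)\<close> the explicit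
  \<open>t\<close> disappears by writing \<open>t^2 = (t^2 - 1) + 1\<close>. Together with
  \<open>rodrigues_Suc_Suc\<close> this yields the three-term recurrence in the degree.\<close>

lemma rodrigues_Suc_plus2:
  "rodrigues (Suc l) (n + 2) t =
     2 * (l + 1) * (2 * l + 1) * rodrigues l n t + 4 * l * (l + 1) * rodrigues (l - 1) n t"
proof -
  let ?f = "\<lambda>l. [:- 1, 0, 1::real:] ^ l"
  have d: "pderiv (?f (Suc k)) = smult (2 * (real k + 1)) ([:0, 1:] * ?f k)" for k
    unfolding pderiv_power_Suc by (simp add: pderiv_pCons algebra_simps)
  have "pderiv ([:0, 1:] * ?f l) = smult (2 * real l + 1) (?f l) + smult (2 * real l) (?f (l - 1))"
  proof (cases l)
    case (Suc k)
    have "pderiv ([:0, 1:] * ?f l) = ?f l + smult (2 * real l) ([:0, 0, 1:] * ?f k)"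
      unfolding pderiv_mult unfolding Suc d by (simp add: pderiv_pCons algebra_simps)
    also have "[:0, 0, 1:] * ?f k = ?f l + ?f k"
      by (intro poly_eq_poly_eq_iff[THEN iffD1] ext) (simp add: Suc algebra_simps)
    finally have "pderiv ([:0, 1:] * ?f l) = ?f l + smult (2 * real l) (?f l + ?f k)" .
    also have "\<dots> = smult (2 * real l + 1) (?f l) + smult (2 * real l) (?f (l - 1))"
      by (intro poly_eq_poly_eq_iff[THEN iffD1] ext) (simp add: Suc algebra_simps)
    finally show ?thesis .
  qed (simp add: pderiv_pCons)
  then have "pderiv (pderiv (?f (Suc l))) = smult (2 * (real l + 1) * (2 * real l + 1)) (?f l)
      + smult (4 * real l * (real l + 1)) (?f (l - 1))"
    unfolding d pderiv_smult by (simp add: smult_add_right algebra_simps)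
  then have "(pderiv ^^ (n + 2)) (?f (Suc l)) = smult (2 * (real l + 1) * (2 * real l + 1)) ((pderiv ^^ n) (?f l))
      + smult (4 * real l * (real l + 1)) ((pderiv ^^ n) (?f (l - 1)))"
    unfolding funpow_add by (simp add: eval_nat_numeral higher_pderiv_add higher_pderiv_smult)
  then show ?thesis
    unfolding rodrigues_def by simp
qed

section \<open>Normalised associated Legendre functions and their ladder relations\<close>

definition polar_norm :: "nat \<Rightarrow> nat \<Rightarrow> real" where
  "polar_norm l k = sqrt (real (2 * l + 1) * fact (l - k) / (4 * pi * fact (l + k))) / (2 ^ l * fact l)"

text \<open>With \<open>sin \<theta>\<close> in place of \<open>sqrt (1 - (cos \<theta>)\<^sup>2)\<close> this is a smooth function of \<open>\<theta>\<close> on the whole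
  line.\<close>

definition polar :: "nat \<Rightarrow> int \<Rightarrow> real \<Rightarrow> real" where
  "polar l m \<theta> = (if m \<ge> 0 then (- 1) ^ nat m else 1) * polar_norm l (nat \<bar>m\<bar>) *
     sin \<theta> ^ nat \<bar>m\<bar> * rodrigues l (l + nat \<bar>m\<bar>) (cos \<theta>)"

lemma rodrigues_eq_0: "rodrigues l n t = 0" if "n > 2 * l"
proof -
  have "degree ([:- 1, 0, 1::real:] ^ l) = 2 * l"
    by (simp add: degree_power_eq)
  then have "(pderiv ^^ n) ([:- 1, 0, 1::real:] ^ l) = 0"
    using that by (intro poly_eqI) (simp add: coeff_higher_pderiv coeff_eq_0)
  then show ?thesis by (simp add: rodrigues_def)
qed

lemma polar_eq_0: "polar l m \<theta> = 0" if "\<bar>m\<bar> > int l"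
  using that by (simp add: polar_def rodrigues_eq_0)

lemma polar_minus: "polar l (- m) \<theta> = (- 1) ^ nat \<bar>m\<bar> * polar l m \<theta>"
proof -
  have "(- 1 :: real) ^ k * ((- 1) ^ k * x) = x" for k x
    by (simp flip: mult.assoc power_mult_distrib)
  then show ?thesis
    by (cases "m = 0") (auto simp: polar_def mult.assoc)
qed

lemma polar_of_nat:
  "polar l (int k) \<theta> = (- 1) ^ k * polar_norm l k * sin \<theta> ^ k * rodrigues l (l + k) (cos \<theta>)"
  by (simp add: polar_def)

lemma sph_harm_angle_eq_polar:
  assumes "sin \<theta> \<ge> 0"
  shows "sph_harm_angle l m \<theta> \<phi> = cis (of_int m * \<phi>) * of_real (polar l m \<theta>)"
proof -
  have sin: "sqrt (1 - (cos \<theta>)\<^sup>2) = sin \<theta>"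
    using assms by (simp add: sin_squared_eq[symmetric])
  have nonneg: "sph_harm_angle_nonneg l k \<theta> \<phi> = cis (k * \<phi>) * of_real (polar l (int k) \<theta>)" for k
    unfolding sph_harm_angle_nonneg_def assoc_legendre_def sin polar_of_nat polar_norm_def
    by (simp add: cis_conv_exp rodrigues_def mult_ac)
  show ?thesis
  proof (cases "m \<ge> 0")
    case True
    then show ?thesis
      using nonneg[of "nat m"] by (simp add: sph_harm_angle_def)
  next
    case False
    have "sph_harm_angle l m \<theta> \<phi> = (- 1) ^ nat (- m) * cnj (sph_harm_angle_nonneg l (nat (- m)) \<theta> \<phi>)"
      using False by (simp add: sph_harm_angle_def)
    also have "\<dots> = cis (m * \<phi>) * of_real ((- 1) ^ nat (- m) * polar l (- m) \<theta>)"
      unfolding nonneg using False by (simp add: cis_cnj mult_ac)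
    also have "(- 1) ^ nat (- m) * polar l (- m) \<theta> = polar l m \<theta>"
      using polar_minus[of l "- m" \<theta>] False by simp
    finally show ?thesis .
  qed
qed

text \<open>Matrix element of the raising operator of angular momentum from order \<open>m\<close>
  to \<open>m + 1\<close>; lowering from \<open>m\<close> uses the element at \<open>m - 1\<close>.
  The zeros at \<open>l\<close> and \<open>- l - 1\<close> end the ladder.\<close>

definition ladder_coeff :: "nat \<Rightarrow> int \<Rightarrow> real" where
  "ladder_coeff l m = sqrt ((real l - of_int m) * (real l + of_int m + 1))"

lemma ladder_coeff_minus: "ladder_coeff l (- m - 1) = ladder_coeff l m"
  by (simp add: ladder_coeff_def algebra_simps)

lemma ladder_coeff_top [simp]: "ladder_coeff l (int l) = 0"
  by (simp add: ladder_coeff_def)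

lemma ladder_coeff_bot [simp]: "ladder_coeff l (- int l - 1) = 0"
  by (simp add: ladder_coeff_def)

lemma ladder_coeff_pos: "ladder_coeff l m > 0" if "- int l \<le> m" "m < int l"
  using that by (simp add: ladder_coeff_def)

lemma polar_norm_pos: "polar_norm l k > 0"
  by (simp add: polar_norm_def)

text \<open>The quotient of the squared normalisations at orders \<open>k\<close> and
  \<open>k + 1\<close> is \<open>(l - k) (l + k + 1)\<close>, the square of the ladder
  coefficient.\<close>

lemma polar_norm_ladder: "ladder_coeff l (int k) * polar_norm l (Suc k) = polar_norm l k" if "k < l"
proof -
  obtain j where l: "l = Suc (k + j)"
    using less_imp_Suc_add[OF \<open>k < l\<close>] by blast
  have "(1 + real j) * (real l + k + 1) * (real (2 * l + 1) * fact j / (4 * pi * fact (l + Suc k))) =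
        real (2 * l + 1) * fact (Suc j) / (4 * pi * fact (l + k))"
  proof -
    have gen: "a * x * (c * F / (4 * pi * (x * A))) = c * (a * F) / (4 * pi * A)"
      if "x > 0" "A > 0" for a x c F A :: real
      using that by (simp add: field_simps)
    have eq: "fact (l + Suc k) = (real l + k + 1) * fact (l + k)" "fact (Suc j) = (1 + real j) * fact j"
      by simp_all
    show ?thesis
      unfolding eq by (rule gen) simp_all
  qed
  moreover have "real l - k = 1 + real j" "l - Suc k = j" "l - k = Suc j"
    by (simp_all add: l)
  ultimately show ?thesis
    unfolding ladder_coeff_def polar_norm_def of_int_of_nat_eq
    by (simp only: times_divide_eq_right flip: real_sqrt_mult)
qed

definition polar_deriv :: "nat \<Rightarrow> int \<Rightarrow> real \<Rightarrow> real" where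
  "polar_deriv l m \<theta> = deriv (polar l m) \<theta>"

lemma polar_deriv_of_nat:
  "(polar l (int k) has_real_derivative
     (- 1) ^ k * polar_norm l k * (k * sin \<theta> ^ (k - 1) * cos \<theta> * rodrigues l (l + k) (cos \<theta>)
       - sin \<theta> ^ Suc k * rodrigues l (l + Suc k) (cos \<theta>))) (at \<theta>)"
  unfolding polar_of_nat[abs_def]
  by (rule derivative_eq_intros refl DERIV_chain2[OF rodrigues_has_field_derivative])+
     (simp add: algebra_simps)

lemma polar_has_real_derivative: "(polar l m has_real_derivative polar_deriv l m \<theta>) (at \<theta>)"
proof -
  have "polar l m field_differentiable at \<theta>"
  proof (cases "m \<ge> 0")
    case True
    then show ?thesis
      using polar_deriv_of_nat[of l "nat m" \<theta>] unfolding field_differentiable_def by auto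
  next
    case False
    then have m: "polar l m = (\<lambda>\<theta>. (- 1) ^ nat (- m) * polar l (- m) \<theta>)"
      using polar_minus[of l "- m"] by auto
    have "polar l (- m) field_differentiable at \<theta>"
      using False polar_deriv_of_nat[of l "nat (- m)" \<theta>] unfolding field_differentiable_def by auto
    then show ?thesis
      unfolding m by (intro derivative_intros)
  qed
  then show ?thesis
    unfolding polar_deriv_def by (rule field_differentiable_derivI)
qed

lemma polar_deriv_minus: "polar_deriv l (- m) \<theta> = (- 1) ^ nat \<bar>m\<bar> * polar_deriv l m \<theta>"
proof (rule DERIV_unique[OF polar_has_real_derivative])
  show "(polar l (- m) has_real_derivative (- 1) ^ nat \<bar>m\<bar> * polar_deriv l m \<theta>) (at \<theta>)"
    unfolding polar_minus[abs_def] by (intro DERIV_cmult polar_has_real_derivative)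
qed

lemma continuous_on_polar [continuous_intros]: "continuous_on A (polar l m)"
  by (intro continuous_at_imp_continuous_on ballI DERIV_isCont[OF polar_has_real_derivative])

text \<open>The product rule: differentiating the power of the sine gives a cotangent term, and
  differentiating the polynomial gives the function of order \<open>k + 1\<close>, with a sign from
  the phase \<open>(- 1) ^ k\<close>. Multiplication by \<open>sin \<theta>\<close> clears the
  cotangent.\<close>

lemma polar_raise_nat:
  "sin \<theta> * polar_deriv l (int k) \<theta> =
     k * cos \<theta> * polar l (int k) \<theta> + sin \<theta> * (ladder_coeff l (int k) * polar l (int k + 1) \<theta>)"
  if "k \<le> l"
proof -
  have D: "polar_deriv l (int k) \<theta> = (- 1) ^ k * polar_norm l k *
      (k * sin \<theta> ^ (k - 1) * cos \<theta> * rodrigues l (l + k) (cos \<theta>) - sin \<theta> ^ Suc k * rodrigues l (l + Suc k) (cos \<theta>))"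
    by (rule DERIV_unique[OF polar_has_real_derivative polar_deriv_of_nat])
  have pow: "sin \<theta> * (k * sin \<theta> ^ (k - 1)) = k * sin \<theta> ^ k"
    by (cases k) auto
  have Suc: "ladder_coeff l (int k) * polar l (int k + 1) \<theta> =
      - ((- 1) ^ k * polar_norm l k * sin \<theta> ^ Suc k * rodrigues l (l + Suc k) (cos \<theta>))"
  proof (cases "k = l")
    case True
    then show ?thesis by (simp add: rodrigues_eq_0)
  next
    case False
    have "int k + 1 = int (Suc k)" by simp
    then have "ladder_coeff l (int k) * polar l (int k + 1) \<theta> = - ((- 1) ^ k *
      (ladder_coeff l (int k) * polar_norm l (Suc k)) * sin \<theta> ^ Suc k * rodrigues l (l + Suc k) (cos \<theta>))"
      by (simp only: polar_of_nat) simp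
    then show ?thesis
      using polar_norm_ladder[of k l] False that by simp
  qed
  have "sin \<theta> * polar_deriv l (int k) \<theta> = (- 1) ^ k * polar_norm l k *
      ((sin \<theta> * (k * sin \<theta> ^ (k - 1))) * cos \<theta> * rodrigues l (l + k) (cos \<theta>)
        - sin \<theta> * sin \<theta> ^ Suc k * rodrigues l (l + Suc k) (cos \<theta>))"
    unfolding D by (simp add: algebra_simps)
  then show ?thesis
    unfolding pow Suc polar_of_nat by (simp add: algebra_simps)
qed

text \<open>Going down uses Legendre's equation, which trades the derivative of order
  \<open>l + k + 1\<close> for the one of order \<open>l + k - 1\<close>. Order 0 is separate
  because its lower neighbour is negative; there the reflection of the order turns raising into
  lowering.\<close>

lemma polar_lower_nat:
  "sin \<theta> * polar_deriv l (int k) \<theta> =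
     - (k * cos \<theta> * polar l (int k) \<theta> + sin \<theta> * (ladder_coeff l (int k - 1) * polar l (int k - 1) \<theta>))"
  if "k \<le> l"
proof (cases k)
  case 0
  have "polar l (- 1) \<theta> = - polar l 1 \<theta>"
    using polar_minus[of l 1 \<theta>] by simp
  moreover have "ladder_coeff l (- 1) = ladder_coeff l 0"
    using ladder_coeff_minus[of l 0] by simp
  ultimately show ?thesis
    using polar_raise_nat[OF that, of \<theta>] 0 by simp
next
  case (Suc j)
  have D: "polar_deriv l (int k) \<theta> = (- 1) ^ k * polar_norm l k *
      (k * sin \<theta> ^ (k - 1) * cos \<theta> * rodrigues l (l + k) (cos \<theta>) - sin \<theta> ^ Suc k * rodrigues l (l + Suc k) (cos \<theta>))"
    by (rule DERIV_unique[OF polar_has_real_derivative polar_deriv_of_nat])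
  have ode: "(sin \<theta>)\<^sup>2 * rodrigues l (l + Suc k) (cos \<theta>) =
      2 * k * cos \<theta> * rodrigues l (l + k) (cos \<theta>)
        - (real l + k) * (real l + 1 - k) * rodrigues l (l + j) (cos \<theta>)"
    using legendre_ode[of "cos \<theta>" l "l + k"] Suc by (simp add: sin_squared_eq algebra_simps)
  have "(ladder_coeff l (int j))\<^sup>2 = (real l - j) * (real l + j + 1)"
    unfolding ladder_coeff_def using Suc that by simp
  then have coeff: "ladder_coeff l (int j) * polar_norm l j = (real l - j) * (real l + j + 1) * polar_norm l k"
    using polar_norm_ladder[of j l] that Suc by (metis Suc_le_lessD mult.assoc power2_eq_square)
  have "sin \<theta> * polar_deriv l (int k) \<theta> + k * cos \<theta> * polar l (int k) \<theta> =
    (- 1) ^ k * polar_norm l k * sin \<theta> ^ k *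
      (2 * k * cos \<theta> * rodrigues l (l + k) (cos \<theta>) - (sin \<theta>)\<^sup>2 * rodrigues l (l + Suc k) (cos \<theta>))"
    unfolding D polar_of_nat by (simp add: Suc algebra_simps power2_eq_square)
  also have "\<dots> = (- 1) ^ k * sin \<theta> ^ k *
      ((real l - j) * (real l + j + 1) * polar_norm l k) * rodrigues l (l + j) (cos \<theta>)"
    unfolding ode by (simp add: Suc algebra_simps)
  also have "\<dots> = - (sin \<theta> * (ladder_coeff l (int j) * polar l (int j) \<theta>))"
    unfolding coeff[symmetric] polar_of_nat by (simp add: Suc)
  finally show ?thesis
    using Suc by simp
qed

text \<open>For negative orders the reflection \<open>polar_minus\<close> exchanges raising and
  lowering.\<close>

lemma polar_raise:
  "sin \<theta> * polar_deriv l m \<theta> =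
     m * cos \<theta> * polar l m \<theta> + sin \<theta> * (ladder_coeff l m * polar l (m + 1) \<theta>)"
  if "\<bar>m\<bar> \<le> int l"
proof (cases "m \<ge> 0")
  case True
  then show ?thesis
    using polar_raise_nat[of "nat m" l \<theta>] that by simp
next
  case False
  define k where "k = nat (- m)"
  have k: "m = - int k" "k \<le> l" "k > 0"
    using False that by (simp_all add: k_def)
  have p: "polar l (m + 1) \<theta> = - ((- 1) ^ k * polar l (int k - 1) \<theta>)"
    using polar_minus[of l "int k - 1" \<theta>] k
    by (cases k) (simp_all add: nat_add_distrib)
  have "sin \<theta> * polar_deriv l m \<theta> = (- 1) ^ k * (sin \<theta> * polar_deriv l (int k) \<theta>)"
    unfolding k polar_deriv_minus by simp
  also have "\<dots> = m * cos \<theta> * ((- 1) ^ k * polar l (int k) \<theta>)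
      - sin \<theta> * (ladder_coeff l (int k - 1) * ((- 1) ^ k * polar l (int k - 1) \<theta>))"
    unfolding polar_lower_nat[OF k(2)] by (simp add: k algebra_simps)
  also have "(- 1) ^ k * polar l (int k) \<theta> = polar l m \<theta>"
    unfolding k polar_minus by simp
  also have "ladder_coeff l (int k - 1) = ladder_coeff l m"
    using ladder_coeff_minus[of l "int k - 1"] k by simp
  finally show ?thesis
    unfolding p by simp
qed

lemma polar_lower:
  "sin \<theta> * polar_deriv l m \<theta> =
     - (m * cos \<theta> * polar l m \<theta> + sin \<theta> * (ladder_coeff l (m - 1) * polar l (m - 1) \<theta>))"
  if "\<bar>m\<bar> \<le> int l"
proof -
  have p: "(- 1) ^ nat \<bar>m\<bar> * polar l (- m + 1) \<theta> = - polar l (m - 1) \<theta>"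
  proof -
    have "(- 1::real) ^ nat \<bar>m\<bar> * (- 1) ^ nat \<bar>m - 1\<bar> = - 1"
    proof (cases "m \<ge> 1")
      case True
      then have "nat \<bar>m\<bar> = Suc (nat \<bar>m - 1\<bar>)" by simp
      then show ?thesis by (simp only: power_Suc mult.assoc flip: power_mult_distrib) simp
    next
      case False
      then have "nat \<bar>m - 1\<bar> = Suc (nat \<bar>m\<bar>)" by simp
      then show ?thesis by (simp only: power_Suc mult.left_commute flip: power_mult_distrib) simp
    qed
    moreover have "- m + 1 = - (m - 1)"
      by simp
    ultimately show ?thesis
      unfolding \<open>- m + 1 = - (m - 1)\<close> polar_minus mult.assoc[symmetric] by simp
  qed
  have sq: "(- 1::real) ^ nat \<bar>m\<bar> * ((- 1) ^ nat \<bar>m\<bar> * x) = x" for x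
    by (simp flip: mult.assoc power_mult_distrib)
  have "sin \<theta> * polar_deriv l m \<theta> = (- 1) ^ nat \<bar>m\<bar> * (sin \<theta> * polar_deriv l (- m) \<theta>)"
    unfolding polar_deriv_minus by (simp add: sq mult.left_commute)
  also have "\<dots> = - m * cos \<theta> * ((- 1) ^ nat \<bar>m\<bar> * polar l (- m) \<theta>)
      + sin \<theta> * (ladder_coeff l (- m) * ((- 1) ^ nat \<bar>m\<bar> * polar l (- m + 1) \<theta>))"
    using that by (subst polar_raise) (simp_all add: algebra_simps)
  also have "(- 1) ^ nat \<bar>m\<bar> * polar l (- m) \<theta> = polar l m \<theta>"
    unfolding polar_minus by (simp add: sq)
  also have "ladder_coeff l (- m) = ladder_coeff l (m - 1)"
    using ladder_coeff_minus[of l "m - 1"] by simp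
  finally show ?thesis
    unfolding p by (simp add: algebra_simps)
qed

section \<open>Racah's formula\<close>

text \<open>Since \<open>rfact\<close> vanishes at negative arguments, the constraints on the summation index in
  Racah's formula become automatic.\<close>

definition rfact :: "int \<Rightarrow> real" where
  "rfact k = (if k < 0 then 0 else 1 / fact (nat k))"

lemma rfact_neg [simp]: "k < 0 \<Longrightarrow> rfact k = 0"
  by (simp add: rfact_def)

lemma rfact_diff_1: "rfact (k - 1) = k * rfact k"
proof (cases "k \<ge> 1")
  case True
  then have "nat k = Suc (nat (k - 1))" by simp
  then have "fact (nat k) = k * (fact (nat (k - 1)) :: real)"
    using True by simp
  then show ?thesis
    using True by (simp add: rfact_def)
qed (auto simp: rfact_def)

lemma rfact_add_1: "(k + 1) * rfact (k + 1) = rfact k"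
  using rfact_diff_1[of "k + 1"] by simp

definition racah_term :: "int \<Rightarrow> int \<Rightarrow> int \<Rightarrow> int \<Rightarrow> int \<Rightarrow> int \<Rightarrow> real" where
  "racah_term a b c d e f = rfact a * rfact b * rfact c * rfact d * rfact e * rfact f"

definition racah_sum :: "int \<Rightarrow> int \<Rightarrow> int \<Rightarrow> int \<Rightarrow> int \<Rightarrow> real" where
  "racah_sum j1 j2 j3 m1 m2 = (\<Sum>s\<le>nat (j1 + j2 - j3). (- 1) ^ s *
     racah_term (int s) (j1 + j2 - j3 - int s) (j1 - m1 - int s) (j2 + m2 - int s)
       (j3 - j2 + m1 + int s) (j3 - j1 - m2 + int s))"

section \<open>Ladder relations of Racah's sum\<close>

lemma alternating_sum_telescope:
  fixes R :: "int \<Rightarrow> real"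
  assumes "R (- 1) = 0" "R (int n) = 0"
  shows "(\<Sum>s\<le>n. (- 1) ^ s * (R (int s) + R (int s - 1))) = 0"
proof -
  have "(\<Sum>s\<le>n. (- 1) ^ s * (R (int s) + R (int s - 1))) = (- 1) ^ n * R (int n) + R (- 1)"
    by (induction n) (simp_all add: algebra_simps)
  then show ?thesis using assms by simp
qed

text \<open>Creative telescoping: the summands combine to \<open>R s + R (s - 1)\<close>, and the
  alternating sign cancels consecutive pairs. The ends vanish because the first argument of the term
  is negative at \<open>s = - 1\<close> and the second at \<open>s = n\<close>.\<close>

lemma racah_sum_raise:
  assumes "j1 + j2 \<ge> j3"
  shows "of_int (j1 + m1 + 1) * racah_sum j1 j2 j3 (m1 + 1) m2 + of_int (j2 + m2 + 1) * racah_sum j1 j2 j3 m1 (m2 + 1)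
    - of_int (j3 - m1 - m2) * racah_sum j1 j2 j3 m1 m2 = 0"
proof -
  define n where "n = nat (j1 + j2 - j3)"
  have n: "int n = j1 + j2 - j3" using assms by (simp add: n_def)
  define R where "R s = racah_term s (j1 + j2 - j3 - s - 1) (j1 - m1 - s - 1) (j2 + m2 - s)
    (j3 - j2 + m1 + s + 1) (j3 - j1 - m2 + s)" for s
  \<comment> \<open>With the six arguments of the summand at \<open>s\<close>, the factors are
    \<open>b + e + 1 = j1 + m1 + 1\<close>, \<open>a + d + 1 = j2 + m2 + 1\<close> and
    \<open>c + f = j3 - m1 - m2\<close>. Each is absorbed into reciprocal factorials through
    \<open>k * rfact k = rfact (k - 1)\<close>; the two terms left over are \<open>R s\<close> and
    \<open>R (s - 1)\<close>.\<close>
  have key: "(b + e + 1) * racah_term a b (c - 1) d (e + 1) f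
      + (a + d + 1) * racah_term a b c (d + 1) e (f - 1) - (c + f) * racah_term a b c d e f
      = racah_term a (b - 1) (c - 1) d (e + 1) f + racah_term (a - 1) b c (d + 1) e (f - 1)"
    for a b c d e f
  proof -
    have "(of_int b + of_int e + 1) * (rfact b * rfact (e + 1)) = rfact (b - 1) * rfact (e + 1) + rfact b * rfact e"
      by (simp add: rfact_diff_1 algebra_simps flip: rfact_add_1[of e])
    moreover have "(of_int a + of_int d + 1) * (rfact a * rfact (d + 1)) = rfact (a - 1) * rfact (d + 1) + rfact a * rfact d"
      by (simp add: rfact_diff_1 algebra_simps flip: rfact_add_1[of d])
    moreover have "rfact (c - 1) = c * rfact c" "rfact (f - 1) = f * rfact f"
      by (rule rfact_diff_1)+
    ultimately show ?thesis
      unfolding racah_term_def by algebra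
  qed
  have "of_int (j1 + m1 + 1) * racah_sum j1 j2 j3 (m1 + 1) m2 + of_int (j2 + m2 + 1) * racah_sum j1 j2 j3 m1 (m2 + 1)
    - of_int (j3 - m1 - m2) * racah_sum j1 j2 j3 m1 m2 = (\<Sum>s\<le>n. (- 1) ^ s * (R (int s) + R (int s - 1)))"
    unfolding racah_sum_def n_def[symmetric] sum_distrib_left
      sum.distrib[symmetric] sum_subtractf[symmetric]
  proof (rule sum.cong[OF refl])
    fix s
    show "of_int (j1 + m1 + 1) * ((- 1) ^ s * racah_term (int s) (j1 + j2 - j3 - int s) (j1 - (m1 + 1) - int s)
            (j2 + m2 - int s) (j3 - j2 + (m1 + 1) + int s) (j3 - j1 - m2 + int s))
        + of_int (j2 + m2 + 1) * ((- 1) ^ s * racah_term (int s) (j1 + j2 - j3 - int s) (j1 - m1 - int s)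
            (j2 + (m2 + 1) - int s) (j3 - j2 + m1 + int s) (j3 - j1 - (m2 + 1) + int s))
        - of_int (j3 - m1 - m2) * ((- 1) ^ s * racah_term (int s) (j1 + j2 - j3 - int s) (j1 - m1 - int s)
            (j2 + m2 - int s) (j3 - j2 + m1 + int s) (j3 - j1 - m2 + int s))
      = (- 1) ^ s * (R (int s) + R (int s - 1))"
      using arg_cong[OF key[of "j1 + j2 - j3 - int s" "j3 - j2 + m1 + int s" "int s" "j1 - m1 - int s" "j2 + m2 - int s" "j3 - j1 - m2 + int s"],
          of "\<lambda>x. (- 1) ^ s * x"]
      by (simp add: R_def algebra_simps)
  qed
  also have "\<dots> = 0"
    by (rule alternating_sum_telescope) (simp_all add: R_def racah_term_def n)
  finally show ?thesis .
qed

text \<open>The telescoping of \<open>racah_sum_raise\<close> after exchanging the third argument of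
  \<open>racah_term\<close> with the fourth and the fifth with the sixth.\<close>

lemma racah_sum_lower:
  assumes "j1 + j2 \<ge> j3"
  shows "of_int (j1 - m1 + 1) * racah_sum j1 j2 j3 (m1 - 1) m2 + of_int (j2 - m2 + 1) * racah_sum j1 j2 j3 m1 (m2 - 1)
    - of_int (j3 + m1 + m2) * racah_sum j1 j2 j3 m1 m2 = 0"
proof -
  define n where "n = nat (j1 + j2 - j3)"
  have n: "int n = j1 + j2 - j3" using assms by (simp add: n_def)
  define R where "R s = racah_term s (j1 + j2 - j3 - s - 1) (j1 - m1 - s) (j2 + m2 - s - 1)
    (j3 - j2 + m1 + s) (j3 - j1 - m2 + s + 1)" for s
  have key: "(a + c + 1) * racah_term a b (c + 1) d (e - 1) f
      + (b + f + 1) * racah_term a b c (d - 1) e (f + 1) - (e + d) * racah_term a b c d e f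
      = racah_term a (b - 1) c (d - 1) e (f + 1) + racah_term (a - 1) b (c + 1) d (e - 1) f"
    for a b c d e f
  proof -
    have "(of_int b + of_int f + 1) * (rfact b * rfact (f + 1)) = rfact (b - 1) * rfact (f + 1) + rfact b * rfact f"
      by (simp add: rfact_diff_1 algebra_simps flip: rfact_add_1[of f])
    moreover have "(of_int a + of_int c + 1) * (rfact a * rfact (c + 1)) = rfact (a - 1) * rfact (c + 1) + rfact a * rfact c"
      by (simp add: rfact_diff_1 algebra_simps flip: rfact_add_1[of c])
    moreover have "rfact (d - 1) = d * rfact d" "rfact (e - 1) = e * rfact e"
      by (rule rfact_diff_1)+
    ultimately show ?thesis
      unfolding racah_term_def by algebra
  qed
  have "of_int (j1 - m1 + 1) * racah_sum j1 j2 j3 (m1 - 1) m2 + of_int (j2 - m2 + 1) * racah_sum j1 j2 j3 m1 (m2 - 1)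
    - of_int (j3 + m1 + m2) * racah_sum j1 j2 j3 m1 m2 = (\<Sum>s\<le>n. (- 1) ^ s * (R (int s) + R (int s - 1)))"
    unfolding racah_sum_def n_def[symmetric] sum_distrib_left
      sum.distrib[symmetric] sum_subtractf[symmetric]
  proof (rule sum.cong[OF refl])
    fix s
    show "of_int (j1 - m1 + 1) * ((- 1) ^ s * racah_term (int s) (j1 + j2 - j3 - int s) (j1 - (m1 - 1) - int s)
            (j2 + m2 - int s) (j3 - j2 + (m1 - 1) + int s) (j3 - j1 - m2 + int s))
        + of_int (j2 - m2 + 1) * ((- 1) ^ s * racah_term (int s) (j1 + j2 - j3 - int s) (j1 - m1 - int s)
            (j2 + (m2 - 1) - int s) (j3 - j2 + m1 + int s) (j3 - j1 - (m2 - 1) + int s))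
        - of_int (j3 + m1 + m2) * ((- 1) ^ s * racah_term (int s) (j1 + j2 - j3 - int s) (j1 - m1 - int s)
            (j2 + m2 - int s) (j3 - j2 + m1 + int s) (j3 - j1 - m2 + int s))
      = (- 1) ^ s * (R (int s) + R (int s - 1))"
      using arg_cong[OF key[of "int s" "j1 - m1 - int s" "j1 + j2 - j3 - int s" "j2 + m2 - int s" "j3 - j2 + m1 + int s" "j3 - j1 - m2 + int s"],
          of "\<lambda>x. (- 1) ^ s * x"]
      by (simp add: R_def algebra_simps)
  qed
  also have "\<dots> = 0"
    by (rule alternating_sum_telescope) (simp_all add: R_def racah_term_def n)
  finally show ?thesis .
qed

text \<open>In each case one argument of \<open>racah_term\<close>, or a sum of two in which
  \<open>s\<close> cancels, is negative for every \<open>s\<close>; for instance the second and the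
  fifth add up to \<open>j1 + m1\<close>.\<close>

lemma racah_sum_eq_0:
  assumes "m1 > j1 \<or> m1 < - j1 \<or> m2 > j2 \<or> m2 < - j2 \<or> m1 + m2 > j3 \<or> m1 + m2 < - j3
    \<or> j3 > j1 + j2 \<or> j2 > j1 + j3 \<or> j1 > j2 + j3"
  shows "racah_sum j1 j2 j3 m1 m2 = 0"
  unfolding racah_sum_def
proof (intro sum.neutral ballI)
  fix s
  have "j1 + j2 - j3 - int s < 0 \<or> j1 - m1 - int s < 0 \<or> j2 + m2 - int s < 0 \<or>
      j3 - j2 + m1 + int s < 0 \<or> j3 - j1 - m2 + int s < 0"
    using assms by linarith
  then show "(- 1) ^ s * racah_term (int s) (j1 + j2 - j3 - int s) (j1 - m1 - int s)
      (j2 + m2 - int s) (j3 - j2 + m1 + int s) (j3 - j1 - m2 + int s) = 0"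
    by (auto simp: racah_term_def)
qed

section \<open>Ladder relations of the 3j-symbols\<close>

definition wigner_norm :: "int \<Rightarrow> int \<Rightarrow> int \<Rightarrow> real" where
  "wigner_norm j1 j2 j3 = sqrt (fact (nat (j1 + j2 - j3)) * fact (nat (j1 - j2 + j3)) *
     fact (nat (- j1 + j2 + j3)) / fact (nat (j1 + j2 + j3 + 1)))"

definition weight_norm :: "int \<Rightarrow> int \<Rightarrow> real" where
  "weight_norm j m = sqrt (fact (nat (j + m)) * fact (nat (j - m)))"

text \<open>The second root of Racah's formula is split by columns, so that a ladder step in one
  column changes a single \<open>weight_norm\<close>.\<close>

lemma wigner3j_eq_racah_sum:
  assumes "m1 + m2 + m3 = 0" "\<bar>j1 - j2\<bar> \<le> j3" "j3 \<le> j1 + j2"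
    "\<bar>m1\<bar> \<le> j1" "\<bar>m2\<bar> \<le> j2" "\<bar>m3\<bar> \<le> j3"
  shows "wigner3j j1 j2 j3 m1 m2 m3 = (- 1) powi (j1 - j2 - m3) * wigner_norm j1 j2 j3 *
    (weight_norm j1 m1 * weight_norm j2 m2 * weight_norm j3 m3) * racah_sum j1 j2 j3 m1 m2"
proof -
  define S where "S = {s. 0 \<le> s \<and> 0 \<le> j1 + j2 - j3 - s \<and> 0 \<le> j1 - m1 - s \<and> 0 \<le> j2 + m2 - s \<and>
      0 \<le> j3 - j2 + m1 + s \<and> 0 \<le> j3 - j1 - m2 + s}"
  define f where "f = (\<lambda>k::int. fact (nat k) :: real)"
  have f: "1 / f k = rfact k" if "k \<ge> 0" for k
    using that by (simp add: f_def rfact_def)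
  define t where "t s = (- 1) powi s * racah_term s (j1 + j2 - j3 - s) (j1 - m1 - s)
      (j2 + m2 - s) (j3 - j2 + m1 + s) (j3 - j1 - m2 + s)" for s :: int
  have "(\<Sum>s\<in>S. (- 1) powi s / (f s * f (j1 + j2 - j3 - s) * f (j1 - m1 - s) * f (j2 + m2 - s) *
            f (j3 - j2 + m1 + s) * f (j3 - j1 - m2 + s))) = (\<Sum>s\<in>S. t s)"
    by (rule sum.cong) (auto simp: t_def S_def racah_term_def f[symmetric])
  also have "\<dots> = (\<Sum>s\<in>{0..j1 + j2 - j3}. t s)"
  proof (rule sum.mono_neutral_left)
    show "\<forall>s\<in>{0..j1 + j2 - j3} - S. t s = 0"
    proof
      fix s assume "s \<in> {0..j1 + j2 - j3} - S"
      then have "j1 + j2 - j3 - s < 0 \<or> j1 - m1 - s < 0 \<or> j2 + m2 - s < 0 \<or>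
          j3 - j2 + m1 + s < 0 \<or> j3 - j1 - m2 + s < 0"
        by (auto simp: S_def)
      then show "t s = 0"
        by (auto simp: t_def racah_term_def)
    qed
  qed (auto simp: S_def)
  also have "\<dots> = (\<Sum>s\<le>nat (j1 + j2 - j3). t (int s))"
    by (rule sum.reindex_bij_witness[of _ int nat]) (use assms in auto)
  also have "\<dots> = racah_sum j1 j2 j3 m1 m2"
    by (simp add: t_def racah_sum_def)
  finally have "(\<Sum>s\<in>S. (- 1) powi s / (f s * f (j1 + j2 - j3 - s) * f (j1 - m1 - s) * f (j2 + m2 - s) *
            f (j3 - j2 + m1 + s) * f (j3 - j1 - m2 + s))) = racah_sum j1 j2 j3 m1 m2" .
  moreover have "sqrt (f (j1 + m1) * f (j1 - m1) * f (j2 + m2) * f (j2 - m2) * f (j3 + m3) * f (j3 - m3)) =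
      weight_norm j1 m1 * weight_norm j2 m2 * weight_norm j3 m3"
    unfolding weight_norm_def f_def by (simp flip: real_sqrt_mult add: mult_ac)
  ultimately show ?thesis
    using assms unfolding wigner3j_def wigner_norm_def f_def S_def Let_def by simp
qed

lemma wigner3j_eq_0:
  assumes "m1 + m2 + m3 \<noteq> 0 \<or> \<bar>m1\<bar> > j1 \<or> \<bar>m2\<bar> > j2 \<or> \<bar>m3\<bar> > j3 \<or>
     j3 > j1 + j2 \<or> j2 > j1 + j3 \<or> j1 > j2 + j3"
  shows "wigner3j j1 j2 j3 m1 m2 m3 = 0"
  using assms unfolding wigner3j_def by auto

text \<open>Trades the root in \<open>ladder_coeff\<close> for the integer factor of
  \<open>racah_sum_raise\<close>: the quotient of the squared weights at \<open>m + 1\<close> and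
  \<open>m\<close> is \<open>(l + m + 1) / (l - m)\<close>.\<close>

lemma ladder_weight_norm:
  assumes "- int l \<le> m" "m < int l"
  shows "ladder_coeff l m * weight_norm (int l) (m + 1) = (of_int (int l + m + 1)) * weight_norm (int l) m"
proof -
  have "nat (int l + (m + 1)) = Suc (nat (int l + m))" "nat (int l - m) = Suc (nat (int l - (m + 1)))"
    using assms by linarith+
  moreover have "real (nat (int l + m)) = l + of_int m" "real (nat (int l - (m + 1))) = real l - m - 1"
    using assms by simp_all
  ultimately have "(real l - of_int m) * (real l + of_int m + 1) *
      (fact (nat (int l + (m + 1))) * fact (nat (int l - (m + 1)))) =
      (of_int (int l + m + 1))\<^sup>2 * (fact (nat (int l + m)) * fact (nat (int l - m)))"
    by (simp add: power2_eq_square)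
  then have "sqrt ((real l - of_int m) * (real l + of_int m + 1) *
      (fact (nat (int l + (m + 1))) * fact (nat (int l - (m + 1))))) =
      sqrt ((of_int (int l + m + 1))\<^sup>2 * (fact (nat (int l + m)) * fact (nat (int l - m))))"
    by simp
  then show ?thesis
    using assms unfolding ladder_coeff_def weight_norm_def real_sqrt_mult[of "_ * (_ :: real)"]
    by (simp add: real_sqrt_mult)
qed

lemma weight_norm_minus: "weight_norm j (- m) = weight_norm j m"
  by (simp add: weight_norm_def mult.commute)

lemma ladder_weight_norm_lower:
  assumes "- int l < m" "m \<le> int l"
  shows "ladder_coeff l (m - 1) * weight_norm (int l) (m - 1) = (of_int (int l - m + 1)) * weight_norm (int l) m"
proof -
  have "ladder_coeff l (- m) = ladder_coeff l (m - 1)"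
    using ladder_coeff_minus[of l "m - 1"] by simp
  then show ?thesis
    using ladder_weight_norm[of l "- m"] assms weight_norm_minus[of "int l" "m - 1"]
    by (simp add: weight_norm_minus)
qed

text \<open>Invariance of the 3j tensor under the total raising operator. All three terms are
  multiples of a common factor \<open>c\<close>, and what remains is
  \<open>racah_sum_raise\<close>.\<close>

lemma wigner3j_raise:
  fixes l1 l2 l3 :: nat
  assumes "m1 + m2 + m3 = - 1" "\<bar>m1\<bar> \<le> int l1" "\<bar>m2\<bar> \<le> int l2" "\<bar>m3\<bar> \<le> int l3"
  shows "ladder_coeff l1 m1 * wigner3j l1 l2 l3 (m1 + 1) m2 m3 +
    ladder_coeff l2 m2 * wigner3j l1 l2 l3 m1 (m2 + 1) m3 +
    ladder_coeff l3 m3 * wigner3j l1 l2 l3 m1 m2 (m3 + 1) = 0"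
proof (cases "\<bar>int l1 - int l2\<bar> \<le> int l3 \<and> int l3 \<le> int l1 + int l2")
  case False
  then have "wigner3j l1 l2 l3 n1 n2 n3 = 0" for n1 n2 n3
    by (intro wigner3j_eq_0) auto
  then show ?thesis by simp
next
  case True
  \<comment> \<open>The weights are taken at the unraised orders, although their sum is
    \<open>- 1\<close> and the symbol itself is 0 there; \<open>ladder_weight_norm\<close> brings
    every term to this form.\<close>
  define c where "c = (- 1) powi (int l1 - int l2 - m3) * wigner_norm l1 l2 l3 *
    (weight_norm l1 m1 * weight_norm l2 m2 * weight_norm l3 m3)"
  have 1: "ladder_coeff l1 m1 * wigner3j l1 l2 l3 (m1 + 1) m2 m3 =
      c * (of_int (int l1 + m1 + 1) * racah_sum l1 l2 l3 (m1 + 1) m2)"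
  proof (cases "m1 = int l1")
    case True
    then show ?thesis by (simp add: racah_sum_eq_0)
  next
    case False
    have "wigner3j l1 l2 l3 (m1 + 1) m2 m3 = (- 1) powi (int l1 - int l2 - m3) * wigner_norm l1 l2 l3 *
        (weight_norm l1 (m1 + 1) * weight_norm l2 m2 * weight_norm l3 m3) * racah_sum l1 l2 l3 (m1 + 1) m2"
      using assms True False by (intro wigner3j_eq_racah_sum) auto
    moreover have "ladder_coeff l1 m1 * weight_norm l1 (m1 + 1) = of_int (int l1 + m1 + 1) * weight_norm l1 m1"
      using False assms by (intro ladder_weight_norm) auto
    ultimately show ?thesis
      unfolding c_def by algebra
  qed
  have 2: "ladder_coeff l2 m2 * wigner3j l1 l2 l3 m1 (m2 + 1) m3 =
      c * (of_int (int l2 + m2 + 1) * racah_sum l1 l2 l3 m1 (m2 + 1))"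
  proof (cases "m2 = int l2")
    case True
    then show ?thesis by (simp add: racah_sum_eq_0)
  next
    case False
    have "wigner3j l1 l2 l3 m1 (m2 + 1) m3 = (- 1) powi (int l1 - int l2 - m3) * wigner_norm l1 l2 l3 *
        (weight_norm l1 m1 * weight_norm l2 (m2 + 1) * weight_norm l3 m3) * racah_sum l1 l2 l3 m1 (m2 + 1)"
      using assms True False by (intro wigner3j_eq_racah_sum) auto
    moreover have "ladder_coeff l2 m2 * weight_norm l2 (m2 + 1) = of_int (int l2 + m2 + 1) * weight_norm l2 m2"
      using False assms by (intro ladder_weight_norm) auto
    ultimately show ?thesis
      unfolding c_def by algebra
  qed
  have 3: "ladder_coeff l3 m3 * wigner3j l1 l2 l3 m1 m2 (m3 + 1) =
      - (c * (of_int (int l3 + m3 + 1) * racah_sum l1 l2 l3 m1 m2))"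
  proof (cases "m3 = int l3")
    case True
    then show ?thesis using assms by (simp add: racah_sum_eq_0)
  next
    case False
    \<comment> \<open>Of the three orders only the third enters the phase of Racah's formula, so
      this term alone changes sign, as in the relation for the sums.\<close>
    have "(- 1 :: real) powi (int l1 - int l2 - (m3 + 1)) = - ((- 1) powi (int l1 - int l2 - m3))"
      using power_int_diff[of "- 1 :: real" "int l1 - int l2 - m3" 1] by (simp add: algebra_simps)
    moreover have "wigner3j l1 l2 l3 m1 m2 (m3 + 1) = (- 1) powi (int l1 - int l2 - (m3 + 1)) * wigner_norm l1 l2 l3 *
        (weight_norm l1 m1 * weight_norm l2 m2 * weight_norm l3 (m3 + 1)) * racah_sum l1 l2 l3 m1 m2"
      using False assms True by (intro wigner3j_eq_racah_sum) auto
    moreover have "ladder_coeff l3 m3 * weight_norm l3 (m3 + 1) = of_int (int l3 + m3 + 1) * weight_norm l3 m3"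
      using False assms by (intro ladder_weight_norm) auto
    ultimately show ?thesis
      unfolding c_def by algebra
  qed
  have eq: "int l3 - m1 - m2 = int l3 + m3 + 1"
    using assms by simp
  have "of_int (int l1 + m1 + 1) * racah_sum l1 l2 l3 (m1 + 1) m2 + of_int (int l2 + m2 + 1) * racah_sum l1 l2 l3 m1 (m2 + 1)
      - of_int (int l3 + m3 + 1) * racah_sum l1 l2 l3 m1 m2 = 0"
    using racah_sum_raise[of "int l3" "int l1" "int l2" m1 m2] True unfolding eq by blast
  then have "c * (of_int (int l1 + m1 + 1) * racah_sum l1 l2 l3 (m1 + 1) m2 + of_int (int l2 + m2 + 1) * racah_sum l1 l2 l3 m1 (m2 + 1)
      - of_int (int l3 + m3 + 1) * racah_sum l1 l2 l3 m1 m2) = 0"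
    by (simp only: mult_zero_right)
  then show ?thesis
    unfolding 1 2 3 by (simp only: right_diff_distrib distrib_left diff_conv_add_uminus)
qed

lemma wigner3j_lower:
  fixes l1 l2 l3 :: nat
  assumes "m1 + m2 + m3 = 1" "\<bar>m1\<bar> \<le> int l1" "\<bar>m2\<bar> \<le> int l2" "\<bar>m3\<bar> \<le> int l3"
  shows "ladder_coeff l1 (m1 - 1) * wigner3j l1 l2 l3 (m1 - 1) m2 m3 +
    ladder_coeff l2 (m2 - 1) * wigner3j l1 l2 l3 m1 (m2 - 1) m3 +
    ladder_coeff l3 (m3 - 1) * wigner3j l1 l2 l3 m1 m2 (m3 - 1) = 0"
proof (cases "\<bar>int l1 - int l2\<bar> \<le> int l3 \<and> int l3 \<le> int l1 + int l2")
  case False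
  then have "wigner3j l1 l2 l3 n1 n2 n3 = 0" for n1 n2 n3
    by (intro wigner3j_eq_0) auto
  then show ?thesis by simp
next
  case True
  define c where "c = (- 1) powi (int l1 - int l2 - m3) * wigner_norm l1 l2 l3 *
    (weight_norm l1 m1 * weight_norm l2 m2 * weight_norm l3 m3)"
  have 1: "ladder_coeff l1 (m1 - 1) * wigner3j l1 l2 l3 (m1 - 1) m2 m3 =
      c * (of_int (int l1 - m1 + 1) * racah_sum l1 l2 l3 (m1 - 1) m2)"
  proof (cases "m1 = - int l1")
    case True
    then show ?thesis by (simp add: racah_sum_eq_0)
  next
    case False
    have "wigner3j l1 l2 l3 (m1 - 1) m2 m3 = (- 1) powi (int l1 - int l2 - m3) * wigner_norm l1 l2 l3 *
        (weight_norm l1 (m1 - 1) * weight_norm l2 m2 * weight_norm l3 m3) * racah_sum l1 l2 l3 (m1 - 1) m2"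
      using assms True False by (intro wigner3j_eq_racah_sum) auto
    moreover have "ladder_coeff l1 (m1 - 1) * weight_norm l1 (m1 - 1) = of_int (int l1 - m1 + 1) * weight_norm l1 m1"
      using False assms by (intro ladder_weight_norm_lower) auto
    ultimately show ?thesis
      unfolding c_def by algebra
  qed
  have 2: "ladder_coeff l2 (m2 - 1) * wigner3j l1 l2 l3 m1 (m2 - 1) m3 =
      c * (of_int (int l2 - m2 + 1) * racah_sum l1 l2 l3 m1 (m2 - 1))"
  proof (cases "m2 = - int l2")
    case True
    then show ?thesis by (simp add: racah_sum_eq_0)
  next
    case False
    have "wigner3j l1 l2 l3 m1 (m2 - 1) m3 = (- 1) powi (int l1 - int l2 - m3) * wigner_norm l1 l2 l3 *
        (weight_norm l1 m1 * weight_norm l2 (m2 - 1) * weight_norm l3 m3) * racah_sum l1 l2 l3 m1 (m2 - 1)"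
      using assms True False by (intro wigner3j_eq_racah_sum) auto
    moreover have "ladder_coeff l2 (m2 - 1) * weight_norm l2 (m2 - 1) = of_int (int l2 - m2 + 1) * weight_norm l2 m2"
      using False assms by (intro ladder_weight_norm_lower) auto
    ultimately show ?thesis
      unfolding c_def by algebra
  qed
  have 3: "ladder_coeff l3 (m3 - 1) * wigner3j l1 l2 l3 m1 m2 (m3 - 1) =
      - (c * (of_int (int l3 - m3 + 1) * racah_sum l1 l2 l3 m1 m2))"
  proof (cases "m3 = - int l3")
    case True
    then show ?thesis using assms by (simp add: racah_sum_eq_0)
  next
    case False
    have "(- 1 :: real) powi (int l1 - int l2 - (m3 - 1)) = - ((- 1) powi (int l1 - int l2 - m3))"
      using power_int_add[of "- 1 :: real" "int l1 - int l2 - m3" 1] by (simp add: algebra_simps)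
    moreover have "wigner3j l1 l2 l3 m1 m2 (m3 - 1) = (- 1) powi (int l1 - int l2 - (m3 - 1)) * wigner_norm l1 l2 l3 *
        (weight_norm l1 m1 * weight_norm l2 m2 * weight_norm l3 (m3 - 1)) * racah_sum l1 l2 l3 m1 m2"
      using False assms True by (intro wigner3j_eq_racah_sum) auto
    moreover have "ladder_coeff l3 (m3 - 1) * weight_norm l3 (m3 - 1) = of_int (int l3 - m3 + 1) * weight_norm l3 m3"
      using False assms by (intro ladder_weight_norm_lower) auto
    ultimately show ?thesis
      unfolding c_def by algebra
  qed
  have eq: "int l3 + m1 + m2 = int l3 - m3 + 1"
    using assms by simp
  have "of_int (int l1 - m1 + 1) * racah_sum l1 l2 l3 (m1 - 1) m2 + of_int (int l2 - m2 + 1) * racah_sum l1 l2 l3 m1 (m2 - 1)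
      - of_int (int l3 - m3 + 1) * racah_sum l1 l2 l3 m1 m2 = 0"
    using racah_sum_lower[of "int l3" "int l1" "int l2" m1 m2] True unfolding eq by blast
  then have "c * (of_int (int l1 - m1 + 1) * racah_sum l1 l2 l3 (m1 - 1) m2 + of_int (int l2 - m2 + 1) * racah_sum l1 l2 l3 m1 (m2 - 1)
      - of_int (int l3 - m3 + 1) * racah_sum l1 l2 l3 m1 m2) = 0"
    by (simp only: mult_zero_right)
  then show ?thesis
    unfolding 1 2 3 by (simp only: right_diff_distrib distrib_left diff_conv_add_uminus)
qed

section \<open>Normalisation of the 3j-symbols at the lowest third order\<close>

lemma sum_choose_convolution:
  "(\<Sum>k\<le>n. (k choose a) * ((n - k) choose b)) = Suc n choose Suc (a + b)"
\<comment> \<open>The identity counts the subsets of \<open>{0..n}\<close> with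
  \<open>a + b + 1\<close> elements by the element \<open>k\<close> that has \<open>a\<close> of
  them below it. The induction starts from the hockey-stick identity and proceeds by Pascal's rule,
  with an inner induction on \<open>n\<close>.\<close>
proof (induction b arbitrary: n)
  case 0
  then show ?case using sum_choose_upper[of a n] by simp
next
  case (Suc b)
  show ?case
  proof (induction n)
    case (Suc n)
    have "(\<Sum>k\<le>Suc n. (k choose a) * ((Suc n - k) choose Suc b)) =
        (\<Sum>k\<le>n. (k choose a) * ((n - k) choose b) + (k choose a) * ((n - k) choose Suc b))"
      by (simp add: Suc_diff_le algebra_simps)
    also have "\<dots> = (Suc n choose Suc (a + b)) + (Suc n choose Suc (a + Suc b))"
      unfolding sum.distrib Suc Suc.IH \<open>\<And>n. (\<Sum>k\<le>n. (k choose a) * ((n - k) choose b)) = Suc n choose Suc (a + b)\<close> by simp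
    finally show ?case by simp
  qed simp
qed

text \<open>At third order \<open>- j3\<close> the third and the sixth argument of the summand are
  negatives of each other, so only \<open>s = j1 - m1\<close>, where both are 0, survives.\<close>

lemma racah_sum_bottom:
  assumes "\<bar>j1 - j2\<bar> \<le> j3" "j3 \<le> j1 + j2" "\<bar>m1\<bar> \<le> j1" "\<bar>j3 - m1\<bar> \<le> j2"
  shows "racah_sum j1 j2 j3 m1 (j3 - m1) = (- 1) ^ nat (j1 - m1) *
    (rfact (j1 - m1) * rfact (j2 - j3 + m1) * rfact (j2 + j3 - j1) * rfact (j3 + j1 - j2))"
proof -
  let ?t = "\<lambda>s. racah_term (int s) (j1 + j2 - j3 - int s) (j1 - m1 - int s) (j2 + (j3 - m1) - int s)
       (j3 - j2 + m1 + int s) (j3 - j1 - (j3 - m1) + int s)"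
  have "racah_sum j1 j2 j3 m1 (j3 - m1) = (\<Sum>s\<in>{nat (j1 - m1)}. (- 1) ^ s * ?t s)"
    unfolding racah_sum_def
  proof (rule sum.mono_neutral_right)
    show "\<forall>s\<in>{..nat (j1 + j2 - j3)} - {nat (j1 - m1)}. (- 1) ^ s * ?t s = 0"
    proof
      fix s assume "s \<in> {..nat (j1 + j2 - j3)} - {nat (j1 - m1)}"
      then have "j1 - m1 - int s < 0 \<or> j3 - j1 - (j3 - m1) + int s < 0"
        by auto
      then show "(- 1) ^ s * ?t s = 0"
        by (auto simp: racah_term_def)
    qed
  qed (use assms in auto)
  also have "\<dots> = (- 1) ^ nat (j1 - m1) *
      racah_term (j1 - m1) (j2 - j3 + m1) 0 (j2 + j3 - j1) (j3 + j1 - j2) 0"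
  proof -
    have "m1 \<le> j1"
      using assms by simp
    then show ?thesis
      by (simp add: algebra_simps)
  qed
  also have "rfact 0 = 1"
    by (simp add: rfact_def)
  ultimately show ?thesis
    by (simp add: racah_term_def)
qed

text \<open>With \<open>k = l1 + m1\<close> the surviving summand turns into a product of two
  binomial coefficients whose upper indices add up to \<open>n\<close>. For \<open>k\<close> outside
  the admissible orders both sides vanish, so \<open>k\<close> may run over all of
  \<open>0..n\<close>.\<close>

lemma wigner3j_bottom_sq:
  fixes l1 l2 l3 :: nat
  defines "a \<equiv> l1 + l3 - l2" and "b \<equiv> l2 + l3 - l1" and "n \<equiv> l1 + l2 + l3"
  assumes tri: "\<bar>int l1 - int l2\<bar> \<le> int l3" "int l3 \<le> int l1 + int l2" and k: "k \<le> n"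
  shows "(wigner3j l1 l2 l3 (int k - l1) (int l3 - (int k - l1)) (- int l3))\<^sup>2 =
    fact (l1 + l2 - l3) * fact (2 * l3) / fact (Suc n) * ((k choose a) * ((n - k) choose b))"
proof (cases "a \<le> k \<and> b \<le> n - k")
  case False
  then have "wigner3j l1 l2 l3 (int k - l1) (int l3 - (int k - l1)) (- int l3) = 0"
    using tri k unfolding a_def b_def n_def by (intro wigner3j_eq_0) linarith
  moreover have "(k choose a) * ((n - k) choose b) = 0"
    using False by (auto simp: binomial_eq_0)
  ultimately show ?thesis
    by (metis mult_zero_right of_nat_0 zero_power2)
next
  case True
  define m1 where "m1 = int k - int l1"
  have m: "\<bar>m1\<bar> \<le> int l1" "\<bar>int l3 - m1\<bar> \<le> int l2"
    using True tri k unfolding a_def b_def n_def m1_def by linarith+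
  have W: "wigner3j l1 l2 l3 m1 (int l3 - m1) (- int l3) =
     (- 1) powi (int l1 - int l2 - (- int l3)) * wigner_norm l1 l2 l3 *
    (weight_norm l1 m1 * weight_norm l2 (int l3 - m1) * weight_norm l3 (- int l3)) *
    racah_sum l1 l2 l3 m1 (int l3 - m1)"
    by (rule wigner3j_eq_racah_sum) (use tri m in auto)
  have sign: "((- 1 :: real) powi z)\<^sup>2 = 1" "((- 1 :: real) ^ j)\<^sup>2 = 1" for z j
    by (simp_all add: power_int_def power_even_eq[symmetric] flip: power_mult)
  have r: "rfact (int i) = 1 / fact i" for i
    by (simp add: rfact_def)
  have idx: "int l1 - m1 = int (n - k - b)" "int l2 - int l3 + m1 = int (k - a)"
      "int l2 + int l3 - int l1 = int b" "int l3 + int l1 - int l2 = int a"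
    using True tri k unfolding a_def b_def n_def m1_def by linarith+
  have idx': "nat (int l1 + m1) = k" "nat (int l1 - m1) = n - k - b"
      "nat (int l2 + (int l3 - m1)) = n - k" "nat (int l2 - (int l3 - m1)) = k - a"
      "nat (int l3 + - int l3) = 0" "nat (int l3 - - int l3) = 2 * l3"
      "nat (int l1 + int l2 - int l3) = l1 + l2 - l3" "nat (int l1 - int l2 + int l3) = a"
      "nat (- int l1 + int l2 + int l3) = b" "nat (int l1 + int l2 + int l3 + 1) = Suc n"
    using True tri k unfolding a_def b_def n_def m1_def by linarith+
  have "(wigner3j l1 l2 l3 m1 (int l3 - m1) (- int l3))\<^sup>2 =
      (wigner_norm l1 l2 l3)\<^sup>2 * ((weight_norm l1 m1)\<^sup>2 * (weight_norm l2 (int l3 - m1))\<^sup>2 * (weight_norm l3 (- int l3))\<^sup>2) *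
      (rfact (int l1 - m1) * rfact (int l2 - int l3 + m1) * rfact (int l2 + int l3 - int l1) * rfact (int l3 + int l1 - int l2))\<^sup>2"
    unfolding W racah_sum_bottom[OF tri m] power_mult_distrib sign by simp
  also have "\<dots> = (fact (l1 + l2 - l3) * fact a * fact b / fact (Suc n)) *
      ((fact k * fact (n - k - b)) * (fact (n - k) * fact (k - a)) * fact (2 * l3)) *
      (1 / fact (n - k - b) * (1 / fact (k - a)) * (1 / fact b) * (1 / fact a))\<^sup>2"
    unfolding idx r wigner_norm_def weight_norm_def idx' by (simp del: fact_Suc)
  also have "\<dots> = fact (l1 + l2 - l3) * fact (2 * l3) / fact (Suc n) *
      ((fact k / (fact a * fact (k - a))) * (fact (n - k) / (fact b * fact (n - k - b))))"
    by (simp add: power2_eq_square mult_ac del: fact_Suc)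
  also have "fact k / (fact a * fact (k - a)) = real (k choose a)"
    using True by (simp add: binomial_fact)
  also have "fact (n - k) / (fact b * fact (n - k - b)) = real ((n - k) choose b)"
    using True by (simp add: binomial_fact)
  finally show ?thesis
    unfolding m1_def by simp
qed

text \<open>The orthogonality relation of the 3j-symbols at one value of the third order; it reduces
  to the convolution of binomial coefficients.\<close>

lemma wigner3j_sum_squares:
  fixes l1 l2 l3 :: nat
  assumes tri: "\<bar>int l1 - int l2\<bar> \<le> int l3" "int l3 \<le> int l1 + int l2"
  shows "(\<Sum>m = - int l1..int l1. (wigner3j l1 l2 l3 m (int l3 - m) (- int l3))\<^sup>2) = 1 / (2 * l3 + 1)"
proof -
  define a b n where "a = l1 + l3 - l2" and "b = l2 + l3 - l1" and "n = l1 + l2 + l3"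
  have ab: "a + b = 2 * l3" "Suc n - Suc (2 * l3) = l1 + l2 - l3" "Suc (2 * l3) \<le> Suc n"
    using tri unfolding a_def b_def n_def by linarith+
  define W where "W m = (wigner3j l1 l2 l3 m (int l3 - m) (- int l3))\<^sup>2" for m
  \<comment> \<open>The longer range makes \<open>k = m + l1\<close> run over \<open>0..n\<close>;
    the added orders exceed \<open>l1\<close>, where the symbol is 0.\<close>
  have "(\<Sum>m = - int l1..int l1. W m) = (\<Sum>m = - int l1..int l2 + int l3. W m)"
    using tri by (intro sum.mono_neutral_left) (auto simp: W_def wigner3j_eq_0)
  also have "\<dots> = (\<Sum>k\<le>n. W (int k - int l1))"
    by (rule sum.reindex_bij_witness[of _ "\<lambda>k. int k - int l1" "\<lambda>m. nat (m + int l1)"])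
      (auto simp: n_def)
  also have "\<dots> = (\<Sum>k\<le>n. fact (l1 + l2 - l3) * fact (2 * l3) / fact (Suc n) * ((k choose a) * ((n - k) choose b)))"
    unfolding W_def a_def b_def n_def
    by (intro sum.cong refl wigner3j_bottom_sq tri) auto
  also have "\<dots> = fact (l1 + l2 - l3) * fact (2 * l3) / fact (Suc n) * real (\<Sum>k\<le>n. (k choose a) * ((n - k) choose b))"
    by (simp add: sum_distrib_left)
  also have "\<dots> = fact (l1 + l2 - l3) * fact (2 * l3) / fact (Suc n) * real (Suc n choose Suc (2 * l3))"
    unfolding sum_choose_convolution ab ..
  also have "real (Suc n choose Suc (2 * l3)) = fact (Suc n) / (fact (Suc (2 * l3)) * fact (l1 + l2 - l3))"
    using ab binomial_fact[of "Suc (2 * l3)" "Suc n"] by simp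
  also have "fact (l1 + l2 - l3) * fact (2 * l3) / fact (Suc n) *
      (fact (Suc n) / (fact (Suc (2 * l3)) * fact (l1 + l2 - l3))) = fact (2 * l3) / (fact (Suc (2 * l3)) :: real)"
    by (simp del: fact_Suc)
  also have "\<dots> = 1 / (2 * l3 + 1)"
    by simp
  finally show ?thesis
    unfolding W_def .
qed

section \<open>Gaunt integrals in the colatitude\<close>

lemma polar_deriv_eq_0: "polar_deriv l m \<theta> = 0" if "\<bar>m\<bar> > int l"
proof -
  have "polar l m = (\<lambda>_. 0)"
    using polar_eq_0[OF that] by auto
  then show ?thesis by (simp add: polar_deriv_def)
qed

text \<open>From outside the range of orders, raising re-enters it only at
  \<open>m = - l - 1\<close>, where the ladder coefficient is 0. The relation without side condition
  can be used under sums and integrals.\<close>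

lemma polar_raise':
  "sin \<theta> * polar_deriv l m \<theta> =
     m * cos \<theta> * polar l m \<theta> + sin \<theta> * (ladder_coeff l m * polar l (m + 1) \<theta>)"
proof (cases "\<bar>m\<bar> \<le> int l")
  case False
  then have "m = - int l - 1 \<or> \<bar>m + 1\<bar> > int l" by linarith
  then show ?thesis
    using False by (auto simp: polar_eq_0 polar_deriv_eq_0)
qed (rule polar_raise)

lemma polar_lower':
  "sin \<theta> * polar_deriv l m \<theta> =
     - (m * cos \<theta> * polar l m \<theta> + sin \<theta> * (ladder_coeff l (m - 1) * polar l (m - 1) \<theta>))"
proof (cases "\<bar>m\<bar> \<le> int l")
  case False
  then have "m = int l + 1 \<or> \<bar>m - 1\<bar> > int l" by linarith
  then show ?thesis
    using False by (auto simp: polar_eq_0 polar_deriv_eq_0)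
qed (rule polar_lower)

lemma wigner3j_raise':
  fixes l1 l2 l3 :: nat
  assumes "m1 + m2 + m3 = - 1"
  shows "ladder_coeff l1 m1 * wigner3j l1 l2 l3 (m1 + 1) m2 m3 +
    ladder_coeff l2 m2 * wigner3j l1 l2 l3 m1 (m2 + 1) m3 +
    ladder_coeff l3 m3 * wigner3j l1 l2 l3 m1 m2 (m3 + 1) = 0"
proof (cases "\<bar>m1\<bar> \<le> int l1 \<and> \<bar>m2\<bar> \<le> int l2 \<and> \<bar>m3\<bar> \<le> int l3")
  case False
  have "ladder_coeff l1 m1 * wigner3j l1 l2 l3 (m1 + 1) m2 m3 = 0"
  proof -
    have "m1 = - int l1 - 1 \<or> \<bar>m1 + 1\<bar> > int l1 \<or> \<bar>m2\<bar> > int l2 \<or> \<bar>m3\<bar> > int l3"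
      using False by linarith
    then show ?thesis
      by (auto simp: wigner3j_eq_0)
  qed
  moreover have "ladder_coeff l2 m2 * wigner3j l1 l2 l3 m1 (m2 + 1) m3 = 0"
  proof -
    have "m2 = - int l2 - 1 \<or> \<bar>m2 + 1\<bar> > int l2 \<or> \<bar>m1\<bar> > int l1 \<or> \<bar>m3\<bar> > int l3"
      using False by linarith
    then show ?thesis
      by (auto simp: wigner3j_eq_0)
  qed
  moreover have "ladder_coeff l3 m3 * wigner3j l1 l2 l3 m1 m2 (m3 + 1) = 0"
  proof -
    have "m3 = - int l3 - 1 \<or> \<bar>m3 + 1\<bar> > int l3 \<or> \<bar>m1\<bar> > int l1 \<or> \<bar>m2\<bar> > int l2"
      using False by linarith
    then show ?thesis
      by (auto simp: wigner3j_eq_0)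
  qed
  ultimately show ?thesis by linarith
qed (use wigner3j_raise assms in blast)

lemma wigner3j_lower':
  fixes l1 l2 l3 :: nat
  assumes "m1 + m2 + m3 = 1"
  shows "ladder_coeff l1 (m1 - 1) * wigner3j l1 l2 l3 (m1 - 1) m2 m3 +
    ladder_coeff l2 (m2 - 1) * wigner3j l1 l2 l3 m1 (m2 - 1) m3 +
    ladder_coeff l3 (m3 - 1) * wigner3j l1 l2 l3 m1 m2 (m3 - 1) = 0"
proof (cases "\<bar>m1\<bar> \<le> int l1 \<and> \<bar>m2\<bar> \<le> int l2 \<and> \<bar>m3\<bar> \<le> int l3")
  case False
  have "ladder_coeff l1 (m1 - 1) * wigner3j l1 l2 l3 (m1 - 1) m2 m3 = 0"
  proof -
    have "m1 = int l1 + 1 \<or> \<bar>m1 - 1\<bar> > int l1 \<or> \<bar>m2\<bar> > int l2 \<or> \<bar>m3\<bar> > int l3"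
      using False by linarith
    then show ?thesis
      by (auto simp: wigner3j_eq_0)
  qed
  moreover have "ladder_coeff l2 (m2 - 1) * wigner3j l1 l2 l3 m1 (m2 - 1) m3 = 0"
  proof -
    have "m2 = int l2 + 1 \<or> \<bar>m2 - 1\<bar> > int l2 \<or> \<bar>m1\<bar> > int l1 \<or> \<bar>m3\<bar> > int l3"
      using False by linarith
    then show ?thesis
      by (auto simp: wigner3j_eq_0)
  qed
  moreover have "ladder_coeff l3 (m3 - 1) * wigner3j l1 l2 l3 m1 m2 (m3 - 1) = 0"
  proof -
    have "m3 = int l3 + 1 \<or> \<bar>m3 - 1\<bar> > int l3 \<or> \<bar>m1\<bar> > int l1 \<or> \<bar>m2\<bar> > int l2"
      using False by linarith
    then show ?thesis
      by (auto simp: wigner3j_eq_0)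
  qed
  ultimately show ?thesis by linarith
qed (use wigner3j_lower assms in blast)

section \<open>Orthonormality in the colatitude by integration by parts\<close>

lemma integral_sin_deriv_eq_0:
  assumes "\<And>\<theta>. (F has_real_derivative F' \<theta>) (at \<theta>)"
  shows "integral {0..pi} (\<lambda>\<theta>. cos \<theta> * F \<theta> + sin \<theta> * F' \<theta>) = 0"
proof -
  have "((\<lambda>\<theta>. cos \<theta> * F \<theta> + sin \<theta> * F' \<theta>) has_integral (sin pi * F pi - sin 0 * F 0)) {0..pi}"
  proof (rule fundamental_theorem_of_calculus)
    fix \<theta> :: real
    have "((\<lambda>\<theta>. sin \<theta> * F \<theta>) has_real_derivative cos \<theta> * F \<theta> + sin \<theta> * F' \<theta>) (at \<theta>)"
      by (auto intro!: derivative_eq_intros assms)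
    then show "((\<lambda>\<theta>. sin \<theta> * F \<theta>) has_vector_derivative cos \<theta> * F \<theta> + sin \<theta> * F' \<theta>) (at \<theta> within {0..pi})"
      by (simp add: has_real_derivative_iff_has_vector_derivative has_vector_derivative_at_within)
  qed auto
  then show ?thesis
    by (simp add: integral_unique)
qed

text \<open>Raising and lowering are adjoint for the weight \<open>sin \<theta>\<close>: the
  derivative of \<open>sin \<theta> * polar l m \<theta> * polar l' (m + 1) \<theta>\<close>
  integrates to 0. Its cosine terms have the coefficient \<open>1 + m - (m + 1) = 0\<close>.\<close>

lemma polar_adjoint:
  "ladder_coeff l m * integral {0..pi} (\<lambda>\<theta>. polar l (m + 1) \<theta> * polar l' (m + 1) \<theta> * sin \<theta>) =
   ladder_coeff l' m * integral {0..pi} (\<lambda>\<theta>. polar l m \<theta> * polar l' m \<theta> * sin \<theta>)"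
proof -
  let ?F = "\<lambda>\<theta>. polar l m \<theta> * polar l' (m + 1) \<theta>"
  let ?F' = "\<lambda>\<theta>. polar l m \<theta> * polar_deriv l' (m + 1) \<theta> + polar_deriv l m \<theta> * polar l' (m + 1) \<theta>"
  have "cos \<theta> * ?F \<theta> + sin \<theta> * ?F' \<theta> =
      ladder_coeff l m * (polar l (m + 1) \<theta> * polar l' (m + 1) \<theta> * sin \<theta>)
      - ladder_coeff l' m * (polar l m \<theta> * polar l' m \<theta> * sin \<theta>)" for \<theta>
    using polar_raise'[of \<theta> l m] polar_lower'[of \<theta> l' "m + 1"] by simp algebra
  moreover have "integral {0..pi} (\<lambda>\<theta>. cos \<theta> * ?F \<theta> + sin \<theta> * ?F' \<theta>) = 0"
    by (rule integral_sin_deriv_eq_0) (auto intro!: derivative_eq_intros polar_has_real_derivative)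
  ultimately have "integral {0..pi} (\<lambda>\<theta>. ladder_coeff l m * (polar l (m + 1) \<theta> * polar l' (m + 1) \<theta> * sin \<theta>)
      - ladder_coeff l' m * (polar l m \<theta> * polar l' m \<theta> * sin \<theta>)) = 0"
    by simp
  then show ?thesis
    by (subst (asm) integral_diff) (auto intro!: integrable_continuous_interval continuous_intros)
qed

text \<open>Descent in the order. At \<open>m = l + 1\<close> the function of the smaller degree is
  zero, and the ladder coefficient of the larger degree \<open>l'\<close> stays positive along the
  whole descent, so \<open>polar_adjoint\<close> passes the zero down.\<close>

lemma integral_polar_mult_eq_0:
  assumes "l < l'"
  shows "integral {0..pi} (\<lambda>\<theta>. polar l m \<theta> * polar l' m \<theta> * sin \<theta>) = 0"
proof -
  let ?I = "\<lambda>m. integral {0..pi} (\<lambda>\<theta>. polar l m \<theta> * polar l' m \<theta> * sin \<theta>)"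
  have "?I (int l - int k) = 0" if "k \<le> 2 * l" for k
    using that
  proof (induction k)
    case 0
    have "?I (int l + 1) = 0"
      by (simp add: polar_eq_0)
    then show ?case
      using polar_adjoint[of l "int l" l'] ladder_coeff_pos[of l' "int l"] assms by simp
  next
    case (Suc k)
    have "int l - int (Suc k) + 1 = int l - int k" by simp
    then show ?case
      using polar_adjoint[of l "int l - int (Suc k)" l'] ladder_coeff_pos[of l' "int l - int (Suc k)"] assms Suc
      by simp
  qed
  note * = this
  show ?thesis
  proof (cases "\<bar>m\<bar> \<le> int l")
    case True
    then have "int l - int (nat (int l - m)) = m" "nat (int l - m) \<le> 2 * l" by auto
    then show ?thesis
      using *[of "nat (int l - m)"] by simp
  qed (simp add: polar_eq_0)
qed

lemma rodrigues_double: "rodrigues l (2 * l) t = fact (2 * l)"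
proof (induction l)
  case 0
  show ?case by (simp add: rodrigues_def)
next
  case (Suc l)
  have "l = 0 \<or> rodrigues (l - 1) (2 * l) t = 0"
    by (auto intro: rodrigues_eq_0)
  then have "rodrigues (Suc l) (2 * l + 2) t = real (2 * (l + 1) * (2 * l + 1)) * fact (2 * l)"
    unfolding rodrigues_Suc_plus2 Suc by (auto simp: algebra_simps)
  moreover have "fact (2 * l + 2) = real (2 * (l + 1) * (2 * l + 1)) * fact (2 * l)"
    by (simp add: algebra_simps)
  moreover have "2 * Suc l = 2 * l + 2"
    by simp
  ultimately show ?case
    by (simp only:)
qed

text \<open>Wallis' recurrence \<open>(2 l + 3) J (l + 1) = (2 l + 2) J l\<close>, obtained by
  integrating the derivative of \<open>sin \<theta> ^ (2 * l + 2) * cos \<theta>\<close>.\<close>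

lemma integral_sin_power:
  "integral {0..pi} (\<lambda>\<theta>. sin \<theta> ^ (2 * l + 1)) = 2 * (2 ^ l * fact l)\<^sup>2 / fact (2 * l + 1)"
proof (induction l)
  case 0
  have "(sin has_integral (- cos pi - - cos 0)) {0..pi}"
    by (rule fundamental_theorem_of_calculus)
      (auto intro!: derivative_eq_intros simp flip: has_real_derivative_iff_has_vector_derivative)
  then show ?case by (simp add: integral_unique)
next
  case (Suc l)
  let ?J = "\<lambda>l. integral {0..pi} (\<lambda>\<theta>. sin \<theta> ^ (2 * l + 1))"
  have D: "((\<lambda>\<theta>. sin \<theta> ^ n * cos \<theta>) has_real_derivative
      n * sin \<theta> ^ (n - 1) * cos \<theta> * cos \<theta> - sin \<theta> ^ n * sin \<theta>) (at \<theta>)" for n \<theta>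
    by (auto intro!: derivative_eq_intros simp: algebra_simps)
  have "integral {0..pi} (\<lambda>\<theta>. cos \<theta> * (sin \<theta> ^ (2 * l + 1) * cos \<theta>) +
      sin \<theta> * (real (2 * l + 1) * sin \<theta> ^ (2 * l) * cos \<theta> * cos \<theta> - sin \<theta> ^ (2 * l + 1) * sin \<theta>)) = 0"
    by (rule integral_sin_deriv_eq_0) (rule D[of "2 * l + 1", unfolded add_diff_cancel_right'])
  moreover have "cos \<theta> * (sin \<theta> ^ (2 * l + 1) * cos \<theta>) +
      sin \<theta> * (real (2 * l + 1) * sin \<theta> ^ (2 * l) * cos \<theta> * cos \<theta> - sin \<theta> ^ (2 * l + 1) * sin \<theta>) =
      real (2 * l + 2) * sin \<theta> ^ (2 * l + 1) - real (2 * l + 3) * sin \<theta> ^ (2 * Suc l + 1)" for \<theta> :: real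
  proof -
    have "cos \<theta> * (sin \<theta> ^ (2 * l + 1) * cos \<theta>) +
      sin \<theta> * (real (2 * l + 1) * sin \<theta> ^ (2 * l) * cos \<theta> * cos \<theta> - sin \<theta> ^ (2 * l + 1) * sin \<theta>) =
      sin \<theta> ^ (2 * l + 1) * ((2 * l + 2) * (cos \<theta>)\<^sup>2 - (sin \<theta>)\<^sup>2)"
      by (simp add: power2_eq_square algebra_simps)
    also have "\<dots> = sin \<theta> ^ (2 * l + 1) * ((2 * l + 2) - (2 * l + 3) * (sin \<theta>)\<^sup>2)"
      by (simp add: cos_squared_eq algebra_simps)
    finally show ?thesis
      by (simp add: power2_eq_square algebra_simps)
  qed
  ultimately have "integral {0..pi} (\<lambda>\<theta>. real (2 * l + 2) * sin \<theta> ^ (2 * l + 1) - real (2 * l + 3) * sin \<theta> ^ (2 * Suc l + 1)) = 0"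
    by simp
  then have "real (2 * l + 2) * ?J l - real (2 * l + 3) * ?J (Suc l) = 0"
    by (subst (asm) integral_diff) (auto intro!: integrable_continuous_interval continuous_intros)
  then have J: "?J (Suc l) = real (2 * l + 2) / real (2 * l + 3) * ?J l"
    by (simp add: field_simps)
  have "fact (2 * Suc l + 1) = real (2 * l + 3) * (real (2 * l + 2) * fact (2 * l + 1))"
    by (simp add: algebra_simps)
  moreover have "(2 ^ Suc l * fact (Suc l))\<^sup>2 = (real (2 * l + 2))\<^sup>2 * (2 ^ l * fact l)\<^sup>2"
    by (simp add: power2_eq_square algebra_simps)
  moreover have "a / b * (2 * x / c) = 2 * (a\<^sup>2 * x) / (b * (a * c))" if "a > 0" for a b c x :: real
    using that by (simp add: power2_eq_square)
  ultimately show ?case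
    unfolding J Suc by simp
qed

text \<open>At the top order the function is a multiple of \<open>sin \<theta> ^ l\<close>, which
  reduces the integral to \<open>integral_sin_power\<close>. For equal degrees the two ladder
  coefficients in \<open>polar_adjoint\<close> agree, so the value is the same at every order. The
  missing factor \<open>2 * pi\<close> is left to the longitude.\<close>

lemma integral_polar_sq:
  assumes "\<bar>m\<bar> \<le> int l"
  shows "integral {0..pi} (\<lambda>\<theta>. polar l m \<theta> * polar l m \<theta> * sin \<theta>) = 1 / (2 * pi)"
proof -
  let ?I = "\<lambda>m. integral {0..pi} (\<lambda>\<theta>. polar l m \<theta> * polar l m \<theta> * sin \<theta>)"
  have "?I (int l - int k) = 1 / (2 * pi)" if "k \<le> 2 * l" for k
    using that
  proof (induction k)
    case 0
    have sq: "(- 1 :: real) ^ l * ((- 1) ^ l * x) = x" for x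
      by (simp flip: mult.assoc power_mult_distrib)
    have "polar l (int l) \<theta> * polar l (int l) \<theta> * sin \<theta> =
        ((polar_norm l l)\<^sup>2 * (fact (2 * l))\<^sup>2) * sin \<theta> ^ (2 * l + 1)" for \<theta>
    proof -
      have "sin \<theta> ^ (2 * l + 1) = sin \<theta> ^ l * sin \<theta> ^ l * sin \<theta>"
        by (simp add: mult_2 power_add)
      then show ?thesis
        unfolding polar_of_nat mult_2[symmetric] rodrigues_double
        by (simp only: power2_eq_square sq mult_ac)
    qed
    then have "?I (int l) = integral {0..pi} (\<lambda>\<theta>. ((polar_norm l l)\<^sup>2 * (fact (2 * l))\<^sup>2) * sin \<theta> ^ (2 * l + 1))"
      by (simp only:)
    also have "\<dots> = (polar_norm l l)\<^sup>2 * (fact (2 * l))\<^sup>2 * (2 * (2 ^ l * fact l)\<^sup>2 / fact (2 * l + 1))"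
      unfolding integral_mult_right integral_sin_power ..
    also have "(polar_norm l l)\<^sup>2 = real (2 * l + 1) / (4 * pi * fact (2 * l)) / (2 ^ l * fact l)\<^sup>2"
      unfolding polar_norm_def power_divide mult_2[symmetric] by simp
    also have "fact (2 * l + 1) = real (2 * l + 1) * fact (2 * l)"
      by simp
    also have "a / (4 * pi * f) / x * f\<^sup>2 * (2 * x / (a * f)) = 1 / (2 * pi)"
      if "a > 0" "f > 0" "x > 0" for a f x :: real
      using that by (simp add: power2_eq_square)
    finally show ?case by simp
  next
    case (Suc k)
    define m where "m = int l - int (Suc k)"
    have m: "int l - int k = m + 1" by (simp add: m_def)
    have "ladder_coeff l m > 0"
      using Suc by (intro ladder_coeff_pos) (simp_all add: m_def)
    moreover have "?I (m + 1) = 1 / (2 * pi)"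
      using Suc m by simp
    ultimately have "?I m = 1 / (2 * pi)"
      using mult_left_cancel[THEN iffD1, OF _ polar_adjoint[of l m l]] by simp
    then show ?case
      by (simp add: m_def)
  qed
  note * = this
  have "int l - int (nat (int l - m)) = m" "nat (int l - m) \<le> 2 * l"
    using assms by auto
  then show ?thesis
    using *[of "nat (int l - m)"] by simp
qed

text \<open>\<open>(t^2 - 1)^l\<close> has a zero of order exactly \<open>l\<close> at 1, with
  cofactor \<open>(t + 1)^l\<close>.\<close>

lemma rodrigues_at_1: "n < l \<Longrightarrow> rodrigues l n 1 = 0" "rodrigues l l 1 = 2 ^ l * fact l"
proof (induction l arbitrary: n)
  case (Suc l)
  {
    case 1
    then show ?case
      using rodrigues_Suc[of l n 1] Suc(1)[of "n - 1"] Suc(1)[of "n - 2"] by (cases "n = 0") auto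
  next
    case 2
    show ?case
      using rodrigues_Suc[of l "Suc l" 1] Suc(1)[of "l - 1"] Suc(2) by (cases "l = 0") auto
  }
qed (simp_all add: rodrigues_def)

lemma polar_at_0: "polar l m 0 = (if m = 0 then sqrt ((2 * l + 1) / (4 * pi)) else 0)"
  using rodrigues_at_1(2)[of l] by (simp add: polar_def polar_norm_def)

section \<open>Gaunt integrals as invariant tensors\<close>

definition polar_gaunt :: "nat \<Rightarrow> nat \<Rightarrow> nat \<Rightarrow> int \<Rightarrow> int \<Rightarrow> int \<Rightarrow> real" where
  "polar_gaunt l1 l2 l3 m1 m2 m3 =
     integral {0..pi} (\<lambda>\<theta>. polar l1 m1 \<theta> * polar l2 m2 \<theta> * polar l3 m3 \<theta> * sin \<theta>)"

lemma polar_gaunt_eq_0: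
  "polar_gaunt l1 l2 l3 m1 m2 m3 = 0" if "\<bar>m1\<bar> > int l1 \<or> \<bar>m2\<bar> > int l2 \<or> \<bar>m3\<bar> > int l3"
  unfolding polar_gaunt_def using that by (auto simp: polar_eq_0)

lemma polar_gaunt_swap: "polar_gaunt l1 l2 l3 m1 m2 m3 = polar_gaunt l2 l1 l3 m2 m1 m3"
  by (simp add: polar_gaunt_def mult_ac)

text \<open>Integration by parts of a product of three functions. The cosine terms collect to the
  factor \<open>1 + m1 + m2 + m3\<close> for raising and \<open>1 - m1 - m2 - m3\<close> for
  lowering, which explains the sums \<open>- 1\<close> and 1 of the orders.\<close>

lemma
  shows polar_gaunt_raise: "m1 + m2 + m3 = - 1 \<Longrightarrow>
      ladder_coeff l1 m1 * polar_gaunt l1 l2 l3 (m1 + 1) m2 m3 +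
      ladder_coeff l2 m2 * polar_gaunt l1 l2 l3 m1 (m2 + 1) m3 +
      ladder_coeff l3 m3 * polar_gaunt l1 l2 l3 m1 m2 (m3 + 1) = 0"
    and polar_gaunt_lower: "m1 + m2 + m3 = 1 \<Longrightarrow>
      ladder_coeff l1 (m1 - 1) * polar_gaunt l1 l2 l3 (m1 - 1) m2 m3 +
      ladder_coeff l2 (m2 - 1) * polar_gaunt l1 l2 l3 m1 (m2 - 1) m3 +
      ladder_coeff l3 (m3 - 1) * polar_gaunt l1 l2 l3 m1 m2 (m3 - 1) = 0"
proof -
  let ?P = "\<lambda>m1 m2 m3 \<theta>. polar l1 m1 \<theta> * polar l2 m2 \<theta> * polar l3 m3 \<theta>"
  let ?P' = "\<lambda>\<theta>. polar_deriv l1 m1 \<theta> * polar l2 m2 \<theta> * polar l3 m3 \<theta> +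
     polar l1 m1 \<theta> * polar_deriv l2 m2 \<theta> * polar l3 m3 \<theta> + polar l1 m1 \<theta> * polar l2 m2 \<theta> * polar_deriv l3 m3 \<theta>"
  have 0: "integral {0..pi} (\<lambda>\<theta>. cos \<theta> * ?P m1 m2 m3 \<theta> + sin \<theta> * ?P' \<theta>) = 0"
    by (rule integral_sin_deriv_eq_0)
       (auto intro!: derivative_eq_intros polar_has_real_derivative simp: algebra_simps)
  have P': "sin \<theta> * ?P' \<theta> = (sin \<theta> * polar_deriv l1 m1 \<theta>) * polar l2 m2 \<theta> * polar l3 m3 \<theta> +
     polar l1 m1 \<theta> * (sin \<theta> * polar_deriv l2 m2 \<theta>) * polar l3 m3 \<theta> +
     polar l1 m1 \<theta> * polar l2 m2 \<theta> * (sin \<theta> * polar_deriv l3 m3 \<theta>)" for \<theta>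
    by (simp add: algebra_simps)
  have int: "(\<lambda>\<theta>. c * (?P m1 m2 m3 \<theta> * sin \<theta>)) integrable_on {0..pi}" for c m1 m2 m3
    by (intro integrable_continuous_interval continuous_intros)
  {
    assume sum: "m1 + m2 + m3 = - 1"
    have m3: "of_int m3 = - 1 - real_of_int m1 - of_int m2"
      using sum by linarith
    have "cos \<theta> * ?P m1 m2 m3 \<theta> + sin \<theta> * ?P' \<theta> =
        ladder_coeff l1 m1 * (?P (m1 + 1) m2 m3 \<theta> * sin \<theta>) +
        ladder_coeff l2 m2 * (?P m1 (m2 + 1) m3 \<theta> * sin \<theta>) +
        ladder_coeff l3 m3 * (?P m1 m2 (m3 + 1) \<theta> * sin \<theta>)" for \<theta>
      unfolding P' polar_raise' m3 by (simp add: algebra_simps)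
    with 0 have "integral {0..pi} (\<lambda>\<theta>. ladder_coeff l1 m1 * (?P (m1 + 1) m2 m3 \<theta> * sin \<theta>) +
        ladder_coeff l2 m2 * (?P m1 (m2 + 1) m3 \<theta> * sin \<theta>) +
        ladder_coeff l3 m3 * (?P m1 m2 (m3 + 1) \<theta> * sin \<theta>)) = 0"
      by simp
    then show "ladder_coeff l1 m1 * polar_gaunt l1 l2 l3 (m1 + 1) m2 m3 +
      ladder_coeff l2 m2 * polar_gaunt l1 l2 l3 m1 (m2 + 1) m3 +
      ladder_coeff l3 m3 * polar_gaunt l1 l2 l3 m1 m2 (m3 + 1) = 0"
      unfolding polar_gaunt_def integral_mult_right[symmetric]
      by (simp only: Henstock_Kurzweil_Integration.integral_add[symmetric] integrable_add int)
  next
    assume sum: "m1 + m2 + m3 = 1"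
    have m3: "of_int m3 = 1 - real_of_int m1 - of_int m2"
      using sum by linarith
    have "cos \<theta> * ?P m1 m2 m3 \<theta> + sin \<theta> * ?P' \<theta> =
        - (ladder_coeff l1 (m1 - 1) * (?P (m1 - 1) m2 m3 \<theta> * sin \<theta>) +
        ladder_coeff l2 (m2 - 1) * (?P m1 (m2 - 1) m3 \<theta> * sin \<theta>) +
        ladder_coeff l3 (m3 - 1) * (?P m1 m2 (m3 - 1) \<theta> * sin \<theta>))" for \<theta>
      unfolding P' polar_lower' m3 by (simp add: algebra_simps)
    with 0 have "integral {0..pi} (\<lambda>\<theta>. ladder_coeff l1 (m1 - 1) * (?P (m1 - 1) m2 m3 \<theta> * sin \<theta>) +
        ladder_coeff l2 (m2 - 1) * (?P m1 (m2 - 1) m3 \<theta> * sin \<theta>) +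
        ladder_coeff l3 (m3 - 1) * (?P m1 m2 (m3 - 1) \<theta> * sin \<theta>)) = 0"
      by (simp only: integral_neg neg_equal_0_iff_equal)
    then show "ladder_coeff l1 (m1 - 1) * polar_gaunt l1 l2 l3 (m1 - 1) m2 m3 +
      ladder_coeff l2 (m2 - 1) * polar_gaunt l1 l2 l3 m1 (m2 - 1) m3 +
      ladder_coeff l3 (m3 - 1) * polar_gaunt l1 l2 l3 m1 m2 (m3 - 1) = 0"
      unfolding polar_gaunt_def integral_mult_right[symmetric]
      by (simp only: Henstock_Kurzweil_Integration.integral_add[symmetric] integrable_add int)
  }
qed

text \<open>The lowering relation determines the tensor on the bottom row \<open>m\<^sub>3 = - l\<^sub>3\<close> from a single entry,
  and the raising relation determines each further row from the preceding one.\<close>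

lemma invariant_tensor_eq_0:
  fixes Z :: "int \<Rightarrow> int \<Rightarrow> int \<Rightarrow> real"
  assumes supp: "\<And>m1 m2 m3. \<bar>m1\<bar> > int l1 \<or> \<bar>m2\<bar> > int l2 \<or> \<bar>m3\<bar> > int l3 \<Longrightarrow> Z m1 m2 m3 = 0"
    and raise: "\<And>m1 m2 m3. m1 + m2 + m3 = - 1 \<Longrightarrow>
      ladder_coeff l1 m1 * Z (m1 + 1) m2 m3 + ladder_coeff l2 m2 * Z m1 (m2 + 1) m3 +
      ladder_coeff l3 m3 * Z m1 m2 (m3 + 1) = 0"
    and lower: "\<And>m1 m2 m3. m1 + m2 + m3 = 1 \<Longrightarrow>
      ladder_coeff l1 (m1 - 1) * Z (m1 - 1) m2 m3 + ladder_coeff l2 (m2 - 1) * Z m1 (m2 - 1) m3 +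
      ladder_coeff l3 (m3 - 1) * Z m1 m2 (m3 - 1) = 0"
    and base: "Z (int l1) (int l3 - int l1) (- int l3) = 0"
    and sum: "m1 + m2 + m3 = 0"
  shows "Z m1 m2 m3 = 0"
proof -
  \<comment> \<open>On this row the third term of the lowering relation has the coefficient
    \<open>ladder_coeff l3 (- int l3 - 1) = 0\<close>, so the relation connects two neighbours
    within the row.\<close>
  have bottom_aux: "Z (int l1 - int k) (int l3 - (int l1 - int k)) (- int l3) = 0" if "k \<le> 2 * l1" for k
    using that
  proof (induction k)
    case (Suc k)
    define m where "m = int l1 - int k"
    have "Z m (int l3 - m) (- int l3) = 0"
      using Suc by (simp add: m_def)
    moreover have "int l3 + 1 - m - 1 = int l3 - m" by simp
    ultimately have "ladder_coeff l1 (m - 1) * Z (m - 1) (int l3 + 1 - m) (- int l3) = 0"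
      using lower[of m "int l3 + 1 - m" "- int l3"] by simp
    moreover have "ladder_coeff l1 (m - 1) > 0"
      using Suc by (intro ladder_coeff_pos) (simp_all add: m_def)
    ultimately show ?case
      by (simp add: m_def algebra_simps)
  qed (simp add: base)
  have bottom: "Z m1 m2 (- int l3) = 0" if "m1 + m2 = int l3" for m1 m2
  proof (cases "\<bar>m1\<bar> \<le> int l1")
    case True
    then have "int l1 - int (nat (int l1 - m1)) = m1" "nat (int l1 - m1) \<le> 2 * l1"
      by auto
    moreover have "m2 = int l3 - m1" using that by simp
    ultimately show ?thesis
      using bottom_aux[of "nat (int l1 - m1)"] by simp
  qed (simp add: supp)
  have "\<forall>m1 m2. m1 + m2 + (int k - int l3) = 0 \<longrightarrow> Z m1 m2 (int k - int l3) = 0" if "k \<le> 2 * l3" for k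
    using that
  proof (induction k)
    case 0
    then show ?case using bottom by simp
  next
    case (Suc k)
    show ?case
    proof (intro allI impI)
      fix m1 m2 assume m: "m1 + m2 + (int (Suc k) - int l3) = 0"
      define m3 where "m3 = int k - int l3"
      have m3: "int (Suc k) - int l3 = m3 + 1" by (simp add: m3_def)
      have "Z (m1 + 1) m2 m3 = 0" "Z m1 (m2 + 1) m3 = 0"
        using Suc m unfolding m3_def by simp_all
      then have "ladder_coeff l3 m3 * Z m1 m2 (m3 + 1) = 0"
        using raise[of m1 m2 m3] m unfolding m3 by simp
      moreover have "ladder_coeff l3 m3 > 0"
        using Suc by (intro ladder_coeff_pos) (simp_all add: m3_def)
      ultimately show "Z m1 m2 (int (Suc k) - int l3) = 0"
        unfolding m3 by simp
    qed
  qed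
  note * = this
  show ?thesis
  proof (cases "\<bar>m3\<bar> \<le> int l3")
    case True
    then have "int (nat (m3 + int l3)) - int l3 = m3" "nat (m3 + int l3) \<le> 2 * l3"
      by auto
    then show ?thesis
      using *[of "nat (m3 + int l3)"] sum by simp
  qed (simp add: supp)
qed

text \<open>The base entry has second order \<open>l3 - l1\<close>, which exceeds \<open>l2\<close>
  in absolute value in the first two cases, so the whole tensor vanishes. For
  \<open>l2 > l1 + l3\<close> it does not, and the first two columns are exchanged
  beforehand.\<close>

lemma polar_gaunt_triangle:
  assumes "m1 + m2 + m3 = 0" "l3 > l1 + l2 \<or> l1 > l2 + l3 \<or> l2 > l1 + l3"
  shows "polar_gaunt l1 l2 l3 m1 m2 m3 = 0"
proof -
  have *: "polar_gaunt l1 l2 l3 m1 m2 m3 = 0"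
    if "m1 + m2 + m3 = 0" "l3 > l1 + l2 \<or> l1 > l2 + l3" for l1 l2 l3 m1 m2 m3
    by (rule invariant_tensor_eq_0[of l1 l2 l3])
       (use that in \<open>auto intro: polar_gaunt_eq_0 polar_gaunt_raise polar_gaunt_lower\<close>)
  show ?thesis
  proof (cases "l2 > l1 + l3")
    case True
    have "polar_gaunt l2 l1 l3 m2 m1 m3 = 0"
      by (rule *) (use assms True in auto)
    then show ?thesis
      by (subst polar_gaunt_swap)
  qed (use * assms in auto)
qed

text \<open>\<open>invariant_tensor_eq_0\<close> is applied to the difference of the two tensors,
  with \<open>c\<close> chosen to cancel the base entry.\<close>

lemma polar_gaunt_proportional:
  assumes tri: "\<bar>int l1 - int l2\<bar> \<le> int l3" "int l3 \<le> int l1 + int l2"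
  obtains c where "\<And>m1 m2 m3. m1 + m2 + m3 = 0 \<Longrightarrow>
    polar_gaunt l1 l2 l3 m1 m2 m3 = c * wigner3j l1 l2 l3 m1 m2 m3"
proof -
  let ?W = "\<lambda>m1 m2 m3. wigner3j l1 l2 l3 m1 m2 m3"
  let ?b = "?W (int l1) (int l3 - int l1) (- int l3)"
  have "?b\<^sup>2 > 0"
  proof -
    \<comment> \<open>The base entry is \<open>k = 2 * l1\<close> in
      \<open>wigner3j_bottom_sq\<close>, where both binomial coefficients are positive by the
      triangle inequalities, so division by it is possible.\<close>
    have "2 * l1 \<le> l1 + l2 + l3" using tri by linarith
    from wigner3j_bottom_sq[OF tri this]
    have "?b\<^sup>2 = fact (l1 + l2 - l3) * fact (2 * l3) / fact (Suc (l1 + l2 + l3)) *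
       ((2 * l1 choose (l1 + l3 - l2)) * ((l1 + l2 + l3 - 2 * l1) choose (l2 + l3 - l1)))"
      by simp
    also have "\<dots> > 0"
    proof -
      have "l1 + l3 - l2 \<le> 2 * l1" "l2 + l3 - l1 \<le> l1 + l2 + l3 - 2 * l1" using tri by linarith+
      then show ?thesis by (simp add: zero_less_binomial_iff del: fact_Suc)
    qed
    finally show ?thesis .
  qed
  then have b: "?b \<noteq> 0" by auto
  define c where "c = polar_gaunt l1 l2 l3 (int l1) (int l3 - int l1) (- int l3) / ?b"
  have "polar_gaunt l1 l2 l3 m1 m2 m3 - c * ?W m1 m2 m3 = 0" if "m1 + m2 + m3 = 0" for m1 m2 m3
  proof (rule invariant_tensor_eq_0[of l1 l2 l3 "\<lambda>m1 m2 m3. polar_gaunt l1 l2 l3 m1 m2 m3 - c * ?W m1 m2 m3"])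
    fix m1 m2 m3 :: int
    show "ladder_coeff l1 m1 * (polar_gaunt l1 l2 l3 (m1 + 1) m2 m3 - c * ?W (m1 + 1) m2 m3) +
       ladder_coeff l2 m2 * (polar_gaunt l1 l2 l3 m1 (m2 + 1) m3 - c * ?W m1 (m2 + 1) m3) +
       ladder_coeff l3 m3 * (polar_gaunt l1 l2 l3 m1 m2 (m3 + 1) - c * ?W m1 m2 (m3 + 1)) = 0"
      if "m1 + m2 + m3 = - 1"
      using polar_gaunt_raise[OF that, of l1 l2 l3] wigner3j_raise'[OF that, of l1 l2 l3] by algebra
    show "ladder_coeff l1 (m1 - 1) * (polar_gaunt l1 l2 l3 (m1 - 1) m2 m3 - c * ?W (m1 - 1) m2 m3) +
       ladder_coeff l2 (m2 - 1) * (polar_gaunt l1 l2 l3 m1 (m2 - 1) m3 - c * ?W m1 (m2 - 1) m3) +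
       ladder_coeff l3 (m3 - 1) * (polar_gaunt l1 l2 l3 m1 m2 (m3 - 1) - c * ?W m1 m2 (m3 - 1)) = 0"
      if "m1 + m2 + m3 = 1"
      using polar_gaunt_lower[OF that, of l1 l2 l3] wigner3j_lower'[OF that, of l1 l2 l3] by algebra
  qed (use b that in \<open>auto simp: c_def polar_gaunt_eq_0 wigner3j_eq_0\<close>)
  then show ?thesis
    by (intro that[of c]) simp
qed

section \<open>The coupled product of two polar functions and the value of the Gaunt
  integral\<close>

lemma sum_int_shift:
  fixes f :: "int \<Rightarrow> 'a :: comm_monoid_add"
  assumes "f (int l) = 0" "f (- int l - 1) = 0"
  shows "(\<Sum>k = - int l..int l. f k) = (\<Sum>k = - int l..int l. f (k - 1))"
proof -
  have "(\<Sum>k = - int l..int l. f k) = (\<Sum>k = - int l - 1..int l - 1. f k)"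
    by (rule sum.mono_neutral_cong) (use assms in \<open>auto simp: not_le\<close>, (metis assms nle_le not_less zle_diff1_eq add1_zle_eq antisym_conv diff_add_cancel)+)
  also have "\<dots> = (\<Sum>k = - int l..int l. f (k - 1))"
    by (rule sum.reindex_bij_witness[of _ "\<lambda>k. k - 1" "\<lambda>k. k + 1"]) auto
  finally show ?thesis .
qed

text \<open>By the ladder relations of the 3j-symbols, the coupled product obeys the same first-order
  relations as \<open>polar l3\<close> and hence is a multiple of it; the factor is read off at \<open>\<theta> = 0\<close>, where
  only order \<open>0\<close> survives.\<close>

definition coupled_polar :: "nat \<Rightarrow> nat \<Rightarrow> nat \<Rightarrow> int \<Rightarrow> real \<Rightarrow> real" where
  "coupled_polar l1 l2 l3 m \<theta> =
     (\<Sum>k = - int l1..int l1. wigner3j l1 l2 l3 k (m - k) (- m) * (polar l1 k \<theta> * polar l2 (m - k) \<theta>))"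

definition coupled_polar_deriv :: "nat \<Rightarrow> nat \<Rightarrow> nat \<Rightarrow> int \<Rightarrow> real \<Rightarrow> real" where
  "coupled_polar_deriv l1 l2 l3 m \<theta> =
     (\<Sum>k = - int l1..int l1. wigner3j l1 l2 l3 k (m - k) (- m) *
       (polar_deriv l1 k \<theta> * polar l2 (m - k) \<theta> + polar l1 k \<theta> * polar_deriv l2 (m - k) \<theta>))"

lemma coupled_polar_has_real_derivative:
  "(coupled_polar l1 l2 l3 m has_real_derivative coupled_polar_deriv l1 l2 l3 m \<theta>) (at \<theta>)"
  unfolding coupled_polar_def[abs_def] coupled_polar_deriv_def
  by (auto intro!: derivative_eq_intros polar_has_real_derivative sum.cong simp: algebra_simps)

text \<open>Both factors are raised, and a shift of \<open>k\<close> in one sum produces the left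
  side of the lowering relation of the 3j-symbols, since the third order is \<open>- m\<close>. The
  sign, opposite to that in \<open>polar_raise'\<close>, means that the coupled functions follow the
  ladder of \<open>polar l3\<close> after multiplication by \<open>(- 1) ^ m\<close>.\<close>

lemma coupled_polar_raise:
  "sin \<theta> * coupled_polar_deriv l1 l2 l3 m \<theta> =
     m * cos \<theta> * coupled_polar l1 l2 l3 m \<theta> - sin \<theta> * (ladder_coeff l3 m * coupled_polar l1 l2 l3 (m + 1) \<theta>)"
proof -
  let ?W = "wigner3j l1 l2 l3" and ?P = "\<lambda>k. polar l1 k \<theta>" and ?Q = "\<lambda>k. polar l2 k \<theta>"
  define f where "f k = ?W k (m - k) (- m) * (ladder_coeff l1 k * ?P (k + 1) * ?Q (m - k))" for k
  define g where "g k = ?W k (m - k) (- m) * (ladder_coeff l2 (m - k) * ?P k * ?Q (m - k + 1))" for k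
  have "sin \<theta> * coupled_polar_deriv l1 l2 l3 m \<theta> = (\<Sum>k = - int l1..int l1. ?W k (m - k) (- m) *
      ((sin \<theta> * polar_deriv l1 k \<theta>) * ?Q (m - k) + ?P k * (sin \<theta> * polar_deriv l2 (m - k) \<theta>)))"
    unfolding coupled_polar_deriv_def sum_distrib_left by (simp add: algebra_simps)
  also have "\<dots> = m * cos \<theta> * coupled_polar l1 l2 l3 m \<theta> +
      sin \<theta> * ((\<Sum>k = - int l1..int l1. f k) + (\<Sum>k = - int l1..int l1. g k))"
    unfolding polar_raise' coupled_polar_def f_def g_def sum_distrib_left sum.distrib[symmetric]
    by (intro sum.cong refl) (simp add: algebra_simps)
  \<comment> \<open>The shift has no boundary terms, because \<open>ladder_coeff l1\<close> vanishes
    at \<open>l1\<close> and at \<open>- l1 - 1\<close>.\<close>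
  also have "(\<Sum>k = - int l1..int l1. f k) = (\<Sum>k = - int l1..int l1. f (k - 1))"
    by (rule sum_int_shift) (simp_all add: f_def)
  also have "\<dots> + (\<Sum>k = - int l1..int l1. g k) = - (ladder_coeff l3 m * coupled_polar l1 l2 l3 (m + 1) \<theta>)"
    unfolding coupled_polar_def sum.distrib[symmetric] sum_distrib_left sum_negf[symmetric]
  proof (intro sum.cong refl)
    fix k
    have eq: "m + 1 - k - 1 = m - k" "- m - 1 = - (m + 1)" "m - (k - 1) = m + 1 - k" "m - k + 1 = m + 1 - k"
      by simp_all
    have sum: "k + (m + 1 - k) + - m = 1" by simp
    have L: "ladder_coeff l1 (k - 1) * ?W (k - 1) (m + 1 - k) (- m) +
       ladder_coeff l2 (m - k) * ?W k (m - k) (- m) = - (ladder_coeff l3 m * ?W k (m + 1 - k) (- (m + 1)))"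
      using wigner3j_lower'[OF sum, of l1 l2 l3] unfolding ladder_coeff_minus unfolding eq by linarith
    have "f (k - 1) + g k = (ladder_coeff l1 (k - 1) * ?W (k - 1) (m + 1 - k) (- m) +
       ladder_coeff l2 (m - k) * ?W k (m - k) (- m)) * (?P k * ?Q (m + 1 - k))"
      unfolding f_def g_def eq by (simp add: algebra_simps)
    then show "f (k - 1) + g k = - (ladder_coeff l3 m * (?W k (m + 1 - k) (- (m + 1)) * (?P k * ?Q (m + 1 - k))))"
      unfolding L by simp
  qed
  finally show ?thesis by simp
qed

lemma coupled_polar_lower:
  "sin \<theta> * coupled_polar_deriv l1 l2 l3 m \<theta> =
     - (m * cos \<theta> * coupled_polar l1 l2 l3 m \<theta>) + sin \<theta> * (ladder_coeff l3 (m - 1) * coupled_polar l1 l2 l3 (m - 1) \<theta>)"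
proof -
  let ?W = "wigner3j l1 l2 l3" and ?P = "\<lambda>k. polar l1 k \<theta>" and ?Q = "\<lambda>k. polar l2 k \<theta>"
  define f where "f k = ?W (k + 1) (m - (k + 1)) (- m) * (ladder_coeff l1 k * ?P k * ?Q (m - (k + 1)))" for k
  define g where "g k = ?W k (m - k) (- m) * (ladder_coeff l2 (m - k - 1) * ?P k * ?Q (m - k - 1))" for k
  have "sin \<theta> * coupled_polar_deriv l1 l2 l3 m \<theta> = (\<Sum>k = - int l1..int l1. ?W k (m - k) (- m) *
      ((sin \<theta> * polar_deriv l1 k \<theta>) * ?Q (m - k) + ?P k * (sin \<theta> * polar_deriv l2 (m - k) \<theta>)))"
    unfolding coupled_polar_deriv_def sum_distrib_left by (simp add: algebra_simps)
  also have "\<dots> = - (m * cos \<theta> * coupled_polar l1 l2 l3 m \<theta>) -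
      sin \<theta> * ((\<Sum>k = - int l1..int l1. f (k - 1)) + (\<Sum>k = - int l1..int l1. g k))"
    unfolding polar_lower' coupled_polar_def f_def g_def sum_distrib_left sum.distrib[symmetric]
      sum_negf[symmetric] sum_subtractf[symmetric]
    by (intro sum.cong refl) (simp add: algebra_simps)
  also have "(\<Sum>k = - int l1..int l1. f (k - 1)) = (\<Sum>k = - int l1..int l1. f k)"
    by (rule sum_int_shift[symmetric]) (simp_all add: f_def wigner3j_eq_0)
  also have "\<dots> + (\<Sum>k = - int l1..int l1. g k) = - (ladder_coeff l3 (m - 1) * coupled_polar l1 l2 l3 (m - 1) \<theta>)"
    unfolding coupled_polar_def sum.distrib[symmetric] sum_distrib_left sum_negf[symmetric]
  proof (intro sum.cong refl)
    fix k
    have eq: "m - 1 - k + 1 = m - k" "- m + 1 = - (m - 1)" "m - (k + 1) = m - 1 - k" "m - k - 1 = m - 1 - k"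
      by simp_all
    have sum: "k + (m - 1 - k) + - m = - 1" by simp
    have lad: "ladder_coeff l3 (- m) = ladder_coeff l3 (m - 1)"
      using ladder_coeff_minus[of l3 "m - 1"] by simp
    have L: "ladder_coeff l1 k * ?W (k + 1) (m - 1 - k) (- m) +
       ladder_coeff l2 (m - 1 - k) * ?W k (m - k) (- m) = - (ladder_coeff l3 (m - 1) * ?W k (m - 1 - k) (- (m - 1)))"
      using wigner3j_raise'[OF sum, of l1 l2 l3] unfolding lad eq by linarith
    have "f k + g k = (ladder_coeff l1 k * ?W (k + 1) (m - 1 - k) (- m) +
       ladder_coeff l2 (m - 1 - k) * ?W k (m - k) (- m)) * (?P k * ?Q (m - 1 - k))"
      unfolding f_def g_def eq by (simp add: algebra_simps)
    then show "f k + g k = - (ladder_coeff l3 (m - 1) * (?W k (m - 1 - k) (- (m - 1)) * (?P k * ?Q (m - 1 - k))))"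
      unfolding L by simp
  qed
  finally show ?thesis by simp
qed

lemma polar_top: "polar l (int l) \<theta> = polar l (int l) (pi / 2) * sin \<theta> ^ l"
  unfolding polar_of_nat mult_2[symmetric] rodrigues_double by simp

lemma polar_top_neq_0: "polar l (int l) (pi / 2) \<noteq> 0"
  unfolding polar_of_nat mult_2[symmetric] rodrigues_double using polar_norm_pos[of l l] by simp

text \<open>At the top order the ladder coefficient is 0 and the raising relation becomes the linear
  equation \<open>sin \<theta> * F' = l3 * cos \<theta> * F\<close>. Its solutions between the poles
  are the multiples of \<open>sin \<theta> ^ l3\<close>.\<close>

lemma coupled_polar_top:
  obtains c where "\<And>\<theta>. 0 < \<theta> \<Longrightarrow> \<theta> < pi \<Longrightarrow>
    coupled_polar l1 l2 l3 (int l3) \<theta> = c * polar l3 (int l3) \<theta>"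
proof -
  let ?F = "coupled_polar l1 l2 l3 (int l3)" and ?F' = "coupled_polar_deriv l1 l2 l3 (int l3)"
  have "((\<lambda>\<theta>. ?F \<theta> / sin \<theta> ^ l3) has_derivative (\<lambda>h. 0)) (at \<theta> within {0<..<pi})"
    if "\<theta> \<in> {0<..<pi}" for \<theta>
  proof -
    have s: "sin \<theta> > 0"
      using that by (simp add: sin_gt_zero)
    have F': "sin \<theta> * ?F' \<theta> = l3 * cos \<theta> * ?F \<theta>"
      using coupled_polar_raise[of \<theta> l1 l2 l3 "int l3"] by simp
    have "sin \<theta> * (?F' \<theta> * sin \<theta> ^ l3 - ?F \<theta> * (l3 * sin \<theta> ^ (l3 - 1) * cos \<theta>)) = 0"
    proof -
      have "sin \<theta> * (l3 * sin \<theta> ^ (l3 - 1)) = l3 * sin \<theta> ^ l3"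
        by (cases l3) auto
      moreover have "sin \<theta> * (?F' \<theta> * sin \<theta> ^ l3 - ?F \<theta> * (l3 * sin \<theta> ^ (l3 - 1) * cos \<theta>)) =
          (sin \<theta> * ?F' \<theta>) * sin \<theta> ^ l3 - ?F \<theta> * (sin \<theta> * (l3 * sin \<theta> ^ (l3 - 1))) * cos \<theta>"
        by (simp only: algebra_simps)
      ultimately show ?thesis
        unfolding F' by (simp only: algebra_simps)
    qed
    then have 0: "?F' \<theta> * sin \<theta> ^ l3 - ?F \<theta> * (l3 * sin \<theta> ^ (l3 - 1) * cos \<theta>) = 0"
      using s by simp
    have "((\<lambda>\<theta>. ?F \<theta> / sin \<theta> ^ l3) has_real_derivative
        (?F' \<theta> * sin \<theta> ^ l3 - ?F \<theta> * (l3 * sin \<theta> ^ (l3 - 1) * cos \<theta>)) / (sin \<theta> ^ l3 * sin \<theta> ^ l3)) (at \<theta>)"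
      using s by (auto intro!: derivative_eq_intros coupled_polar_has_real_derivative)
    then have "((\<lambda>\<theta>. ?F \<theta> / sin \<theta> ^ l3) has_real_derivative 0) (at \<theta>)"
      unfolding 0 by simp
    then show ?thesis
      by (simp add: has_field_derivative_def has_derivative_at_withinI lambda_zero)
  qed
  then obtain d where d: "\<And>\<theta>. \<theta> \<in> {0<..<pi} \<Longrightarrow> ?F \<theta> / sin \<theta> ^ l3 = d"
    using has_derivative_zero_constant[of "{0<..<pi}" "\<lambda>\<theta>. ?F \<theta> / sin \<theta> ^ l3"] by auto
  have "?F \<theta> = d / polar l3 (int l3) (pi / 2) * polar l3 (int l3) \<theta>" if "0 < \<theta>" "\<theta> < pi" for \<theta>
  proof -
    have "sin \<theta> > 0" using that by (simp add: sin_gt_zero)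
    then have "?F \<theta> = d * sin \<theta> ^ l3"
      using d[of \<theta>] that by (auto simp: field_simps)
    then show ?thesis
      using polar_top[of l3 \<theta>] polar_top_neq_0[of l3] by simp
  qed
  then show ?thesis by (rule that)
qed

text \<open>Descent by the lowering relation between the poles, where \<open>sin \<theta>\<close>
  can be cancelled; continuity then adds the poles. Order \<open>l3\<close> is the one to be
  integrated and order 0 the one visible at the pole; the sign counts the steps between
  them.\<close>

lemma coupled_polar_eq:
  obtains c where "\<And>\<theta>. \<theta> \<in> {0..pi} \<Longrightarrow> coupled_polar l1 l2 l3 (int l3) \<theta> = c * polar l3 (int l3) \<theta>"
    and "\<And>\<theta>. \<theta> \<in> {0..pi} \<Longrightarrow> coupled_polar l1 l2 l3 0 \<theta> = (- 1) ^ l3 * c * polar l3 0 \<theta>"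
proof -
  obtain c where c: "\<And>\<theta>. 0 < \<theta> \<Longrightarrow> \<theta> < pi \<Longrightarrow>
      coupled_polar l1 l2 l3 (int l3) \<theta> = c * polar l3 (int l3) \<theta>"
    using coupled_polar_top[of l1 l2 l3] by metis
  have "\<forall>\<theta>\<in>{0<..<pi}. coupled_polar l1 l2 l3 (int l3 - int k) \<theta> = (- 1) ^ k * c * polar l3 (int l3 - int k) \<theta>"
    if "k \<le> l3" for k
    using that
  proof (induction k)
    case (Suc k)
    define m where "m = int l3 - int k"
    show ?case
    proof
      fix \<theta> :: real assume \<theta>: "\<theta> \<in> {0<..<pi}"
      then have s: "sin \<theta> > 0" by (simp add: sin_gt_zero)
      have IH: "coupled_polar l1 l2 l3 m \<theta>' = (- 1) ^ k * c * polar l3 m \<theta>'" if "\<theta>' \<in> {0<..<pi}" for \<theta>'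
        using Suc that by (simp add: m_def)
      have "(coupled_polar l1 l2 l3 m has_real_derivative (- 1) ^ k * c * polar_deriv l3 m \<theta>) (at \<theta>)"
      proof (rule has_field_derivative_transform_within_open)
        show "((\<lambda>\<theta>. (- 1) ^ k * c * polar l3 m \<theta>) has_real_derivative (- 1) ^ k * c * polar_deriv l3 m \<theta>) (at \<theta>)"
          by (intro DERIV_cmult polar_has_real_derivative)
      qed (use \<theta> IH in \<open>auto intro: open_greaterThanLessThan\<close>)
      then have D: "coupled_polar_deriv l1 l2 l3 m \<theta> = (- 1) ^ k * c * polar_deriv l3 m \<theta>"
        using DERIV_unique coupled_polar_has_real_derivative by blast
      have "sin \<theta> * ladder_coeff l3 (m - 1) * coupled_polar l1 l2 l3 (m - 1) \<theta> =
          sin \<theta> * coupled_polar_deriv l1 l2 l3 m \<theta> + m * cos \<theta> * coupled_polar l1 l2 l3 m \<theta>"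
        unfolding coupled_polar_lower by simp
      also have "\<dots> = (- 1) ^ k * c * (sin \<theta> * polar_deriv l3 m \<theta> + m * cos \<theta> * polar l3 m \<theta>)"
        unfolding D IH[OF \<theta>] by (simp add: algebra_simps)
      also have "\<dots> = sin \<theta> * ladder_coeff l3 (m - 1) * ((- 1) ^ Suc k * c * polar l3 (m - 1) \<theta>)"
        unfolding polar_lower' by (simp add: algebra_simps)
      finally have "sin \<theta> * ladder_coeff l3 (m - 1) * coupled_polar l1 l2 l3 (m - 1) \<theta> =
          sin \<theta> * ladder_coeff l3 (m - 1) * ((- 1) ^ Suc k * c * polar l3 (m - 1) \<theta>)" .
      note eq = this
      have "ladder_coeff l3 (m - 1) > 0"
        using Suc by (intro ladder_coeff_pos) (simp_all add: m_def)
      then have "sin \<theta> * ladder_coeff l3 (m - 1) \<noteq> 0"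
        using s by simp
      from mult_left_cancel[THEN iffD1, OF this eq]
      have "coupled_polar l1 l2 l3 (m - 1) \<theta> = (- 1) ^ Suc k * c * polar l3 (m - 1) \<theta>" .
      then show "coupled_polar l1 l2 l3 (int l3 - int (Suc k)) \<theta> = (- 1) ^ Suc k * c * polar l3 (int l3 - int (Suc k)) \<theta>"
        by (simp add: m_def algebra_simps)
    qed
  qed (simp add: c)
  from this[of l3] have zero: "\<And>\<theta>. \<theta> \<in> {0<..<pi} \<Longrightarrow> coupled_polar l1 l2 l3 0 \<theta> = (- 1) ^ l3 * c * polar l3 0 \<theta>"
    by simp
  have cont: "continuous_on A (coupled_polar l1 l2 l3 m)" for A m
    by (intro continuous_at_imp_continuous_on ballI DERIV_isCont[OF coupled_polar_has_real_derivative])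
  have closure: "f \<theta> = g \<theta>" if "\<And>\<theta>. \<theta> \<in> {0<..<pi} \<Longrightarrow> f \<theta> = g \<theta>" "continuous_on {0..pi} f"
      "continuous_on {0..pi} g" "\<theta> \<in> {0..pi}" for f g :: "real \<Rightarrow> real" and \<theta>
  proof -
    have "f \<theta> - g \<theta> = 0"
      by (rule continuous_constant_on_closure[of "{0<..<pi}" "\<lambda>\<theta>. f \<theta> - g \<theta>"])
         (use that in \<open>auto intro!: continuous_intros\<close>)
    then show ?thesis by simp
  qed
  show ?thesis
  proof (rule that[of c])
    show "coupled_polar l1 l2 l3 (int l3) \<theta> = c * polar l3 (int l3) \<theta>" if "\<theta> \<in> {0..pi}" for \<theta>
      by (rule closure) (use that c in \<open>auto intro!: continuous_intros cont\<close>)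
    show "coupled_polar l1 l2 l3 0 \<theta> = (- 1) ^ l3 * c * polar l3 0 \<theta>" if "\<theta> \<in> {0..pi}" for \<theta>
      by (rule closure) (use that zero in \<open>auto intro!: continuous_intros cont\<close>)
  qed
qed

text \<open>There are two unknown factors: \<open>c\<close> relates the Gaunt integral to the
  3j-symbol and \<open>d\<close> relates the coupled product to \<open>polar l3\<close>. Integrating
  the coupled product against \<open>polar l3 (- l3)\<close> links them, and the value at the pole
  expresses \<open>d\<close> by the symbol with zero orders.\<close>

theorem polar_gaunt_wigner3j:
  assumes "m1 + m2 + m3 = 0"
  shows "2 * pi * polar_gaunt l1 l2 l3 m1 m2 m3 =
    sqrt (real ((2 * l1 + 1) * (2 * l2 + 1) * (2 * l3 + 1)) / (4 * pi)) *
    wigner3j l1 l2 l3 0 0 0 * wigner3j l1 l2 l3 m1 m2 m3"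
proof (cases "\<bar>int l1 - int l2\<bar> \<le> int l3 \<and> int l3 \<le> int l1 + int l2")
  case False
  then have "l3 > l1 + l2 \<or> l1 > l2 + l3 \<or> l2 > l1 + l3" by linarith
  moreover from this have "wigner3j l1 l2 l3 0 0 0 = 0"
    by (intro wigner3j_eq_0) linarith
  ultimately show ?thesis
    using polar_gaunt_triangle[OF assms] by simp
next
  case True
  then obtain c where c: "\<And>m1 m2 m3. m1 + m2 + m3 = 0 \<Longrightarrow>
      polar_gaunt l1 l2 l3 m1 m2 m3 = c * wigner3j l1 l2 l3 m1 m2 m3"
    using polar_gaunt_proportional by blast
  obtain d where d: "\<And>\<theta>. \<theta> \<in> {0..pi} \<Longrightarrow> coupled_polar l1 l2 l3 (int l3) \<theta> = d * polar l3 (int l3) \<theta>"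
    and d0: "\<And>\<theta>. \<theta> \<in> {0..pi} \<Longrightarrow> coupled_polar l1 l2 l3 0 \<theta> = (- 1) ^ l3 * d * polar l3 0 \<theta>"
    using coupled_polar_eq[of l1 l2 l3] by metis
  \<comment> \<open>\<open>s l\<close> is the value at the pole of the function of degree
    \<open>l\<close> and order 0.\<close>
  define s where "s l = sqrt ((2 * real l + 1) / (4 * pi))" for l :: nat
  have s: "s l > 0" "(s l)\<^sup>2 = (2 * real l + 1) / (4 * pi)" for l
    by (simp_all add: s_def)
  have "coupled_polar l1 l2 l3 0 0 = (\<Sum>k\<in>{0}. wigner3j l1 l2 l3 k (0 - k) (- 0) * (polar l1 k 0 * polar l2 (0 - k) 0))"
    unfolding coupled_polar_def by (rule sum.mono_neutral_right) (auto simp: polar_at_0)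
  then have 1: "wigner3j l1 l2 l3 0 0 0 * (s l1 * s l2) = (- 1) ^ l3 * d * s l3"
    using d0[of 0] by (simp add: polar_at_0 s_def)
  have int: "(\<lambda>\<theta>. wigner3j l1 l2 l3 k (int l3 - k) (- int l3) * (polar l1 k \<theta> * polar l2 (int l3 - k) \<theta> *
        polar l3 (- int l3) \<theta> * sin \<theta>)) integrable_on {0..pi}" for k
    by (intro integrable_continuous_interval continuous_intros)
  \<comment> \<open>The left side is \<open>c\<close> times the sum of the squared 3j-symbols.
    Absorbing \<open>c\<close> and one factor of each square into a Gaunt integral makes it an
    integral of the coupled product.\<close>
  have "c / (2 * l3 + 1) = (\<Sum>k = - int l1..int l1. wigner3j l1 l2 l3 k (int l3 - k) (- int l3) *
      polar_gaunt l1 l2 l3 k (int l3 - k) (- int l3))"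
  proof -
    have "c / (2 * l3 + 1) = c * (\<Sum>k = - int l1..int l1. (wigner3j l1 l2 l3 k (int l3 - k) (- int l3))\<^sup>2)"
      using wigner3j_sum_squares[of l1 l2 l3] True by simp
    then show ?thesis
      by (simp add: c power2_eq_square sum_distrib_left mult_ac)
  qed
  also have "\<dots> = integral {0..pi} (\<lambda>\<theta>. \<Sum>k = - int l1..int l1. wigner3j l1 l2 l3 k (int l3 - k) (- int l3) *
      (polar l1 k \<theta> * polar l2 (int l3 - k) \<theta> * polar l3 (- int l3) \<theta> * sin \<theta>))"
    unfolding polar_gaunt_def integral_mult_right[symmetric]
    by (rule Henstock_Kurzweil_Integration.integral_sum[symmetric]) (auto intro: int)
  also have "\<dots> = integral {0..pi} (\<lambda>\<theta>. (- 1) ^ l3 * d * (polar l3 (int l3) \<theta> * polar l3 (int l3) \<theta> * sin \<theta>))"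
  proof (rule integral_cong)
    fix \<theta> :: real assume "\<theta> \<in> {0..pi}"
    from d[OF this] have "coupled_polar l1 l2 l3 (int l3) \<theta> * (polar l3 (- int l3) \<theta> * sin \<theta>) =
        (- 1) ^ l3 * d * (polar l3 (int l3) \<theta> * polar l3 (int l3) \<theta> * sin \<theta>)"
      by (simp add: polar_minus)
    moreover have "(\<Sum>k = - int l1..int l1. wigner3j l1 l2 l3 k (int l3 - k) (- int l3) *
      (polar l1 k \<theta> * polar l2 (int l3 - k) \<theta> * polar l3 (- int l3) \<theta> * sin \<theta>)) =
      coupled_polar l1 l2 l3 (int l3) \<theta> * (polar l3 (- int l3) \<theta> * sin \<theta>)"
      unfolding coupled_polar_def sum_distrib_right by (intro sum.cong) (simp_all add: mult_ac)
    ultimately show "(\<Sum>k = - int l1..int l1. wigner3j l1 l2 l3 k (int l3 - k) (- int l3) *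
      (polar l1 k \<theta> * polar l2 (int l3 - k) \<theta> * polar l3 (- int l3) \<theta> * sin \<theta>)) =
      (- 1) ^ l3 * d * (polar l3 (int l3) \<theta> * polar l3 (int l3) \<theta> * sin \<theta>)"
      by (simp only:)
  qed
  also have "\<dots> = (- 1) ^ l3 * d / (2 * pi)"
    using integral_polar_sq[of "int l3" l3] by simp
  finally have 2: "c / (2 * l3 + 1) = (- 1) ^ l3 * d / (2 * pi)" .
  have "(- 1) ^ l3 * d = wigner3j l1 l2 l3 0 0 0 * (s l1 * s l2) / s l3"
    using 1 s(1)[of l3] by (simp add: field_simps)
  moreover have "2 * pi * c = (2 * real l3 + 1) * ((- 1) ^ l3 * d)"
    using 2 by (simp add: field_simps)
  ultimately have "2 * pi * c = (2 * real l3 + 1) * (wigner3j l1 l2 l3 0 0 0 * (s l1 * s l2) / s l3)"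
    by (simp only:)
  also have "2 * real l3 + 1 = 4 * pi * (s l3 * s l3)"
    using s(2)[of l3] by (simp add: power2_eq_square)
  also have "4 * pi * (s l3 * s l3) * (wigner3j l1 l2 l3 0 0 0 * (s l1 * s l2) / s l3) =
      (4 * pi * (s l1 * s l2 * s l3)) * wigner3j l1 l2 l3 0 0 0"
    using s(1)[of l3] by simp
  also have "4 * pi * (s l1 * s l2 * s l3) = sqrt (real ((2 * l1 + 1) * (2 * l2 + 1) * (2 * l3 + 1)) / (4 * pi))"
  proof (rule real_sqrt_unique[symmetric])
    have "(4 * pi * (s l1 * s l2 * s l3))\<^sup>2 = (4 * pi)\<^sup>2 * ((s l1)\<^sup>2 * (s l2)\<^sup>2 * (s l3)\<^sup>2)"
      by (simp add: power_mult_distrib)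
    also have "\<dots> = real ((2 * l1 + 1) * (2 * l2 + 1) * (2 * l3 + 1)) / (4 * pi)"
    proof -
      have r: "real ((2 * l1 + 1) * (2 * l2 + 1) * (2 * l3 + 1)) = (2 * real l1 + 1) * (2 * real l2 + 1) * (2 * real l3 + 1)"
        by (simp only: of_nat_mult of_nat_add of_nat_numeral of_nat_1)
      have "(4 * p)\<^sup>2 * (x / (4 * p) * (y / (4 * p)) * (z / (4 * p))) = x * y * z / (4 * p)" if "p > 0" for p x y z :: real
        using that by (simp add: power2_eq_square)
      from this[OF pi_gt_zero] show ?thesis unfolding s(2) r .
    qed
    finally show "(4 * pi * (s l1 * s l2 * s l3))\<^sup>2 = real ((2 * l1 + 1) * (2 * l2 + 1) * (2 * l3 + 1)) / (4 * pi)" .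
  qed (use s(1) in \<open>simp add: less_imp_le\<close>)
  finally show ?thesis
    by (simp add: c[OF assms])
qed

section \<open>Multiplication by the coordinate functions\<close>

lemma continuous_eq_on_closed_interval:
  fixes f g :: "real \<Rightarrow> real"
  assumes "\<And>\<theta>. \<theta> \<in> {a<..<b} \<Longrightarrow> f \<theta> = g \<theta>" "continuous_on {a..b} f" "continuous_on {a..b} g"
    "a < b" "\<theta> \<in> {a..b}"
  shows "f \<theta> = g \<theta>"
proof -
  have "f \<theta> - g \<theta> = 0"
    by (rule continuous_constant_on_closure[of "{a<..<b}" "\<lambda>\<theta>. f \<theta> - g \<theta>"])
       (use assms in \<open>auto intro!: continuous_intros\<close>)
  then show ?thesis by simp
qed

text \<open>\<open>cos_up\<close> and its three companions are, up to sign, the matrix elements of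
  multiplication by \<open>cos \<theta>\<close> and by \<open>sin \<theta>\<close> times a unit
  shift of the order, between neighbouring degrees. The subtraction in \<open>2 * real l - 1\<close>
  is real; at \<open>l = 0\<close> and order 0 the downward elements are 0, so the truncated degree
  \<open>l - 1\<close> is harmless.\<close>

definition cos_up :: "nat \<Rightarrow> int \<Rightarrow> real" where
  "cos_up l m = sqrt ((real l + 1 - m) * (real l + 1 + m) / ((2 * l + 1) * (2 * l + 3)))"

definition cos_down :: "nat \<Rightarrow> int \<Rightarrow> real" where
  "cos_down l m = sqrt ((real l - m) * (real l + m) / ((2 * real l - 1) * (2 * l + 1)))"

definition sin_up :: "nat \<Rightarrow> int \<Rightarrow> real" where
  "sin_up l m = sqrt ((real l + m + 1) * (real l + m + 2) / ((2 * l + 1) * (2 * l + 3)))"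

definition sin_down :: "nat \<Rightarrow> int \<Rightarrow> real" where
  "sin_down l m = sqrt ((real l - m) * (real l - m - 1) / ((2 * real l - 1) * (2 * l + 1)))"

lemma cos_up_minus: "cos_up l (- m) = cos_up l m"
  by (simp add: cos_up_def mult.commute)

lemma cos_down_minus: "cos_down l (- m) = cos_down l m"
  by (simp add: cos_down_def mult.commute)

lemma cos_down_Suc: "cos_down (Suc l) m = cos_up l m"
  by (simp add: cos_down_def cos_up_def algebra_simps)

lemma polar_norm_cos_up:
  assumes "k \<le> l"
  shows "cos_up l (int k) * polar_norm (Suc l) k = polar_norm l k * (real l + 1 - k) / (2 * (real l + 1) * (2 * real l + 1))"
proof -
  define x where "x = real l + 1 - k"
  define y where "y = real l + 1 + k"
  have xy: "x > 0" "y > 0" using assms by (simp_all add: x_def y_def)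
  have f: "fact (Suc l - k) = x * fact (l - k)" "fact (Suc l + k) = y * fact (l + k)"
    using assms by (simp_all add: x_def y_def Suc_diff_le of_nat_diff)
  have "cos_up l (int k) * sqrt (real (2 * Suc l + 1) * fact (Suc l - k) / (4 * pi * fact (Suc l + k))) =
      sqrt (x * y / ((2 * real l + 1) * (2 * real l + 3)) *
        ((2 * real l + 3) * (x * fact (l - k)) / (4 * pi * (y * fact (l + k)))))"
    unfolding cos_up_def f by (simp add: real_sqrt_mult[symmetric] x_def y_def algebra_simps)
  also have "x * y / ((2 * real l + 1) * (2 * real l + 3)) *
        ((2 * real l + 3) * (x * fact (l - k)) / (4 * pi * (y * fact (l + k)))) =
      (x / (2 * real l + 1))\<^sup>2 * (real (2 * l + 1) * fact (l - k) / (4 * pi * fact (l + k)))"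
  proof -
    have gen: "x * y / (a * b) * (b * (x * F) / (4 * pi * (y * G))) = (x / a)\<^sup>2 * (a * F / (4 * pi * G))"
      if "a > 0" "b > 0" for a b F G :: real
      using that xy by (simp add: power2_eq_square)
    show ?thesis
      using gen[of "2 * real l + 1" "2 * real l + 3"] by simp
  qed
  also have "sqrt \<dots> = x / (2 * real l + 1) * sqrt (real (2 * l + 1) * fact (l - k) / (4 * pi * fact (l + k)))"
    unfolding real_sqrt_mult real_sqrt_abs using xy by simp
  finally have "cos_up l (int k) * sqrt (real (2 * Suc l + 1) * fact (Suc l - k) / (4 * pi * fact (Suc l + k))) =
    x / (2 * real l + 1) * sqrt (real (2 * l + 1) * fact (l - k) / (4 * pi * fact (l + k)))" .
  then have "cos_up l (int k) * polar_norm (Suc l) k =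
      x / (2 * real l + 1) * sqrt (real (2 * l + 1) * fact (l - k) / (4 * pi * fact (l + k))) / (2 ^ Suc l * fact (Suc l))"
    unfolding polar_norm_def times_divide_eq_right by (simp only:)
  also have "\<dots> = polar_norm l k * x / (2 * (real l + 1) * (2 * real l + 1))"
    unfolding polar_norm_def by (simp add: algebra_simps)
  finally show ?thesis
    by (simp add: x_def)
qed

text \<open>The three-term recurrence in the degree, found by eliminating the derivative of order
  \<open>n - 1\<close> at degree \<open>l\<close> between \<open>rodrigues_Suc_Suc\<close> and
  \<open>rodrigues_Suc_plus2\<close>. The rest converts the rational coefficients into the
  normalised ones.\<close>

lemma cos_mult_polar_nat:
  assumes "k \<le> l"
  shows "cos \<theta> * polar l (int k) \<theta> =
    cos_up l (int k) * polar (Suc l) (int k) \<theta> + cos_down l (int k) * polar (l - 1) (int k) \<theta>"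
proof -
  define t where "t = cos \<theta>"
  define n where "n = l + k"
  let ?R = "rodrigues l n t" and ?U = "rodrigues (Suc l) (Suc n) t" and ?D = "rodrigues (l - 1) (n - 1) t"
  have e1: "?U = 2 * (l + 1) * (t * ?R + n * rodrigues l (n - 1) t)"
    using rodrigues_Suc_Suc[of l n t] by simp
  \<comment> \<open>The factor \<open>n\<close> makes the identity hold at \<open>n = 0\<close>,
    where \<open>n - 1\<close> is truncated.\<close>
  have e2: "real n * ?U = real n * (2 * (l + 1) * (2 * l + 1) * rodrigues l (n - 1) t + 4 * l * (l + 1) * ?D)"
    using rodrigues_Suc_plus2[of l "n - 1" t] by (cases n) (simp_all add: algebra_simps)
  have "t * ?R * (2 * (real l + 1) * (2 * real l + 1)) = (2 * real l + 1) * ?U - (2 * (real l + 1) * (2 * real l + 1)) * n * rodrigues l (n - 1) t"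
    unfolding e1 by (simp add: algebra_simps)
  also have "\<dots> = (2 * real l + 1 - n) * ?U + 4 * l * (real l + 1) * n * ?D"
    using e2 by (simp add: algebra_simps)
  finally have key: "t * ?R * (2 * (real l + 1) * (2 * real l + 1)) = (real l + 1 - k) * ?U + 4 * l * (real l + 1) * n * ?D"
    by (simp add: n_def)
  have c: "2 * (real l + 1) * (2 * real l + 1) \<noteq> 0"
    by simp
  have "t * ?R = ((real l + 1 - k) * ?U + 4 * l * (real l + 1) * n * ?D) / (2 * (real l + 1) * (2 * real l + 1))"
    unfolding key[symmetric] using c by (rule nonzero_mult_div_cancel_right[symmetric])
  also have "\<dots> = (real l + 1 - k) / (2 * (real l + 1) * (2 * real l + 1)) * ?U + 2 * l * n / (2 * real l + 1) * ?D"
  proof -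
    have "4 * a * b * c' * d / (2 * b * e) = 2 * a * c' / e * d" if "b \<noteq> 0" for a b c' d e :: real
      using that by simp
    from this[of "real l + 1"] show ?thesis
      by (simp add: add_divide_distrib)
  qed
  finally have tR: "t * ?R = (real l + 1 - k) / (2 * (real l + 1) * (2 * real l + 1)) * ?U + 2 * l * n / (2 * real l + 1) * ?D" .
  \<comment> \<open>For \<open>k < l\<close> this is \<open>polar_norm_cos_up\<close> one degree
    lower, since \<open>cos_down l\<close> is \<open>cos_up (l - 1)\<close>; at \<open>k = l\<close>
    both sides are 0.\<close>
  have D: "polar_norm l k * (2 * l * n / (2 * real l + 1)) * ?D = cos_down l (int k) * polar_norm (l - 1) k * ?D"
  proof (cases "k < l")
    case True
    then obtain j where j: "l = Suc j" by (cases l) auto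
    have k: "k \<le> j" using True j by simp
    have nz: "real j + 1 - k > 0" using k by simp
    have N: "polar_norm j k * (real j + 1 - k) = cos_up j (int k) * polar_norm l k * (2 * (real j + 1) * (2 * real j + 1))"
    proof -
      have D: "2 * (real j + 1) * (2 * real j + 1) \<noteq> 0"
        by simp
      show ?thesis
        unfolding j polar_norm_cos_up[OF k]
        by (simp only: times_divide_eq_left nonzero_mult_div_cancel_right[OF D])
    qed
    have sq: "cos_up j (int k) * cos_up j (int k) = (real j + 1 - k) * (real j + 1 + k) / ((2 * real j + 1) * (2 * real j + 3))"
    proof -
      have "cos_up j (int k) = sqrt ((real j + 1 - k) * (real j + 1 + k) / ((2 * real j + 1) * (2 * real j + 3)))"
        by (simp add: cos_up_def algebra_simps)
      moreover have "(real j + 1 - k) * (real j + 1 + k) / ((2 * real j + 1) * (2 * real j + 3)) \<ge> 0"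
        using k by (intro divide_nonneg_pos mult_nonneg_nonneg mult_pos_pos) auto
      ultimately show ?thesis
        by (simp only: real_sqrt_mult_self abs_of_nonneg)
    qed
    have "(real j + 1 - k) * (cos_down l (int k) * polar_norm (l - 1) k) =
        cos_up j (int k) * (polar_norm j k * (real j + 1 - k))"
      by (simp add: j cos_down_Suc mult_ac)
    also have "\<dots> = (cos_up j (int k) * cos_up j (int k)) * polar_norm l k * (2 * (real j + 1) * (2 * real j + 1))"
      unfolding N by (simp only: mult.assoc)
    also have "\<dots> = (real j + 1 - k) * (polar_norm l k * (2 * l * n / (2 * real l + 1)))"
    proof -
      have gen: "x * y / (a * b) * p * (2 * c * a) = x * (p * (2 * c * y / b))" if "a > 0" for a b c p x y :: real
        using that by simp
      have "2 * l * n / (2 * real l + 1) = 2 * (real j + 1) * (real j + 1 + k) / (2 * real j + 3)"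
        by (simp add: n_def j algebra_simps)
      then show ?thesis
        unfolding sq by (simp only:) (rule gen, simp)
    qed
    finally have eq: "(real j + 1 - k) * (cos_down l (int k) * polar_norm (l - 1) k) =
        (real j + 1 - k) * (polar_norm l k * (2 * l * n / (2 * real l + 1)))" .
    have "polar_norm l k * (2 * l * n / (2 * real l + 1)) = cos_down l (int k) * polar_norm (l - 1) k"
      using mult_left_cancel[THEN iffD1, OF _ eq] nz by (simp only:)
    then show ?thesis by simp
  next
    case False
    then have "k = l" using assms by simp
    then have "l = 0 \<or> ?D = 0"
      by (auto simp: n_def intro: rodrigues_eq_0)
    then show ?thesis
      using \<open>k = l\<close> by (auto simp: cos_down_def n_def)
  qed
  have sD: "polar (l - 1) (int k) \<theta> = (- 1) ^ k * polar_norm (l - 1) k * sin \<theta> ^ k * rodrigues (l - 1) (l - 1 + k) t"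
    unfolding t_def by (rule polar_of_nat)
  have "cos_down l (int k) * rodrigues (l - 1) (l - 1 + k) t = cos_down l (int k) * ?D"
    using assms by (cases l) (auto simp: n_def cos_down_def)
  have 2: "cos_down l (int k) * polar (l - 1) (int k) \<theta> =
      (- 1) ^ k * sin \<theta> ^ k * (cos_down l (int k) * polar_norm (l - 1) k * ?D)"
  proof -
    have "cos_down l (int k) * polar (l - 1) (int k) \<theta> =
      (- 1) ^ k * sin \<theta> ^ k * (polar_norm (l - 1) k * (cos_down l (int k) * rodrigues (l - 1) (l - 1 + k) t))"
      unfolding sD by (simp only: mult_ac)
    also have "\<dots> = (- 1) ^ k * sin \<theta> ^ k * (cos_down l (int k) * polar_norm (l - 1) k * ?D)"
      unfolding \<open>cos_down l (int k) * rodrigues (l - 1) (l - 1 + k) t = cos_down l (int k) * ?D\<close>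
      by (simp only: mult_ac)
    finally show ?thesis .
  qed
  have 1: "cos_up l (int k) * polar (Suc l) (int k) \<theta> =
      (- 1) ^ k * sin \<theta> ^ k * (polar_norm l k * ((real l + 1 - k) / (2 * (real l + 1) * (2 * real l + 1))) * ?U)"
  proof -
    have "cos_up l (int k) * polar (Suc l) (int k) \<theta> =
      (- 1) ^ k * sin \<theta> ^ k * ((cos_up l (int k) * polar_norm (Suc l) k) * ?U)"
      unfolding polar_of_nat by (simp add: n_def t_def)
    then show ?thesis
      unfolding polar_norm_cos_up[OF assms] by simp
  qed
  have "cos \<theta> * polar l (int k) \<theta> = (- 1) ^ k * sin \<theta> ^ k * (polar_norm l k * (t * ?R))"
    unfolding polar_of_nat by (simp add: n_def t_def)
  then show ?thesis
    unfolding 1 2 D[symmetric] tR by (simp add: algebra_simps)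
qed

lemma cos_mult_polar:
  "cos \<theta> * polar l m \<theta> = cos_up l m * polar (Suc l) m \<theta> + cos_down l m * polar (l - 1) m \<theta>"
proof (cases "\<bar>m\<bar> \<le> int l")
  case False
  then have "\<bar>m\<bar> = int l + 1 \<or> \<bar>m\<bar> > int (Suc l)" by auto
  then have "cos_up l m * polar (Suc l) m \<theta> = 0"
    by (auto simp: cos_up_def polar_eq_0 abs_if split: if_splits)
  with False show ?thesis
    by (simp add: polar_eq_0)
next
  case True
  show ?thesis
  proof (cases "m \<ge> 0")
    case True
    then show ?thesis
      using cos_mult_polar_nat[of "nat m" l \<theta>] \<open>\<bar>m\<bar> \<le> int l\<close> by simp
  next
    case False
    define k where "k = nat (- m)"
    have m: "m = - int k" "k \<le> l"
      using False \<open>\<bar>m\<bar> \<le> int l\<close> by (simp_all add: k_def)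
    have "(- 1) ^ k * (cos \<theta> * polar l (int k) \<theta>) = (- 1) ^ k * (cos_up l (int k) * polar (Suc l) (int k) \<theta> +
        cos_down l (int k) * polar (l - 1) (int k) \<theta>)"
      unfolding cos_mult_polar_nat[OF m(2)] ..
    then show ?thesis
      unfolding m polar_minus cos_up_minus cos_down_minus by (simp add: algebra_simps)
  qed
qed

text \<open>Both products contain the same root \<open>r\<close>, and the factors
  \<open>l + 1 - m\<close> and \<open>l - m\<close> in front of it differ by 1.\<close>

lemma ladder_cos_up:
  assumes "\<bar>m\<bar> \<le> int l"
  shows "cos_up l m * ladder_coeff (Suc l) m - ladder_coeff l m * cos_up l (m + 1) = sin_up l m"
proof -
  define N where "N = (2 * real l + 1) * (2 * real l + 3)"
  define r where "r = sqrt ((real l + m + 1) * (real l + m + 2) / N)"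
  have nn: "real l - m \<ge> 0" "real l + m \<ge> 0"
    using assms by (simp_all add: abs_le_iff)
  have "cos_up l m * ladder_coeff (Suc l) m =
      sqrt ((real l + 1 - m)\<^sup>2 * ((real l + m + 1) * (real l + m + 2) / N))"
    unfolding cos_up_def ladder_coeff_def real_sqrt_mult[symmetric]
    by (simp add: N_def power2_eq_square algebra_simps)
  also have "\<dots> = (real l + 1 - m) * r"
    unfolding real_sqrt_mult real_sqrt_abs r_def using nn by simp
  finally have 1: "cos_up l m * ladder_coeff (Suc l) m = (real l + 1 - m) * r" .
  have "ladder_coeff l m * cos_up l (m + 1) =
      sqrt ((real l - m)\<^sup>2 * ((real l + m + 1) * (real l + m + 2) / N))"
    unfolding cos_up_def ladder_coeff_def real_sqrt_mult[symmetric]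
    by (simp add: N_def power2_eq_square algebra_simps)
  also have "\<dots> = (real l - m) * r"
    unfolding real_sqrt_mult real_sqrt_abs r_def using nn by simp
  finally have 2: "ladder_coeff l m * cos_up l (m + 1) = (real l - m) * r" .
  have "sin_up l m = r"
    by (simp add: sin_up_def r_def N_def algebra_simps)
  then show ?thesis
    unfolding 1 2 by (simp add: algebra_simps)
qed

lemma ladder_cos_down:
  assumes "\<bar>m\<bar> \<le> int l" "\<bar>m + 1\<bar> \<le> int (l - 1)" "l \<ge> 1"
  shows "cos_down l m * ladder_coeff (l - 1) m - ladder_coeff l m * cos_down l (m + 1) = - sin_down l m"
proof -
  define N where "N = (2 * real l - 1) * (2 * real l + 1)"
  define r where "r = sqrt ((real l - m) * (real l - m - 1) / N)"
  have nn: "real l + m \<ge> 0" "real l + m + 1 \<ge> 0"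
    using assms by (simp_all add: abs_le_iff)
  have l: "real (l - 1) = real l - 1"
    using assms by (simp add: of_nat_diff)
  have "cos_down l m * ladder_coeff (l - 1) m =
      sqrt ((real l + m)\<^sup>2 * ((real l - m) * (real l - m - 1) / N))"
    unfolding cos_down_def ladder_coeff_def real_sqrt_mult[symmetric] l
    by (simp add: N_def power2_eq_square algebra_simps)
  also have "\<dots> = (real l + m) * r"
    unfolding real_sqrt_mult real_sqrt_abs r_def using nn by simp
  finally have 1: "cos_down l m * ladder_coeff (l - 1) m = (real l + m) * r" .
  have "ladder_coeff l m * cos_down l (m + 1) =
      sqrt ((real l + m + 1)\<^sup>2 * ((real l - m) * (real l - m - 1) / N))"
    unfolding cos_down_def ladder_coeff_def real_sqrt_mult[symmetric]
    by (simp add: N_def power2_eq_square algebra_simps)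
  also have "\<dots> = (real l + m + 1) * r"
    unfolding real_sqrt_mult real_sqrt_abs r_def using nn by simp
  finally have 2: "ladder_coeff l m * cos_down l (m + 1) = (real l + m + 1) * r" .
  have "sin_down l m = r"
    by (simp add: sin_down_def r_def N_def)
  then show ?thesis
    unfolding 1 2 by (simp add: algebra_simps)
qed

text \<open>The commutator of multiplication by \<open>cos \<theta>\<close> with the raising operator is
  multiplication by \<open>- sin \<theta>\<close>.\<close>

lemma sin_mult_polar_raise:
  assumes "\<theta> \<in> {0..pi}"
  shows "sin \<theta> * polar l m \<theta> =
    - sin_up l m * polar (Suc l) (m + 1) \<theta> + sin_down l m * polar (l - 1) (m + 1) \<theta>"
proof (cases "\<bar>m\<bar> \<le> int l")
  case False
  have "sin_up l m * polar (Suc l) (m + 1) \<theta> = 0"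
  proof -
    have "m = - int l - 1 \<or> m = - int l - 2 \<or> \<bar>m + 1\<bar> > int (Suc l)"
      using False by linarith
    then show ?thesis by (auto simp: sin_up_def polar_eq_0)
  qed
  moreover have "sin_down l m * polar (l - 1) (m + 1) \<theta> = 0"
    using False by (cases "l = 0 \<and> m = - 1") (auto simp: polar_eq_0 sin_down_def)
  moreover have "polar l m \<theta> = 0"
    using False by (simp add: polar_eq_0)
  ultimately show ?thesis
    by auto
next
  case True
  show ?thesis
  proof (rule continuous_eq_on_closed_interval[OF _ _ _ pi_gt_zero assms])
    fix \<theta> :: real assume "\<theta> \<in> {0<..<pi}"
    then have s: "sin \<theta> > 0" by (simp add: sin_gt_zero)
    let ?U = "polar (Suc l)" and ?D = "polar (l - 1)"
    let ?a = "cos_up l m" and ?b = "cos_down l m"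
    \<comment> \<open>The derivative is computed by the product rule and, alternatively, through
      \<open>cos_mult_polar\<close>. After multiplication by \<open>sin \<theta>\<close> and use of
      the raising relation, the terms with \<open>m * cos \<theta>\<close> cancel and the commutator
      remains.\<close>
    have "((\<lambda>\<theta>. cos \<theta> * polar l m \<theta>) has_real_derivative
        - sin \<theta> * polar l m \<theta> + cos \<theta> * polar_deriv l m \<theta>) (at \<theta>)"
      by (auto intro!: derivative_eq_intros polar_has_real_derivative)
    moreover have "((\<lambda>\<theta>. cos \<theta> * polar l m \<theta>) has_real_derivative
        ?a * polar_deriv (Suc l) m \<theta> + ?b * polar_deriv (l - 1) m \<theta>) (at \<theta>)"
      unfolding cos_mult_polar by (auto intro!: derivative_eq_intros polar_has_real_derivative)
    ultimately have "- sin \<theta> * polar l m \<theta> + cos \<theta> * polar_deriv l m \<theta> =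
        ?a * polar_deriv (Suc l) m \<theta> + ?b * polar_deriv (l - 1) m \<theta>"
      by (rule DERIV_unique)
    then have "sin \<theta> * (- sin \<theta> * polar l m \<theta> + cos \<theta> * polar_deriv l m \<theta>) =
        sin \<theta> * (?a * polar_deriv (Suc l) m \<theta> + ?b * polar_deriv (l - 1) m \<theta>)"
      by (simp only:)
    then have "- (sin \<theta> * sin \<theta> * polar l m \<theta>) + cos \<theta> * (sin \<theta> * polar_deriv l m \<theta>) =
        ?a * (sin \<theta> * polar_deriv (Suc l) m \<theta>) + ?b * (sin \<theta> * polar_deriv (l - 1) m \<theta>)"
      by (simp only: algebra_simps)
    then have "- (sin \<theta> * sin \<theta> * polar l m \<theta>) + m * cos \<theta> * (cos \<theta> * polar l m \<theta>) +
          sin \<theta> * (ladder_coeff l m * (cos \<theta> * polar l (m + 1) \<theta>)) =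
        m * cos \<theta> * (?a * ?U m \<theta> + ?b * ?D m \<theta>) +
        sin \<theta> * (?a * ladder_coeff (Suc l) m * ?U (m + 1) \<theta> + ?b * ladder_coeff (l - 1) m * ?D (m + 1) \<theta>)"
      unfolding polar_raise' by (simp only: algebra_simps)
    then have "sin \<theta> * (sin \<theta> * polar l m \<theta>) = sin \<theta> *
        (- (?a * ladder_coeff (Suc l) m - ladder_coeff l m * cos_up l (m + 1)) * ?U (m + 1) \<theta>
         - (?b * ladder_coeff (l - 1) m - ladder_coeff l m * cos_down l (m + 1)) * ?D (m + 1) \<theta>)"
      unfolding cos_mult_polar[symmetric] unfolding cos_mult_polar[of \<theta> l "m + 1"]
      by (simp add: algebra_simps)
    then have "sin \<theta> * polar l m \<theta> =
        - (?a * ladder_coeff (Suc l) m - ladder_coeff l m * cos_up l (m + 1)) * ?U (m + 1) \<theta>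
         - (?b * ladder_coeff (l - 1) m - ladder_coeff l m * cos_down l (m + 1)) * ?D (m + 1) \<theta>"
      using s by simp
    moreover have "(?b * ladder_coeff (l - 1) m - ladder_coeff l m * cos_down l (m + 1)) * ?D (m + 1) \<theta> =
        - sin_down l m * ?D (m + 1) \<theta>"
    proof (cases "l \<ge> 1 \<and> \<bar>m + 1\<bar> \<le> int (l - 1)")
      case T: True
      show ?thesis
        unfolding ladder_cos_down[OF True conjunct2[OF T] conjunct1[OF T]] ..
    next
      case False
      then show ?thesis
        using True by (cases "l = 0") (auto simp: polar_eq_0)
    qed
    ultimately show "sin \<theta> * polar l m \<theta> = - sin_up l m * ?U (m + 1) \<theta> + sin_down l m * ?D (m + 1) \<theta>"
      unfolding ladder_cos_up[OF True] by simp
  qed (intro continuous_intros)+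
qed

text \<open>\<open>sin_mult_polar_raise\<close> at order \<open>- m\<close>, reflected by
  \<open>polar_minus\<close>.\<close>

lemma sin_mult_polar_lower:
  assumes "\<theta> \<in> {0..pi}"
  shows "sin \<theta> * polar l m \<theta> =
    sin_up l (- m) * polar (Suc l) (m - 1) \<theta> - sin_down l (- m) * polar (l - 1) (m - 1) \<theta>"
proof -
  define e :: real where "e = (- 1) ^ nat \<bar>m\<bar>"
  have e: "e * e = 1"
    unfolding e_def by (simp flip: power_mult_distrib)
  have "(- 1 :: real) ^ nat \<bar>m - 1\<bar> = - e"
  proof (cases "m \<ge> 1")
    case True
    then have "nat \<bar>m\<bar> = Suc (nat \<bar>m - 1\<bar>)" by simp
    then show ?thesis unfolding e_def by (simp only: power_Suc)
  next
    case False
    then have "nat \<bar>m - 1\<bar> = Suc (nat \<bar>m\<bar>)" by simp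
    then show ?thesis unfolding e_def by (simp only: power_Suc mult_minus1)
  qed
  then have p: "polar j (- m + 1) \<theta> = - e * polar j (m - 1) \<theta>" for j
    using polar_minus[of j "m - 1" \<theta>] by simp
  have "e * (sin \<theta> * polar l (- m) \<theta>) = e * (- sin_up l (- m) * polar (Suc l) (- m + 1) \<theta> + sin_down l (- m) * polar (l - 1) (- m + 1) \<theta>)"
    unfolding sin_mult_polar_raise[OF assms, of l "- m"] ..
  then have "(e * e) * (sin \<theta> * polar l m \<theta>) = (e * e) *
      (sin_up l (- m) * polar (Suc l) (m - 1) \<theta> - sin_down l (- m) * polar (l - 1) (m - 1) \<theta>)"
    unfolding p unfolding polar_minus e_def[symmetric] by (simp only: algebra_simps)
  then show ?thesis
    unfolding e by simp
qed

section \<open>Spherical harmonics as functions on the sphere\<close>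

lemma (in pair_sigma_finite)
  fixes f :: "'a \<Rightarrow> 'c :: {real_normed_field, banach, second_countable_topology}" and g :: "'b \<Rightarrow> 'c"
  assumes f: "integrable M1 f" and g: "integrable M2 g"
  shows integrable_mult_pair: "integrable (M1 \<Otimes>\<^sub>M M2) (\<lambda>(x, y). f x * g y)"
    and integral_mult_pair: "(\<integral>p. (case p of (x, y) \<Rightarrow> f x * g y) \<partial>(M1 \<Otimes>\<^sub>M M2)) = (\<integral>x. f x \<partial>M1) * (\<integral>y. g y \<partial>M2)"
proof -
  note [measurable] = borel_measurable_integrable[OF f] borel_measurable_integrable[OF g]
  show *: "integrable (M1 \<Otimes>\<^sub>M M2) (\<lambda>(x, y). f x * g y)"
  proof (rule Fubini_integrable)
    have "(\<lambda>x. \<integral>y. norm (case (x, y) of (x, y) \<Rightarrow> f x * g y) \<partial>M2) = (\<lambda>x. norm (f x) * (\<integral>y. norm (g y) \<partial>M2))"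
      by (simp add: norm_mult)
    then show "integrable M1 (\<lambda>x. \<integral>y. norm (case (x, y) of (x, y) \<Rightarrow> f x * g y) \<partial>M2)"
      using f by simp
    show "AE x in M1. integrable M2 (\<lambda>y. case (x, y) of (x, y) \<Rightarrow> f x * g y)"
      using g by simp
  qed measurable
  show "(\<integral>p. (case p of (x, y) \<Rightarrow> f x * g y) \<partial>(M1 \<Otimes>\<^sub>M M2)) = (\<integral>x. f x \<partial>M1) * (\<integral>y. g y \<partial>M2)"
    using integral_fst'[OF *] by simp
qed

section \<open>Integration over the sphere in polar coordinates\<close>

abbreviation sph_box :: "(real \<times> real) set" where
  "sph_box \<equiv> {0..pi} \<times> {0..<2 * pi}"

lemma sph_point_nth [simp]:
  "sph_point (\<theta>, \<phi>) $ 1 = sin \<theta> * cos \<phi>" "sph_point (\<theta>, \<phi>) $ 2 = sin \<theta> * sin \<phi>" "sph_point (\<theta>, \<phi>) $ 3 = cos \<theta>"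
  by (simp_all add: sph_point_def)

lemma sph_point_in_S2: "sph_point p \<in> S2"
proof (cases p)
  case (Pair \<theta> \<phi>)
  have "(sin \<theta> * cos \<phi>)\<^sup>2 + (sin \<theta> * sin \<phi>)\<^sup>2 + (cos \<theta>)\<^sup>2 =
      (sin \<theta>)\<^sup>2 * ((cos \<phi>)\<^sup>2 + (sin \<phi>)\<^sup>2) + (cos \<theta>)\<^sup>2"
    by (simp only: power_mult_distrib algebra_simps)
  also have "\<dots> = 1"
    by (simp only: sin_cos_squared_add sin_cos_squared_add2 mult_1_right)
  finally have "sph_point p \<bullet> sph_point p = 1"
    by (simp add: Pair inner_vec_def sum_3 power2_eq_square)
  then show ?thesis
    by (simp add: norm_eq_sqrt_inner)
qed

lemma norm_sph_point [simp]: "norm (sph_point p) = 1"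
  using sph_point_in_S2 by simp

lemma S2_sum_squares: "x \<in> S2 \<Longrightarrow> (x $ 1)\<^sup>2 + (x $ 2)\<^sup>2 + (x $ 3)\<^sup>2 = 1"
  by (simp add: norm_eq_sqrt_inner inner_vec_def sum_3 power2_eq_square)

lemma continuous_on_sph_point: "continuous_on A sph_point"
proof -
  have "sph_point = (\<lambda>p. \<chi> i. if i = 1 then sin (fst p) * cos (snd p)
      else if i = 2 then sin (fst p) * sin (snd p) else cos (fst p))"
    by (auto simp: fun_eq_iff vec_eq_iff forall_3)
  note eq = this
  show ?thesis
    unfolding eq
  proof (rule continuous_on_vec_lambda)
    fix i :: 3
    show "continuous_on A (\<lambda>p. if i = 1 then sin (fst p) * cos (snd p)
      else if i = 2 then sin (fst p) * sin (snd p) else cos (fst p))"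
      by (cases "i = 1"; cases "i = 2"; simp) (intro continuous_intros)+
  qed
qed

lemma sph_box_sets: "sph_box \<in> sets borel"
  by (intro borel_Times) auto

lemma space_surf [simp]: "space surf = S2"
  by (simp add: surf_def space_restrict_space)

lemma sets_surf [measurable_cong]: "sets surf = sets (restrict_space borel S2)"
  by (simp add: surf_def)

lemma sph_point_measurable: "sph_point \<in> measurable (restrict_space lborel sph_box) (restrict_space borel S2)"
  by (intro measurable_restrict_space1 measurable_restrict_space2)
     (auto intro: borel_measurable_continuous_onI continuous_on_sph_point)

lemma borel_measurable_surf_continuous:
  assumes "continuous_on S2 f"
  shows "f \<in> borel_measurable surf"
  using borel_measurable_continuous_on_restrict[OF assms] by (simp cong: measurable_cong_sets add: sets_surf)

lemma sin_nonneg_sph_box: "AE p in restrict_space lborel sph_box. 0 \<le> sin (fst p)"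
  by (rule AE_I2) (auto simp: space_restrict_space intro: sin_ge_zero)

lemma surf_density_measurable: "(\<lambda>p. sin (fst p)) \<in> borel_measurable (restrict_space lborel sph_box)"
  by (intro measurable_restrict_space1) (auto intro!: borel_measurable_continuous_onI continuous_intros)

lemma surf_eq: "surf = distr (density (restrict_space lborel sph_box) (\<lambda>p. ennreal (sin (fst p))))
     (restrict_space borel S2) sph_point"
  unfolding surf_def by (simp add: split_beta')

lemma finite_measure_surf: "finite_measure surf"
proof
  have "emeasure surf (space surf) = (\<integral>\<^sup>+p. ennreal (sin (fst p)) \<partial>restrict_space lborel sph_box)"
  proof -
    have "emeasure surf (space surf) = emeasure (density (restrict_space lborel sph_box) (\<lambda>p. ennreal (sin (fst p)))) (space (restrict_space lborel sph_box))"
      unfolding space_surf unfolding surf_eq using sph_point_measurable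
      by (subst emeasure_distr) (auto intro!: arg_cong2[where f=emeasure] sets.top[of "restrict_space borel S2", unfolded space_restrict_space, simplified])
    also have "\<dots> = (\<integral>\<^sup>+p. ennreal (sin (fst p)) \<partial>restrict_space lborel sph_box)"
      using surf_density_measurable
      by (subst emeasure_density) (auto intro!: nn_integral_cong)
    finally show ?thesis .
  qed
  also have "\<dots> \<le> (\<integral>\<^sup>+p. 1 \<partial>restrict_space lborel sph_box)"
    by (intro nn_integral_mono) simp
  also have "\<dots> = emeasure lborel sph_box"
    using sph_box_sets by (simp add: emeasure_restrict_space space_restrict_space)
  also have "\<dots> < \<infinity>"
    by (rule emeasure_bounded_finite) (auto intro: bounded_Times)
  finally show "emeasure surf (space surf) \<noteq> \<infinity>" by simp
qed

interpretation surf: finite_measure surf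
  by (rule finite_measure_surf)

lemma integral_surf:
  fixes f :: "real^3 \<Rightarrow> complex"
  assumes f: "f \<in> borel_measurable surf"
  shows "(\<integral>x. f x \<partial>surf) = (\<integral>p. indicator sph_box p *\<^sub>R (sin (fst p) *\<^sub>R f (sph_point p)) \<partial>lborel)"
proof -
  have f': "f \<in> borel_measurable (restrict_space borel S2)"
    using f by (simp cong: measurable_cong_sets add: sets_surf)
  have "(\<integral>x. f x \<partial>surf) = (\<integral>p. f (sph_point p) \<partial>density (restrict_space lborel sph_box) (\<lambda>p. ennreal (sin (fst p))))"
    unfolding surf_eq using sph_point_measurable f' by (subst integral_distr) auto
  also have "\<dots> = (\<integral>p. sin (fst p) *\<^sub>R f (sph_point p) \<partial>restrict_space lborel sph_box)"
    using measurable_compose[OF sph_point_measurable f'] surf_density_measurable sin_nonneg_sph_box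
    by (subst integral_density) auto
  also have "\<dots> = (\<integral>p. indicator sph_box p *\<^sub>R (sin (fst p) *\<^sub>R f (sph_point p)) \<partial>lborel)"
    using sph_box_sets by (subst integral_restrict_space) auto
  finally show ?thesis .
qed

lemma integral_cis_period:
  "(\<integral>\<phi>. indicator {0..<2 * pi} \<phi> *\<^sub>R cis (of_int k * \<phi>) \<partial>lborel) = (if k = 0 then 2 * pi else 0)"
  "integrable lborel (\<lambda>\<phi>. indicator {0..<2 * pi} \<phi> *\<^sub>R cis (of_int k * \<phi>))"
proof -
  let ?f = "\<lambda>\<phi>. cis (of_int k * \<phi>)"
  have cont: "continuous_on {0..2 * pi} ?f"
    by (intro continuous_intros)
  have AE: "AE \<phi> in lborel. indicator {0..2 * pi} \<phi> *\<^sub>R ?f \<phi> = indicator {0..<2 * pi} \<phi> *\<^sub>R ?f \<phi>"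
    using AE_lborel_singleton[of "2 * pi"] by eventually_elim (auto simp: indicator_def)
  have int: "integrable lborel (\<lambda>\<phi>. indicator {0..2 * pi} \<phi> *\<^sub>R ?f \<phi>)"
    using borel_integrable_atLeastAtMost'[OF cont] by (simp add: set_integrable_def)
  have meas: "(\<lambda>\<phi>. indicator {0..<2 * pi} \<phi> *\<^sub>R ?f \<phi>) \<in> borel_measurable lborel"
  proof -
    have "?f \<in> borel_measurable borel"
      by (intro borel_measurable_continuous_onI continuous_intros)
    then show ?thesis by measurable
  qed
  show "integrable lborel (\<lambda>\<phi>. indicator {0..<2 * pi} \<phi> *\<^sub>R ?f \<phi>)"
    using int meas AE by (rule integrable_cong_AE_imp)
  have "(\<integral>\<phi>. indicator {0..<2 * pi} \<phi> *\<^sub>R ?f \<phi> \<partial>lborel) = (\<integral>\<phi>. indicator {0..2 * pi} \<phi> *\<^sub>R ?f \<phi> \<partial>lborel)"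
    using int meas AE by (intro integral_cong_AE) (auto elim: eventually_mono)
  also have "\<dots> = integral {0..2 * pi} ?f"
    using set_borel_integral_eq_integral(2)[OF borel_integrable_atLeastAtMost'[OF cont]]
    by (simp add: set_lebesgue_integral_def)
  also have "\<dots> = (if k = 0 then 2 * pi else 0)"
  proof (cases "k = 0")
    case True
    then show ?thesis by (simp add: of_real_def)
  next
    case False
    have "(?f has_integral (- \<i> / k * cis (of_int k * (2 * pi)) - (- \<i> / k * cis (of_int k * 0)))) {0..2 * pi}"
    proof (rule fundamental_theorem_of_calculus)
      fix \<phi> :: real
      show "((\<lambda>\<phi>. - \<i> / k * ?f \<phi>) has_vector_derivative ?f \<phi>) (at \<phi> within {0..2 * pi})"
      proof -
        have "((\<lambda>z. - \<i> / k * exp (\<i> * (k * z))) has_field_derivative exp (\<i> * (k * of_real \<phi>))) (at (of_real \<phi>))"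
          using False by (auto intro!: derivative_eq_intros)
        from has_vector_derivative_real_field[OF this] show ?thesis
          by (simp add: cis_conv_exp)
      qed
    qed simp
    moreover have "cis (of_int k * (2 * pi)) = 1"
      using cis_multiple_2pi[of "of_int k"] by (simp add: mult_ac)
    ultimately show ?thesis
      using False by (simp add: integral_unique)
  qed
  finally show "(\<integral>\<phi>. indicator {0..<2 * pi} \<phi> *\<^sub>R ?f \<phi> \<partial>lborel) = (if k = 0 then 2 * pi else 0)" .
qed

text \<open>The integral separates: the longitude contributes the integral of a character over a
  period, and the colatitude an integral of the kind evaluated by the ladder relations.\<close>

lemma integral_surf_polar:
  fixes f :: "real^3 \<Rightarrow> complex"
  assumes f: "f \<in> borel_measurable surf" and h: "continuous_on {0..pi} h"
    and eq: "\<And>\<theta> \<phi>. \<theta> \<in> {0..pi} \<Longrightarrow> \<phi> \<in> {0..<2 * pi} \<Longrightarrow> f (sph_point (\<theta>, \<phi>)) = cis (of_int k * \<phi>) * of_real (h \<theta>)"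
  shows "(\<integral>x. f x \<partial>surf) = (if k = 0 then of_real (2 * pi * integral {0..pi} (\<lambda>\<theta>. h \<theta> * sin \<theta>)) else 0)"
proof -
  let ?A = "\<lambda>\<theta>. complex_of_real (indicator {0..pi} \<theta> *\<^sub>R (h \<theta> * sin \<theta>))"
  let ?B = "\<lambda>\<phi>. indicator {0..<2 * pi} \<phi> *\<^sub>R cis (of_int k * \<phi>)"
  have set_int: "set_integrable lborel {0..pi} (\<lambda>\<theta>. h \<theta> * sin \<theta>)"
    by (intro borel_integrable_atLeastAtMost' continuous_intros h)
  have "(\<integral>x. f x \<partial>surf) = (\<integral>p. indicator sph_box p *\<^sub>R (sin (fst p) *\<^sub>R f (sph_point p)) \<partial>lborel)"
    by (rule integral_surf[OF f])
  also have "\<dots> = (\<integral>p. (case p of (\<theta>, \<phi>) \<Rightarrow> ?A \<theta> * ?B \<phi>) \<partial>(lborel \<Otimes>\<^sub>M lborel))"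
    unfolding lborel_prod
    by (intro Bochner_Integration.integral_cong refl)
       (auto simp: indicator_def eq scaleR_conv_of_real)
  also have "\<dots> = (\<integral>\<theta>. ?A \<theta> \<partial>lborel) * (\<integral>\<phi>. ?B \<phi> \<partial>lborel)"
    using set_int by (intro lborel_pair.integral_mult_pair integral_cis_period integrable_of_real)
      (simp add: set_integrable_def)
  also have "(\<integral>\<theta>. ?A \<theta> \<partial>lborel) = of_real (integral {0..pi} (\<lambda>\<theta>. h \<theta> * sin \<theta>))"
    using set_borel_integral_eq_integral(2)[OF set_int]
    unfolding integral_complex_of_real by (simp add: set_lebesgue_integral_def)
  finally show ?thesis
    unfolding integral_cis_period by simp
qed

section \<open>Spherical harmonics in polar and in Cartesian coordinates\<close>

lemma sph_harm_sph_point: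
  assumes "\<theta> \<in> {0..pi}" "\<phi> \<in> {0..<2 * pi}"
  shows "sph_harm l m (sph_point (\<theta>, \<phi>)) = cis (of_int m * \<phi>) * of_real (polar l m \<theta>)"
proof -
  have s: "sin \<theta> \<ge> 0"
    using assms by (auto intro: sin_ge_zero)
  have ac: "arccos (cos \<theta>) = \<theta>"
    using assms by (simp add: arccos_cos)
  show ?thesis
  proof (cases "sin \<theta> = 0")
    case False
    with s have "sin \<theta> > 0" by simp
    then have "Arg2pi (Complex (sin \<theta> * cos \<phi>) (sin \<theta> * sin \<phi>)) = \<phi>"
      using assms by (intro Arg2pi_unique[of "sin \<theta>"]) (auto simp: complex_eq_iff Re_exp Im_exp)
    then show ?thesis
      unfolding sph_harm_def using s by (simp add: ac sph_harm_angle_eq_polar)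
  next
    \<comment> \<open>At a pole \<open>Arg2pi\<close> may differ from the given longitude. Either
      \<open>m = 0\<close> and the exponential is 1, or the power of the sine makes both sides
      0.\<close>
    case True
    then have "Complex (sin \<theta> * cos \<phi>) (sin \<theta> * sin \<phi>) = 0"
      by (simp add: complex_eq_iff)
    moreover have "m = 0 \<or> polar l m \<theta> = 0"
      using True by (auto simp: polar_def)
    ultimately show ?thesis
      unfolding sph_harm_def using s by (auto simp: ac sph_harm_angle_eq_polar)
  qed
qed

lemma S2_polar_coordinates:
  assumes "x \<in> S2"
  obtains \<theta> \<phi> where "\<theta> \<in> {0..pi}" "\<phi> \<in> {0..<2 * pi}" "x = sph_point (\<theta>, \<phi>)"
proof -
  define z where "z = Complex (x $ 1) (x $ 2)"
  have sq: "(x $ 1)\<^sup>2 + (x $ 2)\<^sup>2 + (x $ 3)\<^sup>2 = 1"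
    using assms by (rule S2_sum_squares)
  then have "(x $ 3)\<^sup>2 \<le> 1"
    by (smt (verit) zero_le_power2)
  then have x3: "\<bar>x $ 3\<bar> \<le> 1"
    by (simp add: abs_square_le_1)
  have "sin (arccos (x $ 3)) = sqrt (1 - (x $ 3)\<^sup>2)"
    using x3 by (intro sin_arccos) auto
  also have "\<dots> = cmod z"
    using sq by (simp add: z_def complex_norm algebra_simps)
  finally have s: "sin (arccos (x $ 3)) = cmod z" .
  have "x = sph_point (arccos (x $ 3), Arg2pi z)"
    using x3 by (simp add: vec_eq_iff forall_3 s cos_Arg2pi sin_Arg2pi abs_le_iff) (simp add: z_def)
  moreover have "arccos (x $ 3) \<in> {0..pi}"
    using x3 by (auto intro: arccos_lbound arccos_ubound simp: abs_le_iff)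
  moreover have "Arg2pi z \<in> {0..<2 * pi}"
    using Arg2pi[of z] by simp
  ultimately show ?thesis
    using that by blast
qed

text \<open>On the sphere this is \<open>sin \<theta>\<close> times \<open>cis \<phi>\<close>.
  Multiplication by it, by its conjugate and by the third coordinate shifts the order by 1, - 1 and
  0, which is simpler than the action of the real coordinates.\<close>

definition xi :: "real^3 \<Rightarrow> complex" where
  "xi x = Complex (x $ 1) (x $ 2)"

lemma continuous_on_xi [continuous_intros]: "continuous_on A xi"
  unfolding xi_def Complex_eq by (intro continuous_intros)

lemma xi_sph_point: "xi (sph_point (\<theta>, \<phi>)) = of_real (sin \<theta>) * cis \<phi>"
  by (simp add: xi_def complex_eq_iff)

lemma continuous_on_rodrigues [continuous_intros]:
  "continuous_on A f \<Longrightarrow> continuous_on A (\<lambda>x. rodrigues l n (f x))"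
  unfolding rodrigues_def by (intro continuous_intros)

text \<open>A harmonic is a polynomial in \<open>xi\<close>, its conjugate and the third coordinate.
  This gives continuity on the whole sphere, including the poles and the meridian where
  \<open>Arg2pi\<close> jumps.\<close>

lemma sph_harm_cartesian:
  assumes "x \<in> S2"
  shows "sph_harm l m x = of_real ((if m \<ge> 0 then (- 1) ^ nat m else 1) * polar_norm l (nat \<bar>m\<bar>)) *
    (if m \<ge> 0 then xi x else cnj (xi x)) ^ nat \<bar>m\<bar> * of_real (rodrigues l (l + nat \<bar>m\<bar>) (x $ 3))"
proof -
  obtain \<theta> \<phi> where p: "\<theta> \<in> {0..pi}" "\<phi> \<in> {0..<2 * pi}" "x = sph_point (\<theta>, \<phi>)"
    using S2_polar_coordinates[OF assms] .
  have c: "cis (of_int m * \<phi>) = (if m \<ge> 0 then cis \<phi> else cnj (cis \<phi>)) ^ nat \<bar>m\<bar>"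
    using Complex.DeMoivre[of \<phi> "nat m"] Complex.DeMoivre[of "- \<phi>" "nat (- m)"]
    by (cases "m \<ge> 0") (auto simp: cis_cnj)
  show ?thesis
    unfolding p(3) sph_harm_sph_point[OF p(1,2)] xi_sph_point c polar_def
    by (simp add: power_mult_distrib)
qed

lemma continuous_on_sph_harm: "continuous_on S2 (sph_harm l m)"
proof (rule continuous_on_eq)
  show "continuous_on S2 (\<lambda>x. of_real ((if m \<ge> 0 then (- 1) ^ nat m else 1) * polar_norm l (nat \<bar>m\<bar>)) *
    (if m \<ge> 0 then xi x else cnj (xi x)) ^ nat \<bar>m\<bar> * of_real (rodrigues l (l + nat \<bar>m\<bar>) (x $ 3)))"
    by (cases "m \<ge> 0") (auto intro!: continuous_intros)
qed (use sph_harm_cartesian in auto)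

lemma borel_measurable_cnj [measurable (raw)]:
  "f \<in> borel_measurable M \<Longrightarrow> (\<lambda>x. cnj (f x)) \<in> borel_measurable M"
  by (rule measurable_compose[of f M borel cnj borel])
     (auto intro!: borel_measurable_continuous_onI continuous_intros)

lemma sph_harm_measurable [measurable]: "sph_harm l m \<in> borel_measurable surf"
  by (rule borel_measurable_surf_continuous[OF continuous_on_sph_harm])

lemma sph_harm_bounded: obtains B where "B > 0" "\<And>x. x \<in> S2 \<Longrightarrow> cmod (sph_harm l m x) \<le> B"
proof -
  have "compact (sph_harm l m ` S2)"
    by (intro compact_continuous_image continuous_on_sph_harm) simp
  then obtain B where "B > 0" "\<forall>y\<in>sph_harm l m ` S2. norm y \<le> B"
    using compact_imp_bounded bounded_pos by blast
  then show ?thesis using that by auto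
qed

lemma cnj_sph_harm:
  assumes "x \<in> S2"
  shows "cnj (sph_harm l m x) = (- 1) ^ nat \<bar>m\<bar> * sph_harm l (- m) x"
proof -
  obtain \<theta> \<phi> where p: "\<theta> \<in> {0..pi}" "\<phi> \<in> {0..<2 * pi}" "x = sph_point (\<theta>, \<phi>)"
    using S2_polar_coordinates[OF assms] .
  have "(- 1) ^ nat \<bar>m\<bar> * polar l (- m) \<theta> = polar l m \<theta>"
    unfolding polar_minus by (simp flip: mult.assoc power_mult_distrib)
  then have "complex_of_real (polar l m \<theta>) = (- 1) ^ nat \<bar>m\<bar> * of_real (polar l (- m) \<theta>)"
    by (metis of_real_1 of_real_minus of_real_mult of_real_power)
  then show ?thesis
    unfolding p(3) sph_harm_sph_point[OF p(1,2)] by (simp add: cis_cnj mult_ac)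
qed

lemma sph_harm_eq_0: "x \<in> S2 \<Longrightarrow> \<bar>m\<bar> > int l \<Longrightarrow> sph_harm l m x = 0"
  by (erule S2_polar_coordinates) (simp add: sph_harm_sph_point polar_eq_0)

theorem sph_harm_orthonormal:
  assumes "\<bar>m\<bar> \<le> int l" "\<bar>m'\<bar> \<le> int l'"
  shows "(\<integral>x. sph_harm l m x * cnj (sph_harm l' m' x) \<partial>surf) = (if l = l' \<and> m = m' then 1 else 0)"
proof -
  have "(\<integral>x. sph_harm l m x * cnj (sph_harm l' m' x) \<partial>surf) =
    (if m - m' = 0 then of_real (2 * pi * integral {0..pi} (\<lambda>\<theta>. polar l m \<theta> * polar l' m' \<theta> * sin \<theta>)) else 0)"
  proof (rule integral_surf_polar)
    fix \<theta> \<phi> :: real assume "\<theta> \<in> {0..pi}" "\<phi> \<in> {0..<2 * pi}"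
    moreover have "cis (of_int (m - m') * \<phi>) = cis (of_int m * \<phi>) * cis (- (of_int m' * \<phi>))"
      by (simp add: cis_mult algebra_simps)
    ultimately show "sph_harm l m (sph_point (\<theta>, \<phi>)) * cnj (sph_harm l' m' (sph_point (\<theta>, \<phi>))) =
        cis (of_int (m - m') * \<phi>) * of_real (polar l m \<theta> * polar l' m' \<theta>)"
      by (simp add: sph_harm_sph_point cis_cnj)
  qed (measurable, intro continuous_intros)
  also have "\<dots> = (if l = l' \<and> m = m' then 1 else 0)"
  proof (cases "m = m'")
    case True
    consider "l < l'" | "l' < l" | "l = l'" by linarith
    then show ?thesis
    proof cases
      case 1
      then show ?thesis using True integral_polar_mult_eq_0[OF 1, of m] by simp
    next
      case 2
      then show ?thesis using True integral_polar_mult_eq_0[OF 2, of m] by (simp add: mult.commute)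
    next
      case 3
      then show ?thesis using True integral_polar_sq[OF assms(1)] by simp
    qed
  qed simp
  finally show ?thesis .
qed

text \<open>If the orders do not add up to 0, the longitude integral and the selection rule both
  give 0; otherwise the colatitude integral is \<open>polar_gaunt_wigner3j\<close>.\<close>

theorem sph_harm_gaunt:
  "(\<integral>x. sph_harm l1 m1 x * sph_harm l2 m2 x * sph_harm l3 m3 x \<partial>surf) =
    of_real (sqrt (real ((2 * l1 + 1) * (2 * l2 + 1) * (2 * l3 + 1)) / (4 * pi)) *
    wigner3j l1 l2 l3 0 0 0 * wigner3j l1 l2 l3 m1 m2 m3)"
proof -
  have "(\<integral>x. sph_harm l1 m1 x * sph_harm l2 m2 x * sph_harm l3 m3 x \<partial>surf) =
    (if m1 + m2 + m3 = 0 then of_real (2 * pi * integral {0..pi} (\<lambda>\<theta>. polar l1 m1 \<theta> * polar l2 m2 \<theta> * polar l3 m3 \<theta> * sin \<theta>)) else 0)"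
    by (rule integral_surf_polar)
       (auto simp: sph_harm_sph_point cis_mult[symmetric] distrib_right intro!: continuous_intros)
  also have "\<dots> = of_real (sqrt (real ((2 * l1 + 1) * (2 * l2 + 1) * (2 * l3 + 1)) / (4 * pi)) *
    wigner3j l1 l2 l3 0 0 0 * wigner3j l1 l2 l3 m1 m2 m3)"
    using polar_gaunt_wigner3j[of m1 m2 m3 l1 l2 l3]
    by (cases "m1 + m2 + m3 = 0") (simp_all only: polar_gaunt_def[symmetric] if_True if_False simp_thms, simp add: wigner3j_eq_0)
  finally show ?thesis .
qed

lemma sph_harm_mult_x3:
  assumes "x \<in> S2"
  shows "of_real (x $ 3) * sph_harm l m x =
    of_real (cos_up l m) * sph_harm (Suc l) m x + of_real (cos_down l m) * sph_harm (l - 1) m x"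
proof -
  obtain \<theta> \<phi> where p: "\<theta> \<in> {0..pi}" "\<phi> \<in> {0..<2 * pi}" "x = sph_point (\<theta>, \<phi>)"
    using S2_polar_coordinates[OF assms] .
  have "cis (of_int m * \<phi>) * of_real (cos \<theta> * polar l m \<theta>) = cis (of_int m * \<phi>) *
      of_real (cos_up l m * polar (Suc l) m \<theta> + cos_down l m * polar (l - 1) m \<theta>)"
    unfolding cos_mult_polar[of \<theta> l m] ..
  then show ?thesis
    unfolding p(3) sph_harm_sph_point[OF p(1,2)] sph_point_nth by (simp add: algebra_simps)
qed

lemma sph_harm_mult_xi:
  assumes "x \<in> S2"
  shows "xi x * sph_harm l m x =
    - of_real (sin_up l m) * sph_harm (Suc l) (m + 1) x + of_real (sin_down l m) * sph_harm (l - 1) (m + 1) x"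
proof -
  obtain \<theta> \<phi> where p: "\<theta> \<in> {0..pi}" "\<phi> \<in> {0..<2 * pi}" "x = sph_point (\<theta>, \<phi>)"
    using S2_polar_coordinates[OF assms] .
  have c: "cis (of_int (m + 1) * \<phi>) = cis \<phi> * cis (of_int m * \<phi>)"
    by (simp add: cis_mult algebra_simps)
  have "cis (of_int (m + 1) * \<phi>) * of_real (sin \<theta> * polar l m \<theta>) = cis (of_int (m + 1) * \<phi>) *
      of_real (- sin_up l m * polar (Suc l) (m + 1) \<theta> + sin_down l m * polar (l - 1) (m + 1) \<theta>)"
    unfolding sin_mult_polar_raise[OF p(1), of l m] ..
  then show ?thesis
    unfolding p(3) sph_harm_sph_point[OF p(1,2)] xi_sph_point c by (simp add: algebra_simps)
qed

lemma sph_harm_mult_cnj_xi: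
  assumes "x \<in> S2"
  shows "cnj (xi x) * sph_harm l m x =
    of_real (sin_up l (- m)) * sph_harm (Suc l) (m - 1) x - of_real (sin_down l (- m)) * sph_harm (l - 1) (m - 1) x"
proof -
  obtain \<theta> \<phi> where p: "\<theta> \<in> {0..pi}" "\<phi> \<in> {0..<2 * pi}" "x = sph_point (\<theta>, \<phi>)"
    using S2_polar_coordinates[OF assms] .
  have c: "cis (of_int (m - 1) * \<phi>) = cis (- \<phi>) * cis (of_int m * \<phi>)"
    by (simp add: cis_mult algebra_simps)
  have "cis (of_int (m - 1) * \<phi>) * of_real (sin \<theta> * polar l m \<theta>) = cis (of_int (m - 1) * \<phi>) *
      of_real (sin_up l (- m) * polar (Suc l) (m - 1) \<theta> - sin_down l (- m) * polar (l - 1) (m - 1) \<theta>)"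
    unfolding sin_mult_polar_lower[OF p(1), of l m] ..
  then show ?thesis
    unfolding p(3) sph_harm_sph_point[OF p(1,2)] xi_sph_point c by (simp add: cis_cnj algebra_simps)
qed

section \<open>Completeness of the spherical harmonics\<close>

definition L2_sq :: "'a measure \<Rightarrow> ('a \<Rightarrow> complex) \<Rightarrow> real" where
  "L2_sq N f = (\<integral>x. (cmod (f x))\<^sup>2 \<partial>N)"

lemma L2_sq_nonneg [simp]: "L2_sq N f \<ge> 0"
  by (simp add: L2_sq_def)

lemma square_integrable_measurable: "square_integrable N f \<Longrightarrow> f \<in> borel_measurable N"
  by (simp add: square_integrable_def)

lemma square_integrable_integrable:
  "square_integrable N f \<Longrightarrow> integrable N (\<lambda>x. (norm (f x))\<^sup>2)"
  by (simp add: square_integrable_def)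

lemma square_integrable_cmult:
  fixes f :: "'a \<Rightarrow> complex"
  shows "square_integrable N f \<Longrightarrow> square_integrable N (\<lambda>x. c * f x)"
  by (auto simp: square_integrable_def norm_mult power_mult_distrib)

lemma square_integrable_cnj:
  "square_integrable N f \<Longrightarrow> square_integrable N (\<lambda>x. cnj (f x))"
  by (auto simp: square_integrable_def)

lemma square_integrable_of_real:
  "square_integrable N f \<Longrightarrow> square_integrable N (\<lambda>x. complex_of_real (f x))"
  by (auto simp: square_integrable_def)

lemma norm_add_sq_le: "(norm (a + b :: complex))\<^sup>2 \<le> 2 * (norm a)\<^sup>2 + 2 * (norm b)\<^sup>2"
proof -
  have "(norm (a + b))\<^sup>2 \<le> (norm a + norm b)\<^sup>2"
    by (intro power_mono norm_triangle_ineq) simp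
  also have "\<dots> \<le> 2 * (norm a)\<^sup>2 + 2 * (norm b)\<^sup>2"
    using sum_squares_bound[of "norm a" "norm b"] by (simp add: power2_sum)
  finally show ?thesis .
qed

lemma square_integrable_add:
  fixes f g :: "'a \<Rightarrow> complex"
  assumes "square_integrable N f" "square_integrable N g"
  shows "square_integrable N (\<lambda>x. f x + g x)"
  unfolding square_integrable_def
proof
  note [measurable] = assms[THEN square_integrable_measurable]
  show "(\<lambda>x. f x + g x) \<in> borel_measurable N" by measurable
  show "integrable N (\<lambda>x. (norm (f x + g x))\<^sup>2)"
  proof (rule Bochner_Integration.integrable_bound)
    show "integrable N (\<lambda>x. 2 * (norm (f x))\<^sup>2 + 2 * (norm (g x))\<^sup>2)"
      using assms by (auto dest!: square_integrable_integrable)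
    show "AE x in N. norm ((norm (f x + g x))\<^sup>2) \<le> norm (2 * (norm (f x))\<^sup>2 + 2 * (norm (g x))\<^sup>2)"
      using norm_add_sq_le by (intro AE_I2) auto
  qed measurable
qed

lemma square_integrable_diff:
  fixes f g :: "'a \<Rightarrow> complex"
  assumes "square_integrable N f" "square_integrable N g"
  shows "square_integrable N (\<lambda>x. f x - g x)"
  using square_integrable_add[OF assms(1) square_integrable_cmult[OF assms(2), of "- 1"]] by simp

lemma square_integrable_zero [simp]: "square_integrable N (\<lambda>_. 0 :: complex)"
  by (simp add: square_integrable_def)

lemma square_integrable_sum:
  fixes f :: "'i \<Rightarrow> 'a \<Rightarrow> complex"
  assumes "\<And>i. i \<in> I \<Longrightarrow> square_integrable N (f i)"
  shows "square_integrable N (\<lambda>x. \<Sum>i\<in>I. f i x)"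
  using assms by (induction I rule: infinite_finite_induct) (auto intro: square_integrable_add)

lemma square_integrable_cong:
  assumes "\<And>x. x \<in> space N \<Longrightarrow> f x = g x"
  shows "square_integrable N f \<longleftrightarrow> square_integrable N g"
  unfolding square_integrable_def using assms
  by (auto cong: measurable_cong Bochner_Integration.integrable_cong)

lemma L2_sq_cong: "(\<And>x. x \<in> space N \<Longrightarrow> f x = g x) \<Longrightarrow> L2_sq N f = L2_sq N g"
  unfolding L2_sq_def by (intro Bochner_Integration.integral_cong) auto

lemma L2_sq_add_le:
  assumes "square_integrable N f" "square_integrable N g"
  shows "L2_sq N (\<lambda>x. f x + g x) \<le> 2 * L2_sq N f + 2 * L2_sq N g"
proof -
  have "L2_sq N (\<lambda>x. f x + g x) \<le> (\<integral>x. 2 * (norm (f x))\<^sup>2 + 2 * (norm (g x))\<^sup>2 \<partial>N)"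
    unfolding L2_sq_def
    using square_integrable_add[OF assms] assms norm_add_sq_le
    by (intro integral_mono) (auto dest!: square_integrable_integrable)
  also have "\<dots> = 2 * L2_sq N f + 2 * L2_sq N g"
    unfolding L2_sq_def using assms by (simp add: square_integrable_integrable)
  finally show ?thesis .
qed

lemma L2_sq_cmult: "L2_sq N (\<lambda>x. c * f x) = (cmod c)\<^sup>2 * L2_sq N f"
  by (simp add: L2_sq_def norm_mult power_mult_distrib)

lemma L2_sq_minus_commute: "L2_sq N (\<lambda>x. f x - g x) = L2_sq N (\<lambda>x. g x - f x)"
  by (simp add: L2_sq_def norm_minus_commute)

lemma integrable_mult_square_integrable:
  fixes f g :: "'a \<Rightarrow> complex"
  assumes "square_integrable N f" "square_integrable N g"
  shows "integrable N (\<lambda>x. f x * g x)"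
proof (rule Bochner_Integration.integrable_bound)
  note [measurable] = assms[THEN square_integrable_measurable]
  show "integrable N (\<lambda>x. (norm (f x))\<^sup>2 + (norm (g x))\<^sup>2)"
    using assms by (auto dest!: square_integrable_integrable)
  have "norm (f x) * norm (g x) \<le> (norm (f x))\<^sup>2 + (norm (g x))\<^sup>2" for x
    using sum_squares_bound[of "norm (f x)" "norm (g x)"] mult_nonneg_nonneg[OF norm_ge_zero[of "f x"] norm_ge_zero[of "g x"]]
    by linarith
  then show "AE x in N. norm (f x * g x) \<le> norm ((norm (f x))\<^sup>2 + (norm (g x))\<^sup>2)"
    by (auto simp: norm_mult)
  show "(\<lambda>x. f x * g x) \<in> borel_measurable N" by measurable
qed

lemma Cauchy_Schwarz_L2:
  fixes f g :: "'a \<Rightarrow> complex"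
  assumes f: "square_integrable N f" and g: "square_integrable N g"
  shows "(cmod (\<integral>x. f x * g x \<partial>N))\<^sup>2 \<le> L2_sq N f * L2_sq N g"
proof -
  note [measurable] = f[THEN square_integrable_measurable] g[THEN square_integrable_measurable]
  have int: "integrable N (\<lambda>x. norm (f x) * norm (g x))"
    using integrable_norm[OF integrable_mult_square_integrable[OF f g]] by (simp add: norm_mult)
  have nn: "(\<integral>\<^sup>+x. (ennreal (norm (h x)))\<^sup>2 \<partial>N) = ennreal (L2_sq N h)" if "square_integrable N h" for h
    unfolding L2_sq_def using nn_integral_eq_integral[OF square_integrable_integrable[OF that]]
    by (simp add: ennreal_power)
  have "cmod (\<integral>x. f x * g x \<partial>N) \<le> (\<integral>x. norm (f x) * norm (g x) \<partial>N)"
    using integral_norm_bound[of N "\<lambda>x. f x * g x"] by (simp add: norm_mult)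
  then have "(cmod (\<integral>x. f x * g x \<partial>N))\<^sup>2 \<le> (\<integral>x. norm (f x) * norm (g x) \<partial>N)\<^sup>2"
    by (intro power_mono) auto
  also have "ennreal ((\<integral>x. norm (f x) * norm (g x) \<partial>N)\<^sup>2) =
      (\<integral>\<^sup>+x. ennreal (norm (f x)) * ennreal (norm (g x)) \<partial>N)\<^sup>2"
    using nn_integral_eq_integral[OF int] by (simp add: ennreal_power ennreal_mult)
  then have "ennreal ((\<integral>x. norm (f x) * norm (g x) \<partial>N)\<^sup>2) \<le> ennreal (L2_sq N f * L2_sq N g)"
    using Cauchy_Schwarz_nn_integral[of "\<lambda>x. ennreal (norm (f x))" N "\<lambda>x. ennreal (norm (g x))"]
    unfolding nn[OF f] nn[OF g] by (simp add: ennreal_mult)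
  then have "(\<integral>x. norm (f x) * norm (g x) \<partial>N)\<^sup>2 \<le> L2_sq N f * L2_sq N g"
    by simp
  finally show ?thesis .
qed

lemma square_integrable_mult_bounded:
  fixes f g :: "'a \<Rightarrow> complex"
  assumes f: "square_integrable N f" and g: "g \<in> borel_measurable N" "\<And>x. x \<in> space N \<Longrightarrow> norm (g x) \<le> B"
  shows "square_integrable N (\<lambda>x. f x * g x)" "L2_sq N (\<lambda>x. f x * g x) \<le> B\<^sup>2 * L2_sq N f"
proof -
  note [measurable] = f[THEN square_integrable_measurable] g(1)
  have le: "(norm (f x * g x))\<^sup>2 \<le> B\<^sup>2 * (norm (f x))\<^sup>2" if "x \<in> space N" for x
  proof -
    have "(norm (g x))\<^sup>2 \<le> B\<^sup>2"
      using g(2)[OF that] by (intro power_mono) auto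
    then show ?thesis
      by (simp add: norm_mult power_mult_distrib mult.commute[of "(norm (f x))\<^sup>2"] mult_right_mono)
  qed
  have int: "integrable N (\<lambda>x. B\<^sup>2 * (norm (f x))\<^sup>2)"
    using f by (auto dest!: square_integrable_integrable)
  show *: "square_integrable N (\<lambda>x. f x * g x)"
    unfolding square_integrable_def
  proof
    show "integrable N (\<lambda>x. (norm (f x * g x))\<^sup>2)"
      by (rule Bochner_Integration.integrable_bound[OF int]) (auto simp: le)
  qed measurable
  have "L2_sq N (\<lambda>x. f x * g x) \<le> (\<integral>x. B\<^sup>2 * (norm (f x))\<^sup>2 \<partial>N)"
    unfolding L2_sq_def using square_integrable_integrable[OF *] int le by (intro integral_mono) auto
  then show "L2_sq N (\<lambda>x. f x * g x) \<le> B\<^sup>2 * L2_sq N f"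
    by (simp add: L2_sq_def)
qed

lemma (in finite_measure) square_integrable_bounded:
  fixes g :: "'a \<Rightarrow> complex"
  assumes "g \<in> borel_measurable M" "\<And>x. x \<in> space M \<Longrightarrow> norm (g x) \<le> B"
  shows "square_integrable M g"
proof -
  have "square_integrable M (\<lambda>_. 1 :: complex)"
    by (simp add: square_integrable_def)
  from square_integrable_mult_bounded(1)[OF this assms] show ?thesis
    by simp
qed

lemma (in finite_measure) integrable_if_square_integrable:
  fixes f :: "'a \<Rightarrow> complex"
  assumes "square_integrable M f"
  shows "integrable M f"
  using integrable_mult_square_integrable[OF assms square_integrable_bounded[of "\<lambda>_. 1" 1]] by simp

text \<open>By Cauchy-Schwarz, integration against a fixed square-integrable function is continuous
  in mean square.\<close>

lemma L2_tendsto_integral_mult: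
  assumes "L2_tendsto N s f F" "square_integrable N g"
  shows "((\<lambda>i. \<integral>x. s i x * g x \<partial>N) \<longlongrightarrow> (\<integral>x. f x * g x \<partial>N)) F"
proof -
  have s: "square_integrable N (s i)" for i
    using assms by (simp add: L2_tendsto_def)
  have f: "square_integrable N f"
    using assms by (simp add: L2_tendsto_def)
  have lim: "((\<lambda>i. L2_sq N (\<lambda>x. s i x - f x)) \<longlongrightarrow> 0) F"
    using assms by (simp add: L2_tendsto_def L2_sq_def)
  have "((\<lambda>i. (\<integral>x. s i x * g x \<partial>N) - (\<integral>x. f x * g x \<partial>N)) \<longlongrightarrow> 0) F"
  proof (rule Lim_null_comparison)
    show "((\<lambda>i. sqrt (L2_sq N (\<lambda>x. s i x - f x) * L2_sq N g)) \<longlongrightarrow> 0) F"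
      using tendsto_real_sqrt[OF tendsto_mult_left_zero[OF lim]] by simp
    show "\<forall>\<^sub>F i in F. norm ((\<integral>x. s i x * g x \<partial>N) - (\<integral>x. f x * g x \<partial>N)) \<le> sqrt (L2_sq N (\<lambda>x. s i x - f x) * L2_sq N g)"
    proof (rule always_eventually, rule allI)
      fix i
      have "(\<integral>x. s i x * g x \<partial>N) - (\<integral>x. f x * g x \<partial>N) = (\<integral>x. (s i x - f x) * g x \<partial>N)"
        using integrable_mult_square_integrable[OF s[of i] assms(2)] integrable_mult_square_integrable[OF f assms(2)]
        by (simp add: left_diff_distrib)
      then show "norm ((\<integral>x. s i x * g x \<partial>N) - (\<integral>x. f x * g x \<partial>N)) \<le> sqrt (L2_sq N (\<lambda>x. s i x - f x) * L2_sq N g)"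
        using Cauchy_Schwarz_L2[OF square_integrable_diff[OF s[of i] f] assms(2)]
        by (simp add: real_le_rsqrt)
    qed
  qed
  then show ?thesis
    by (simp add: Lim_null[symmetric])
qed

lemma L2_sq_complex: "complex_of_real (L2_sq N f) = (\<integral>x. f x * cnj (f x) \<partial>N)"
  unfolding L2_sq_def complex_norm_square[symmetric] of_real_power[symmetric] integral_complex_of_real ..

text \<open>The difference between the squared distances of an arbitrary combination and of the
  Fourier sum is the squared distance of the coefficients.\<close>

lemma L2_sq_diff_orthonormal_sum:
  fixes e :: "'i \<Rightarrow> 'a \<Rightarrow> complex"
  assumes I: "finite I" and e: "\<And>i. i \<in> I \<Longrightarrow> square_integrable N (e i)"
    and orth: "\<And>i j. i \<in> I \<Longrightarrow> j \<in> I \<Longrightarrow> (\<integral>x. e i x * cnj (e j x) \<partial>N) = (if i = j then 1 else 0)"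
    and f: "square_integrable N f"
  defines "c \<equiv> \<lambda>i. \<integral>x. f x * cnj (e i x) \<partial>N"
  shows "L2_sq N (\<lambda>x. f x - (\<Sum>i\<in>I. d i * e i x)) =
    L2_sq N f - (\<Sum>i\<in>I. (cmod (c i))\<^sup>2) + (\<Sum>i\<in>I. (cmod (c i - d i))\<^sup>2)"
proof -
  let ?g = "\<lambda>x. \<Sum>i\<in>I. d i * e i x"
  have g: "square_integrable N ?g"
    by (intro square_integrable_sum square_integrable_cmult e)
  have int: "integrable N (\<lambda>x. u x * cnj (v x))" if "square_integrable N u" "square_integrable N v" for u v
    using that by (intro integrable_mult_square_integrable square_integrable_cnj)
  have fg: "(\<integral>x. f x * cnj (?g x) \<partial>N) = (\<Sum>i\<in>I. cnj (d i) * c i)"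
  proof -
    have "(\<integral>x. f x * cnj (?g x) \<partial>N) = (\<integral>x. (\<Sum>i\<in>I. cnj (d i) * (f x * cnj (e i x))) \<partial>N)"
      by (simp add: sum_distrib_left mult_ac)
    then show ?thesis
      using int[OF f e] by (simp add: c_def)
  qed
  have cnj_int: "(\<integral>x. u x * cnj (v x) \<partial>N) = cnj (\<integral>x. v x * cnj (u x) \<partial>N)" for u v
    by (subst Bochner_Integration.integral_cnj[symmetric]) (simp only: complex_cnj_mult complex_cnj_cnj mult.commute)
  have gf: "(\<integral>x. ?g x * cnj (f x) \<partial>N) = (\<Sum>i\<in>I. d i * cnj (c i))"
    unfolding cnj_int[of ?g f] fg by (simp only: cnj_sum complex_cnj_mult complex_cnj_cnj)
  have ge: "(\<integral>x. ?g x * cnj (e j x) \<partial>N) = d j" if "j \<in> I" for j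
  proof -
    have "(\<integral>x. ?g x * cnj (e j x) \<partial>N) = (\<integral>x. (\<Sum>i\<in>I. d i * (e i x * cnj (e j x))) \<partial>N)"
      by (simp add: sum_distrib_right mult.assoc)
    also have "\<dots> = (\<Sum>i\<in>I. d i * (if i = j then 1 else 0))"
      using int[OF e e[OF that]] orth[OF _ that] by simp
    also have "\<dots> = (\<Sum>i\<in>I. if i = j then d j else 0)"
      by (intro sum.cong) auto
    also have "\<dots> = d j"
      using I that by (simp add: sum.delta)
    finally show ?thesis .
  qed
  have gg: "(\<integral>x. ?g x * cnj (?g x) \<partial>N) = (\<Sum>i\<in>I. d i * cnj (d i))"
  proof -
    have "(\<integral>x. ?g x * cnj (?g x) \<partial>N) = (\<integral>x. (\<Sum>i\<in>I. cnj (d i) * (?g x * cnj (e i x))) \<partial>N)"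
      by (simp only: cnj_sum complex_cnj_mult sum_distrib_left mult.left_commute)
    also have "\<dots> = (\<Sum>i\<in>I. cnj (d i) * d i)"
      using int[OF g e] ge by simp
    finally show ?thesis by (simp add: mult.commute)
  qed
  have pt: "complex_of_real ((cmod (c i - d i))\<^sup>2) =
      of_real ((cmod (c i))\<^sup>2) - cnj (d i) * c i - d i * cnj (c i) + d i * cnj (d i)" for i
    unfolding complex_norm_square complex_cnj_diff by (simp only: algebra_simps)
  have "complex_of_real (L2_sq N (\<lambda>x. f x - ?g x)) =
      (\<integral>x. f x * cnj (f x) - f x * cnj (?g x) - ?g x * cnj (f x) + ?g x * cnj (?g x) \<partial>N)"
    unfolding L2_sq_complex by (simp add: algebra_simps)
  also have "\<dots> = of_real (L2_sq N f) - (\<Sum>i\<in>I. cnj (d i) * c i) - (\<Sum>i\<in>I. d i * cnj (c i)) + (\<Sum>i\<in>I. d i * cnj (d i))"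
    using int[OF f f] int[OF f g] int[OF g f] int[OF g g]
    by (simp add: L2_sq_complex fg gf gg del: cnj_sum)
  also have "\<dots> = of_real (L2_sq N f - (\<Sum>i\<in>I. (cmod (c i))\<^sup>2) + (\<Sum>i\<in>I. (cmod (c i - d i))\<^sup>2))"
    unfolding of_real_add of_real_diff of_real_sum pt
    by (simp only: sum.distrib sum_subtractf) simp
  finally show ?thesis
    unfolding of_real_eq_iff .
qed

section \<open>The span of the spherical harmonics\<close>

definition sph_index :: "nat \<Rightarrow> (nat \<times> int) set" where
  "sph_index L = (SIGMA l:{..L}. {- int l..int l})"

lemma finite_sph_index [simp]: "finite (sph_index L)"
  by (auto simp: sph_index_def)

lemma sum_sph_index: "(\<Sum>l\<le>L. \<Sum>m = - int l..int l. f l m) = (\<Sum>(l, m)\<in>sph_index L. f l m)"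
  unfolding sph_index_def by (rule sum.Sigma) auto

lemma sph_index_mono: "L \<le> L' \<Longrightarrow> sph_index L \<subseteq> sph_index L'"
  by (auto simp: sph_index_def)

lemma square_integrable_sph_harm: "square_integrable surf (sph_harm l m)"
proof -
  obtain B where "\<And>x. x \<in> S2 \<Longrightarrow> cmod (sph_harm l m x) \<le> B"
    using sph_harm_bounded by blast
  then show ?thesis
    by (intro surf.square_integrable_bounded) auto
qed

definition sph_poly :: "(real^3 \<Rightarrow> complex) \<Rightarrow> bool" where
  "sph_poly f \<longleftrightarrow> (\<exists>L c. \<forall>x\<in>S2. f x = (\<Sum>(l, m)\<in>sph_index L. c l m * sph_harm l m x))"

text \<open>Padding with zeros makes one family of coefficients serve all larger degrees. Two
  functions can then be written over a common degree, and all later partial sums can be compared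
  with the same approximant.\<close>

lemma sph_poly_eventually:
  assumes "sph_poly f"
  shows "\<exists>L c. \<forall>L'\<ge>L. \<forall>x\<in>S2. f x = (\<Sum>(l, m)\<in>sph_index L'. c l m * sph_harm l m x)"
proof -
  obtain L c where c: "\<And>x. x \<in> S2 \<Longrightarrow> f x = (\<Sum>(l, m)\<in>sph_index L. c l m * sph_harm l m x)"
    using assms unfolding sph_poly_def by blast
  define c' where "c' l m = (if (l, m) \<in> sph_index L then c l m else 0)" for l m
  show ?thesis
  proof (rule exI[of _ L], rule exI[of _ c'], intro allI impI ballI)
    fix L' x assume "L \<le> L'" "x \<in> S2"
    have "(\<Sum>(l, m)\<in>sph_index L. c l m * sph_harm l m x) = (\<Sum>(l, m)\<in>sph_index L'. c' l m * sph_harm l m x)"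
      using sph_index_mono[OF \<open>L \<le> L'\<close>] by (intro sum.mono_neutral_cong_left) (auto simp: c'_def)
    then show "f x = (\<Sum>(l, m)\<in>sph_index L'. c' l m * sph_harm l m x)"
      using c[OF \<open>x \<in> S2\<close>] by simp
  qed
qed

lemma sph_poly_cong: "(\<And>x. x \<in> S2 \<Longrightarrow> f x = g x) \<Longrightarrow> sph_poly f \<longleftrightarrow> sph_poly g"
  by (simp add: sph_poly_def)

lemma sph_poly_zero: "sph_poly (\<lambda>_. 0)"
  unfolding sph_poly_def by (intro exI[of _ 0] exI[of _ "\<lambda>_ _. 0"]) simp

lemma sph_poly_add:
  assumes "sph_poly f" "sph_poly g"
  shows "sph_poly (\<lambda>x. f x + g x)"
proof -
  obtain L c where f: "\<forall>L'\<ge>L. \<forall>x\<in>S2. f x = (\<Sum>(l, m)\<in>sph_index L'. c l m * sph_harm l m x)"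
    using sph_poly_eventually[OF assms(1)] by blast
  obtain K d where g: "\<forall>L'\<ge>K. \<forall>x\<in>S2. g x = (\<Sum>(l, m)\<in>sph_index L'. d l m * sph_harm l m x)"
    using sph_poly_eventually[OF assms(2)] by blast
  have "f x + g x = (\<Sum>(l, m)\<in>sph_index (max L K). (c l m + d l m) * sph_harm l m x)" if "x \<in> S2" for x
    using f[rule_format, of "max L K" x] g[rule_format, of "max L K" x] that
    by (simp add: sum.distrib[symmetric] distrib_right split_beta')
  then show ?thesis
    unfolding sph_poly_def
    by (intro exI[of _ "max L K"] exI[of _ "\<lambda>l m. c l m + d l m"] ballI)
qed

lemma sph_poly_cmult:
  assumes "sph_poly f"
  shows "sph_poly (\<lambda>x. a * f x)"
proof -
  obtain L c where f: "\<And>x. x \<in> S2 \<Longrightarrow> f x = (\<Sum>(l, m)\<in>sph_index L. c l m * sph_harm l m x)"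
    using assms unfolding sph_poly_def by blast
  show ?thesis
    unfolding sph_poly_def
    by (rule exI[of _ L], rule exI[of _ "\<lambda>l m. a * c l m"])
       (simp add: f sum_distrib_left split_beta' mult.assoc)
qed

lemma sph_poly_sum: "(\<And>i. i \<in> I \<Longrightarrow> sph_poly (f i)) \<Longrightarrow> sph_poly (\<lambda>x. \<Sum>i\<in>I. f i x)"
  by (induction I rule: infinite_finite_induct) (auto intro: sph_poly_zero sph_poly_add)

lemma sph_poly_sph_harm: "sph_poly (sph_harm l m)"
proof (cases "\<bar>m\<bar> \<le> int l")
  case True
  have "sph_harm l m x = (\<Sum>(l', m')\<in>sph_index l. (if (l', m') = (l, m) then 1 else 0) * sph_harm l' m' x)" for x
  proof -
    have "(\<Sum>(l', m')\<in>sph_index l. (if (l', m') = (l, m) then 1 else 0) * sph_harm l' m' x) =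
        (\<Sum>p\<in>sph_index l. if p = (l, m) then sph_harm l m x else 0)"
      by (intro sum.cong) (auto split: if_splits)
    also have "\<dots> = sph_harm l m x"
      using True by (auto simp: sum.delta sph_index_def)
    finally show ?thesis by simp
  qed
  then show ?thesis
    unfolding sph_poly_def
    by (intro exI[of _ l] exI[of _ "\<lambda>l' m'. if (l', m') = (l, m) then 1 else 0"] ballI)
next
  case False
  then show ?thesis
    using sph_poly_cong[of "sph_harm l m" "\<lambda>_. 0"] sph_harm_eq_0 sph_poly_zero by simp
qed

lemma sph_poly_multI:
  assumes "sph_poly f" "\<And>l m. sph_poly (\<lambda>x. g x * sph_harm l m x)"
  shows "sph_poly (\<lambda>x. g x * f x)"
proof -
  obtain L c where f: "\<And>x. x \<in> S2 \<Longrightarrow> f x = (\<Sum>(l, m)\<in>sph_index L. c l m * sph_harm l m x)"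
    using assms(1) unfolding sph_poly_def by blast
  have "sph_poly (\<lambda>x. \<Sum>(l, m)\<in>sph_index L. c l m * (g x * sph_harm l m x))"
    unfolding split_beta' by (intro sph_poly_sum sph_poly_cmult assms(2))
  moreover have "g x * f x = (\<Sum>(l, m)\<in>sph_index L. c l m * (g x * sph_harm l m x))" if "x \<in> S2" for x
    using f[OF that] by (simp add: sum_distrib_left split_beta' mult_ac)
  ultimately show ?thesis
    using sph_poly_cong[of "\<lambda>x. g x * f x"] by simp
qed

lemma sph_poly_mult_x3: "sph_poly f \<Longrightarrow> sph_poly (\<lambda>x. of_real (x $ 3) * f x)"
proof (erule sph_poly_multI)
  fix l m
  show "sph_poly (\<lambda>x. of_real (x $ 3) * sph_harm l m x)"
    using sph_poly_cong[OF sph_harm_mult_x3[of _ l m]]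
    by (simp add: sph_poly_add sph_poly_cmult sph_poly_sph_harm)
qed

lemma sph_poly_mult_xi: "sph_poly f \<Longrightarrow> sph_poly (\<lambda>x. xi x * f x)"
proof (erule sph_poly_multI)
  fix l m
  have "sph_poly (\<lambda>x. (- of_real (sin_up l m)) * sph_harm (Suc l) (m + 1) x + of_real (sin_down l m) * sph_harm (l - 1) (m + 1) x)"
    by (intro sph_poly_add sph_poly_cmult sph_poly_sph_harm)
  then show "sph_poly (\<lambda>x. xi x * sph_harm l m x)"
    using sph_poly_cong[OF sph_harm_mult_xi[of _ l m]] by simp
qed

lemma sph_poly_mult_cnj_xi: "sph_poly f \<Longrightarrow> sph_poly (\<lambda>x. cnj (xi x) * f x)"
proof (erule sph_poly_multI)
  fix l m
  have "sph_poly (\<lambda>x. of_real (sin_up l (- m)) * sph_harm (Suc l) (m - 1) x + (- of_real (sin_down l (- m))) * sph_harm (l - 1) (m - 1) x)"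
    by (intro sph_poly_add sph_poly_cmult sph_poly_sph_harm)
  then show "sph_poly (\<lambda>x. cnj (xi x) * sph_harm l m x)"
    using sph_poly_cong[OF sph_harm_mult_cnj_xi[of _ l m]] by simp
qed

lemma sph_harm_0_0: "x \<in> S2 \<Longrightarrow> sph_harm 0 0 x = of_real (sqrt (1 / (4 * pi)))"
  by (simp add: sph_harm_cartesian polar_norm_def rodrigues_def)

lemma sph_poly_1: "sph_poly (\<lambda>_. 1)"
proof -
  have "sph_poly (\<lambda>x. of_real (sqrt (4 * pi)) * sph_harm 0 0 x)"
    by (intro sph_poly_cmult sph_poly_sph_harm)
  moreover have "of_real (sqrt (4 * pi)) * sph_harm 0 0 x = 1" if "x \<in> S2" for x
    unfolding sph_harm_0_0[OF that] by (simp add: real_sqrt_divide flip: of_real_mult)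
  ultimately show ?thesis
    using sph_poly_cong[of "\<lambda>x. of_real (sqrt (4 * pi)) * sph_harm 0 0 x" "\<lambda>_. 1"] by simp
qed

text \<open>Generalising over \<open>f\<close> lets the induction pass products:
  \<open>p q f\<close> is \<open>p\<close> times the element \<open>q f\<close> of the span.\<close>

lemma sph_poly_mult_real_polynomial_function:
  fixes p :: "real^3 \<Rightarrow> real"
  assumes "real_polynomial_function p" "sph_poly f"
  shows "sph_poly (\<lambda>x. of_real (p x) * f x)"
  using assms
proof (induction p arbitrary: f rule: real_polynomial_function.induct)
  case (linear p)
  define a where "a i = complex_of_real (p (axis i 1))" for i
  have p: "p x = (\<Sum>i\<in>UNIV. x $ i * p (axis i 1))" for x
  proof -
    have "linear p"
      using linear(1) by (rule bounded_linear.linear)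
    have "p x = p (\<Sum>i\<in>UNIV. x $ i *\<^sub>R axis i 1)"
      using basis_expansion[of x] by (simp add: scalar_mult_eq_scaleR)
    also have "\<dots> = (\<Sum>i\<in>UNIV. x $ i * p (axis i 1))"
      using \<open>linear p\<close> by (simp add: linear_sum linear_scale)
    finally show ?thesis .
  qed
  have xi: "complex_of_real (x $ 1) = (xi x + cnj (xi x)) / 2" "complex_of_real (x $ 2) = (cnj (xi x) - xi x) * \<i> / 2" for x
    by (simp_all add: complex_eq_iff xi_def)
  have eq: "of_real (p x) * f x = (a 1 / 2 - a 2 * \<i> / 2) * (xi x * f x) + ((a 1 / 2 + a 2 * \<i> / 2) * (cnj (xi x) * f x)
      + a 3 * (of_real (x $ 3) * f x))" for x
    unfolding p[of x] sum_3 of_real_add of_real_mult xi a_def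
    by (simp add: algebra_simps add_divide_distrib diff_divide_distrib)
  show ?case
    unfolding eq using linear(2)
    by (intro sph_poly_add sph_poly_cmult sph_poly_mult_x3 sph_poly_mult_xi sph_poly_mult_cnj_xi)
next
  case (const c)
  then show ?case by (rule sph_poly_cmult)
next
  case (add p q)
  then show ?case by (simp add: distrib_right sph_poly_add)
next
  case (mult p q)
  have "sph_poly (\<lambda>x. of_real (p x) * (of_real (q x) * f x))"
    using mult by blast
  then show ?case by (simp add: mult.assoc)
qed

lemma square_integrable_sph_poly: "sph_poly f \<Longrightarrow> square_integrable surf f"
proof -
  assume "sph_poly f"
  then obtain L c where f: "\<And>x. x \<in> S2 \<Longrightarrow> f x = (\<Sum>(l, m)\<in>sph_index L. c l m * sph_harm l m x)"
    unfolding sph_poly_def by blast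
  have "square_integrable surf (\<lambda>x. \<Sum>(l, m)\<in>sph_index L. c l m * sph_harm l m x)"
    unfolding split_beta' by (intro square_integrable_sum square_integrable_cmult square_integrable_sph_harm)
  then show ?thesis
    using square_integrable_cong[of surf f] f by simp
qed

section \<open>Density of the span in L2\<close>

definition sph_approx :: "(real^3 \<Rightarrow> complex) \<Rightarrow> bool" where
  "sph_approx f \<longleftrightarrow> square_integrable surf f \<and>
     (\<forall>e>0. \<exists>g. sph_poly g \<and> L2_sq surf (\<lambda>x. f x - g x) < e)"

lemma sph_approx_square_integrable: "sph_approx f \<Longrightarrow> square_integrable surf f"
  by (simp add: sph_approx_def)

lemma sph_approx_closed:
  assumes f: "square_integrable surf f"
    and *: "\<And>e. e > 0 \<Longrightarrow> \<exists>g. sph_approx g \<and> L2_sq surf (\<lambda>x. f x - g x) < e"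
  shows "sph_approx f"
  unfolding sph_approx_def
proof (intro conjI allI impI f)
  fix e :: real assume e: "e > 0"
  then obtain g where g: "sph_approx g" "L2_sq surf (\<lambda>x. f x - g x) < e / 4"
    using *[of "e / 4"] by auto
  then obtain h where h: "sph_poly h" "L2_sq surf (\<lambda>x. g x - h x) < e / 4"
    using e unfolding sph_approx_def by (metis zero_less_divide_iff zero_less_numeral)
  have "L2_sq surf (\<lambda>x. (f x - g x) + (g x - h x)) \<le> 2 * L2_sq surf (\<lambda>x. f x - g x) + 2 * L2_sq surf (\<lambda>x. g x - h x)"
    using f g(1) h(1)
    by (intro L2_sq_add_le square_integrable_diff) (auto simp: sph_approx_def square_integrable_sph_poly)
  then show "\<exists>g. sph_poly g \<and> L2_sq surf (\<lambda>x. f x - g x) < e"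
    using g h by (intro exI[of _ h]) simp
qed

lemma sph_approx_add:
  assumes "sph_approx f" "sph_approx g"
  shows "sph_approx (\<lambda>x. f x + g x)"
  unfolding sph_approx_def
proof (intro conjI allI impI)
  show "square_integrable surf (\<lambda>x. f x + g x)"
    using assms by (intro square_integrable_add sph_approx_square_integrable)
  fix e :: real assume "e > 0"
  then have e: "e / 4 > 0" by simp
  obtain p where p: "sph_poly p" "L2_sq surf (\<lambda>x. f x - p x) < e / 4"
    using assms(1) e unfolding sph_approx_def by blast
  obtain q where q: "sph_poly q" "L2_sq surf (\<lambda>x. g x - q x) < e / 4"
    using assms(2) e unfolding sph_approx_def by blast
  have "L2_sq surf (\<lambda>x. (f x - p x) + (g x - q x)) \<le> 2 * L2_sq surf (\<lambda>x. f x - p x) + 2 * L2_sq surf (\<lambda>x. g x - q x)"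
    using assms p(1) q(1)
    by (intro L2_sq_add_le square_integrable_diff square_integrable_sph_poly sph_approx_square_integrable)
  also have "\<dots> < e"
    using p q by simp
  finally show "\<exists>h. sph_poly h \<and> L2_sq surf (\<lambda>x. f x + g x - h x) < e"
    using sph_poly_add[OF p(1) q(1)] by (intro exI[of _ "\<lambda>x. p x + q x"]) (simp add: algebra_simps)
qed

lemma sph_approx_cmult:
  assumes "sph_approx f"
  shows "sph_approx (\<lambda>x. a * f x)"
  unfolding sph_approx_def
proof (intro conjI allI impI)
  show "square_integrable surf (\<lambda>x. a * f x)"
    using assms by (intro square_integrable_cmult sph_approx_square_integrable)
  fix e :: real assume "e > 0"
  then have "e / ((cmod a)\<^sup>2 + 1) > 0"
    by (simp add: add_nonneg_pos)
  then obtain p where p: "sph_poly p" "L2_sq surf (\<lambda>x. f x - p x) < e / ((cmod a)\<^sup>2 + 1)"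
    using assms unfolding sph_approx_def by blast
  have "L2_sq surf (\<lambda>x. a * f x - a * p x) = (cmod a)\<^sup>2 * L2_sq surf (\<lambda>x. f x - p x)"
    by (simp add: L2_sq_cmult flip: right_diff_distrib)
  also have "\<dots> \<le> ((cmod a)\<^sup>2 + 1) * L2_sq surf (\<lambda>x. f x - p x)"
    by (intro mult_right_mono) auto
  also have "\<dots> < e"
    using p(2) by (simp add: pos_less_divide_eq add_nonneg_pos mult.commute)
  finally show "\<exists>h. sph_poly h \<and> L2_sq surf (\<lambda>x. a * f x - h x) < e"
    using sph_poly_cmult[OF p(1)] by (intro exI[of _ "\<lambda>x. a * p x"]) simp
qed

text \<open>Dominated convergence turns pointwise limits below a square-integrable majorant into
  mean-square limits. The inductions over sets and over functions rest on this closure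
  property.\<close>

lemma sph_approx_limit:
  assumes s: "\<And>i::nat. sph_approx (s i)"
    and lim: "\<And>x. x \<in> S2 \<Longrightarrow> (\<lambda>i. s i x) \<longlonglongrightarrow> f x"
    and bound: "\<And>i x. x \<in> S2 \<Longrightarrow> cmod (s i x) \<le> w x"
    and w: "square_integrable surf (w :: real^3 \<Rightarrow> real)"
  shows "sph_approx f"
proof -
  note [measurable] = s[THEN sph_approx_square_integrable, THEN square_integrable_measurable]
    w[THEN square_integrable_measurable]
  have f_meas [measurable]: "f \<in> borel_measurable surf"
    by (rule borel_measurable_LIMSEQ_metric[of s]) (auto intro: lim)
  have f_le: "cmod (f x) \<le> w x" if "x \<in> S2" for x
    by (rule tendsto_upperbound[OF tendsto_norm[OF lim[OF that]]]) (auto intro!: always_eventually bound[OF that])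
  have sq_le: "(cmod (f x))\<^sup>2 \<le> (norm (w x))\<^sup>2" if "x \<in> S2" for x
    using f_le[OF that] by (simp add: abs_le_square_iff[symmetric])
  have f: "square_integrable surf f"
    unfolding square_integrable_def
  proof
    show "integrable surf (\<lambda>x. (cmod (f x))\<^sup>2)"
      by (rule Bochner_Integration.integrable_bound[OF square_integrable_integrable[OF w]])
         (use sq_le in \<open>auto intro!: AE_I2\<close>)
  qed measurable
  have "(\<lambda>i. L2_sq surf (\<lambda>x. f x - s i x)) \<longlonglongrightarrow> (\<integral>x. 0 \<partial>surf)"
    unfolding L2_sq_def
  proof (rule integral_dominated_convergence[where w = "\<lambda>x. 4 * (norm (w x))\<^sup>2"])
    show "integrable surf (\<lambda>x. 4 * (norm (w x))\<^sup>2)"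
      using square_integrable_integrable[OF w] by simp
    show "AE x in surf. (\<lambda>i. (cmod (f x - s i x))\<^sup>2) \<longlonglongrightarrow> 0"
    proof (rule AE_I2)
      fix x assume "x \<in> space surf"
      then have "(\<lambda>i. f x - s i x) \<longlonglongrightarrow> f x - f x"
        by (intro tendsto_intros lim) simp
      then have "(\<lambda>i. (cmod (f x - s i x))\<^sup>2) \<longlonglongrightarrow> (cmod 0)\<^sup>2"
        by (intro tendsto_intros) simp
      then show "(\<lambda>i. (cmod (f x - s i x))\<^sup>2) \<longlonglongrightarrow> 0" by simp
    qed
    show "AE x in surf. norm ((cmod (f x - s i x))\<^sup>2) \<le> 4 * (norm (w x))\<^sup>2" for i
    proof (rule AE_I2)
      fix x assume "x \<in> space surf"
      then have x: "x \<in> S2" by simp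
      have "cmod (f x - s i x) \<le> 2 * w x"
        using norm_triangle_ineq4[of "f x" "s i x"] f_le[OF x] bound[OF x, of i] by linarith
      then have "(cmod (f x - s i x))\<^sup>2 \<le> (2 * w x)\<^sup>2"
        by (intro power_mono) auto
      then show "norm ((cmod (f x - s i x))\<^sup>2) \<le> 4 * (norm (w x))\<^sup>2"
        by (simp add: power_mult_distrib)
    qed
  qed measurable
  then have lim0: "(\<lambda>i. L2_sq surf (\<lambda>x. f x - s i x)) \<longlonglongrightarrow> 0" by simp
  show ?thesis
  proof (rule sph_approx_closed[OF f])
    fix e :: real assume "e > 0"
    then obtain i where "L2_sq surf (\<lambda>x. f x - s i x) < e"
      using order_tendstoD(2)[OF lim0, of e] by (auto simp: eventually_sequentially)
    then show "\<exists>g. sph_approx g \<and> L2_sq surf (\<lambda>x. f x - g x) < e"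
      using s by blast
  qed
qed

lemma sph_approx_cong:
  assumes "\<And>x. x \<in> S2 \<Longrightarrow> f x = g x"
  shows "sph_approx f \<longleftrightarrow> sph_approx g"
proof -
  have "L2_sq surf (\<lambda>x. f x - h x) = L2_sq surf (\<lambda>x. g x - h x)" for h
    using assms by (intro L2_sq_cong) simp
  moreover have "square_integrable surf f \<longleftrightarrow> square_integrable surf g"
    using assms by (intro square_integrable_cong) simp
  ultimately show ?thesis
    by (simp add: sph_approx_def)
qed

lemma sph_approx_continuous:
  assumes f: "continuous_on S2 f"
  shows "sph_approx (\<lambda>x. of_real (f x))"
  unfolding sph_approx_def
proof (intro conjI allI impI)
  have "compact (f ` S2)"
    by (intro compact_continuous_image f) simp
  then obtain B where "\<forall>y\<in>f ` S2. norm y \<le> B"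
    using compact_imp_bounded bounded_iff by blast
  then show sq: "square_integrable surf (\<lambda>x. complex_of_real (f x))"
    using f by (intro surf.square_integrable_bounded borel_measurable_surf_continuous continuous_intros) auto
  fix e :: real assume e: "e > 0"
  define M where "M = measure surf (space surf)"
  \<comment> \<open>With this \<open>d\<close> the squared error is at most
    \<open>e * (M / (M + 1))\<close>, where \<open>M\<close> is the total mass.\<close>
  define d where "d = sqrt (e / (M + 1))"
  have M: "M \<ge> 0" by (simp add: M_def)
  then have d: "d > 0" "d\<^sup>2 = e / (M + 1)"
    using e by (simp_all add: d_def)
  obtain g where g: "real_polynomial_function g" "\<And>x. x \<in> S2 \<Longrightarrow> \<bar>f x - g x\<bar> < d"
    using Stone_Weierstrass_real_polynomial_function[of S2 f d] f d by auto
  have p: "sph_poly (\<lambda>x. of_real (g x))"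
    using sph_poly_mult_real_polynomial_function[OF g(1) sph_poly_1] by simp
  have "L2_sq surf (\<lambda>x. of_real (f x) - of_real (g x)) \<le> (\<integral>x. d\<^sup>2 \<partial>surf)"
    unfolding L2_sq_def
  proof (rule integral_mono)
    show "integrable surf (\<lambda>x. (cmod (complex_of_real (f x) - complex_of_real (g x)))\<^sup>2)"
      using square_integrable_diff[OF sq square_integrable_sph_poly[OF p]] by (rule square_integrable_integrable)
    fix x assume "x \<in> space surf"
    then have "\<bar>f x - g x\<bar> < d"
      using g by simp
    then have "\<bar>f x - g x\<bar>\<^sup>2 \<le> d\<^sup>2"
      by (intro power_mono) auto
    then show "(cmod (complex_of_real (f x) - complex_of_real (g x)))\<^sup>2 \<le> d\<^sup>2"
      by (simp flip: of_real_diff)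
  qed simp
  also have "\<dots> = e * (M / (M + 1))"
    by (simp add: d M_def)
  also have "\<dots> < e"
    using e M by (simp add: pos_divide_less_eq)
  finally show "\<exists>g. sph_poly g \<and> L2_sq surf (\<lambda>x. complex_of_real (f x) - g x) < e"
    using p by blast
qed

lemma square_integrable_surf_const: "square_integrable surf (\<lambda>_. 1 :: real)"
  by (simp add: square_integrable_def)

lemma sph_approx_open:
  assumes "open U"
  shows "sph_approx (\<lambda>x. of_real (indicator U x))"
\<comment> \<open>For \<open>U = UNIV\<close> the complement is empty and \<open>infdist\<close> to
  it is 0 by convention, so the approximating functions would all vanish.\<close>
proof (cases "U = UNIV")
  case True
  then show ?thesis
    using sph_approx_continuous[of "\<lambda>_. 1"] by simp
next
  case False
  let ?f = "\<lambda>n x. min 1 (real n * infdist x (- U))"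
  show ?thesis
  proof (rule sph_approx_limit[OF _ _ _ square_integrable_surf_const])
    show "sph_approx (\<lambda>x. complex_of_real (?f n x))" for n
      by (intro sph_approx_continuous continuous_intros)
    show "(\<lambda>n. complex_of_real (?f n x)) \<longlonglongrightarrow> of_real (indicator U x)" for x
    proof (intro tendsto_of_real)
      show "(\<lambda>n. ?f n x) \<longlonglongrightarrow> indicator U x"
      proof (cases "x \<in> U")
        case True
        have "infdist x (- U) \<noteq> 0"
          using in_closed_iff_infdist_zero[of "- U" x] assms False True by auto
        then have pos: "infdist x (- U) > 0"
          using infdist_nonneg[of x "- U"] by linarith
        obtain N where N: "1 / infdist x (- U) < real N"
          using reals_Archimedean2 by blast
        have "?f n x = 1" if "n \<ge> N" for n
        proof -
          have "1 / infdist x (- U) \<le> real n"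
            using N that by linarith
          then show ?thesis
            using pos by (simp add: pos_divide_le_eq)
        qed
        then have "eventually (\<lambda>n. ?f n x = indicator U x) sequentially"
          using True by (auto simp: eventually_sequentially)
        then show ?thesis
          by (rule tendsto_eventually)
      qed simp
    qed
    show "cmod (complex_of_real (?f n x)) \<le> 1" for n x
      by (simp add: infdist_nonneg)
  qed
qed

text \<open>Dynkin's argument: the open sets are stable under intersection and generate the Borel
  sets, and the class is closed under complements and countable disjoint unions.\<close>

lemma sph_approx_indicator:
  assumes "A \<in> sets borel"
  shows "sph_approx (\<lambda>x. of_real (indicator A x))"
proof -
  have "Int_stable {S :: (real^3) set. open S}"
    by (auto simp: Int_stable_def)
  moreover have "{S :: (real^3) set. open S} \<subseteq> Pow UNIV"
    by simp
  moreover have "A \<in> sigma_sets UNIV {S. open S}"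
    using assms by (simp add: borel_def)
  ultimately show ?thesis
  proof (induction A rule: sigma_sets_induct_disjoint[consumes 3, case_names basic empty compl union])
    case (basic A)
    then show ?case by (simp add: sph_approx_open)
  next
    case empty
    then show ?case using sph_approx_open[of "{}"] by simp
  next
    case (compl A)
    have "sph_approx (\<lambda>x. of_real 1 + (- 1) * of_real (indicator A x))"
      by (intro sph_approx_add sph_approx_cmult compl sph_approx_continuous) auto
    moreover have "of_real 1 + (- 1) * of_real (indicator A x) = complex_of_real (indicator (UNIV - A) x)" for x
      by (simp add: indicator_def)
    ultimately show ?case
      by simp
  next
    case (union A)
    show ?case
    proof (rule sph_approx_limit[OF _ _ _ square_integrable_surf_const])
      have "sph_approx (\<lambda>x. \<Sum>i<n. of_real (indicator (A i) x))" for n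
        by (induction n) (use union sph_approx_open[of "{}"] in \<open>auto intro: sph_approx_add\<close>)
      moreover have "(\<Sum>i<n. complex_of_real (indicator (A i) x)) = of_real (indicator (\<Union>i<n. A i) x)" for n x
      proof -
        have "indicator (\<Union>i\<in>{..<n}. A i) x = (\<Sum>i\<in>{..<n}. indicator (A i) x :: real)"
          using union(1) by (intro indicator_UN_disjoint) (auto simp: disjoint_family_on_def)
        then show ?thesis by simp
      qed
      ultimately show "sph_approx (\<lambda>x. of_real (indicator (\<Union>i<n. A i) x))" for n
        by simp
      show "(\<lambda>n. complex_of_real (indicator (\<Union>i<n. A i) x)) \<longlonglongrightarrow> of_real (indicator (\<Union>i. A i) x)" for x
        by (intro tendsto_of_real LIMSEQ_indicator_UN)
      show "cmod (complex_of_real (indicator (\<Union>i<n. A i) x)) \<le> 1" for n x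
        by (simp add: indicator_def)
    qed
  qed
qed

lemma sph_approx_nonneg:
  assumes "u \<in> borel_measurable surf" "\<And>x. 0 \<le> u x" "square_integrable surf u"
  shows "sph_approx (\<lambda>x. of_real (u x))"
  using assms
proof (induction u rule: borel_measurable_induct_real)
  case (set A)
  then obtain B where B: "B \<in> sets borel" "A = S2 \<inter> B"
    by (auto simp: sets_surf sets_restrict_space)
  have "sph_approx (\<lambda>x. complex_of_real (indicator A x)) \<longleftrightarrow> sph_approx (\<lambda>x. of_real (indicator B x))"
    by (rule sph_approx_cong) (auto simp: B indicator_def)
  then show ?case
    using sph_approx_indicator[OF B(1)] by simp
next
  case (mult u c)
  show ?case
  \<comment> \<open>For \<open>c = 0\<close> the function \<open>u\<close> itself need not be square
    integrable, and the induction hypothesis would not apply.\<close>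
  proof (cases "c = 0")
    case True
    then show ?thesis using sph_approx_open[of "{}"] by simp
  next
    case False
    have "(\<lambda>x. (norm (c * u x))\<^sup>2) = (\<lambda>x. c\<^sup>2 * (norm (u x))\<^sup>2)"
      by (simp add: abs_mult power_mult_distrib)
    then have "integrable surf (\<lambda>x. c\<^sup>2 * (norm (u x))\<^sup>2)"
      using mult.prems unfolding square_integrable_def by metis
    then have "square_integrable surf u"
      using False mult.hyps unfolding square_integrable_def by simp
    then show ?thesis
      using mult.IH sph_approx_cmult[of "\<lambda>x. of_real (u x)" "of_real c"] by simp
  qed
next
  case (add u v)
  \<comment> \<open>Both summands are nonnegative, so each is dominated by the square-integrable
    sum.\<close>
  have *: "square_integrable surf f" if "f \<in> borel_measurable surf" "\<And>x. 0 \<le> f x" "\<And>x. f x \<le> v x + u x" for f :: "real^3 \<Rightarrow> real"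
    unfolding square_integrable_def
  proof
    show "integrable surf (\<lambda>x. (norm (f x))\<^sup>2)"
    proof (rule Bochner_Integration.integrable_bound[OF square_integrable_integrable[OF add.prems]])
      show "AE x in surf. norm ((norm (f x))\<^sup>2) \<le> norm ((norm (v x + u x))\<^sup>2)"
        using that(2,3) by (intro AE_I2) (auto intro: power_mono)
    qed (use that(1) in measurable)
  qed fact
  have "square_integrable surf u" "square_integrable surf v"
    by (rule *; use add.hyps in simp)+
  then show ?case
    using add.IH sph_approx_add[of "\<lambda>x. of_real (v x)" "\<lambda>x. of_real (u x)"] by simp
next
  case (seq U)
  have le: "U i x \<le> u x" if "x \<in> S2" for i x
    using seq.hyps that by (intro incseq_le) (auto simp: incseq_def le_fun_def)
  have "square_integrable surf (U i)" for i
    unfolding square_integrable_def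
  proof
    show "integrable surf (\<lambda>x. (norm (U i x))\<^sup>2)"
    proof (rule Bochner_Integration.integrable_bound[OF square_integrable_integrable[OF seq.prems]])
      show "AE x in surf. norm ((norm (U i x))\<^sup>2) \<le> norm ((norm (u x))\<^sup>2)"
        using le seq.hyps by (intro AE_I2) (auto intro!: power_mono)
    qed (use seq.hyps in measurable)
  qed fact
  then have "sph_approx (\<lambda>x. of_real (U i x))" for i
    using seq.IH by blast
  moreover have "(\<lambda>i. complex_of_real (U i x)) \<longlonglongrightarrow> of_real (u x)" if "x \<in> S2" for x
    using seq.hyps(4) that by (intro tendsto_of_real) simp
  moreover have "cmod (complex_of_real (U i x)) \<le> u x" if "x \<in> S2" for i x
    using seq.hyps(2) le[OF that] by simp
  ultimately show ?case
    by (rule sph_approx_limit[OF _ _ _ seq.prems])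
qed

theorem sph_approx_real:
  assumes "square_integrable surf (f :: real^3 \<Rightarrow> real)"
  shows "sph_approx (\<lambda>x. of_real (f x))"
proof -
  note [measurable] = assms[THEN square_integrable_measurable]
  have *: "sph_approx (\<lambda>x. of_real (g x))" if "g \<in> borel_measurable surf" "\<And>x. 0 \<le> g x" "\<And>x. g x \<le> \<bar>f x\<bar>"
    for g :: "real^3 \<Rightarrow> real"
  proof (rule sph_approx_nonneg[OF that(1,2)])
    show "square_integrable surf g"
      unfolding square_integrable_def
    proof
      show "integrable surf (\<lambda>x. (norm (g x))\<^sup>2)"
      proof (rule Bochner_Integration.integrable_bound[OF square_integrable_integrable[OF assms]])
        show "AE x in surf. norm ((norm (g x))\<^sup>2) \<le> norm ((norm (f x))\<^sup>2)"
          using that(2,3) by (intro AE_I2) (auto intro: power_mono simp: abs_le_square_iff[symmetric])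
      qed (use that(1) in measurable)
    qed fact
  qed
  have "sph_approx (\<lambda>x. of_real (max 0 (f x)) + (- 1) * of_real (max 0 (- f x)))"
    by (intro sph_approx_add sph_approx_cmult *) auto
  moreover have "complex_of_real (max 0 (f x)) + (- 1) * of_real (max 0 (- f x)) = of_real (f x)" for x
    by (auto simp: max_def)
  ultimately show ?thesis
    by simp
qed

section \<open>Convergence of the Laplace series\<close>

definition sph_partial_sum :: "(nat \<Rightarrow> int \<Rightarrow> complex) \<Rightarrow> nat \<Rightarrow> real^3 \<Rightarrow> complex" where
  "sph_partial_sum c L x = (\<Sum>l\<le>L. \<Sum>m = - int l..int l. c l m * sph_harm l m x)"

lemma L2_sq_sph_partial_sum:
  assumes "square_integrable surf f"
  shows "L2_sq surf (\<lambda>x. f x - sph_partial_sum c L x) = L2_sq surf f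
    - (\<Sum>(l, m)\<in>sph_index L. (cmod (harm_coeff f l m))\<^sup>2)
    + (\<Sum>(l, m)\<in>sph_index L. (cmod (harm_coeff f l m - c l m))\<^sup>2)"
proof -
  have "L2_sq surf (\<lambda>x. f x - (\<Sum>i\<in>sph_index L. c (fst i) (snd i) * sph_harm (fst i) (snd i) x)) =
    L2_sq surf f - (\<Sum>i\<in>sph_index L. (cmod (\<integral>x. f x * cnj (sph_harm (fst i) (snd i) x) \<partial>surf))\<^sup>2)
    + (\<Sum>i\<in>sph_index L. (cmod ((\<integral>x. f x * cnj (sph_harm (fst i) (snd i) x) \<partial>surf) - c (fst i) (snd i)))\<^sup>2)"
    by (rule L2_sq_diff_orthonormal_sum[where e = "\<lambda>i. sph_harm (fst i) (snd i)"])
       (auto simp: square_integrable_sph_harm assms sph_index_def sph_harm_orthonormal abs_le_iff split: if_splits)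
  then show ?thesis
    by (simp add: sph_partial_sum_def sum_sph_index split_beta' harm_coeff_def)
qed

text \<open>By \<open>L2_sq_sph_partial_sum\<close> the Fourier coefficients minimise the distance
  for each degree, so a single approximant from the span bounds the errors of all sufficiently long
  partial sums.\<close>

theorem L2_tendsto_sph_partial_sum:
  assumes f: "square_integrable surf (f :: real^3 \<Rightarrow> real)"
  shows "(\<lambda>L. L2_sq surf (\<lambda>x. of_real (f x) - sph_partial_sum (harm_coeff (\<lambda>x. of_real (f x))) L x)) \<longlonglongrightarrow> 0"
proof (rule LIMSEQ_I)
  let ?f = "\<lambda>x. complex_of_real (f x)"
  fix e :: real assume "e > 0"
  then obtain g where g: "sph_poly g" "L2_sq surf (\<lambda>x. ?f x - g x) < e"
    using sph_approx_real[OF f] unfolding sph_approx_def by blast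
  obtain L c where c: "\<forall>L'\<ge>L. \<forall>x\<in>S2. g x = (\<Sum>(l, m)\<in>sph_index L'. c l m * sph_harm l m x)"
    using sph_poly_eventually[OF g(1)] by blast
  have "L2_sq surf (\<lambda>x. ?f x - sph_partial_sum (harm_coeff ?f) L' x) < e" if "L' \<ge> L" for L'
  proof -
    have "L2_sq surf (\<lambda>x. ?f x - sph_partial_sum (harm_coeff ?f) L' x) \<le>
        L2_sq surf (\<lambda>x. ?f x - sph_partial_sum c L' x)"
      unfolding L2_sq_sph_partial_sum[OF square_integrable_of_real[OF f]]
      by (simp add: split_beta' sum_nonneg)
    also have "\<dots> = L2_sq surf (\<lambda>x. ?f x - g x)"
      using c[rule_format, OF that] by (intro L2_sq_cong) (simp add: sph_partial_sum_def sum_sph_index)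
    finally show ?thesis
      using g by simp
  qed
  then show "\<exists>no. \<forall>n\<ge>no. norm (L2_sq surf (\<lambda>x. ?f x - sph_partial_sum (harm_coeff ?f) n x) - 0) < e"
    by auto
qed

section \<open>Isotropic kernels\<close>

text \<open>The reproducing kernel of the harmonics of degree \<open>l\<close>, classically
  \<open>(2 l + 1) / (4 pi)\<close> times the Legendre polynomial of \<open>x \<bullet> y\<close>.
  In the form of this sum its Fourier coefficients can be read off.\<close>

definition zonal_kernel :: "nat \<Rightarrow> real^3 \<Rightarrow> real^3 \<Rightarrow> complex" where
  "zonal_kernel l x y = (\<Sum>m = - int l..int l. sph_harm l m x * cnj (sph_harm l m y))"

lemma zonal_kernel_extend:
  assumes "x \<in> S2" "l \<le> n"
  shows "zonal_kernel l x y = (\<Sum>m = - int n..int n. sph_harm l m x * cnj (sph_harm l m y))"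
  unfolding zonal_kernel_def using assms
  by (intro sum.mono_neutral_left) (auto simp: sph_harm_eq_0 abs_less_iff abs_if)

lemma inner_eq_xi:
  "complex_of_real (x \<bullet> y) = of_real (x $ 3) * of_real (y $ 3) + (xi x * cnj (xi y) + cnj (xi x) * xi y) / 2"
  by (simp add: complex_eq_iff inner_vec_def sum_3 xi_def)

text \<open>These are the diagonal coefficients at degree \<open>l + 1\<close> when
  \<open>x \<bullet> y\<close> times the kernel is expanded; the point is that they do not depend on
  \<open>m\<close>.\<close>

lemma zonal_coeff_up:
  assumes "\<bar>m\<bar> \<le> int (Suc l)"
  shows "(cos_up l m)\<^sup>2 + (sin_up l (m - 1))\<^sup>2 / 2 + (sin_up l (- (m + 1)))\<^sup>2 / 2 = (real l + 1) / (2 * real l + 3)"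
proof -
  have nn: "real l + 1 - m \<ge> 0" "real l + 1 + m \<ge> 0"
    using assms by (simp_all add: abs_le_iff)
  \<comment> \<open>At \<open>m = - l - 1\<close> the first factor is negative, but the second is
    0.\<close>
  have i1: "(real l + m) * (real l + m + 1) \<ge> 0"
  proof (cases "m = - int l - 1")
    case False
    then have "m \<ge> - int l" using assms by linarith
    then have "real l + m \<ge> 0" by linarith
    then show ?thesis by simp
  qed simp
  have i2: "(real l - m) * (real l - m + 1) \<ge> 0"
  proof (cases "m = int l + 1")
    case False
    then have "m \<le> int l" using assms by linarith
    then have "real l - m \<ge> 0" by linarith
    then show ?thesis by simp
  qed simp
  note i = i1 i2
  define N where "N = (2 * real l + 1) * (2 * real l + 3)"
  have N: "N > 0" by (simp add: N_def)
  have 1: "(cos_up l m)\<^sup>2 = (real l + 1 - m) * (real l + 1 + m) / N"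
  proof -
    have "cos_up l m = sqrt ((real l + 1 - m) * (real l + 1 + m) / N)"
      unfolding cos_up_def by (simp add: N_def algebra_simps)
    moreover have "(real l + 1 - m) * (real l + 1 + m) / N \<ge> 0"
      using nn N by simp
    ultimately show ?thesis
      by simp
  qed
  have 2: "(sin_up l (m - 1))\<^sup>2 = (real l + m) * (real l + m + 1) / N"
  proof -
    have "sin_up l (m - 1) = sqrt ((real l + m) * (real l + m + 1) / N)"
      unfolding sin_up_def by (simp add: N_def algebra_simps)
    then show ?thesis
      using i N by simp
  qed
  have 3: "(sin_up l (- (m + 1)))\<^sup>2 = (real l - m) * (real l - m + 1) / N"
  proof -
    have "sin_up l (- (m + 1)) = sqrt ((real l - m) * (real l - m + 1) / N)"
      unfolding sin_up_def by (simp add: N_def algebra_simps)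
    then show ?thesis
      using i N by simp
  qed
  have "(real l + 1 - m) * (real l + 1 + m) / N + (real l + m) * (real l + m + 1) / N / 2 + (real l - m) * (real l - m + 1) / N / 2
      = ((real l + 1) * (2 * real l + 1)) / N"
    using N by (simp add: field_simps)
  also have "\<dots> = (real l + 1) / (2 * real l + 3)"
    by (simp add: N_def)
  finally show ?thesis
    unfolding 1 2 3 .
qed

text \<open>The coefficients at degree \<open>l - 1\<close> are independent of \<open>m\<close> as
  well. The mixed terms between the degrees \<open>l + 1\<close> and \<open>l - 1\<close> cancel
  because all three products are the same root.\<close>

lemma zonal_coeff_down:
  assumes "\<bar>m\<bar> \<le> int l - 1"
  shows "(cos_down l m)\<^sup>2 + (sin_down l (m - 1))\<^sup>2 / 2 + (sin_down l (- (m + 1)))\<^sup>2 / 2 = real l / (2 * real l - 1)"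
    (is ?down)
    and "cos_up l m * cos_down l m = sin_up l (m - 1) * sin_down l (m - 1) / 2 + sin_up l (- (m + 1)) * sin_down l (- (m + 1)) / 2"
    (is ?cross)
proof -
  have nn: "real l - m - 1 \<ge> 0" "real l + m - 1 \<ge> 0"
    using assms by (simp_all add: abs_le_iff)
  have l: "real l \<ge> 1"
    using assms by linarith
  define N where "N = (2 * real l - 1) * (2 * real l + 1)"
  have N: "N > 0" using l by (simp add: N_def)
  have 1: "cos_down l m = sqrt ((real l - m) * (real l + m) / N)"
    unfolding cos_down_def by (simp add: N_def algebra_simps)
  have 2: "sin_down l (m - 1) = sqrt ((real l - m + 1) * (real l - m) / N)"
    unfolding sin_down_def by (simp add: N_def algebra_simps)
  have 3: "sin_down l (- (m + 1)) = sqrt ((real l + m + 1) * (real l + m) / N)"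
    unfolding sin_down_def by (simp add: N_def algebra_simps)
  have "(real l - m) * (real l + m) \<ge> 0" "(real l - m + 1) * (real l - m) \<ge> 0" "(real l + m + 1) * (real l + m) \<ge> 0"
    using nn by (auto intro!: mult_nonneg_nonneg)
  then have sq: "(cos_down l m)\<^sup>2 = (real l - m) * (real l + m) / N" "(sin_down l (m - 1))\<^sup>2 = (real l - m + 1) * (real l - m) / N"
      "(sin_down l (- (m + 1)))\<^sup>2 = (real l + m + 1) * (real l + m) / N"
    using N unfolding 1 2 3 by simp_all
  have "(real l - m) * (real l + m) / N + (real l - m + 1) * (real l - m) / N / 2 + (real l + m + 1) * (real l + m) / N / 2
      = (real l * (2 * real l + 1)) / N"
    using N by (simp add: field_simps)
  also have "\<dots> = real l / (2 * real l - 1)"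
    by (simp add: N_def)
  finally show ?down
    unfolding sq .
  define N' where "N' = (2 * real l + 1) * (2 * real l + 3)"
  define p q s t where "p = real l - m" and "q = real l - m + 1" and "s = real l + m" and "t = real l + m + 1"
  have roots: "cos_up l m = sqrt (q * t / N')" "cos_down l m = sqrt (p * s / N)"
      "sin_up l (m - 1) = sqrt (s * t / N')" "sin_down l (m - 1) = sqrt (q * p / N)"
      "sin_up l (- (m + 1)) = sqrt (p * q / N')" "sin_down l (- (m + 1)) = sqrt (t * s / N)"
    unfolding 1 2 3 unfolding cos_up_def sin_up_def p_def q_def s_def t_def N'_def
    by (simp_all add: algebra_simps)
  have "cos_up l m * cos_down l m = sqrt (p * q * s * t / (N * N'))"
    unfolding roots real_sqrt_mult[symmetric] by (simp add: mult_ac)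
  moreover have "sin_up l (m - 1) * sin_down l (m - 1) = sqrt (p * q * s * t / (N * N'))"
    unfolding roots real_sqrt_mult[symmetric] by (simp add: mult_ac)
  moreover have "sin_up l (- (m + 1)) * sin_down l (- (m + 1)) = sqrt (p * q * s * t / (N * N'))"
    unfolding roots real_sqrt_mult[symmetric] by (simp add: mult_ac)
  ultimately show ?cross by simp
qed

text \<open>The recurrence of the Legendre polynomials, without the addition theorem. At \<open>l = 0\<close> the
  truncated \<open>l - 1\<close> is harmless, because its coefficient vanishes.\<close>

lemma zonal_kernel_mult_inner:
  assumes x: "x \<in> S2" and y: "y \<in> S2"
  shows "of_real (x \<bullet> y) * zonal_kernel l x y =
    of_real ((real l + 1) / (2 * real l + 3)) * zonal_kernel (Suc l) x y +
    of_real (real l / (2 * real l - 1)) * zonal_kernel (l - 1) x y"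
proof -
  let ?Y = "sph_harm l" and ?U = "sph_harm (Suc l)" and ?D = "sph_harm (l - 1)"
  let ?R = "complex_of_real"
  \<comment> \<open>Large enough to contain the orders of degree \<open>l + 1\<close> and to leave
    room for a shift by 1 in either direction.\<close>
  define n where "n = l + 3"
  define T1 where "T1 m = (?R (x $ 3) * ?Y m x) * cnj (?R (y $ 3) * ?Y m y)" for m
  define T2 where "T2 m = (xi x * ?Y m x) * cnj (xi y * ?Y m y)" for m
  define T3 where "T3 m = (cnj (xi x) * ?Y m x) * cnj (cnj (xi y) * ?Y m y)" for m
  have zero: "?Y (int n) x = 0" "?Y (- int n - 1) x = 0" "?Y (int n + 1) x = 0" "?Y (- int n) x = 0"
    using x by (simp_all add: sph_harm_eq_0 n_def)
  have "of_real (x \<bullet> y) * zonal_kernel l x y = (\<Sum>m = - int n..int n. T1 m + T2 m / 2 + T3 m / 2)"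
    unfolding zonal_kernel_extend[OF x, of l n, unfolded n_def, simplified] sum_distrib_left inner_eq_xi n_def
    by (intro sum.cong) (auto simp: T1_def T2_def T3_def algebra_simps add_divide_distrib)
  also have "\<dots> = (\<Sum>m = - int n..int n. T1 m) + (\<Sum>m = - int n..int n. T2 m / 2) + (\<Sum>m = - int n..int n. T3 m / 2)"
    by (simp add: sum.distrib)
  \<comment> \<open>\<open>xi\<close> raises the order and its conjugate lowers it; after the shifts
    all three summands involve harmonics of the same order \<open>m\<close>.\<close>
  also have "(\<Sum>m = - int n..int n. T2 m / 2) = (\<Sum>m = - int n..int n. T2 (m - 1) / 2)"
    by (rule sum_int_shift) (simp_all add: T2_def zero)
  also have "(\<Sum>m = - int n..int n. T3 m / 2) = (\<Sum>m = - int n..int n. T3 (m + 1) / 2)"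
    using sum_int_shift[of "\<lambda>m. T3 (m + 1) / 2" n] by (simp add: T3_def zero)
  also have "(\<Sum>m = - int n..int n. T1 m) + (\<Sum>m = - int n..int n. T2 (m - 1) / 2) + (\<Sum>m = - int n..int n. T3 (m + 1) / 2) =
      (\<Sum>m = - int n..int n. T1 m + T2 (m - 1) / 2 + T3 (m + 1) / 2)"
    by (simp add: sum.distrib)
  also have "\<dots> = (\<Sum>m = - int n..int n. ?R ((real l + 1) / (2 * real l + 3)) * (?U m x * cnj (?U m y)) +
      ?R (real l / (2 * real l - 1)) * (?D m x * cnj (?D m y)))"
  proof (intro sum.cong refl)
    fix m
    define a b c d e f where "a = cos_up l m" and "b = cos_down l m" and "c = sin_up l (m - 1)"
      and "d = sin_down l (m - 1)" and "e = sin_up l (- (m + 1))" and "f = sin_down l (- (m + 1))"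
    have t1: "T1 m = (?R a * ?U m x + ?R b * ?D m x) * cnj (?R a * ?U m y + ?R b * ?D m y)"
      unfolding T1_def sph_harm_mult_x3[OF x] sph_harm_mult_x3[OF y] a_def b_def ..
    have t2: "T2 (m - 1) = (- ?R c * ?U m x + ?R d * ?D m x) * cnj (- ?R c * ?U m y + ?R d * ?D m y)"
      unfolding T2_def sph_harm_mult_xi[OF x] sph_harm_mult_xi[OF y] c_def d_def by simp
    have t3: "T3 (m + 1) = (?R e * ?U m x - ?R f * ?D m x) * cnj (?R e * ?U m y - ?R f * ?D m y)"
      unfolding T3_def sph_harm_mult_cnj_xi[OF x] sph_harm_mult_cnj_xi[OF y] e_def f_def by simp
    have "T1 m + T2 (m - 1) / 2 + T3 (m + 1) / 2 =
        ?R (a\<^sup>2 + c\<^sup>2 / 2 + e\<^sup>2 / 2) * (?U m x * cnj (?U m y)) + ?R (b\<^sup>2 + d\<^sup>2 / 2 + f\<^sup>2 / 2) * (?D m x * cnj (?D m y)) +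
        ?R (a * b - (c * d / 2 + e * f / 2)) * (?U m x * cnj (?D m y) + ?D m x * cnj (?U m y))"
      unfolding t1 t2 t3
      by (simp add: power2_eq_square algebra_simps add_divide_distrib diff_divide_distrib)
    moreover have "?R (a\<^sup>2 + c\<^sup>2 / 2 + e\<^sup>2 / 2) * (?U m x * cnj (?U m y)) =
        ?R ((real l + 1) / (2 * real l + 3)) * (?U m x * cnj (?U m y))"
    proof (cases "\<bar>m\<bar> \<le> int (Suc l)")
      case True
      show ?thesis
        unfolding a_def c_def e_def zonal_coeff_up[OF True] ..
    next
      case False
      then show ?thesis
        using sph_harm_eq_0[OF x, of "Suc l" m] by simp
    qed
    moreover have "?R (b\<^sup>2 + d\<^sup>2 / 2 + f\<^sup>2 / 2) * (?D m x * cnj (?D m y)) = ?R (real l / (2 * real l - 1)) * (?D m x * cnj (?D m y))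
      \<and> ?R (a * b - (c * d / 2 + e * f / 2)) * (?U m x * cnj (?D m y) + ?D m x * cnj (?U m y)) = 0"
    proof (cases "\<bar>m\<bar> \<le> int l - 1")
      case True
      have "a * b - (c * d / 2 + e * f / 2) = 0"
        unfolding a_def b_def c_def d_def e_def f_def zonal_coeff_down(2)[OF True] by simp
      moreover have "b\<^sup>2 + d\<^sup>2 / 2 + f\<^sup>2 / 2 = real l / (2 * real l - 1)"
        unfolding b_def d_def f_def by (rule zonal_coeff_down(1)[OF True])
      ultimately show ?thesis by simp
    next
      case False
      show ?thesis
      \<comment> \<open>At \<open>l = 0\<close> the degree \<open>l - 1\<close> is truncated to 0
        and its harmonic of order 0 does not vanish; the coefficients \<open>b\<close>,
        \<open>d\<close> and \<open>f\<close> do.\<close>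
      proof (cases "l = 0 \<and> m = 0")
        case True
        then have "b = 0" "d = 0" "f = 0"
          by (simp_all add: b_def d_def f_def cos_down_def sin_down_def)
        then show ?thesis
          using True by simp
      next
        case F: False
        then have "\<bar>m\<bar> > int (l - 1)"
          using False by (cases "l = 0") auto
        then show ?thesis
          using sph_harm_eq_0[OF x, of "l - 1" m] sph_harm_eq_0[OF y, of "l - 1" m] by simp
      qed
    qed
    ultimately show "T1 m + T2 (m - 1) / 2 + T3 (m + 1) / 2 =
        ?R ((real l + 1) / (2 * real l + 3)) * (?U m x * cnj (?U m y)) +
        ?R (real l / (2 * real l - 1)) * (?D m x * cnj (?D m y))"
      by (simp only: add_0_right)
  qed
  also have "\<dots> = of_real ((real l + 1) / (2 * real l + 3)) * zonal_kernel (Suc l) x y +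
    of_real (real l / (2 * real l - 1)) * zonal_kernel (l - 1) x y"
    using zonal_kernel_extend[OF x, of "Suc l" n y] zonal_kernel_extend[OF x, of "l - 1" n y]
    by (simp add: n_def sum.distrib sum_distrib_left)
  finally show ?thesis .
qed

section \<open>Polynomials in the inner product\<close>

definition zonal :: "(real^3 \<Rightarrow> real^3 \<Rightarrow> complex) \<Rightarrow> bool" where
  "zonal F \<longleftrightarrow> (\<exists>I c. finite I \<and> (\<forall>x\<in>S2. \<forall>y\<in>S2. F x y = (\<Sum>l\<in>I. c l * zonal_kernel l x y)))"

lemma zonal_kernel_zonal: "zonal (zonal_kernel l)"
  unfolding zonal_def by (intro exI[of _ "{l}"] exI[of _ "\<lambda>_. 1"]) simp

lemma zonal_cong: "(\<And>x y. x \<in> S2 \<Longrightarrow> y \<in> S2 \<Longrightarrow> F x y = G x y) \<Longrightarrow> zonal F \<longleftrightarrow> zonal G"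
  by (simp add: zonal_def)

lemma zonal_zero: "zonal (\<lambda>_ _. 0)"
  unfolding zonal_def by (intro exI[of _ "{}"]) simp

lemma zonal_add:
  assumes "zonal F" "zonal G"
  shows "zonal (\<lambda>x y. F x y + G x y)"
proof -
  obtain I c where F: "finite I" "\<And>x y. x \<in> S2 \<Longrightarrow> y \<in> S2 \<Longrightarrow> F x y = (\<Sum>l\<in>I. c l * zonal_kernel l x y)"
    using assms(1) unfolding zonal_def by blast
  obtain J d where G: "finite J" "\<And>x y. x \<in> S2 \<Longrightarrow> y \<in> S2 \<Longrightarrow> G x y = (\<Sum>l\<in>J. d l * zonal_kernel l x y)"
    using assms(2) unfolding zonal_def by blast
  define c' d' where "c' l = (if l \<in> I then c l else 0)" and "d' l = (if l \<in> J then d l else 0)" for l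
  have "F x y + G x y = (\<Sum>l\<in>I \<union> J. (c' l + d' l) * zonal_kernel l x y)" if "x \<in> S2" "y \<in> S2" for x y
  proof -
    have "(\<Sum>l\<in>I. c l * zonal_kernel l x y) = (\<Sum>l\<in>I \<union> J. c' l * zonal_kernel l x y)"
      using F(1) G(1) by (intro sum.mono_neutral_cong_left) (auto simp: c'_def)
    moreover have "(\<Sum>l\<in>J. d l * zonal_kernel l x y) = (\<Sum>l\<in>I \<union> J. d' l * zonal_kernel l x y)"
      using F(1) G(1) by (intro sum.mono_neutral_cong_left) (auto simp: d'_def)
    ultimately show ?thesis
      using F(2) G(2) that by (simp add: sum.distrib distrib_right)
  qed
  then show ?thesis
    unfolding zonal_def using F(1) G(1)
    by (intro exI[of _ "I \<union> J"] exI[of _ "\<lambda>l. c' l + d' l"]) simp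
qed

lemma zonal_cmult:
  assumes "zonal F"
  shows "zonal (\<lambda>x y. a * F x y)"
proof -
  obtain I c where F: "finite I" "\<And>x y. x \<in> S2 \<Longrightarrow> y \<in> S2 \<Longrightarrow> F x y = (\<Sum>l\<in>I. c l * zonal_kernel l x y)"
    using assms unfolding zonal_def by blast
  show ?thesis
    unfolding zonal_def
    by (intro exI[of _ I] exI[of _ "\<lambda>l. a * c l"]) (simp add: F sum_distrib_left mult.assoc)
qed

lemma zonal_sum: "(\<And>i. i \<in> I \<Longrightarrow> zonal (F i)) \<Longrightarrow> zonal (\<lambda>x y. \<Sum>i\<in>I. F i x y)"
  by (induction I rule: infinite_finite_induct) (auto intro: zonal_zero zonal_add)

lemma zonal_mult_inner:
  assumes "zonal F"
  shows "zonal (\<lambda>x y. of_real (x \<bullet> y) * F x y)"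
proof -
  obtain I c where F: "finite I" "\<And>x y. x \<in> S2 \<Longrightarrow> y \<in> S2 \<Longrightarrow> F x y = (\<Sum>l\<in>I. c l * zonal_kernel l x y)"
    using assms unfolding zonal_def by blast
  have "of_real (x \<bullet> y) * F x y = (\<Sum>l\<in>I. c l * (of_real ((real l + 1) / (2 * real l + 3)) * zonal_kernel (Suc l) x y +
    of_real (real l / (2 * real l - 1)) * zonal_kernel (l - 1) x y))" if "x \<in> S2" "y \<in> S2" for x y
  proof -
    have "of_real (x \<bullet> y) * F x y = (\<Sum>l\<in>I. c l * (of_real (x \<bullet> y) * zonal_kernel l x y))"
      using F(2)[OF that] by (simp add: sum_distrib_left mult_ac)
    then show ?thesis
      unfolding zonal_kernel_mult_inner[OF that] .
  qed
  moreover have "zonal (\<lambda>x y. \<Sum>l\<in>I. c l * (of_real ((real l + 1) / (2 * real l + 3)) * zonal_kernel (Suc l) x y +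
    of_real (real l / (2 * real l - 1)) * zonal_kernel (l - 1) x y))"
    by (intro zonal_sum zonal_cmult zonal_add zonal_kernel_zonal)
  ultimately show ?thesis
    using zonal_cong[of "\<lambda>x y. of_real (x \<bullet> y) * F x y"] by simp
qed

lemma zonal_1: "zonal (\<lambda>_ _. 1)"
proof -
  have "zonal (\<lambda>x y. of_real (4 * pi) * zonal_kernel 0 x y)"
    by (intro zonal_cmult zonal_kernel_zonal)
  moreover have "of_real (4 * pi) * zonal_kernel 0 x y = 1" if "x \<in> S2" "y \<in> S2" for x y
  proof -
    have "zonal_kernel 0 x y = of_real (sqrt (1 / (4 * pi))) * of_real (sqrt (1 / (4 * pi)))"
      using that by (simp add: zonal_kernel_def sph_harm_0_0)
    also have "\<dots> = of_real (sqrt (1 / (4 * pi)) * sqrt (1 / (4 * pi)))"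
      by (simp only: of_real_mult)
    also have "sqrt (1 / (4 * pi)) * sqrt (1 / (4 * pi)) = 1 / (4 * pi)"
      by (rule real_sqrt_mult_self[THEN trans]) simp
    finally have "of_real (4 * pi) * zonal_kernel 0 x y = of_real (4 * pi * (1 / (4 * pi)))"
      by (simp only: of_real_mult)
    then show ?thesis
      by simp
  qed
  ultimately show ?thesis
    using zonal_cong[of "\<lambda>x y. of_real (4 * pi) * zonal_kernel 0 x y" "\<lambda>_ _. 1"] by simp
qed

text \<open>The induction shows that multiplication by a polynomial in \<open>x \<bullet> y\<close>
  preserves zonal kernels, which handles products of polynomials; the claim is the case of the
  constant kernel.\<close>

lemma zonal_real_polynomial_function:
  fixes p :: "real \<Rightarrow> real"
  assumes "real_polynomial_function p"
  shows "zonal (\<lambda>x y. of_real (p (x \<bullet> y)))"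
proof -
  have "zonal (\<lambda>x y. of_real (p (x \<bullet> y)) * F x y)" if "zonal F" for F
    using assms that
  proof (induction p arbitrary: F rule: real_polynomial_function.induct)
    case (linear p)
    have p: "p t = t * p 1" for t
      using bounded_linear.linear[OF linear(1)] linear_scale[of p t 1] by simp
    have "zonal (\<lambda>x y. of_real (p 1) * (of_real (x \<bullet> y) * F x y))"
      by (intro zonal_cmult zonal_mult_inner linear)
    moreover have "of_real (p 1) * (of_real (x \<bullet> y) * F x y) = of_real (p (x \<bullet> y)) * F x y" for x y
      using p[of "x \<bullet> y"] by simp
    ultimately show ?case by simp
  next
    case (const c)
    then show ?case by (rule zonal_cmult)
  next
    case (add p q)
    then show ?case by (simp add: distrib_right zonal_add)
  next
    case (mult p q)
    have "zonal (\<lambda>x y. of_real (p (x \<bullet> y)) * (of_real (q (x \<bullet> y)) * F x y))"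
      using mult by blast
    then show ?case by (simp add: mult.assoc)
  qed
  from this[OF zonal_1] show ?thesis by simp
qed

section \<open>Fourier coefficients of kernels\<close>

interpretation surf_pair: pair_sigma_finite surf surf ..

interpretation surf_pair: finite_measure "surf \<Otimes>\<^sub>M surf"
  by (rule finite_measure_pair_measure[OF finite_measure_surf finite_measure_surf])

lemma integral_sph_harm_pair:
  assumes "\<bar>m1\<bar> \<le> int l1" "\<bar>m2\<bar> \<le> int l2" "\<bar>m\<bar> \<le> int l" "\<bar>m'\<bar> \<le> int l'"
  shows "(\<integral>(x, y). (sph_harm l1 m1 x * cnj (sph_harm l2 m2 y)) * cnj (sph_harm l m x * cnj (sph_harm l' m' y)) \<partial>(surf \<Otimes>\<^sub>M surf)) =
    (if (l1, m1) = (l, m) \<and> (l2, m2) = (l', m') then 1 else 0)"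
proof -
  have "(\<integral>(x, y). (sph_harm l1 m1 x * cnj (sph_harm l2 m2 y)) * cnj (sph_harm l m x * cnj (sph_harm l' m' y)) \<partial>(surf \<Otimes>\<^sub>M surf)) =
    (\<integral>(x, y). (sph_harm l1 m1 x * cnj (sph_harm l m x)) * (sph_harm l' m' y * cnj (sph_harm l2 m2 y)) \<partial>(surf \<Otimes>\<^sub>M surf))"
    by (intro Bochner_Integration.integral_cong) (auto simp: mult_ac)
  also have "\<dots> = (\<integral>x. sph_harm l1 m1 x * cnj (sph_harm l m x) \<partial>surf) * (\<integral>y. sph_harm l' m' y * cnj (sph_harm l2 m2 y) \<partial>surf)"
    by (intro surf_pair.integral_mult_pair integrable_mult_square_integrable square_integrable_cnj square_integrable_sph_harm)
  also have "\<dots> = (if (l1, m1) = (l, m) \<and> (l2, m2) = (l', m') then 1 else 0)"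
    using assms by (auto simp: sph_harm_orthonormal)
  finally show ?thesis .
qed

lemma square_integrable_sph_harm_pair:
  "square_integrable (surf \<Otimes>\<^sub>M surf) (\<lambda>(x, y). sph_harm l m x * cnj (sph_harm l' m' y))"
proof -
  obtain B where B: "B > 0" "\<And>x. x \<in> S2 \<Longrightarrow> cmod (sph_harm l m x) \<le> B"
    using sph_harm_bounded by blast
  obtain B' where B': "\<And>x. x \<in> S2 \<Longrightarrow> cmod (sph_harm l' m' x) \<le> B'"
    using sph_harm_bounded by blast
  show ?thesis
  proof (rule surf_pair.square_integrable_bounded)
    show "norm (case z of (x, y) \<Rightarrow> sph_harm l m x * cnj (sph_harm l' m' y)) \<le> B * B'"
      if "z \<in> space (surf \<Otimes>\<^sub>M surf)" for z
      using that B B' by (auto simp: space_pair_measure norm_mult split: prod.split intro!: mult_mono)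
  qed measurable
qed

definition kernel_coeff :: "(real^3 \<Rightarrow> real^3 \<Rightarrow> complex) \<Rightarrow> nat \<Rightarrow> int \<Rightarrow> nat \<Rightarrow> int \<Rightarrow> complex" where
  "kernel_coeff F l m l' m' =
     (\<integral>(x, y). F x y * cnj (sph_harm l m x * cnj (sph_harm l' m' y)) \<partial>(surf \<Otimes>\<^sub>M surf))"

lemma square_integrable_zonal_kernel: "square_integrable (surf \<Otimes>\<^sub>M surf) (\<lambda>(x, y). zonal_kernel l x y)"
  unfolding zonal_kernel_def split_beta'
  by (intro square_integrable_sum square_integrable_sph_harm_pair[unfolded split_beta'])

lemma integrable_sph_harm_pair_mult:
  assumes "square_integrable (surf \<Otimes>\<^sub>M surf) (\<lambda>(x, y). F x y)"
  shows "integrable (surf \<Otimes>\<^sub>M surf) (\<lambda>(x, y). F x y * cnj (sph_harm l m x * cnj (sph_harm l' m' y)))"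
  using integrable_mult_square_integrable[OF assms square_integrable_cnj[OF square_integrable_sph_harm_pair[of l m l' m']]]
  by (simp add: split_beta')

lemma kernel_coeff_zonal_kernel:
  assumes "\<bar>m\<bar> \<le> int l" "\<bar>m'\<bar> \<le> int l'"
  shows "kernel_coeff (zonal_kernel k) l m l' m' = (if k = l \<and> l = l' \<and> m = m' then 1 else 0)"
proof -
  have "kernel_coeff (zonal_kernel k) l m l' m' = (\<integral>z. (\<Sum>i = - int k..int k.
      case z of (x, y) \<Rightarrow> (sph_harm k i x * cnj (sph_harm k i y)) * cnj (sph_harm l m x * cnj (sph_harm l' m' y))) \<partial>(surf \<Otimes>\<^sub>M surf))"
    unfolding kernel_coeff_def zonal_kernel_def by (simp add: split_beta' sum_distrib_right)
  also have "\<dots> = (\<Sum>i = - int k..int k. \<integral>(x, y). (sph_harm k i x * cnj (sph_harm k i y)) * cnj (sph_harm l m x * cnj (sph_harm l' m' y)) \<partial>(surf \<Otimes>\<^sub>M surf))"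
    by (rule Bochner_Integration.integral_sum) (intro integrable_sph_harm_pair_mult square_integrable_sph_harm_pair)
  also have "\<dots> = (\<Sum>i = - int k..int k. if (k, i) = (l, m) \<and> (k, i) = (l', m') then 1 else 0)"
    using assms by (intro sum.cong refl integral_sph_harm_pair) auto
  also have "\<dots> = (\<Sum>i = - int k..int k. if i = m then (if k = l \<and> l = l' \<and> m = m' then 1 else 0) else 0)"
    by (intro sum.cong) auto
  also have "\<dots> = (if k = l \<and> l = l' \<and> m = m' then 1 else 0)"
    using assms by (auto simp: sum.delta)
  finally show ?thesis .
qed

lemma square_integrable_zonal:
  assumes "zonal F"
  shows "square_integrable (surf \<Otimes>\<^sub>M surf) (\<lambda>(x, y). F x y)"
proof -
  obtain I c where F: "finite I" "\<And>x y. x \<in> S2 \<Longrightarrow> y \<in> S2 \<Longrightarrow> F x y = (\<Sum>l\<in>I. c l * zonal_kernel l x y)"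
    using assms unfolding zonal_def by blast
  have "square_integrable (surf \<Otimes>\<^sub>M surf) (\<lambda>(x, y). \<Sum>l\<in>I. c l * zonal_kernel l x y)"
    unfolding split_beta' by (intro square_integrable_sum square_integrable_cmult square_integrable_zonal_kernel[unfolded split_beta'])
  moreover have "(case z of (x, y) \<Rightarrow> F x y) = (case z of (x, y) \<Rightarrow> \<Sum>l\<in>I. c l * zonal_kernel l x y)"
    if "z \<in> space (surf \<Otimes>\<^sub>M surf)" for z
    using that F(2) by (auto simp: space_pair_measure)
  ultimately show ?thesis
    using square_integrable_cong[of "surf \<Otimes>\<^sub>M surf" "\<lambda>(x, y). F x y"] by simp
qed

lemma kernel_coeff_zonal:
  assumes "zonal F"
  obtains d where "\<And>l m l' m'. \<bar>m\<bar> \<le> int l \<Longrightarrow> \<bar>m'\<bar> \<le> int l' \<Longrightarrow>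
    kernel_coeff F l m l' m' = (if l = l' \<and> m = m' then d l else 0)"
proof -
  obtain I c where F: "finite I" "\<And>x y. x \<in> S2 \<Longrightarrow> y \<in> S2 \<Longrightarrow> F x y = (\<Sum>l\<in>I. c l * zonal_kernel l x y)"
    using assms unfolding zonal_def by blast
  have "kernel_coeff F l m l' m' = (if l = l' \<and> m = m' then if l \<in> I then c l else 0 else 0)"
    if lm: "\<bar>m\<bar> \<le> int l" "\<bar>m'\<bar> \<le> int l'" for l m l' m'
  proof -
    have "kernel_coeff F l m l' m' = (\<integral>z. (\<Sum>k\<in>I. c k * (case z of (x, y) \<Rightarrow>
        zonal_kernel k x y * cnj (sph_harm l m x * cnj (sph_harm l' m' y)))) \<partial>(surf \<Otimes>\<^sub>M surf))"
      unfolding kernel_coeff_def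
      by (intro Bochner_Integration.integral_cong refl)
         (auto simp: space_pair_measure F(2) sum_distrib_right mult.assoc)
    also have "\<dots> = (\<Sum>k\<in>I. c k * kernel_coeff (zonal_kernel k) l m l' m')"
    proof -
      have "integrable (surf \<Otimes>\<^sub>M surf) (\<lambda>z. c k * (case z of (x, y) \<Rightarrow>
          zonal_kernel k x y * cnj (sph_harm l m x * cnj (sph_harm l' m' y))))" for k
        by (intro integrable_mult_right integrable_sph_harm_pair_mult square_integrable_zonal_kernel)
      then show ?thesis
        unfolding kernel_coeff_def by (subst Bochner_Integration.integral_sum) (simp_all only: integral_mult_right_zero)
    qed
    also have "\<dots> = (\<Sum>k\<in>I. if k = l then (if l = l' \<and> m = m' then c l else 0) else 0)"
      using lm by (intro sum.cong) (auto simp: kernel_coeff_zonal_kernel)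
    also have "\<dots> = (if l = l' \<and> m = m' then if l \<in> I then c l else 0 else 0)"
      using F(1) by (auto simp: sum.delta)
    finally show ?thesis .
  qed
  then show ?thesis
    using that[of "\<lambda>l. if l \<in> I then c l else 0"] by blast
qed

text \<open>Cauchy-Schwarz against a function of norm 1, which makes the bound uniform over all
  indices.\<close>

lemma kernel_coeff_diff_le:
  assumes F: "square_integrable (surf \<Otimes>\<^sub>M surf) (\<lambda>(x, y). F x y)"
    and G: "square_integrable (surf \<Otimes>\<^sub>M surf) (\<lambda>(x, y). G x y)"
    and le: "\<And>x y. x \<in> S2 \<Longrightarrow> y \<in> S2 \<Longrightarrow> cmod (F x y - G x y) \<le> e"
    and lm: "\<bar>m\<bar> \<le> int l" "\<bar>m'\<bar> \<le> int l'" and "e \<ge> 0"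
  shows "cmod (kernel_coeff F l m l' m' - kernel_coeff G l m l' m') \<le> e * sqrt (measure (surf \<Otimes>\<^sub>M surf) (space (surf \<Otimes>\<^sub>M surf)))"
proof -
  let ?N = "surf \<Otimes>\<^sub>M surf"
  let ?Y = "\<lambda>(x, y). cnj (sph_harm l m x * cnj (sph_harm l' m' y))"
  let ?D = "\<lambda>z. (case z of (x, y) \<Rightarrow> F x y) - (case z of (x, y) \<Rightarrow> G x y)"
  have Y: "square_integrable ?N ?Y"
    using square_integrable_cnj[OF square_integrable_sph_harm_pair[of l m l' m']] by (simp add: split_beta')
  have D: "square_integrable ?N ?D"
    by (rule square_integrable_diff[OF F G])
  have "complex_of_real (L2_sq ?N ?Y) = 1"
    using integral_sph_harm_pair[OF lm lm] unfolding L2_sq_complex by (simp add: split_beta' mult_ac)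
  then have Y1: "L2_sq ?N ?Y = 1"
    by simp
  have "L2_sq ?N ?D \<le> (\<integral>z. e\<^sup>2 \<partial>?N)"
    unfolding L2_sq_def
    using square_integrable_integrable[OF D] le
    by (intro integral_mono) (auto simp: space_pair_measure intro!: power_mono)
  then have D_le: "L2_sq ?N ?D \<le> e\<^sup>2 * measure ?N (space ?N)"
    by (simp add: mult.commute)
  have "kernel_coeff F l m l' m' - kernel_coeff G l m l' m' = (\<integral>z. ?D z * ?Y z \<partial>?N)"
    unfolding kernel_coeff_def
    using integrable_mult_square_integrable[OF F Y] integrable_mult_square_integrable[OF G Y]
    by (simp add: split_beta' left_diff_distrib)
  then have "(cmod (kernel_coeff F l m l' m' - kernel_coeff G l m l' m'))\<^sup>2 \<le> e\<^sup>2 * measure ?N (space ?N)"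
    using Cauchy_Schwarz_L2[OF D Y] D_le unfolding Y1 by simp
  then have "cmod (kernel_coeff F l m l' m' - kernel_coeff G l m l' m') \<le> sqrt (e\<^sup>2 * measure ?N (space ?N))"
    by (rule real_le_rsqrt)
  then show ?thesis
    using \<open>e \<ge> 0\<close> by (simp add: real_sqrt_mult)
qed

text \<open>The uniform bound of \<open>kernel_coeff_diff_le\<close> compares the coefficients of
  order \<open>m\<close> and of order 0 with the same number \<open>d l\<close>, hence with each
  other.\<close>

theorem kernel_coeff_isotropic:
  fixes g :: "real \<Rightarrow> real"
  assumes g: "continuous_on {- 1..1} g"
    and F: "square_integrable (surf \<Otimes>\<^sub>M surf) (\<lambda>(x, y). F x y)"
    and Fg: "\<And>x y. x \<in> S2 \<Longrightarrow> y \<in> S2 \<Longrightarrow> F x y = of_real (g (x \<bullet> y))"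
    and lm: "\<bar>m\<bar> \<le> int l" "\<bar>m'\<bar> \<le> int l'"
  shows "kernel_coeff F l m l' m' = (if l = l' \<and> m = m' then kernel_coeff F l 0 l 0 else 0)"
proof -
  define B where "B = sqrt (measure (surf \<Otimes>\<^sub>M surf) (space (surf \<Otimes>\<^sub>M surf)))"
  have B: "B \<ge> 0" by (simp add: B_def)
  let ?d = "kernel_coeff F l m l' m' - (if l = l' \<and> m = m' then kernel_coeff F l 0 l 0 else 0)"
  have "cmod ?d \<le> e" if e: "e > 0" for e
  proof -
    \<comment> \<open>The factor 2 serves the two comparisons in the diagonal case, and
      \<open>B + 1\<close> avoids a division by zero.\<close>
    define e' where "e' = e / (2 * (B + 1))"
    have e': "e' > 0" "2 * (e' * B) \<le> e"
      using e B by (simp_all add: e'_def field_simps)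
    obtain p where p: "real_polynomial_function p" "\<And>t. t \<in> {- 1..1} \<Longrightarrow> \<bar>g t - p t\<bar> < e'"
      using Stone_Weierstrass_real_polynomial_function[OF _ g e'(1)] by auto
    let ?P = "\<lambda>x y. complex_of_real (p (x \<bullet> y))"
    have z: "zonal ?P"
      by (rule zonal_real_polynomial_function[OF p(1)])
    have le: "cmod (F x y - ?P x y) \<le> e'" if "x \<in> S2" "y \<in> S2" for x y
    proof -
      have "\<bar>x \<bullet> y\<bar> \<le> 1"
        using Cauchy_Schwarz_ineq2[of x y] that by simp
      then have "\<bar>g (x \<bullet> y) - p (x \<bullet> y)\<bar> < e'"
        by (intro p(2)) (simp add: abs_le_iff)
      then show ?thesis
        using Fg[OF that] by (simp flip: of_real_diff)
    qed
    obtain d where d: "\<And>l m l' m'. \<bar>m\<bar> \<le> int l \<Longrightarrow> \<bar>m'\<bar> \<le> int l' \<Longrightarrow>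
        kernel_coeff ?P l m l' m' = (if l = l' \<and> m = m' then d l else 0)"
      using kernel_coeff_zonal[OF z] by blast
    have close: "cmod (kernel_coeff F l m l' m' - (if l = l' \<and> m = m' then d l else 0)) \<le> e' * B"
      if "\<bar>m\<bar> \<le> int l" "\<bar>m'\<bar> \<le> int l'" for l m l' m'
      using kernel_coeff_diff_le[OF F square_integrable_zonal[OF z] le that] e'(1) d[OF that]
      unfolding B_def by simp
    show ?thesis
    proof (cases "l = l' \<and> m = m'")
      case True
      have "?d = (kernel_coeff F l m l m - d l) - (kernel_coeff F l 0 l 0 - d l)"
        using True by simp
      then have "cmod ?d \<le> cmod (kernel_coeff F l m l m - d l) + cmod (kernel_coeff F l 0 l 0 - d l)"
        by (simp only: norm_triangle_ineq4)
      then show ?thesis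
        using close[OF lm(1) lm(1)] close[of 0 l 0 l] e'(2) by simp
    next
      case False
      then show ?thesis
        using close[OF lm] e'(2) mult_nonneg_nonneg[OF less_imp_le[OF e'(1)] B] unfolding if_not_P[OF False]
        by (simp only: diff_0_right)
    qed
  qed
  then have "cmod ?d \<le> 0"
    by (rule field_le_epsilon[where y = 0, simplified])
  then show ?thesis by simp
qed

section \<open>Fields of second order\<close>

lemma square_integrable_pair_mult:
  fixes u :: "'a \<Rightarrow> complex" and v :: "'b \<Rightarrow> complex"
  assumes "pair_sigma_finite M N" and u: "square_integrable M u" and v: "square_integrable N v"
  shows "square_integrable (M \<Otimes>\<^sub>M N) (\<lambda>(x, y). u x * v y)"
proof -
  interpret pair_sigma_finite M N by fact
  note [measurable] = u[THEN square_integrable_measurable] v[THEN square_integrable_measurable]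
  have "integrable (M \<Otimes>\<^sub>M N) (\<lambda>(x, y). (norm (u x))\<^sup>2 * (norm (v y))\<^sup>2)"
    by (intro integrable_mult_pair square_integrable_integrable u v)
  then show ?thesis
    unfolding square_integrable_def by (simp add: split_beta' norm_mult power_mult_distrib)
qed

text \<open>The field, its truncations and the remainders are all instances; the values are complex
  because the terms of a truncation are. Joint square integrability gives the mean-square
  statements, and the condition at each point makes \<open>cross_kernel\<close> meaningful
  everywhere on the sphere.\<close>

locale square_integrable_process = prob_space M for M :: "'w measure" +
  fixes W :: "'w \<times> (real^3) \<Rightarrow> complex"
  assumes square_integrable_joint: "square_integrable (M \<Otimes>\<^sub>M surf) W"
    and square_integrable_point: "x \<in> S2 \<Longrightarrow> square_integrable M (\<lambda>w. W (w, x))"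
begin

sublocale surf_prod: pair_sigma_finite M surf ..

lemma W_measurable [measurable]: "W \<in> borel_measurable (M \<Otimes>\<^sub>M surf)"
  using square_integrable_joint by (rule square_integrable_measurable)

lemma AE_square_integrable_path: "AE w in M. square_integrable surf (\<lambda>x. W (w, x))"
  using surf_prod.AE_integrable_fst'[OF square_integrable_integrable[OF square_integrable_joint]] AE_space
proof eventually_elim
  case (elim w)
  then have "(\<lambda>x. W (w, x)) \<in> borel_measurable surf"
    by measurable
  with elim show ?case
    by (simp add: square_integrable_def)
qed

lemma integrable_path_energy: "integrable M (\<lambda>w. L2_sq surf (\<lambda>x. W (w, x)))"
  unfolding L2_sq_def
  by (rule surf_prod.integrable_fst'[OF square_integrable_integrable[OF square_integrable_joint]])

lemma integral_path_energy: "(\<integral>w. L2_sq surf (\<lambda>x. W (w, x)) \<partial>M) = L2_sq (M \<Otimes>\<^sub>M surf) W"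
  unfolding L2_sq_def
  by (rule surf_prod.integral_fst'[OF square_integrable_integrable[OF square_integrable_joint]])

lemma integrable_point_energy: "integrable surf (\<lambda>x. L2_sq M (\<lambda>w. W (w, x)))"
  unfolding L2_sq_def
  using surf_prod.integrable_snd[of "\<lambda>w x. (norm (W (w, x)))\<^sup>2"] square_integrable_integrable[OF square_integrable_joint]
  by (simp add: split_beta')

lemma integral_point_energy: "(\<integral>x. L2_sq M (\<lambda>w. W (w, x)) \<partial>surf) = L2_sq (M \<Otimes>\<^sub>M surf) W"
  unfolding L2_sq_def
  using surf_prod.integral_snd[of "\<lambda>w x. (norm (W (w, x)))\<^sup>2"] square_integrable_integrable[OF square_integrable_joint]
  by (simp add: split_beta')

text \<open>Cauchy-Schwarz on almost every path, then integration over the sample space. The last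
  bound makes the passage from processes to random variables continuous.\<close>

lemma integral_path_mult:
  assumes f: "square_integrable surf f"
  shows "AE w in M. integrable surf (\<lambda>x. W (w, x) * f x)"
    and "square_integrable M (\<lambda>w. \<integral>x. W (w, x) * f x \<partial>surf)"
    and "L2_sq M (\<lambda>w. \<integral>x. W (w, x) * f x \<partial>surf) \<le> L2_sq (M \<Otimes>\<^sub>M surf) W * L2_sq surf f"
proof -
  note [measurable] = f[THEN square_integrable_measurable]
  let ?a = "\<lambda>w. \<integral>x. W (w, x) * f x \<partial>surf"
  show "AE w in M. integrable surf (\<lambda>x. W (w, x) * f x)"
    using AE_square_integrable_path by eventually_elim (intro integrable_mult_square_integrable f)
  have le: "AE w in M. (norm (?a w))\<^sup>2 \<le> L2_sq surf (\<lambda>x. W (w, x)) * L2_sq surf f"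
    using AE_square_integrable_path by eventually_elim (rule Cauchy_Schwarz_L2[OF _ f])
  have int: "integrable M (\<lambda>w. L2_sq surf (\<lambda>x. W (w, x)) * L2_sq surf f)"
    by (intro integrable_mult_left integrable_path_energy)
  show *: "square_integrable M ?a"
    unfolding square_integrable_def
  proof
    show "?a \<in> borel_measurable M"
      by measurable
    show "integrable M (\<lambda>w. (norm (?a w))\<^sup>2)"
    proof (rule Bochner_Integration.integrable_bound[OF int])
      show "AE w in M. norm ((norm (?a w))\<^sup>2) \<le> norm (L2_sq surf (\<lambda>x. W (w, x)) * L2_sq surf f)"
        using le by eventually_elim simp
    qed measurable
  qed
  have "L2_sq M ?a \<le> (\<integral>w. L2_sq surf (\<lambda>x. W (w, x)) * L2_sq surf f \<partial>M)"
    unfolding L2_sq_def[of M]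
    using square_integrable_integrable[OF *] int le by (rule integral_mono_AE)
  also have "\<dots> = L2_sq (M \<Otimes>\<^sub>M surf) W * L2_sq surf f"
    using integral_path_energy by simp
  finally show "L2_sq M ?a \<le> L2_sq (M \<Otimes>\<^sub>M surf) W * L2_sq surf f" .
qed

end

definition cross_kernel :: "'w measure \<Rightarrow> ('w \<times> (real^3) \<Rightarrow> complex) \<Rightarrow> ('w \<times> (real^3) \<Rightarrow> complex) \<Rightarrow> real^3 \<Rightarrow> real^3 \<Rightarrow> complex" where
  "cross_kernel M W1 W2 x y = (\<integral>w. W1 (w, x) * cnj (W2 (w, y)) \<partial>M)"

text \<open>Cauchy-Schwarz over the sample space bounds the squared kernel by a function of
  \<open>x\<close> times a function of \<open>y\<close>, and the integral of this product
  factorises.\<close>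

lemma square_integrable_cross_kernel:
  assumes W1: "square_integrable_process M W1" and W2: "square_integrable_process M W2"
  shows "square_integrable (surf \<Otimes>\<^sub>M surf) (\<lambda>(x, y). cross_kernel M W1 W2 x y)"
    and "L2_sq (surf \<Otimes>\<^sub>M surf) (\<lambda>(x, y). cross_kernel M W1 W2 x y) \<le> L2_sq (M \<Otimes>\<^sub>M surf) W1 * L2_sq (M \<Otimes>\<^sub>M surf) W2"
proof -
  interpret W1: square_integrable_process M W1 by fact
  interpret W2: square_integrable_process M W2 by fact
  let ?K = "\<lambda>(x, y). cross_kernel M W1 W2 x y"
  let ?h = "\<lambda>(x, y). L2_sq M (\<lambda>w. W1 (w, x)) * L2_sq M (\<lambda>w. W2 (w, y))"
  have h: "integrable (surf \<Otimes>\<^sub>M surf) ?h"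
    by (intro surf_pair.integrable_mult_pair W1.integrable_point_energy W2.integrable_point_energy)
  have le: "(norm (?K z))\<^sup>2 \<le> ?h z" if "z \<in> space (surf \<Otimes>\<^sub>M surf)" for z
  proof -
    obtain x y where z: "z = (x, y)" "x \<in> S2" "y \<in> S2"
      using \<open>z \<in> space (surf \<Otimes>\<^sub>M surf)\<close> by (auto simp: space_pair_measure)
    have "L2_sq M (\<lambda>w. cnj (W2 (w, y))) = L2_sq M (\<lambda>w. W2 (w, y))"
      by (simp add: L2_sq_def)
    then show ?thesis
      using Cauchy_Schwarz_L2[OF W1.square_integrable_point[OF z(2)] square_integrable_cnj[OF W2.square_integrable_point[OF z(3)]]]
      by (simp add: z(1) cross_kernel_def)
  qed
  have K [measurable]: "?K \<in> borel_measurable (surf \<Otimes>\<^sub>M surf)"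
    unfolding cross_kernel_def split_beta' by measurable
  show *: "square_integrable (surf \<Otimes>\<^sub>M surf) ?K"
    unfolding square_integrable_def
  proof
    show "integrable (surf \<Otimes>\<^sub>M surf) (\<lambda>z. (norm (?K z))\<^sup>2)"
    proof (rule Bochner_Integration.integrable_bound[OF h])
      show "AE z in surf \<Otimes>\<^sub>M surf. norm ((norm (?K z))\<^sup>2) \<le> norm (?h z)"
        using order_trans[OF le abs_ge_self] by (intro AE_I2) (simp only: real_norm_def abs_of_nonneg[OF zero_le_power2])
    qed measurable
  qed fact
  have "L2_sq (surf \<Otimes>\<^sub>M surf) ?K \<le> (\<integral>z. ?h z \<partial>(surf \<Otimes>\<^sub>M surf))"
    unfolding L2_sq_def[of "surf \<Otimes>\<^sub>M surf"]
    using square_integrable_integrable[OF *] h le by (rule integral_mono)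
  also have "\<dots> = L2_sq (M \<Otimes>\<^sub>M surf) W1 * L2_sq (M \<Otimes>\<^sub>M surf) W2"
    unfolding W1.integral_point_energy[symmetric] W2.integral_point_energy[symmetric]
    by (intro surf_pair.integral_mult_pair W1.integrable_point_energy W2.integrable_point_energy)
  finally show "L2_sq (surf \<Otimes>\<^sub>M surf) ?K \<le> L2_sq (M \<Otimes>\<^sub>M surf) W1 * L2_sq (M \<Otimes>\<^sub>M surf) W2" .
qed

text \<open>Fubini over the sample space and two copies of the sphere. The integrand is dominated by
  \<open>B^2\<close> times the sum of the squared moduli of \<open>W1\<close> and \<open>W2\<close>;
  each of these ignores one point of the sphere and is integrable because \<open>surf\<close> is
  finite.\<close>

lemma integral_cross_kernel:
  assumes W1: "square_integrable_process M W1" and W2: "square_integrable_process M W2"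
    and f: "f \<in> borel_measurable surf" "\<And>x. x \<in> S2 \<Longrightarrow> cmod (f x) \<le> B"
    and g: "g \<in> borel_measurable surf" "\<And>x. x \<in> S2 \<Longrightarrow> cmod (g x) \<le> B"
  shows "(\<integral>(x, y). cross_kernel M W1 W2 x y * (f x * cnj (g y)) \<partial>(surf \<Otimes>\<^sub>M surf)) =
    (\<integral>w. (\<integral>x. W1 (w, x) * f x \<partial>surf) * cnj (\<integral>y. W2 (w, y) * g y \<partial>surf) \<partial>M)"
proof -
  interpret W1: square_integrable_process M W1 by fact
  interpret W2: square_integrable_process M W2 by fact
  interpret Q: pair_sigma_finite M "surf \<Otimes>\<^sub>M surf" ..
  note [measurable] = f(1) g(1)
  let ?\<Phi> = "\<lambda>w z. (W1 (w, fst z) * f (fst z)) * cnj (W2 (w, snd z) * g (snd z))"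
  let ?h = "\<lambda>(w, z). B\<^sup>2 * ((norm (W1 (w, fst z)))\<^sup>2 + (norm (W2 (w, snd z)))\<^sup>2)"
  define m where "m = emeasure surf (space surf)"
  have m: "m < \<infinity>"
  proof -
    have "m \<noteq> \<infinity>"
      unfolding m_def infinity_ennreal_def by (rule surf.emeasure_finite)
    then show ?thesis
      by (simp add: less_top)
  qed
  have fin: "(\<integral>\<^sup>+w. \<integral>\<^sup>+x. ennreal ((norm (W (w, x)))\<^sup>2) \<partial>surf \<partial>M) < \<infinity>"
    if "square_integrable_process M W" for W
  proof -
    interpret W: square_integrable_process M W by fact
    have "(\<integral>\<^sup>+w. \<integral>\<^sup>+x. ennreal ((norm (W (w, x)))\<^sup>2) \<partial>surf \<partial>M) = (\<integral>\<^sup>+p. ennreal ((norm (W p))\<^sup>2) \<partial>(M \<Otimes>\<^sub>M surf))"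
      by (rule surf.nn_integral_fst) measurable
    also have "\<dots> < \<infinity>"
      using square_integrable_integrable[OF W.square_integrable_joint] by (simp add: integrable_iff_bounded)
    finally show ?thesis .
  qed
  have int1: "integrable (M \<Otimes>\<^sub>M (surf \<Otimes>\<^sub>M surf)) (\<lambda>(w, z). (norm (W1 (w, fst z)))\<^sup>2)"
  proof (rule integrableI_bounded)
    have "(\<integral>\<^sup>+p. ennreal (norm (case p of (w, z) \<Rightarrow> (norm (W1 (w, fst z)))\<^sup>2)) \<partial>(M \<Otimes>\<^sub>M (surf \<Otimes>\<^sub>M surf))) =
        (\<integral>\<^sup>+w. \<integral>\<^sup>+z. ennreal ((norm (W1 (w, fst z)))\<^sup>2) \<partial>(surf \<Otimes>\<^sub>M surf) \<partial>M)"
      by (subst surf_pair.nn_integral_fst[symmetric]) simp_all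
    also have "\<dots> = (\<integral>\<^sup>+w. \<integral>\<^sup>+x. \<integral>\<^sup>+y. ennreal ((norm (W1 (w, x)))\<^sup>2) \<partial>surf \<partial>surf \<partial>M)"
      by (intro nn_integral_cong, subst surf.nn_integral_fst[symmetric]) (simp_all, measurable)
    also have "\<dots> = (\<integral>\<^sup>+w. \<integral>\<^sup>+x. ennreal ((norm (W1 (w, x)))\<^sup>2) \<partial>surf \<partial>M) * m"
      unfolding m_def nn_integral_const
      by (subst nn_integral_multc[symmetric], measurable)
         (intro nn_integral_cong nn_integral_multc, measurable)
    also have "\<dots> < \<infinity>"
      using fin[OF W1] m by (simp add: ennreal_mult_less_top)
    finally show "(\<integral>\<^sup>+p. ennreal (norm (case p of (w, z) \<Rightarrow> (norm (W1 (w, fst z)))\<^sup>2)) \<partial>(M \<Otimes>\<^sub>M (surf \<Otimes>\<^sub>M surf))) < \<infinity>" .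
  qed measurable
  have int2: "integrable (M \<Otimes>\<^sub>M (surf \<Otimes>\<^sub>M surf)) (\<lambda>(w, z). (norm (W2 (w, snd z)))\<^sup>2)"
  proof (rule integrableI_bounded)
    have "(\<integral>\<^sup>+p. ennreal (norm (case p of (w, z) \<Rightarrow> (norm (W2 (w, snd z)))\<^sup>2)) \<partial>(M \<Otimes>\<^sub>M (surf \<Otimes>\<^sub>M surf))) =
        (\<integral>\<^sup>+w. \<integral>\<^sup>+z. ennreal ((norm (W2 (w, snd z)))\<^sup>2) \<partial>(surf \<Otimes>\<^sub>M surf) \<partial>M)"
      by (subst surf_pair.nn_integral_fst[symmetric]) simp_all
    also have "\<dots> = (\<integral>\<^sup>+w. \<integral>\<^sup>+x. \<integral>\<^sup>+y. ennreal ((norm (W2 (w, y)))\<^sup>2) \<partial>surf \<partial>surf \<partial>M)"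
      by (intro nn_integral_cong, subst surf.nn_integral_fst[symmetric]) (simp_all, measurable)
    also have "\<dots> = (\<integral>\<^sup>+w. \<integral>\<^sup>+x. ennreal ((norm (W2 (w, x)))\<^sup>2) \<partial>surf \<partial>M) * m"
      unfolding m_def nn_integral_const
      by (subst nn_integral_multc[symmetric], measurable)
    also have "\<dots> < \<infinity>"
      using fin[OF W2] m by (simp add: ennreal_mult_less_top)
    finally show "(\<integral>\<^sup>+p. ennreal (norm (case p of (w, z) \<Rightarrow> (norm (W2 (w, snd z)))\<^sup>2)) \<partial>(M \<Otimes>\<^sub>M (surf \<Otimes>\<^sub>M surf))) < \<infinity>" .
  qed measurable
  have h: "integrable (M \<Otimes>\<^sub>M (surf \<Otimes>\<^sub>M surf)) ?h"
    using int1 int2 by (simp add: split_beta')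
  have \<Phi>: "integrable (M \<Otimes>\<^sub>M (surf \<Otimes>\<^sub>M surf)) (\<lambda>(w, z). ?\<Phi> w z)"
  proof (rule Bochner_Integration.integrable_bound[OF h])
    show "AE p in M \<Otimes>\<^sub>M (surf \<Otimes>\<^sub>M surf). norm (case p of (w, z) \<Rightarrow> ?\<Phi> w z) \<le> norm (?h p)"
    proof (rule AE_I2)
      fix p assume "p \<in> space (M \<Otimes>\<^sub>M (surf \<Otimes>\<^sub>M surf))"
      then obtain w x y where p: "p = (w, (x, y))" "x \<in> S2" "y \<in> S2"
        by (auto simp: space_pair_measure)
      let ?a = "cmod (W1 (w, x))" and ?b = "cmod (W2 (w, y))"
      have "?a * ?b \<le> ?a\<^sup>2 + ?b\<^sup>2"
        using sum_squares_bound[of ?a ?b] mult_nonneg_nonneg[OF norm_ge_zero[of "W1 (w, x)"] norm_ge_zero[of "W2 (w, y)"]]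
        by linarith
      moreover have "cmod (f x) * cmod (g y) \<le> B\<^sup>2"
        unfolding power2_eq_square using f(2)[OF p(2)] g(2)[OF p(3)]
        by (intro mult_mono) (auto intro: order_trans[OF norm_ge_zero])
      ultimately have "(cmod (f x) * cmod (g y)) * (?a * ?b) \<le> B\<^sup>2 * (?a\<^sup>2 + ?b\<^sup>2)"
        by (intro mult_mono) auto
      then show "norm (case p of (w, z) \<Rightarrow> ?\<Phi> w z) \<le> norm (?h p)"
        by (simp add: p(1) norm_mult mult_ac)
    qed
  qed measurable
  have "(\<integral>(x, y). cross_kernel M W1 W2 x y * (f x * cnj (g y)) \<partial>(surf \<Otimes>\<^sub>M surf)) =
      (\<integral>z. (\<integral>w. ?\<Phi> w z \<partial>M) \<partial>(surf \<Otimes>\<^sub>M surf))"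
  proof (intro Bochner_Integration.integral_cong refl)
    fix z
    have "(\<integral>w. ?\<Phi> w z \<partial>M) = (\<integral>w. W1 (w, fst z) * cnj (W2 (w, snd z)) * (f (fst z) * cnj (g (snd z))) \<partial>M)"
      by (simp add: mult_ac)
    then show "(case z of (x, y) \<Rightarrow> cross_kernel M W1 W2 x y * (f x * cnj (g y))) = (\<integral>w. ?\<Phi> w z \<partial>M)"
      by (simp add: cross_kernel_def split_beta')
  qed
  also have "\<dots> = (\<integral>w. (\<integral>z. ?\<Phi> w z \<partial>(surf \<Otimes>\<^sub>M surf)) \<partial>M)"
    by (rule Q.Fubini_integral[OF \<Phi>])
  also have "\<dots> = (\<integral>w. (\<integral>x. W1 (w, x) * f x \<partial>surf) * cnj (\<integral>y. W2 (w, y) * g y \<partial>surf) \<partial>M)"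
  proof (rule integral_cong_AE)
    have f': "square_integrable surf f" and g': "square_integrable surf g"
      using surf.square_integrable_bounded[of f B] surf.square_integrable_bounded[of g B] f g by simp_all
    show "AE w in M. (\<integral>z. ?\<Phi> w z \<partial>(surf \<Otimes>\<^sub>M surf)) =
        (\<integral>x. W1 (w, x) * f x \<partial>surf) * cnj (\<integral>y. W2 (w, y) * g y \<partial>surf)"
      using W1.integral_path_mult(1)[OF f'] W2.integral_path_mult(1)[OF g']
    proof eventually_elim
      case (elim w)
      then have "integrable surf (\<lambda>y. cnj (W2 (w, y) * g y))"
        by (rule_tac integrable_cnj)
      from surf_pair.integral_mult_pair[OF elim(1) this] show ?case
        by (simp add: split_beta' del: complex_cnj_mult)
    qed
  qed measurable
  finally show ?thesis .
qed

text \<open>What survives of a spherical random field under multiplication by a function in L2: the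
  variance is integrable, but in general neither bounded nor continuous. Both \<open>T\<close> and
  \<open>V T\<close> are instances.\<close>

locale second_order_field = prob_space M for M :: "'w measure" +
  fixes Z :: "real^3 \<Rightarrow> 'w \<Rightarrow> real"
  assumes field_measurable: "(\<lambda>(w, x). Z x w) \<in> borel_measurable (M \<Otimes>\<^sub>M surf)"
    and field_square_integrable: "x \<in> S2 \<Longrightarrow> square_integrable M (Z x)"
    and field_centered: "x \<in> S2 \<Longrightarrow> (\<integral>w. Z x w \<partial>M) = 0"
    and integrable_variance: "integrable surf (\<lambda>x. \<integral>w. (Z x w)\<^sup>2 \<partial>M)"
begin

definition field_fun :: "'w \<times> (real^3) \<Rightarrow> complex" where
  "field_fun = (\<lambda>(w, x). complex_of_real (Z x w))"

sublocale field: square_integrable_process M field_fun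
proof
  interpret P: pair_sigma_finite M surf ..
  interpret S: pair_sigma_finite surf M ..
  note [measurable] = field_measurable
  have m: "(\<lambda>(x, w). (Z x w)\<^sup>2) \<in> borel_measurable (surf \<Otimes>\<^sub>M M)"
    using measurable_compose[OF measurable_pair_swap' field_measurable] by (simp add: split_beta')
  have "integrable (surf \<Otimes>\<^sub>M M) (\<lambda>(x, w). (Z x w)\<^sup>2)"
  proof (rule S.Fubini_integrable[OF m])
    show "integrable surf (\<lambda>x. \<integral>w. norm (case (x, w) of (x, w) \<Rightarrow> (Z x w)\<^sup>2) \<partial>M)"
      using integrable_variance by simp
    show "AE x in surf. integrable M (\<lambda>w. case (x, w) of (x, w) \<Rightarrow> (Z x w)\<^sup>2)"
      using field_square_integrable by (intro AE_I2) (auto simp: square_integrable_def)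
  qed
  from S.integrable_product_swap[OF this]
  show "square_integrable (M \<Otimes>\<^sub>M surf) field_fun"
    unfolding square_integrable_def field_fun_def by (simp add: split_beta')
  show "square_integrable M (\<lambda>w. field_fun (w, x))" if "x \<in> S2" for x
    using square_integrable_of_real[OF field_square_integrable[OF that]] by (simp add: field_fun_def)
qed

lemma field_coeff_eq: "field_coeff Z l m w = (\<integral>x. field_fun (w, x) * cnj (sph_harm l m x) \<partial>surf)"
  by (simp add: field_coeff_def harm_coeff_def field_fun_def)

lemma square_integrable_field_coeff: "square_integrable M (field_coeff Z l m)"
  unfolding field_coeff_eq[abs_def]
  by (intro field.integral_path_mult square_integrable_cnj square_integrable_sph_harm)

lemma AE_integrable_field_sph_harm:
  "AE w in M. integrable surf (\<lambda>x. complex_of_real (Z x w) * cnj (sph_harm l m x))"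
  using field.integral_path_mult(1)[OF square_integrable_cnj[OF square_integrable_sph_harm[of l m]]]
  by (simp add: field_fun_def)

lemma integral_field_coeff: "(\<integral>w. field_coeff Z l m w \<partial>M) = 0"
proof -
  have "square_integrable (M \<Otimes>\<^sub>M surf) (\<lambda>(w, x). 1 * cnj (sph_harm l m x))"
    by (intro square_integrable_pair_mult square_integrable_cnj square_integrable_sph_harm)
       (auto intro: field.surf_prod.pair_sigma_finite_axioms simp: square_integrable_def)
  from integrable_mult_square_integrable[OF field.square_integrable_joint this]
  have int: "integrable (M \<Otimes>\<^sub>M surf) (\<lambda>(w, x). field_fun (w, x) * cnj (sph_harm l m x))"
    by (simp add: split_beta')
  have "(\<integral>w. field_coeff Z l m w \<partial>M) = (\<integral>x. (\<integral>w. field_fun (w, x) * cnj (sph_harm l m x) \<partial>M) \<partial>surf)"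
    unfolding field_coeff_eq by (rule field.surf_prod.Fubini_integral[OF int, symmetric])
  also have "\<dots> = (\<integral>x. 0 \<partial>surf)"
    by (intro Bochner_Integration.integral_cong refl) (simp add: field_fun_def field_centered)
  finally show ?thesis by simp
qed

section \<open>Mean-square expansion of a field\<close>

definition truncated_field :: "nat \<Rightarrow> 'w \<times> (real^3) \<Rightarrow> complex" where
  "truncated_field L = (\<lambda>(w, x). \<Sum>l\<le>L. \<Sum>m = - int l..int l. field_coeff Z l m w * sph_harm l m x)"

lemma truncated_field_eq: "truncated_field L (w, x) = sph_partial_sum (harm_coeff (\<lambda>x. of_real (Z x w))) L x"
  by (simp add: truncated_field_def sph_partial_sum_def field_coeff_def)

sublocale truncated: square_integrable_process M "truncated_field L" for L
proof
  show "square_integrable (M \<Otimes>\<^sub>M surf) (truncated_field L)"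
    unfolding truncated_field_def split_beta'
    by (intro square_integrable_sum square_integrable_pair_mult[unfolded split_beta']
      field.surf_prod.pair_sigma_finite_axioms square_integrable_field_coeff square_integrable_sph_harm)
  show "square_integrable M (\<lambda>w. truncated_field L (w, x))" for x
    unfolding truncated_field_def split_conv
    using square_integrable_cmult[OF square_integrable_field_coeff, of "sph_harm _ _ x"]
    by (intro square_integrable_sum) (simp add: mult.commute)
qed

sublocale remainder: square_integrable_process M "\<lambda>p. field_fun p - truncated_field L p" for L
proof
  show "square_integrable (M \<Otimes>\<^sub>M surf) (\<lambda>p. field_fun p - truncated_field L p)"
    by (intro square_integrable_diff field.square_integrable_joint truncated.square_integrable_joint)
  show "square_integrable M (\<lambda>w. field_fun (w, x) - truncated_field L (w, x))" if "x \<in> S2" for x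
    by (intro square_integrable_diff field.square_integrable_point truncated.square_integrable_point that)
qed

lemma truncated_field_tendsto: "(\<lambda>L. L2_sq (M \<Otimes>\<^sub>M surf) (\<lambda>p. field_fun p - truncated_field L p)) \<longlonglongrightarrow> 0"
proof -
  have "(\<lambda>L. \<integral>w. L2_sq surf (\<lambda>x. field_fun (w, x) - truncated_field L (w, x)) \<partial>M) \<longlonglongrightarrow> (\<integral>w. 0 \<partial>M)"
  proof (rule integral_dominated_convergence)
    show "integrable M (\<lambda>w. L2_sq surf (\<lambda>x. field_fun (w, x)))"
      by (rule field.integrable_path_energy)
    show "(\<lambda>w. L2_sq surf (\<lambda>x. field_fun (w, x) - truncated_field L (w, x))) \<in> borel_measurable M" for L
      using remainder.integrable_path_energy by (rule borel_measurable_integrable)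
    show "AE w in M. (\<lambda>L. L2_sq surf (\<lambda>x. field_fun (w, x) - truncated_field L (w, x))) \<longlonglongrightarrow> 0"
      using field.AE_square_integrable_path
    proof eventually_elim
      case (elim w)
      then have "square_integrable surf (\<lambda>x. Re (field_fun (w, x)))"
        by (simp add: square_integrable_def field_fun_def borel_measurable_complex_iff)
      then have "square_integrable surf (\<lambda>x. Z x w)"
        by (simp add: field_fun_def)
      from L2_tendsto_sph_partial_sum[OF this] show ?case
        by (simp add: truncated_field_eq) (simp add: field_fun_def)
    qed
    \<comment> \<open>Bessel's inequality on each path supplies the majorant: the squared error
      never exceeds the energy of the path.\<close>
    show "AE w in M. norm (L2_sq surf (\<lambda>x. field_fun (w, x) - truncated_field L (w, x))) \<le> L2_sq surf (\<lambda>x. field_fun (w, x))" for L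
      using field.AE_square_integrable_path
    proof eventually_elim
      case (elim w)
      then have "square_integrable surf (\<lambda>x. complex_of_real (Z x w))"
        by (simp add: field_fun_def)
      from L2_sq_sph_partial_sum[OF this, of "harm_coeff (\<lambda>x. of_real (Z x w))" L] show ?case
        by (simp add: truncated_field_eq) (simp add: field_fun_def split_beta' sum_nonneg)
    qed
  qed simp
  then show ?thesis
    by (simp add: remainder.integral_path_energy)
qed

lemma covariance_eq: "x \<in> S2 \<Longrightarrow> y \<in> S2 \<Longrightarrow> of_real (covariance M (Z x) (Z y)) = cross_kernel M field_fun field_fun x y"
  unfolding covariance_def cross_kernel_def by (simp add: field_centered field_fun_def flip: of_real_mult)

lemma kernel_coeff_cross_kernel:
  assumes "square_integrable_process M W1" "square_integrable_process M W2"
  shows "kernel_coeff (cross_kernel M W1 W2) l m l' m' =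
    (\<integral>w. (\<integral>x. W1 (w, x) * cnj (sph_harm l m x) \<partial>surf) * cnj (\<integral>y. W2 (w, y) * cnj (sph_harm l' m' y) \<partial>surf) \<partial>M)"
proof -
  obtain B1 where B1: "\<And>x. x \<in> S2 \<Longrightarrow> cmod (sph_harm l m x) \<le> B1"
    using sph_harm_bounded by blast
  obtain B2 where B2: "\<And>x. x \<in> S2 \<Longrightarrow> cmod (sph_harm l' m' x) \<le> B2"
    using sph_harm_bounded by blast
  show ?thesis
    unfolding kernel_coeff_def complex_cnj_mult
  proof (rule integral_cross_kernel[OF assms, where B = "max B1 B2"])
    fix x :: "real^3" assume "x \<in> S2"
    then show "cmod (cnj (sph_harm l m x)) \<le> max B1 B2" "cmod (cnj (sph_harm l' m' x)) \<le> max B1 B2"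
      using B1[of x] B2[of x] by auto
  qed measurable
qed

lemma kernel_coeff_covariance:
  "kernel_coeff (cross_kernel M field_fun field_fun) l m l' m' = (\<integral>w. field_coeff Z l m w * cnj (field_coeff Z l' m' w) \<partial>M)"
  unfolding field_coeff_eq
  by (rule kernel_coeff_cross_kernel) (rule field.square_integrable_process_axioms)+

end

text \<open>The product of \<open>s\<close> and the conjugate of \<open>t\<close> is split by
  replacing \<open>t\<close> with \<open>t - g\<close> and with \<open>g\<close>; in the first part
  the norms of \<open>s\<close> stay bounded because \<open>s\<close> converges.\<close>

lemma L2_tendsto_integral_mult_cnj:
  assumes s: "L2_tendsto N s f F" and t: "L2_tendsto N t g F"
  shows "((\<lambda>i. \<integral>x. s i x * cnj (t i x) \<partial>N) \<longlongrightarrow> (\<integral>x. f x * cnj (g x) \<partial>N)) F"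
proof -
  have sq: "square_integrable N (s i)" "square_integrable N f" "square_integrable N (t i)" "square_integrable N g" for i
    using s t by (simp_all add: L2_tendsto_def)
  have lim_s: "((\<lambda>i. L2_sq N (\<lambda>x. s i x - f x)) \<longlongrightarrow> 0) F" and lim_t: "((\<lambda>i. L2_sq N (\<lambda>x. t i x - g x)) \<longlongrightarrow> 0) F"
    using s t by (simp_all add: L2_tendsto_def L2_sq_def)
  let ?B = "\<lambda>i. (2 * L2_sq N (\<lambda>x. s i x - f x) + 2 * L2_sq N f) * L2_sq N (\<lambda>x. t i x - g x)"
  have "((\<lambda>i. \<integral>x. s i x * cnj (t i x - g x) \<partial>N) \<longlongrightarrow> 0) F"
  proof (rule Lim_null_comparison)
    have "(?B \<longlongrightarrow> (2 * 0 + 2 * L2_sq N f) * 0) F"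
      by (intro tendsto_intros lim_s lim_t)
    then show "((\<lambda>i. sqrt (?B i)) \<longlongrightarrow> 0) F"
      using tendsto_real_sqrt by fastforce
    show "\<forall>\<^sub>F i in F. norm (\<integral>x. s i x * cnj (t i x - g x) \<partial>N) \<le> sqrt (?B i)"
    proof (rule always_eventually, rule allI)
      fix i
      have d: "square_integrable N (\<lambda>x. cnj (t i x - g x))"
        by (intro square_integrable_cnj square_integrable_diff sq)
      have "L2_sq N (\<lambda>x. cnj (t i x - g x)) = L2_sq N (\<lambda>x. t i x - g x)"
        by (simp add: L2_sq_def del: complex_cnj_diff)
      then have "(norm (\<integral>x. s i x * cnj (t i x - g x) \<partial>N))\<^sup>2 \<le> L2_sq N (s i) * L2_sq N (\<lambda>x. t i x - g x)"
        using Cauchy_Schwarz_L2[OF sq(1)[of i] d] by (simp only:)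
      also have "\<dots> \<le> ?B i"
        using L2_sq_add_le[OF square_integrable_diff[OF sq(1)[of i] sq(2)] sq(2)]
        by (intro mult_right_mono) simp_all
      finally show "norm (\<integral>x. s i x * cnj (t i x - g x) \<partial>N) \<le> sqrt (?B i)"
        by (rule real_le_rsqrt)
    qed
  qed
  moreover have "((\<lambda>i. \<integral>x. s i x * cnj (g x) \<partial>N) \<longlongrightarrow> (\<integral>x. f x * cnj (g x) \<partial>N)) F"
    by (rule L2_tendsto_integral_mult[OF s square_integrable_cnj[OF sq(4)]])
  ultimately have "((\<lambda>i. (\<integral>x. s i x * cnj (t i x - g x) \<partial>N) + (\<integral>x. s i x * cnj (g x) \<partial>N)) \<longlongrightarrow> 0 + (\<integral>x. f x * cnj (g x) \<partial>N)) F"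
    by (rule tendsto_add)
  moreover have "(\<integral>x. s i x * cnj (t i x - g x) \<partial>N) + (\<integral>x. s i x * cnj (g x) \<partial>N) = (\<integral>x. s i x * cnj (t i x) \<partial>N)" for i
    using integrable_mult_square_integrable[OF sq(1)[of i] square_integrable_cnj[OF sq(3)[of i]]]
      integrable_mult_square_integrable[OF sq(1)[of i] square_integrable_cnj[OF sq(4)]]
    by (simp add: right_diff_distrib)
  ultimately show ?thesis
    by simp
qed

context second_order_field
begin

lemma integral_truncated_field:
  assumes f: "square_integrable surf f"
  shows "(\<integral>x. truncated_field L (w, x) * f x \<partial>surf) =
    (\<Sum>(l, m)\<in>sph_index L. field_coeff Z l m w * (\<integral>x. sph_harm l m x * f x \<partial>surf))"
proof -
  have int: "integrable surf (\<lambda>x. sph_harm l m x * f x)" for l m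
    by (intro integrable_mult_square_integrable square_integrable_sph_harm f)
  have "(\<integral>x. truncated_field L (w, x) * f x \<partial>surf) =
      (\<integral>x. (\<Sum>p\<in>sph_index L. field_coeff Z (fst p) (snd p) w * (sph_harm (fst p) (snd p) x * f x)) \<partial>surf)"
    by (simp add: truncated_field_def sum_sph_index split_beta' sum_distrib_right mult.assoc)
  then show ?thesis
    using int by (simp add: split_beta')
qed

text \<open>Integration of a process against \<open>f\<close> is bounded in mean square, so the
  convergence of the truncations carries over to these random variables.\<close>

lemma L2_tendsto_integral_truncated_field:
  assumes f: "square_integrable surf f"
  shows "L2_tendsto M (\<lambda>L w. \<integral>x. truncated_field L (w, x) * f x \<partial>surf) (\<lambda>w. \<integral>x. field_fun (w, x) * f x \<partial>surf) sequentially"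
proof -
  let ?s = "\<lambda>L w. \<integral>x. truncated_field L (w, x) * f x \<partial>surf" and ?a = "\<lambda>w. \<integral>x. field_fun (w, x) * f x \<partial>surf"
  have s: "square_integrable M (?s L)" for L
    by (rule truncated.integral_path_mult(2)[OF f])
  have a: "square_integrable M ?a"
    by (rule field.integral_path_mult(2)[OF f])
  have le: "L2_sq M (\<lambda>w. ?s L w - ?a w) \<le> L2_sq (M \<Otimes>\<^sub>M surf) (\<lambda>p. field_fun p - truncated_field L p) * L2_sq surf f" for L
  proof -
    have AE: "AE w in M. (cmod (?s L w - ?a w))\<^sup>2 = (cmod (\<integral>x. (field_fun (w, x) - truncated_field L (w, x)) * f x \<partial>surf))\<^sup>2"
      using truncated.integral_path_mult(1)[OF f, of L] field.integral_path_mult(1)[OF f]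
      by eventually_elim (simp add: left_diff_distrib norm_minus_commute)
    have "L2_sq M (\<lambda>w. ?s L w - ?a w) = L2_sq M (\<lambda>w. \<integral>x. (field_fun (w, x) - truncated_field L (w, x)) * f x \<partial>surf)"
      unfolding L2_sq_def
    proof (rule integral_cong_AE[OF _ _ AE])
      show "(\<lambda>w. (cmod (?s L w - ?a w))\<^sup>2) \<in> borel_measurable M"
        using square_integrable_diff[OF s a] by (simp add: square_integrable_def borel_measurable_integrable)
      show "(\<lambda>w. (cmod (\<integral>x. (field_fun (w, x) - truncated_field L (w, x)) * f x \<partial>surf))\<^sup>2) \<in> borel_measurable M"
        using remainder.integral_path_mult(2)[OF f] by (simp add: square_integrable_def borel_measurable_integrable)
    qed
    then show ?thesis
      using remainder.integral_path_mult(3)[OF f] by simp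
  qed
  have "(\<lambda>L. L2_sq M (\<lambda>w. ?s L w - ?a w)) \<longlonglongrightarrow> 0"
  proof (rule tendsto_sandwich[where f = "\<lambda>_. 0"])
    show "(\<lambda>L. L2_sq (M \<Otimes>\<^sub>M surf) (\<lambda>p. field_fun p - truncated_field L p) * L2_sq surf f) \<longlonglongrightarrow> 0"
      using tendsto_mult_left_zero[OF truncated_field_tendsto] by simp
  qed (auto intro!: always_eventually le)
  then show ?thesis
    using s a by (simp add: L2_tendsto_def L2_sq_def)
qed

lemma L2_tendsto_truncated_field: "L2_tendsto (M \<Otimes>\<^sub>M surf) truncated_field field_fun sequentially"
  using truncated.square_integrable_joint field.square_integrable_joint truncated_field_tendsto
  unfolding L2_tendsto_def L2_sq_minus_commute[of _ field_fun] by (simp add: L2_sq_def)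

text \<open>The difference of the kernels is that of the remainder with the field plus that of the
  truncation with the remainder. Each is bounded by a product of two energies, one of which tends to
  0 while the other stays bounded.\<close>

lemma cross_kernel_tendsto:
  "(\<lambda>L. L2_sq (surf \<Otimes>\<^sub>M surf) (\<lambda>(x, y). cross_kernel M field_fun field_fun x y - cross_kernel M (truncated_field L) (truncated_field L) x y)) \<longlonglongrightarrow> 0"
proof -
  let ?R = "\<lambda>L p. field_fun p - truncated_field L p"
  let ?r = "\<lambda>L. L2_sq (M \<Otimes>\<^sub>M surf) (?R L)" and ?f = "L2_sq (M \<Otimes>\<^sub>M surf) field_fun"
  let ?t = "\<lambda>L. L2_sq (M \<Otimes>\<^sub>M surf) (truncated_field L)"
  have F: "square_integrable_process M field_fun" and T: "square_integrable_process M (truncated_field L)"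
    and R: "square_integrable_process M (?R L)" for L
    by (rule field.square_integrable_process_axioms truncated.square_integrable_process_axioms
        remainder.square_integrable_process_axioms)+
  have split: "cross_kernel M field_fun field_fun x y - cross_kernel M (truncated_field L) (truncated_field L) x y =
      cross_kernel M (?R L) field_fun x y + cross_kernel M (truncated_field L) (?R L) x y"
    if "x \<in> S2" "y \<in> S2" for x y L
  proof -
    have int: "integrable M (\<lambda>w. A (w, x) * cnj (B (w, y)))"
      if "square_integrable_process M A" "square_integrable_process M B" for A B
      using that \<open>x \<in> S2\<close> \<open>y \<in> S2\<close>
      by (intro integrable_mult_square_integrable square_integrable_cnj)
         (auto simp: square_integrable_process_def square_integrable_process_axioms_def)
    have "cross_kernel M (?R L) field_fun x y = cross_kernel M field_fun field_fun x y - cross_kernel M (truncated_field L) field_fun x y"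
      unfolding cross_kernel_def using int[OF F F] int[OF T F] by (simp add: left_diff_distrib)
    moreover have "cross_kernel M (truncated_field L) (?R L) x y =
        cross_kernel M (truncated_field L) field_fun x y - cross_kernel M (truncated_field L) (truncated_field L) x y"
      unfolding cross_kernel_def using int[OF T F] int[OF T T] by (simp add: right_diff_distrib)
    ultimately show ?thesis by simp
  qed
  have "L2_sq (surf \<Otimes>\<^sub>M surf) (\<lambda>(x, y). cross_kernel M field_fun field_fun x y - cross_kernel M (truncated_field L) (truncated_field L) x y)
      \<le> 2 * (?r L * ?f) + 2 * ((2 * ?r L + 2 * ?f) * ?r L)" for L
  proof -
    have t: "?t L \<le> 2 * ?r L + 2 * ?f"
    proof -
      have "?t L = L2_sq (M \<Otimes>\<^sub>M surf) (\<lambda>p. (truncated_field L p - field_fun p) + field_fun p)"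
        by simp
      also have "\<dots> \<le> 2 * L2_sq (M \<Otimes>\<^sub>M surf) (\<lambda>p. truncated_field L p - field_fun p) + 2 * ?f"
        by (intro L2_sq_add_le square_integrable_diff truncated.square_integrable_joint field.square_integrable_joint)
      finally show ?thesis
        by (simp add: L2_sq_minus_commute)
    qed
    have "L2_sq (surf \<Otimes>\<^sub>M surf) (\<lambda>(x, y). cross_kernel M field_fun field_fun x y - cross_kernel M (truncated_field L) (truncated_field L) x y) =
        L2_sq (surf \<Otimes>\<^sub>M surf) (\<lambda>z. (case z of (x, y) \<Rightarrow> cross_kernel M (?R L) field_fun x y) +
          (case z of (x, y) \<Rightarrow> cross_kernel M (truncated_field L) (?R L) x y))"
      by (rule L2_sq_cong) (auto simp: space_pair_measure split)
    also have "\<dots> \<le> 2 * L2_sq (surf \<Otimes>\<^sub>M surf) (\<lambda>(x, y). cross_kernel M (?R L) field_fun x y) +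
        2 * L2_sq (surf \<Otimes>\<^sub>M surf) (\<lambda>(x, y). cross_kernel M (truncated_field L) (?R L) x y)"
      by (intro L2_sq_add_le square_integrable_cross_kernel F T R)
    also have "\<dots> \<le> 2 * (?r L * ?f) + 2 * (?t L * ?r L)"
      using square_integrable_cross_kernel(2)[OF R F, of L] square_integrable_cross_kernel(2)[OF T R, of L L] by simp
    also have "\<dots> \<le> 2 * (?r L * ?f) + 2 * ((2 * ?r L + 2 * ?f) * ?r L)"
      using mult_right_mono[OF t L2_sq_nonneg] by simp
    finally show ?thesis .
  qed
  note le = this
  show ?thesis
  proof (rule tendsto_sandwich[where f = "\<lambda>_. 0"])
    have "(\<lambda>L. 2 * (?r L * ?f) + 2 * ((2 * ?r L + 2 * ?f) * ?r L)) \<longlonglongrightarrow> 2 * (0 * ?f) + 2 * ((2 * 0 + 2 * ?f) * 0)"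
      by (intro tendsto_intros truncated_field_tendsto)
    then show "(\<lambda>L. 2 * (?r L * ?f) + 2 * ((2 * ?r L + 2 * ?f) * ?r L)) \<longlonglongrightarrow> 0"
      by simp
  qed (auto intro!: always_eventually le)
qed

section \<open>Expansion of the covariance function\<close>

abbreviation covariance_coeff :: "nat \<Rightarrow> int \<Rightarrow> nat \<Rightarrow> int \<Rightarrow> complex" where
  "covariance_coeff \<equiv> kernel_coeff (cross_kernel M field_fun field_fun)"

definition covariance_sum :: "(nat \<times> nat) set \<Rightarrow> (real^3) \<times> (real^3) \<Rightarrow> complex" where
  "covariance_sum A = (\<lambda>(x, y). \<Sum>(l, l')\<in>A. \<Sum>m = - int l..int l. \<Sum>m' = - int l'..int l'.
     covariance_coeff l m l' m' * sph_harm l m x * cnj (sph_harm l' m' y))"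

lemma cross_kernel_truncated_field:
  "cross_kernel M (truncated_field L) (truncated_field L) x y = covariance_sum ({..L} \<times> {..L}) (x, y)"
proof -
  let ?a = "field_coeff Z"
  have int: "integrable M (\<lambda>w. ?a l m w * cnj (?a l' m' w))" for l m l' m'
    by (intro integrable_mult_square_integrable square_integrable_cnj square_integrable_field_coeff)
  have "cross_kernel M (truncated_field L) (truncated_field L) x y =
      (\<integral>w. (\<Sum>p\<in>sph_index L. \<Sum>q\<in>sph_index L. (sph_harm (fst p) (snd p) x * cnj (sph_harm (fst q) (snd q) y)) *
        (?a (fst p) (snd p) w * cnj (?a (fst q) (snd q) w))) \<partial>M)"
    unfolding cross_kernel_def truncated_field_def sum_sph_index split_beta' split_conv
    by (simp add: sum_product mult_ac)
  also have "\<dots> = (\<Sum>p\<in>sph_index L. \<Sum>q\<in>sph_index L. (sph_harm (fst p) (snd p) x * cnj (sph_harm (fst q) (snd q) y)) *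
        covariance_coeff (fst p) (snd p) (fst q) (snd q))"
    using int by (simp add: kernel_coeff_covariance)
  also have "\<dots> = (\<Sum>l\<le>L. \<Sum>m = - int l..int l. \<Sum>l'\<le>L. \<Sum>m' = - int l'..int l'.
      (sph_harm l m x * cnj (sph_harm l' m' y)) * covariance_coeff l m l' m')"
    unfolding sum_sph_index by (simp add: split_beta')
  also have "\<dots> = (\<Sum>l\<le>L. \<Sum>l'\<le>L. \<Sum>m = - int l..int l. \<Sum>m' = - int l'..int l'.
      covariance_coeff l m l' m' * sph_harm l m x * cnj (sph_harm l' m' y))"
    by (intro sum.cong refl, subst sum.swap) (simp add: mult_ac)
  also have "\<dots> = covariance_sum ({..L} \<times> {..L}) (x, y)"
    unfolding covariance_sum_def by (simp add: sum.cartesian_product)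
  finally show ?thesis .
qed

definition pair_index :: "(nat \<times> nat) set \<Rightarrow> ((nat \<times> nat) \<times> (int \<times> int)) set" where
  "pair_index A = (SIGMA p:A. {- int (fst p)..int (fst p)} \<times> {- int (snd p)..int (snd p)})"

lemma covariance_sum_eq:
  assumes "finite A"
  shows "covariance_sum A z = (\<Sum>i\<in>pair_index A. covariance_coeff (fst (fst i)) (fst (snd i)) (snd (fst i)) (snd (snd i)) *
    (case z of (x, y) \<Rightarrow> sph_harm (fst (fst i)) (fst (snd i)) x * cnj (sph_harm (snd (fst i)) (snd (snd i)) y)))"
proof -
  obtain x y where z: "z = (x, y)" by fastforce
  show ?thesis
    unfolding covariance_sum_def pair_index_def z split_conv using assms
    by (simp add: sum.Sigma split_beta' mult.assoc)
qed

lemma square_integrable_covariance_sum: "square_integrable (surf \<Otimes>\<^sub>M surf) (covariance_sum A)"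
proof -
  have "square_integrable (surf \<Otimes>\<^sub>M surf) (\<lambda>z. \<Sum>p\<in>A. \<Sum>m = - int (fst p)..int (fst p). \<Sum>m' = - int (snd p)..int (snd p).
     covariance_coeff (fst p) m (snd p) m' * (sph_harm (fst p) m (fst z) * cnj (sph_harm (snd p) m' (snd z))))"
    by (intro square_integrable_sum square_integrable_cmult square_integrable_sph_harm_pair[unfolded split_beta'])
  then show ?thesis
    unfolding covariance_sum_def by (simp add: split_beta' mult.assoc)
qed

text \<open>The products of harmonics in the two variables are orthonormal, so removing a Fourier
  sum subtracts its squared coefficients. In particular the error decreases as the index set
  grows.\<close>

lemma L2_sq_covariance_sum:
  assumes A: "finite A"
  shows "L2_sq (surf \<Otimes>\<^sub>M surf) (\<lambda>z. (case z of (x, y) \<Rightarrow> cross_kernel M field_fun field_fun x y) - covariance_sum A z) =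
    L2_sq (surf \<Otimes>\<^sub>M surf) (\<lambda>(x, y). cross_kernel M field_fun field_fun x y) -
    (\<Sum>i\<in>pair_index A. (cmod (covariance_coeff (fst (fst i)) (fst (snd i)) (snd (fst i)) (snd (snd i))))\<^sup>2)"
proof -
  let ?N = "surf \<Otimes>\<^sub>M surf" and ?K = "\<lambda>(x, y). cross_kernel M field_fun field_fun x y"
  let ?e = "\<lambda>i. \<lambda>(x, y). sph_harm (fst (fst i)) (fst (snd i)) x * cnj (sph_harm (snd (fst i)) (snd (snd i)) y)"
  let ?d = "\<lambda>i. covariance_coeff (fst (fst i)) (fst (snd i)) (snd (fst i)) (snd (snd i))"
  have c: "(\<integral>z. ?K z * cnj (?e i z) \<partial>?N) = ?d i" for i
    unfolding kernel_coeff_def by (simp add: split_beta')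
  have K: "square_integrable ?N ?K"
    by (rule square_integrable_cross_kernel) (rule field.square_integrable_process_axioms)+
  have "L2_sq ?N (\<lambda>z. ?K z - (\<Sum>i\<in>pair_index A. ?d i * ?e i z)) = L2_sq ?N ?K -
      (\<Sum>i\<in>pair_index A. (cmod (\<integral>z. ?K z * cnj (?e i z) \<partial>?N))\<^sup>2) +
      (\<Sum>i\<in>pair_index A. (cmod ((\<integral>z. ?K z * cnj (?e i z) \<partial>?N) - ?d i))\<^sup>2)"
  proof (rule L2_sq_diff_orthonormal_sum)
    show "finite (pair_index A)"
      using A by (auto simp: pair_index_def)
    show "square_integrable ?N (?e i)" for i
      by (rule square_integrable_sph_harm_pair)
    fix i j assume "i \<in> pair_index A" "j \<in> pair_index A"
    then show "(\<integral>z. ?e i z * cnj (?e j z) \<partial>?N) = (if i = j then 1 else 0)"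
      using integral_sph_harm_pair[of "fst (snd i)" "fst (fst i)" "snd (snd i)" "snd (fst i)"
          "fst (snd j)" "fst (fst j)" "snd (snd j)" "snd (fst j)"]
      by (auto simp: pair_index_def split_beta' abs_le_iff prod_eq_iff)
  qed (rule K)
  then show ?thesis
    unfolding c covariance_sum_eq[OF A] by simp
qed

theorem L2_tendsto_covariance_sum:
  "L2_tendsto (surf \<Otimes>\<^sub>M surf) covariance_sum (\<lambda>(x, y). complex_of_real (covariance M (Z x) (Z y))) (finite_subsets_at_top UNIV)"
proof -
  let ?N = "surf \<Otimes>\<^sub>M surf" and ?K = "\<lambda>(x, y). cross_kernel M field_fun field_fun x y"
  have K: "square_integrable ?N ?K"
    by (rule square_integrable_cross_kernel) (rule field.square_integrable_process_axioms)+
  have cov: "(case z of (x, y) \<Rightarrow> complex_of_real (covariance M (Z x) (Z y))) = ?K z" if "z \<in> space ?N" for z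
    using that by (auto simp: space_pair_measure covariance_eq)
  have lim: "((\<lambda>A. L2_sq ?N (\<lambda>z. ?K z - covariance_sum A z)) \<longlongrightarrow> 0) (finite_subsets_at_top UNIV)"
  proof (rule tendstoI)
    fix e :: real assume "e > 0"
    have "\<forall>\<^sub>F L in sequentially. L2_sq ?N (\<lambda>(x, y). cross_kernel M field_fun field_fun x y - cross_kernel M (truncated_field L) (truncated_field L) x y) < e"
      using order_tendstoD(2)[OF cross_kernel_tendsto \<open>e > 0\<close>] .
    then obtain L where "L2_sq ?N (\<lambda>(x, y). cross_kernel M field_fun field_fun x y - cross_kernel M (truncated_field L) (truncated_field L) x y) < e"
      by (auto simp: eventually_sequentially)
    then have L: "L2_sq ?N (\<lambda>z. ?K z - covariance_sum ({..L} \<times> {..L}) z) < e"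
      unfolding cross_kernel_truncated_field by (simp add: split_beta')
    show "\<forall>\<^sub>F A in finite_subsets_at_top UNIV. dist (L2_sq ?N (\<lambda>z. ?K z - covariance_sum A z)) 0 < e"
      unfolding eventually_finite_subsets_at_top
    proof (intro exI[of _ "{..L} \<times> {..L}"] conjI allI impI)
      fix A :: "(nat \<times> nat) set" assume A: "finite A \<and> {..L} \<times> {..L} \<subseteq> A \<and> A \<subseteq> UNIV"
      \<comment> \<open>The truncations provide one square of degrees with a small error, and
        passing to a finite superset only decreases it.\<close>
      have "L2_sq ?N (\<lambda>z. ?K z - covariance_sum A z) \<le> L2_sq ?N (\<lambda>z. ?K z - covariance_sum ({..L} \<times> {..L}) z)"
      proof -
        have "pair_index ({..L} \<times> {..L}) \<subseteq> pair_index A" "finite (pair_index A)"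
          using A by (auto simp: pair_index_def)
        then show ?thesis
          using A by (simp add: L2_sq_covariance_sum sum_mono2)
      qed
      then show "dist (L2_sq ?N (\<lambda>z. ?K z - covariance_sum A z)) 0 < e"
        using L by simp
    qed auto
  qed
  have "L2_sq ?N (\<lambda>z. covariance_sum A z - (case z of (x, y) \<Rightarrow> complex_of_real (covariance M (Z x) (Z y)))) =
      L2_sq ?N (\<lambda>z. ?K z - covariance_sum A z)" for A
    unfolding L2_sq_minus_commute[of ?N ?K] by (rule L2_sq_cong) (simp only: cov)
  moreover have "square_integrable ?N (\<lambda>z. case z of (x, y) \<Rightarrow> complex_of_real (covariance M (Z x) (Z y))) \<longleftrightarrow> square_integrable ?N ?K"
    by (rule square_integrable_cong) (rule cov)
  ultimately show ?thesis
    using K lim square_integrable_covariance_sum by (simp add: L2_tendsto_def L2_sq_def)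
qed

end

section \<open>Multiplication by a deterministic function\<close>

lemma second_order_field_mult:
  assumes T: "spherical_random_field M T" and V: "square_integrable surf (V :: real^3 \<Rightarrow> real)"
  shows "second_order_field M (\<lambda>x w. V x * T x w)"
proof -
  interpret prob_space M
    using T by (simp add: spherical_random_field_def)
  interpret P: pair_sigma_finite M surf ..
  have T_meas [measurable]: "(\<lambda>(w, x). T x w) \<in> borel_measurable (M \<Otimes>\<^sub>M surf)"
    and T_sq: "\<And>x. x \<in> S2 \<Longrightarrow> square_integrable M (T x)" and T_0: "\<And>x. x \<in> S2 \<Longrightarrow> (\<integral>w. T x w \<partial>M) = 0"
    and cont: "continuous_on (S2 \<times> S2) (\<lambda>(x, y). covariance M (T x) (T y))"
    using T by (simp_all add: spherical_random_field_def)
  note V_meas [measurable] = V[THEN square_integrable_measurable]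
  \<comment> \<open>The resulting bound \<open>B\<close> on the variance of \<open>T\<close> makes
    \<open>B * V^2\<close> an integrable majorant for the variance of the product.\<close>
  have "compact ((\<lambda>(x, y). covariance M (T x) (T y)) ` (S2 \<times> S2))"
    by (intro compact_continuous_image cont compact_Times) auto
  then obtain B where B: "\<forall>r\<in>(\<lambda>(x, y). covariance M (T x) (T y)) ` (S2 \<times> S2). norm r \<le> B"
    using compact_imp_bounded bounded_iff by blast
  have var: "covariance M (T x) (T x) = (\<integral>w. (T x w)\<^sup>2 \<partial>M)" if "x \<in> S2" for x
    using T_0[OF that] by (simp add: covariance_def power2_eq_square)
  have var_le: "(\<integral>w. (T x w)\<^sup>2 \<partial>M) \<le> B" if "x \<in> S2" for x
    using B that var[OF that] by (force simp: image_iff)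
  show ?thesis
  proof
    show "(\<lambda>(w, x). V x * T x w) \<in> borel_measurable (M \<Otimes>\<^sub>M surf)"
    proof -
      have "(\<lambda>p. V (snd p) * (case p of (w, x) \<Rightarrow> T x w)) \<in> borel_measurable (M \<Otimes>\<^sub>M surf)"
        by measurable
      then show ?thesis by (simp add: split_beta')
    qed
    fix x :: "real^3" assume x: "x \<in> S2"
    show "square_integrable M (\<lambda>w. V x * T x w)"
      using T_sq[OF x] by (auto simp: square_integrable_def abs_mult power_mult_distrib)
    show "(\<integral>w. V x * T x w \<partial>M) = 0"
      using T_0[OF x] by simp
  next
    have swap: "(\<lambda>(x, w). T x w) \<in> borel_measurable (surf \<Otimes>\<^sub>M M)"
      using measurable_compose[OF measurable_pair_swap' T_meas] by (simp add: split_beta')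
    have meas [measurable]: "(\<lambda>x. \<integral>w. (T x w)\<^sup>2 \<partial>M) \<in> borel_measurable surf"
      using swap by (intro borel_measurable_lebesgue_integral) (simp add: split_beta')
    have "integrable surf (\<lambda>x. (V x)\<^sup>2 * (\<integral>w. (T x w)\<^sup>2 \<partial>M))"
    proof (rule Bochner_Integration.integrable_bound)
      show "integrable surf (\<lambda>x. B * (norm (V x))\<^sup>2)"
        using square_integrable_integrable[OF V] by simp
      show "AE x in surf. norm ((V x)\<^sup>2 * (\<integral>w. (T x w)\<^sup>2 \<partial>M)) \<le> norm (B * (norm (V x))\<^sup>2)"
      proof (rule AE_I2)
        fix x assume "x \<in> space surf"
        then have "x \<in> S2" by simp
        have "(V x)\<^sup>2 * (\<integral>w. (T x w)\<^sup>2 \<partial>M) \<le> (V x)\<^sup>2 * B"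
          using var_le[OF \<open>x \<in> S2\<close>] by (intro mult_left_mono) auto
        moreover have "0 \<le> (V x)\<^sup>2 * (\<integral>w. (T x w)\<^sup>2 \<partial>M)"
          by simp
        ultimately have "\<bar>(V x)\<^sup>2 * (\<integral>w. (T x w)\<^sup>2 \<partial>M)\<bar> \<le> \<bar>(V x)\<^sup>2 * B\<bar>"
          by linarith
        then show "norm ((V x)\<^sup>2 * (\<integral>w. (T x w)\<^sup>2 \<partial>M)) \<le> norm (B * (norm (V x))\<^sup>2)"
          by (simp add: mult.commute)
      qed
    qed measurable
    then show "integrable surf (\<lambda>x. \<integral>w. (V x * T x w)\<^sup>2 \<partial>M)"
      by (simp add: power_mult_distrib)
  qed
qed

lemma second_order_field_spherical:
  assumes "spherical_random_field M T"
  shows "second_order_field M T"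
  using second_order_field_mult[OF assms square_integrable_surf_const] by simp

text \<open>The profile \<open>\<gamma>\<close> of an isotropic covariance comes without regularity.
  Fixing one point at the pole and moving the other along a meridian exhibits \<open>g\<close> as a
  restriction of the continuous covariance. The number \<open>C l\<close> is then the second moment
  of the coefficient of order 0.\<close>

theorem angular_power_spectrum_moments:
  assumes T: "spherical_random_field M T" and iso: "isotropic M T"
    and lm: "\<bar>m\<bar> \<le> int l" "\<bar>m'\<bar> \<le> int l'"
  shows "(\<integral>w. field_coeff T l m w * cnj (field_coeff T l' m' w) \<partial>M) =
    (if l = l' \<and> m = m' then complex_of_real (angular_power_spectrum M T l) else 0)"
proof -
  interpret second_order_field M T
    by (rule second_order_field_spherical[OF T])
  obtain \<gamma> where \<gamma>: "\<And>x y. x \<in> S2 \<Longrightarrow> y \<in> S2 \<Longrightarrow> covariance M (T x) (T y) = \<gamma> (great_circle_dist x y)"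
    using iso unfolding isotropic_def by blast
  have cont: "continuous_on (S2 \<times> S2) (\<lambda>(x, y). covariance M (T x) (T y))"
    using T by (simp add: spherical_random_field_def)
  define g where "g t = \<gamma> (arccos t)" for t
  define pole :: "real^3" where "pole = sph_point (0, 0)"
  have g: "g t = covariance M (T pole) (T (sph_point (arccos t, 0)))" if "t \<in> {- 1..1}" for t
  proof -
    have "pole \<bullet> sph_point (arccos t, 0) = t"
      using that by (simp add: inner_vec_def sum_3 pole_def)
    then show ?thesis
      using \<gamma>[OF sph_point_in_S2 sph_point_in_S2, of "(0, 0)" "(arccos t, 0)"]
      by (simp add: g_def pole_def great_circle_dist_def)
  qed
  have "continuous_on {- 1..1} (\<lambda>t. (\<lambda>(x, y). covariance M (T x) (T y)) (pole, sph_point (arccos t, 0)))"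
  proof (rule continuous_on_compose2[OF cont])
    show "continuous_on {- 1..1} (\<lambda>t. (pole, sph_point (arccos t, 0)))"
      by (intro continuous_intros continuous_on_compose2[OF continuous_on_sph_point[of UNIV]] continuous_on_arccos') auto
    show "(\<lambda>t. (pole, sph_point (arccos t, 0))) ` {- 1..1} \<subseteq> S2 \<times> S2"
      by (auto simp: pole_def)
  qed
  then have g_cont: "continuous_on {- 1..1} g"
    by (rule continuous_on_eq) (simp add: g)
  have F: "square_integrable (surf \<Otimes>\<^sub>M surf) (\<lambda>(x, y). cross_kernel M field_fun field_fun x y)"
    by (rule square_integrable_cross_kernel) (rule field.square_integrable_process_axioms)+
  have Fg: "cross_kernel M field_fun field_fun x y = of_real (g (x \<bullet> y))" if "x \<in> S2" "y \<in> S2" for x y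
    using covariance_eq[OF that] \<gamma>[OF that] by (simp add: g_def great_circle_dist_def)
  define C where "C l = L2_sq M (field_coeff T l 0)" for l
  have moments: "(\<integral>w. field_coeff T l m w * cnj (field_coeff T l' m' w) \<partial>M) = (if l = l' \<and> m = m' then complex_of_real (C l) else 0)"
    if "\<bar>m\<bar> \<le> int l" "\<bar>m'\<bar> \<le> int l'" for l m l' m'
    using kernel_coeff_isotropic[OF g_cont F Fg that]
    by (simp add: kernel_coeff_covariance C_def L2_sq_complex)
  have "angular_power_spectrum M T l = C l" for l
    unfolding angular_power_spectrum_def
  proof (rule the_equality)
    show "\<forall>l' m m'. \<bar>m\<bar> \<le> int l \<longrightarrow> \<bar>m'\<bar> \<le> int l' \<longrightarrow>
        (\<integral>w. field_coeff T l m w * cnj (field_coeff T l' m' w) \<partial>M) = (if l = l' \<and> m = m' then complex_of_real (C l) else 0)"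
      using moments by blast
    fix c assume "\<forall>l' m m'. \<bar>m\<bar> \<le> int l \<longrightarrow> \<bar>m'\<bar> \<le> int l' \<longrightarrow>
        (\<integral>w. field_coeff T l m w * cnj (field_coeff T l' m' w) \<partial>M) = (if l = l' \<and> m = m' then complex_of_real c else 0)"
    from this[rule_format, of 0 0 l] show "c = C l"
      using moments[of 0 l 0 l] by simp
  qed
  then show ?thesis
    using moments[OF lm] by simp
qed

section \<open>Multiplication by \<open>V\<close> in the basis of spherical harmonics\<close>

definition gaunt_factor :: "nat \<Rightarrow> nat \<Rightarrow> nat \<Rightarrow> int \<Rightarrow> int \<Rightarrow> int \<Rightarrow> real" where
  "gaunt_factor l1 l2 l m1 m2 m = sqrt (real ((2 * l1 + 1) * (2 * l2 + 1) * (2 * l + 1)) / (4 * pi)) *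
     wigner3j (int l1) (int l2) (int l) 0 0 0 * wigner3j (int l1) (int l2) (int l) m1 m2 m"

lemma neg_one_powi: "(- 1 :: 'a :: field) powi m = (- 1) ^ nat \<bar>m\<bar>"
  by (cases "m \<ge> 0") (simp_all add: power_int_def flip: power_inverse)

text \<open>Conjugation reverses the order at the cost of a sign; this produces the Gaunt integral
  and the sign in front of the final formulas.\<close>

lemma integral_sph_harm_mult_cnj:
  "(\<integral>x. sph_harm l1 m1 x * (sph_harm l2 m2 x * cnj (sph_harm l m x)) \<partial>surf) =
    (- 1) powi m * of_real (gaunt_factor l1 l2 l m1 m2 (- m))"
proof -
  have "(\<integral>x. sph_harm l1 m1 x * (sph_harm l2 m2 x * cnj (sph_harm l m x)) \<partial>surf) =
      (\<integral>x. (- 1) ^ nat \<bar>m\<bar> * (sph_harm l1 m1 x * sph_harm l2 m2 x * sph_harm l (- m) x) \<partial>surf)"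
    by (intro Bochner_Integration.integral_cong refl) (simp add: cnj_sph_harm mult_ac)
  also have "\<dots> = (- 1) ^ nat \<bar>m\<bar> * of_real (gaunt_factor l1 l2 l m1 m2 (- m))"
    unfolding integral_mult_right_zero sph_harm_gaunt gaunt_factor_def ..
  finally show ?thesis
    by (simp add: neg_one_powi)
qed

text \<open>The partial sums of \<open>V\<close>, integrated against a fixed square-integrable
  function, converge. By the triangle rule this sequence is constant from \<open>L = l2 + l\<close>
  on, so its limit is a finite sum.\<close>

lemma integral_mult_sph_harm:
  assumes V: "square_integrable surf V" and v: "laplace_expansion V v"
  shows "(\<integral>x. of_real (V x) * (sph_harm l2 m2 x * cnj (sph_harm l m x)) \<partial>surf) =
    (- 1) powi m * (\<Sum>l1 = nat \<bar>int l2 - int l\<bar>..l2 + l. v l1 (m - m2) * of_real (gaunt_factor l1 l2 l (m - m2) m2 (- m)))"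
proof -
  let ?g = "\<lambda>x. sph_harm l2 m2 x * cnj (sph_harm l m x)"
  let ?G = "\<lambda>l1 m1. complex_of_real (gaunt_factor l1 l2 l m1 m2 (- m))"
  obtain B where B: "\<And>x. x \<in> S2 \<Longrightarrow> cmod (sph_harm l m x) \<le> B"
    using sph_harm_bounded by blast
  have g: "square_integrable surf ?g"
    by (rule square_integrable_mult_bounded[OF square_integrable_sph_harm, where B = B]) (auto intro: B)
  have "L2_tendsto surf (sph_partial_sum v) (\<lambda>x. of_real (V x)) sequentially"
    using v unfolding laplace_expansion_def sph_partial_sum_def[abs_def] .
  then have lim: "(\<lambda>L. \<integral>x. sph_partial_sum v L x * ?g x \<partial>surf) \<longlonglongrightarrow> (\<integral>x. of_real (V x) * ?g x \<partial>surf)"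
    by (rule L2_tendsto_integral_mult[OF _ g])
  have partial_sum: "(\<integral>x. sph_partial_sum v L x * ?g x \<partial>surf) = (- 1) powi m *
      (\<Sum>l1 = nat \<bar>int l2 - int l\<bar>..l2 + l. v l1 (m - m2) * ?G l1 (m - m2))" if "L \<ge> l2 + l" for L
  proof -
    have int: "integrable surf (\<lambda>x. sph_harm l1 m1 x * ?g x)" for l1 m1
      by (intro integrable_mult_square_integrable square_integrable_sph_harm g)
    have "(\<integral>x. sph_partial_sum v L x * ?g x \<partial>surf) =
        (\<integral>x. (\<Sum>l1\<le>L. \<Sum>m1 = - int l1..int l1. v l1 m1 * (sph_harm l1 m1 x * ?g x)) \<partial>surf)"
      by (simp only: sph_partial_sum_def sum_distrib_right mult.assoc)
    also have "\<dots> = (\<Sum>l1\<le>L. \<Sum>m1 = - int l1..int l1. v l1 m1 * ((- 1) powi m * ?G l1 m1))"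
      using int by (simp add: integral_sph_harm_mult_cnj)
    also have "\<dots> = (\<Sum>l1\<le>L. v l1 (m - m2) * ((- 1) powi m * ?G l1 (m - m2)))"
    proof (intro sum.cong refl)
      fix l1
      have G0: "?G l1 m1 = 0" if "m1 \<noteq> m - m2" for m1
        using that by (simp add: gaunt_factor_def wigner3j_eq_0)
      show "(\<Sum>m1 = - int l1..int l1. v l1 m1 * ((- 1) powi m * ?G l1 m1)) = v l1 (m - m2) * ((- 1) powi m * ?G l1 (m - m2))"
      proof (cases "m - m2 \<in> {- int l1..int l1}")
        case True
        have "(\<Sum>m1 = - int l1..int l1. v l1 m1 * ((- 1) powi m * ?G l1 m1)) =
            (\<Sum>m1\<in>{m - m2}. v l1 m1 * ((- 1) powi m * ?G l1 m1))"
          using True G0 by (intro sum.mono_neutral_right) auto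
        then show ?thesis by simp
      next
        \<comment> \<open>Here \<open>v l1 (m - m2)\<close> is an arbitrary number, since a Laplace
          expansion only constrains the orders up to \<open>l1\<close>; the 3j-symbol is 0 and
          removes it.\<close>
        case False
        have "wigner3j (int l1) (int l2) (int l) (m - m2) m2 (- m) = 0"
          using False by (intro wigner3j_eq_0) auto
        then have "?G l1 (m - m2) = 0"
          by (simp add: gaunt_factor_def)
        moreover have "(\<Sum>m1 = - int l1..int l1. v l1 m1 * ((- 1) powi m * ?G l1 m1)) = 0"
          using False G0 by (intro sum.neutral) auto
        ultimately show ?thesis by simp
      qed
    qed
    also have "\<dots> = (\<Sum>l1 = nat \<bar>int l2 - int l\<bar>..l2 + l. v l1 (m - m2) * ((- 1) powi m * ?G l1 (m - m2)))"
    proof (rule sum.mono_neutral_right)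
      show "\<forall>l1\<in>{..L} - {nat \<bar>int l2 - int l\<bar>..l2 + l}. v l1 (m - m2) * ((- 1) powi m * ?G l1 (m - m2)) = 0"
      proof
        fix l1 assume "l1 \<in> {..L} - {nat \<bar>int l2 - int l\<bar>..l2 + l}"
        then have "wigner3j (int l1) (int l2) (int l) 0 0 0 = 0"
          by (intro wigner3j_eq_0) auto
        then show "v l1 (m - m2) * ((- 1) powi m * ?G l1 (m - m2)) = 0"
          by (simp add: gaunt_factor_def)
      qed
    qed (use that in auto)
    finally show ?thesis
      by (simp add: sum_distrib_left mult.left_commute)
  qed
  have "\<forall>\<^sub>F L in sequentially. (\<integral>x. sph_partial_sum v L x * ?g x \<partial>surf) = (- 1) powi m *
      (\<Sum>l1 = nat \<bar>int l2 - int l\<bar>..l2 + l. v l1 (m - m2) * ?G l1 (m - m2))"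
    by (rule eventually_sequentiallyI[of "l2 + l"]) (rule partial_sum)
  from Lim_transform_eventually[OF lim this] show ?thesis
    using LIMSEQ_unique tendsto_const by blast
qed

text \<open>The matrix of the operator of multiplication by \<open>V\<close>, by
  \<open>integral_mult_sph_harm\<close>: row \<open>(l, m)\<close> and column
  \<open>(l2, m2)\<close>.\<close>

definition gaunt_matrix :: "(nat \<Rightarrow> int \<Rightarrow> complex) \<Rightarrow> nat \<Rightarrow> int \<Rightarrow> nat \<Rightarrow> int \<Rightarrow> complex" where
  "gaunt_matrix v l m l2 m2 = (- 1) powi m *
     (\<Sum>l1 = nat \<bar>int l2 - int l\<bar>..l2 + l. v l1 (m - m2) * of_real (gaunt_factor l1 l2 l (m - m2) m2 (- m)))"

text \<open>The expansion of \<open>T\<close> is integrated against \<open>V\<close> times a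
  conjugate harmonic. The harmonic is bounded, so this function is square integrable even if
  \<open>V\<close> is unbounded.\<close>

lemma L2_tendsto_field_coeff_mult:
  assumes T: "spherical_random_field M T" and V: "square_integrable surf V" and v: "laplace_expansion V v"
  shows "L2_tendsto M (\<lambda>L w. \<Sum>(l2, m2)\<in>sph_index L. field_coeff T l2 m2 w * gaunt_matrix v l m l2 m2)
    (field_coeff (\<lambda>x w. V x * T x w) l m) sequentially"
proof -
  interpret second_order_field M T
    by (rule second_order_field_spherical[OF T])
  let ?f = "\<lambda>x. complex_of_real (V x) * cnj (sph_harm l m x)"
  obtain B where "\<And>x. x \<in> S2 \<Longrightarrow> cmod (sph_harm l m x) \<le> B"
    using sph_harm_bounded by blast
  then have f: "square_integrable surf ?f"
    by (intro square_integrable_mult_bounded(1)[where B = B] square_integrable_of_real V) auto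
  have "(\<integral>x. sph_harm l2 m2 x * ?f x \<partial>surf) = gaunt_matrix v l m l2 m2" for l2 m2
    using integral_mult_sph_harm[OF V v, of l2 m2 l m] by (simp add: gaunt_matrix_def mult_ac)
  moreover have "(\<integral>x. field_fun (w, x) * ?f x \<partial>surf) = field_coeff (\<lambda>x w. V x * T x w) l m w" for w
    by (simp add: field_coeff_def harm_coeff_def field_fun_def mult_ac)
  ultimately show ?thesis
    using L2_tendsto_integral_truncated_field[OF f] by (simp add: integral_truncated_field[OF f])
qed

text \<open>The mixed moments of the partial sums converge to that of the limits, and the
  orthogonality of the coefficients of \<open>T\<close> collapses the double sum over pairs of
  indices to its diagonal.\<close>

lemma sums_covariance_field_coeff_mult:
  assumes T: "spherical_random_field M T" "isotropic M T"
    and V: "square_integrable surf V" and v: "laplace_expansion V v"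
  shows "(\<lambda>l2. of_real (angular_power_spectrum M T l2) * (\<Sum>m2 = - int l2..int l2. gaunt_matrix v l m l2 m2 * cnj (gaunt_matrix v l' m' l2 m2)))
    sums (\<integral>w. field_coeff (\<lambda>x w. V x * T x w) l m w * cnj (field_coeff (\<lambda>x w. V x * T x w) l' m' w) \<partial>M)"
proof -
  interpret second_order_field M T
    by (rule second_order_field_spherical[OF T(1)])
  let ?a = "\<lambda>p. field_coeff T (fst p) (snd p)" and ?D = "\<lambda>p. gaunt_matrix v l m (fst p) (snd p)"
    and ?D' = "\<lambda>p. gaunt_matrix v l' m' (fst p) (snd p)" and ?C = "angular_power_spectrum M T"
  have int: "integrable M (\<lambda>w. ?a p w * cnj (?a q w))" for p q
    by (intro integrable_mult_square_integrable square_integrable_cnj square_integrable_field_coeff)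
  have "(\<integral>w. (\<Sum>(l2, m2)\<in>sph_index L. field_coeff T l2 m2 w * gaunt_matrix v l m l2 m2) *
      cnj (\<Sum>(l2, m2)\<in>sph_index L. field_coeff T l2 m2 w * gaunt_matrix v l' m' l2 m2) \<partial>M) =
    (\<Sum>l2\<le>L. of_real (?C l2) * (\<Sum>m2 = - int l2..int l2. gaunt_matrix v l m l2 m2 * cnj (gaunt_matrix v l' m' l2 m2)))"
    (is "?lhs = ?rhs") for L
  proof -
    have "?lhs = (\<integral>w. (\<Sum>p\<in>sph_index L. \<Sum>q\<in>sph_index L. (?D p * cnj (?D' q)) * (?a p w * cnj (?a q w))) \<partial>M)"
      by (simp add: split_beta' sum_product mult_ac)
    also have "\<dots> = (\<Sum>p\<in>sph_index L. \<Sum>q\<in>sph_index L. (?D p * cnj (?D' q)) * (\<integral>w. ?a p w * cnj (?a q w) \<partial>M))"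
      using int by simp
    also have "\<dots> = (\<Sum>p\<in>sph_index L. \<Sum>q\<in>sph_index L. if p = q then ?D p * cnj (?D' p) * of_real (?C (fst p)) else 0)"
    proof (intro sum.cong refl)
      fix p q assume "p \<in> sph_index L" "q \<in> sph_index L"
      then have "\<bar>snd p\<bar> \<le> int (fst p)" "\<bar>snd q\<bar> \<le> int (fst q)"
        by (auto simp: sph_index_def)
      from angular_power_spectrum_moments[OF T this]
      show "(?D p * cnj (?D' q)) * (\<integral>w. ?a p w * cnj (?a q w) \<partial>M) = (if p = q then ?D p * cnj (?D' p) * of_real (?C (fst p)) else 0)"
        by (auto simp: prod_eq_iff)
    qed
    also have "\<dots> = (\<Sum>p\<in>sph_index L. ?D p * cnj (?D' p) * of_real (?C (fst p)))"
      by (simp add: sum.delta)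
    also have "\<dots> = (\<Sum>l2\<le>L. \<Sum>m2 = - int l2..int l2. gaunt_matrix v l m l2 m2 * cnj (gaunt_matrix v l' m' l2 m2) * of_real (?C l2))"
      unfolding sum_sph_index by (simp add: split_beta')
    also have "\<dots> = ?rhs"
      by (simp add: sum_distrib_left mult_ac)
    finally show ?thesis .
  qed
  then show ?thesis
    using L2_tendsto_integral_mult_cnj[OF L2_tendsto_field_coeff_mult[OF T(1) V v, of l m] L2_tendsto_field_coeff_mult[OF T(1) V v, of l' m']]
    unfolding sums_def_le by simp
qed

lemma sum_field_coeff_gaunt_matrix:
  "(\<Sum>(l2, m2)\<in>sph_index L. a l2 m2 * gaunt_matrix v l m l2 m2) = (- 1) powi m *
     (\<Sum>l2\<le>L. \<Sum>l1 = nat \<bar>int l2 - int l\<bar>..l2 + l. \<Sum>m2 = - int l2..int l2.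
        v l1 (m - m2) * a l2 m2 *
        complex_of_real
          (sqrt (real ((2 * l1 + 1) * (2 * l2 + 1) * (2 * l + 1)) / (4 * pi)) *
           wigner3j (int l1) (int l2) (int l) 0 0 0 *
           wigner3j (int l1) (int l2) (int l) (m - m2) m2 (- m)))"
  unfolding sum_sph_index[symmetric] gaunt_matrix_def gaunt_factor_def[symmetric]
  unfolding sum_distrib_left
  by (intro sum.cong refl, subst sum.swap) (simp only: mult_ac)

text \<open>The two roots share the factor \<open>2 * l2 + 1\<close> and the divisor
  \<open>4 * pi\<close>, which leave the root as a rational factor.\<close>

lemma gaunt_factor_mult:
  "gaunt_factor l1 l2 l m1 m2 m * gaunt_factor l1' l2 l' m1' m2 m' =
    real (2 * l2 + 1) / (4 * pi) *
    sqrt (real ((2 * l1 + 1) * (2 * l1' + 1) * (2 * l + 1) * (2 * l' + 1))) *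
    wigner3j (int l1) (int l2) (int l) 0 0 0 *
    wigner3j (int l1') (int l2) (int l') 0 0 0 *
    wigner3j (int l1) (int l2) (int l) m1 m2 m *
    wigner3j (int l1') (int l2) (int l') m1' m2 m'"
proof -
  define k where "k = real (2 * l2 + 1) / (4 * pi)"
  have "k \<ge> 0"
    by (simp add: k_def)
  have "sqrt (real ((2 * l1 + 1) * (2 * l2 + 1) * (2 * l + 1)) / (4 * pi)) * sqrt (real ((2 * l1' + 1) * (2 * l2 + 1) * (2 * l' + 1)) / (4 * pi)) =
      sqrt (k\<^sup>2 * real ((2 * l1 + 1) * (2 * l1' + 1) * (2 * l + 1) * (2 * l' + 1)))"
    unfolding real_sqrt_mult[symmetric] k_def by (rule arg_cong[where f = sqrt]) (simp add: field_simps power2_eq_square)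
  also have "\<dots> = k * sqrt (real ((2 * l1 + 1) * (2 * l1' + 1) * (2 * l + 1) * (2 * l' + 1)))"
    using \<open>k \<ge> 0\<close> by (simp only: real_sqrt_mult real_sqrt_abs abs_of_nonneg)
  finally show ?thesis
    unfolding gaunt_factor_def k_def[symmetric] by (metis (no_types, opaque_lifting) mult.assoc mult.commute mult.left_commute)
qed

text \<open>All sums are finite, so the one over \<open>m2\<close> can be moved innermost; the two
  signs merge because they are real.\<close>

lemma sum_gaunt_matrix_mult_cnj:
  "of_real (C l2) * (\<Sum>m2 = - int l2..int l2. gaunt_matrix v l m l2 m2 * cnj (gaunt_matrix v l' m' l2 m2)) =
   (- 1) powi (m + m') *
   (\<Sum>l1 = nat \<bar>int l2 - int l\<bar>..l2 + l.
    \<Sum>l1' = nat \<bar>int l2 - int l'\<bar>..l2 + l'.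
    \<Sum>m2 = - int l2..int l2.
      v l1 (m - m2) * cnj (v l1' (m' - m2)) *
      complex_of_real
        (C l2 * (real (2 * l2 + 1) / (4 * pi)) *
         sqrt (real ((2 * l1 + 1) * (2 * l1' + 1) * (2 * l + 1) * (2 * l' + 1))) *
         wigner3j (int l1) (int l2) (int l) 0 0 0 *
         wigner3j (int l1') (int l2) (int l') 0 0 0 *
         wigner3j (int l1) (int l2) (int l) (m - m2) m2 (- m) *
         wigner3j (int l1') (int l2) (int l') (m' - m2) m2 (- m')))"
proof -
  let ?I = "{nat \<bar>int l2 - int l\<bar>..l2 + l}" and ?I' = "{nat \<bar>int l2 - int l'\<bar>..l2 + l'}"
  let ?g = "\<lambda>l1 m2. gaunt_factor l1 l2 l (m - m2) m2 (- m)" and ?g' = "\<lambda>l1 m2. gaunt_factor l1 l2 l' (m' - m2) m2 (- m')"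
  have sign: "(- 1) powi m * cnj ((- 1) powi m') = ((- 1) powi (m + m') :: complex)"
    by (simp add: power_int_add neg_one_powi[of m'])
  have product: "gaunt_matrix v l m l2 m2 * cnj (gaunt_matrix v l' m' l2 m2) = (- 1) powi m * cnj ((- 1) powi m') *
      (\<Sum>l1\<in>?I. \<Sum>l1'\<in>?I'. (v l1 (m - m2) * of_real (?g l1 m2)) * cnj (v l1' (m' - m2) * of_real (?g' l1' m2)))" for m2
    unfolding gaunt_matrix_def complex_cnj_mult[of "(- 1) powi m'"] cnj_sum sum_product[symmetric] by (simp only: mult_ac)
  have "of_real (C l2) * (\<Sum>m2 = - int l2..int l2. gaunt_matrix v l m l2 m2 * cnj (gaunt_matrix v l' m' l2 m2)) =
      (- 1) powi m * cnj ((- 1) powi m') * (\<Sum>m2 = - int l2..int l2. \<Sum>l1\<in>?I. \<Sum>l1'\<in>?I'.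
        of_real (C l2) * ((v l1 (m - m2) * of_real (?g l1 m2)) * cnj (v l1' (m' - m2) * of_real (?g' l1' m2))))"
    unfolding product sum_distrib_left by (simp only: mult_ac)
  also have "\<dots> = (- 1) powi (m + m') * (\<Sum>l1\<in>?I. \<Sum>l1'\<in>?I'. \<Sum>m2 = - int l2..int l2.
        v l1 (m - m2) * cnj (v l1' (m' - m2)) * of_real (C l2 * (?g l1 m2 * ?g' l1' m2)))"
    unfolding sign
    by (subst sum.swap, intro arg_cong2[where f = times] sum.cong refl, subst sum.swap) (simp add: mult_ac)
  finally show ?thesis
    unfolding gaunt_factor_mult by (simp only: mult.assoc)
qed

theorem theorem8:
  fixes M :: "'w measure"
    and T :: "real^3 \<Rightarrow> 'w \<Rightarrow> real"
    and V :: "real^3 \<Rightarrow> real"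
    and v :: "nat \<Rightarrow> int \<Rightarrow> complex"
    and a :: "nat \<Rightarrow> int \<Rightarrow> 'w \<Rightarrow> complex"
    and C :: "nat \<Rightarrow> real"
    and TV :: "real^3 \<Rightarrow> 'w \<Rightarrow> real"
    and aV :: "nat \<Rightarrow> int \<Rightarrow> 'w \<Rightarrow> complex"
  assumes "spherical_random_field M T"
    and "isotropic M T"
    and "a = field_coeff T"
    and "C = angular_power_spectrum M T"
    and "square_integrable surf V"
    and "laplace_expansion V v"
    and "TV = (\<lambda>x w. V x * T x w)"
    and "aV = field_coeff TV"
  shows
    "L2_tendsto (M \<Otimes>\<^sub>M surf)
       (\<lambda>L (w, x). \<Sum>l\<le>L. \<Sum>m = - int l..int l. aV l m w * sph_harm l m x)
       (\<lambda>(w, x). complex_of_real (TV x w)) sequentially \<and>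
     (\<forall>l m. \<bar>m\<bar> \<le> int l \<longrightarrow>
       (AE w in M. integrable surf (\<lambda>x. complex_of_real (TV x w) * cnj (sph_harm l m x))) \<and>
       integrable M (aV l m) \<and> (\<integral>w. aV l m w \<partial>M) = 0 \<and>
       L2_tendsto M
         (\<lambda>L w. (- 1) powi m *
            (\<Sum>l2\<le>L. \<Sum>l1 = nat \<bar>int l2 - int l\<bar>..l2 + l. \<Sum>m2 = - int l2..int l2.
               v l1 (m - m2) * a l2 m2 w *
               complex_of_real
                 (sqrt (real ((2 * l1 + 1) * (2 * l2 + 1) * (2 * l + 1)) / (4 * pi)) *
                  wigner3j (int l1) (int l2) (int l) 0 0 0 *
                  wigner3j (int l1) (int l2) (int l) (m - m2) m2 (- m))))
         (aV l m) sequentially) \<and>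
     (\<forall>x\<in>S2. integrable M (TV x) \<and> (\<integral>w. TV x w \<partial>M) = 0) \<and>
     (\<exists>CV :: nat \<Rightarrow> nat \<Rightarrow> int \<Rightarrow> int \<Rightarrow> complex.
       L2_tendsto (surf \<Otimes>\<^sub>M surf)
         (\<lambda>A (x1, x2). \<Sum>(l, l')\<in>A. \<Sum>m = - int l..int l. \<Sum>m' = - int l'..int l'.
            CV l l' m m' * sph_harm l m x1 * cnj (sph_harm l' m' x2))
         (\<lambda>(x1, x2). complex_of_real (covariance M (TV x1) (TV x2)))
         (finite_subsets_at_top UNIV) \<and>
       (\<forall>l l' m m'. \<bar>m\<bar> \<le> int l \<longrightarrow> \<bar>m'\<bar> \<le> int l' \<longrightarrow>
          (\<lambda>l2. (- 1) powi (m + m') *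
             (\<Sum>l1 = nat \<bar>int l2 - int l\<bar>..l2 + l.
              \<Sum>l1' = nat \<bar>int l2 - int l'\<bar>..l2 + l'.
              \<Sum>m2 = - int l2..int l2.
                v l1 (m - m2) * cnj (v l1' (m' - m2)) *
                complex_of_real
                  (C l2 * (real (2 * l2 + 1) / (4 * pi)) *
                   sqrt (real ((2 * l1 + 1) * (2 * l1' + 1) * (2 * l + 1) * (2 * l' + 1))) *
                   wigner3j (int l1) (int l2) (int l) 0 0 0 *
                   wigner3j (int l1') (int l2) (int l') 0 0 0 *
                   wigner3j (int l1) (int l2) (int l) (m - m2) m2 (- m) *
                   wigner3j (int l1') (int l2) (int l') (m' - m2) m2 (- m'))))
          sums CV l l' m m'))"
proof -
  note T = assms(1,2) and V = assms(5) and v = assms(6)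
  \<comment> \<open>The general theory is instantiated with the product field. \<open>T\<close>
    itself enters through the series for the coefficients and for their mixed moments.\<close>
  interpret second_order_field M TV
    unfolding assms(7) by (rule second_order_field_mult[OF T(1) V])
  have expansion: "L2_tendsto (M \<Otimes>\<^sub>M surf)
      (\<lambda>L (w, x). \<Sum>l\<le>L. \<Sum>m = - int l..int l. aV l m w * sph_harm l m x)
      (\<lambda>(w, x). complex_of_real (TV x w)) sequentially"
    using L2_tendsto_truncated_field unfolding field_fun_def truncated_field_def[abs_def] assms(8) .
  have coeff: "(AE w in M. integrable surf (\<lambda>x. complex_of_real (TV x w) * cnj (sph_harm l m x))) \<and>
      integrable M (aV l m) \<and> (\<integral>w. aV l m w \<partial>M) = 0" for l m
    unfolding assms(8)
    by (intro conjI AE_integrable_field_sph_harm integral_field_coeff integrable_if_square_integrable square_integrable_field_coeff)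
  have pointwise: "integrable M (TV x) \<and> (\<integral>w. TV x w \<partial>M) = 0" if "x \<in> S2" for x
  proof
    have "integrable M (\<lambda>w. complex_of_real (TV x w))"
      using field.square_integrable_point[OF that] by (intro integrable_if_square_integrable) (simp add: field_fun_def)
    then show "integrable M (TV x)"
      by (simp add: complex_of_real_integrable_eq)
  qed (rule field_centered[OF that])
  \<comment> \<open>The witness is the array of Fourier coefficients of the covariance function,
    with its arguments reordered; the series in \<open>l2\<close> is then shown to sum to these
    numbers.\<close>
  let ?CV = "\<lambda>l l' m m'. covariance_coeff l m l' m'"
  have covariance: "L2_tendsto (surf \<Otimes>\<^sub>M surf)
      (\<lambda>A (x1, x2). \<Sum>(l, l')\<in>A. \<Sum>m = - int l..int l. \<Sum>m' = - int l'..int l'.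
         ?CV l l' m m' * sph_harm l m x1 * cnj (sph_harm l' m' x2))
      (\<lambda>(x1, x2). complex_of_real (covariance M (TV x1) (TV x2))) (finite_subsets_at_top UNIV)"
    using L2_tendsto_covariance_sum unfolding covariance_sum_def[abs_def] .
  have series: "L2_tendsto M (\<lambda>L w. \<Sum>(l2, m2)\<in>sph_index L. a l2 m2 w * gaunt_matrix v l m l2 m2) (aV l m) sequentially" for l m
    using L2_tendsto_field_coeff_mult[OF T(1) V v] unfolding assms(3,7,8) .
  have power_spectrum: "(\<lambda>l2. of_real (C l2) * (\<Sum>m2 = - int l2..int l2. gaunt_matrix v l m l2 m2 * cnj (gaunt_matrix v l' m' l2 m2)))
      sums ?CV l l' m m'" for l l' m m'
    unfolding kernel_coeff_covariance
    using sums_covariance_field_coeff_mult[OF T V v] unfolding assms(4,7) .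
  show ?thesis
    using expansion coeff series[unfolded sum_field_coeff_gaunt_matrix] pointwise covariance
      power_spectrum[unfolded sum_gaunt_matrix_mult_cnj]
    by (intro conjI allI impI ballI exI[of _ ?CV]) (assumption | blast)+
qed

end
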